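(* $\mathsf{WKL}_0 + \mathsf{EM}$ is $\forall\Pi^0_4$-conservative over $\mathsf{RCA}_0 + \mathsf{B}\Sigma^0_2$.
   Context: $\mathsf{EM}$ (Erdős–Moser theorem): for every coloring $f:[\mathbb{N}]^2\to 2$ there is an infinite $f$-transitive set $H$, i.e. for all $x<y<z$ in $H$ and $i<2$, if $f(x,y)=f(y,z)=i$ then $f(x,z)=i$. A $\forall\Pi^0_4$ formula is of the form $\forall X\,\varphi(X)$ with $\varphi$ a $\Pi^0_4$ formula; conservativity means every such sentence provable in the stronger theory is provable in the weaker one. *)

theory Defs
  imports Main
begin

section \<open>The language of second-order arithmetic\<close>

text \<open>
  Two-sorted first-order logic in de Bruijn notation. Number variables and set variables are
  indexed independently: \<open>AllN\<close> binds number index 0 of its body, \<open>AllS\<close> binds set index 0.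
  As in Simpson's book, equality is primitive for numbers only.
\<close>

datatype tm = Var nat | Zero | One | Add tm tm (infixl "\<^bold>+" 75) | Mul tm tm (infixl "\<^bold>*" 80)

datatype fm =
    Fls  ("\<^bold>\<bottom>")
  | Eq tm tm  (infix "\<^bold>=" 65)
  | Less tm tm  (infix "\<^bold><" 65)
  | Mem tm nat  (infix "\<^bold>\<in>" 65)
  | Imp fm fm  (infixr "\<^bold>\<longrightarrow>" 55)
  | AllN fm
  | AllS fm

abbreviation Neg :: "fm \<Rightarrow> fm"  ("\<^bold>\<not> _" [62] 62) where "\<^bold>\<not> \<phi> \<equiv> \<phi> \<^bold>\<longrightarrow> \<^bold>\<bottom>"
abbreviation Or :: "fm \<Rightarrow> fm \<Rightarrow> fm"  (infixr "\<^bold>\<or>" 58) where "\<phi> \<^bold>\<or> \<psi> \<equiv> \<^bold>\<not> \<phi> \<^bold>\<longrightarrow> \<psi>"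
abbreviation And :: "fm \<Rightarrow> fm \<Rightarrow> fm"  (infixr "\<^bold>\<and>" 60) where "\<phi> \<^bold>\<and> \<psi> \<equiv> \<^bold>\<not> (\<phi> \<^bold>\<longrightarrow> \<^bold>\<not> \<psi>)"
abbreviation Iff :: "fm \<Rightarrow> fm \<Rightarrow> fm"  (infix "\<^bold>\<longleftrightarrow>" 54) where
  "\<phi> \<^bold>\<longleftrightarrow> \<psi> \<equiv> (\<phi> \<^bold>\<longrightarrow> \<psi>) \<^bold>\<and> (\<psi> \<^bold>\<longrightarrow> \<phi>)"
abbreviation ExN :: "fm \<Rightarrow> fm" where "ExN \<phi> \<equiv> \<^bold>\<not> AllN (\<^bold>\<not> \<phi>)"
abbreviation ExS :: "fm \<Rightarrow> fm" where "ExS \<phi> \<equiv> \<^bold>\<not> AllS (\<^bold>\<not> \<phi>)"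

text \<open>Simultaneous substitution of terms for number variables and of set variables for set variables.\<close>

primrec substt :: "(nat \<Rightarrow> tm) \<Rightarrow> tm \<Rightarrow> tm" where
  "substt \<sigma> (Var n) = \<sigma> n"
| "substt \<sigma> Zero = Zero"
| "substt \<sigma> One = One"
| "substt \<sigma> (s \<^bold>+ t) = substt \<sigma> s \<^bold>+ substt \<sigma> t"
| "substt \<sigma> (s \<^bold>* t) = substt \<sigma> s \<^bold>* substt \<sigma> t"

definition shift :: "nat \<Rightarrow> tm \<Rightarrow> tm" where
  "shift k = substt (\<lambda>n. Var (n + k))"

primrec subst :: "(nat \<Rightarrow> tm) \<Rightarrow> (nat \<Rightarrow> nat) \<Rightarrow> fm \<Rightarrow> fm" where
  "subst \<sigma> \<rho> \<^bold>\<bottom> = \<^bold>\<bottom>"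
| "subst \<sigma> \<rho> (s \<^bold>= t) = (substt \<sigma> s \<^bold>= substt \<sigma> t)"
| "subst \<sigma> \<rho> (s \<^bold>< t) = (substt \<sigma> s \<^bold>< substt \<sigma> t)"
| "subst \<sigma> \<rho> (t \<^bold>\<in> X) = (substt \<sigma> t \<^bold>\<in> \<rho> X)"
| "subst \<sigma> \<rho> (\<phi> \<^bold>\<longrightarrow> \<psi>) = (subst \<sigma> \<rho> \<phi> \<^bold>\<longrightarrow> subst \<sigma> \<rho> \<psi>)"
| "subst \<sigma> \<rho> (AllN \<phi>) = AllN (subst (case_nat (Var 0) (\<lambda>n. shift 1 (\<sigma> n))) \<rho> \<phi>)"
| "subst \<sigma> \<rho> (AllS \<phi>) = AllS (subst \<sigma> (case_nat 0 (\<lambda>n. Suc (\<rho> n))) \<phi>)"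

definition liftN :: "fm \<Rightarrow> fm" where "liftN = subst (\<lambda>n. Var (Suc n)) id"
definition liftS :: "fm \<Rightarrow> fm" where "liftS = subst Var Suc"
definition instN :: "tm \<Rightarrow> fm \<Rightarrow> fm" where "instN t = subst (case_nat t Var) id"
definition instS :: "nat \<Rightarrow> fm \<Rightarrow> fm" where "instS X = subst Var (case_nat X id)"

text \<open>\<open>closed_fm m k \<phi>\<close>: all free number indices of \<open>\<phi>\<close> are below \<open>m\<close>, all free set indices below \<open>k\<close>.\<close>

primrec closed_tm :: "nat \<Rightarrow> tm \<Rightarrow> bool" where
  "closed_tm m (Var n) = (n < m)"
| "closed_tm m Zero = True"
| "closed_tm m One = True"
| "closed_tm m (s \<^bold>+ t) = (closed_tm m s \<and> closed_tm m t)"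
| "closed_tm m (s \<^bold>* t) = (closed_tm m s \<and> closed_tm m t)"

primrec closed_fm :: "nat \<Rightarrow> nat \<Rightarrow> fm \<Rightarrow> bool" where
  "closed_fm m k \<^bold>\<bottom> = True"
| "closed_fm m k (s \<^bold>= t) = (closed_tm m s \<and> closed_tm m t)"
| "closed_fm m k (s \<^bold>< t) = (closed_tm m s \<and> closed_tm m t)"
| "closed_fm m k (t \<^bold>\<in> X) = (closed_tm m t \<and> X < k)"
| "closed_fm m k (\<phi> \<^bold>\<longrightarrow> \<psi>) = (closed_fm m k \<phi> \<and> closed_fm m k \<psi>)"
| "closed_fm m k (AllN \<phi>) = closed_fm (Suc m) k \<phi>"
| "closed_fm m k (AllS \<phi>) = closed_fm m (Suc k) \<phi>"

abbreviation sentence :: "fm \<Rightarrow> bool" where "sentence \<equiv> closed_fm 0 0"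


section \<open>Provability\<close>

text \<open>Classical two-sorted natural deduction with equality on the number sort.\<close>

inductive provable :: "fm set \<Rightarrow> fm \<Rightarrow> bool"  (infix "\<turnstile>" 50) where
  Assm: "\<phi> \<in> \<Gamma> \<Longrightarrow> \<Gamma> \<turnstile> \<phi>"
| ImpI: "insert \<phi> \<Gamma> \<turnstile> \<psi> \<Longrightarrow> \<Gamma> \<turnstile> \<phi> \<^bold>\<longrightarrow> \<psi>"
| ImpE: "\<Gamma> \<turnstile> \<phi> \<^bold>\<longrightarrow> \<psi> \<Longrightarrow> \<Gamma> \<turnstile> \<phi> \<Longrightarrow> \<Gamma> \<turnstile> \<psi>"
| Contr: "insert (\<^bold>\<not> \<phi>) \<Gamma> \<turnstile> \<^bold>\<bottom> \<Longrightarrow> \<Gamma> \<turnstile> \<phi>"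
| AllNI: "liftN ` \<Gamma> \<turnstile> \<phi> \<Longrightarrow> \<Gamma> \<turnstile> AllN \<phi>"
| AllNE: "\<Gamma> \<turnstile> AllN \<phi> \<Longrightarrow> \<Gamma> \<turnstile> instN t \<phi>"
| AllSI: "liftS ` \<Gamma> \<turnstile> \<phi> \<Longrightarrow> \<Gamma> \<turnstile> AllS \<phi>"
| AllSE: "\<Gamma> \<turnstile> AllS \<phi> \<Longrightarrow> \<Gamma> \<turnstile> instS X \<phi>"
| EqRefl: "\<Gamma> \<turnstile> t \<^bold>= t"
| EqSubst: "\<Gamma> \<turnstile> s \<^bold>= t \<Longrightarrow> \<Gamma> \<turnstile> instN s \<phi> \<Longrightarrow> \<Gamma> \<turnstile> instN t \<phi>"

definition conservative_over :: "fm set \<Rightarrow> fm set \<Rightarrow> fm set \<Rightarrow> bool" where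
  "conservative_over T T' C \<longleftrightarrow> (\<forall>\<phi>\<in>C. sentence \<phi> \<longrightarrow> T \<turnstile> \<phi> \<longrightarrow> T' \<turnstile> \<phi>)"

text \<open>The sentences obtained from formulas in \<open>A\<close> by universally quantifying all parameters.\<close>

definition closures :: "fm set \<Rightarrow> fm set" where
  "closures A = {\<psi>. sentence \<psi> \<and> (\<exists>\<phi>\<in>A. \<exists>m k. \<psi> = (AllS ^^ k) ((AllN ^^ m) \<phi>))}"


section \<open>The arithmetical hierarchy\<close>

text \<open>The bound \<open>t\<close> is shifted past the quantifier, so it cannot contain the quantified variable.\<close>

definition BAll :: "tm \<Rightarrow> fm \<Rightarrow> fm" where "BAll t \<phi> = AllN (Var 0 \<^bold>< shift 1 t \<^bold>\<longrightarrow> \<phi>)"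
definition BEx :: "tm \<Rightarrow> fm \<Rightarrow> fm" where "BEx t \<phi> = ExN (Var 0 \<^bold>< shift 1 t \<^bold>\<and> \<phi>)"

inductive_set delta0 :: "fm set" where
  "\<^bold>\<bottom> \<in> delta0"
| "s \<^bold>= t \<in> delta0"
| "s \<^bold>< t \<in> delta0"
| "t \<^bold>\<in> X \<in> delta0"
| "\<phi> \<in> delta0 \<Longrightarrow> \<psi> \<in> delta0 \<Longrightarrow> \<phi> \<^bold>\<longrightarrow> \<psi> \<in> delta0"
| "\<phi> \<in> delta0 \<Longrightarrow> BAll t \<phi> \<in> delta0"
| "\<phi> \<in> delta0 \<Longrightarrow> BEx t \<phi> \<in> delta0"

fun sigma0 :: "nat \<Rightarrow> fm set" and pi0 :: "nat \<Rightarrow> fm set" where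
  "sigma0 0 = delta0"
| "sigma0 (Suc n) = {ExN \<phi> |\<phi>. \<phi> \<in> pi0 n}"
| "pi0 0 = delta0"
| "pi0 (Suc n) = {AllN \<phi> |\<phi>. \<phi> \<in> sigma0 n}"

definition forall_pi0 :: "nat \<Rightarrow> fm set" where
  "forall_pi0 n = {AllS \<phi> |\<phi>. \<phi> \<in> pi0 n}"


section \<open>\<open>RCA\<^sub>0\<close> and bounding\<close>

definition basic_axioms :: "fm set" where
  "basic_axioms = {
     \<^bold>\<not> (Var 0 \<^bold>+ One \<^bold>= Zero),
     Var 0 \<^bold>+ One \<^bold>= Var 1 \<^bold>+ One \<^bold>\<longrightarrow> Var 0 \<^bold>= Var 1,
     Var 0 \<^bold>+ Zero \<^bold>= Var 0,
     Var 0 \<^bold>+ (Var 1 \<^bold>+ One) \<^bold>= (Var 0 \<^bold>+ Var 1) \<^bold>+ One,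
     Var 0 \<^bold>* Zero \<^bold>= Zero,
     Var 0 \<^bold>* (Var 1 \<^bold>+ One) \<^bold>= (Var 0 \<^bold>* Var 1) \<^bold>+ Var 0,
     \<^bold>\<not> (Var 0 \<^bold>< Zero),
     Var 0 \<^bold>< Var 1 \<^bold>+ One \<^bold>\<longleftrightarrow> (Var 0 \<^bold>< Var 1 \<^bold>\<or> Var 0 \<^bold>= Var 1)}"

text \<open>In the schemas, number index 0 of \<open>\<phi>\<close> (and \<open>\<psi>\<close>) is the distinguished variable; all other
  indices are parameters.\<close>

definition induction_axiom :: "fm \<Rightarrow> fm" where
  "induction_axiom \<phi> =
     (instN Zero \<phi> \<^bold>\<and> AllN (\<phi> \<^bold>\<longrightarrow> subst (case_nat (Var 0 \<^bold>+ One) (\<lambda>n. Var (Suc n))) id \<phi>)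
      \<^bold>\<longrightarrow> AllN \<phi>)"

definition comprehension_axiom :: "fm \<Rightarrow> fm \<Rightarrow> fm" where
  "comprehension_axiom \<phi> \<psi> =
     (AllN (\<phi> \<^bold>\<longleftrightarrow> \<psi>) \<^bold>\<longrightarrow> ExS (AllN (Var 0 \<^bold>\<in> 0 \<^bold>\<longleftrightarrow> liftS \<phi>)))"

definition RCA0 :: "fm set" where
  "RCA0 = closures (basic_axioms
     \<union> {induction_axiom \<phi> |\<phi>. \<phi> \<in> sigma0 1}
     \<union> {comprehension_axiom \<phi> \<psi> |\<phi> \<psi>. \<phi> \<in> sigma0 1 \<and> \<psi> \<in> pi0 1})"

text \<open>
  \<open>\<forall>a. (\<forall>x<a. \<exists>y. \<phi>(x,y)) \<longrightarrow> (\<exists>b. \<forall>x<a. \<exists>y<b. \<phi>(x,y))\<close>, where \<open>y\<close>, \<open>x\<close> are number indices 0, 1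
  of \<open>\<phi>\<close>; the substitutions move the parameters of \<open>\<phi>\<close> past \<open>a\<close>, respectively past \<open>b\<close> and \<open>a\<close>.
\<close>

definition bounding_axiom :: "fm \<Rightarrow> fm" where
  "bounding_axiom \<phi> = AllN
     (BAll (Var 0) (ExN (subst (\<lambda>n. Var (if n < 2 then n else n + 1)) id \<phi>))
      \<^bold>\<longrightarrow> ExN (BAll (Var 1) (BEx (Var 1) (subst (\<lambda>n. Var (if n < 2 then n else n + 2)) id \<phi>))))"

definition BSigma :: "nat \<Rightarrow> fm set" where
  "BSigma n = closures {bounding_axiom \<phi> |\<phi>. \<phi> \<in> sigma0 n}"


section \<open>Coding pairs and finite sequences\<close>

definition pr :: "tm \<Rightarrow> tm \<Rightarrow> tm" where
  "pr s t = (s \<^bold>+ t) \<^bold>* (s \<^bold>+ t) \<^bold>+ s"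

definition two :: tm where "two = One \<^bold>+ One"

text \<open>
  Simpson's coding: a triple \<open>(k,(m,n))\<close> represents the finite set of all \<open>i < k\<close> such that
  \<open>m(i+1)+1\<close> divides \<open>n\<close>; the code of a finite set is the least triple representing it, and a
  finite sequence is identified with the code of its graph, whose domain is \<open>{i. i < l}\<close> for
  some \<open>l\<close>. \<open>in_code i c\<close> says that \<open>i\<close> belongs to the finite set represented by \<open>c\<close>.
\<close>

definition triple :: "tm \<Rightarrow> fm" where
  "triple c = ExN (ExN (ExN (shift 3 c \<^bold>= pr (Var 2) (pr (Var 1) (Var 0)))))"

definition in_code :: "tm \<Rightarrow> tm \<Rightarrow> fm" where
  "in_code i c = ExN (ExN (ExN
     (shift 3 c \<^bold>= pr (Var 2) (pr (Var 1) (Var 0)) \<^bold>\<and> shift 3 i \<^bold>< Var 2 \<^bold>\<and>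
      ExN (Var 1 \<^bold>= Var 0 \<^bold>* (Var 2 \<^bold>* (shift 4 i \<^bold>+ One) \<^bold>+ One)))))"

definition set_code :: "tm \<Rightarrow> fm" where
  "set_code c = (triple c \<^bold>\<and> BAll c
     (triple (Var 0) \<^bold>\<longrightarrow> \<^bold>\<not> AllN (in_code (Var 0) (Var 1) \<^bold>\<longleftrightarrow> in_code (Var 0) (shift 2 c))))"

definition has_length :: "tm \<Rightarrow> tm \<Rightarrow> fm" where
  "has_length s l = AllN
     (Var 0 \<^bold>< shift 1 l \<^bold>\<longleftrightarrow> ExN (in_code (pr (Var 1) (Var 0)) (shift 2 s)))"

definition fin_seq :: "tm \<Rightarrow> fm" where
  "fin_seq s = (set_code s
     \<^bold>\<and> AllN (in_code (Var 0) (shift 1 s) \<^bold>\<longrightarrow> ExN (ExN (Var 2 \<^bold>= pr (Var 1) (Var 0))))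
     \<^bold>\<and> AllN (AllN (AllN
          (in_code (pr (Var 2) (Var 1)) (shift 3 s) \<^bold>\<and> in_code (pr (Var 2) (Var 0)) (shift 3 s)
           \<^bold>\<longrightarrow> Var 1 \<^bold>= Var 0)))
     \<^bold>\<and> ExN (has_length (shift 1 s) (Var 0)))"

definition binary_seq :: "tm \<Rightarrow> fm" where
  "binary_seq s = (fin_seq s
     \<^bold>\<and> AllN (AllN (in_code (pr (Var 1) (Var 0)) (shift 2 s) \<^bold>\<longrightarrow> Var 0 \<^bold>< two)))"

text \<open>For sequences, being an initial segment is inclusion of graphs.\<close>

definition initial_segment :: "tm \<Rightarrow> tm \<Rightarrow> fm" where
  "initial_segment t s = AllN (in_code (Var 0) (shift 1 t) \<^bold>\<longrightarrow> in_code (Var 0) (shift 1 s))"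


section \<open>Weak Koenig's lemma and the Erdos-Moser theorem\<close>

definition infinite_set :: "nat \<Rightarrow> fm" where
  "infinite_set X = AllN (ExN (Var 1 \<^bold>< Var 0 \<^bold>\<and> Var 0 \<^bold>\<in> X))"

definition binary_tree :: "nat \<Rightarrow> fm" where
  "binary_tree T =
     (AllN (Var 0 \<^bold>\<in> T \<^bold>\<longrightarrow> binary_seq (Var 0))
      \<^bold>\<and> AllN (AllN (Var 1 \<^bold>\<in> T \<^bold>\<and> fin_seq (Var 0) \<^bold>\<and> initial_segment (Var 0) (Var 1)
          \<^bold>\<longrightarrow> Var 0 \<^bold>\<in> T)))"

definition total_function :: "nat \<Rightarrow> fm" where
  "total_function G =
     (AllN (Var 0 \<^bold>\<in> G \<^bold>\<longrightarrow> ExN (ExN (Var 2 \<^bold>= pr (Var 1) (Var 0))))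
      \<^bold>\<and> AllN (ExN (pr (Var 1) (Var 0) \<^bold>\<in> G))
      \<^bold>\<and> AllN (AllN (AllN (pr (Var 2) (Var 1) \<^bold>\<in> G \<^bold>\<and> pr (Var 2) (Var 0) \<^bold>\<in> G
          \<^bold>\<longrightarrow> Var 1 \<^bold>= Var 0))))"

text \<open>\<open>G\<close> is a path through \<open>T\<close>: for every \<open>n\<close>, the sequence \<open>\<langle>G(0),\<dots>,G(n-1)\<rangle>\<close> is in \<open>T\<close>.\<close>

definition path_through :: "nat \<Rightarrow> nat \<Rightarrow> fm" where
  "path_through G T = (total_function G
     \<^bold>\<and> AllN (ExN (Var 0 \<^bold>\<in> T \<^bold>\<and> fin_seq (Var 0) \<^bold>\<and> has_length (Var 0) (Var 1)
         \<^bold>\<and> AllN (in_code (Var 0) (Var 1) \<^bold>\<longrightarrow> Var 0 \<^bold>\<in> G))))"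

definition WKL :: fm where
  "WKL = AllS (binary_tree 0 \<^bold>\<and> infinite_set 0 \<^bold>\<longrightarrow> ExS (path_through 0 1))"

definition WKL0 :: "fm set" where
  "WKL0 = insert WKL RCA0"

text \<open>A coloring \<open>[\<nat>]\<^sup>2 \<rightarrow> 2\<close> is a function coded by its graph, the set of all \<open>((x,y),i)\<close> such that
  \<open>x < y\<close> and the color of \<open>{x,y}\<close> is \<open>i\<close>.\<close>

definition color :: "nat \<Rightarrow> tm \<Rightarrow> tm \<Rightarrow> tm \<Rightarrow> fm" where
  "color F x y i = (pr (pr x y) i \<^bold>\<in> F)"

definition coloring :: "nat \<Rightarrow> fm" where
  "coloring F =
     (AllN (Var 0 \<^bold>\<in> F \<^bold>\<longrightarrow> ExN (ExN (ExN
        (Var 3 \<^bold>= pr (pr (Var 2) (Var 1)) (Var 0) \<^bold>\<and> Var 2 \<^bold>< Var 1 \<^bold>\<and> Var 0 \<^bold>< two))))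
      \<^bold>\<and> AllN (AllN (Var 1 \<^bold>< Var 0 \<^bold>\<longrightarrow> ExN (color F (Var 2) (Var 1) (Var 0))))
      \<^bold>\<and> AllN (AllN (AllN (AllN
          (color F (Var 3) (Var 2) (Var 1) \<^bold>\<and> color F (Var 3) (Var 2) (Var 0)
           \<^bold>\<longrightarrow> Var 1 \<^bold>= Var 0)))))"

definition transitive_set :: "nat \<Rightarrow> nat \<Rightarrow> fm" where
  "transitive_set F H = AllN (AllN (AllN
     (Var 2 \<^bold>< Var 1 \<^bold>\<and> Var 1 \<^bold>< Var 0 \<^bold>\<and> Var 2 \<^bold>\<in> H \<^bold>\<and> Var 1 \<^bold>\<in> H \<^bold>\<and> Var 0 \<^bold>\<in> H \<^bold>\<longrightarrow>
      BAll two (color F (Var 3) (Var 2) (Var 0) \<^bold>\<and> color F (Var 2) (Var 1) (Var 0)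
                \<^bold>\<longrightarrow> color F (Var 3) (Var 1) (Var 0)))))"

definition EM :: fm where
  "EM = AllS (coloring 0 \<^bold>\<longrightarrow> ExS (infinite_set 0 \<^bold>\<and> transitive_set 1 0))"

end

theory Submission
  imports Defs "HOL-Library.Countable_Set"
begin

text \<open>
  Suppose that \<open>RCA\<^sub>0 + B\<Sigma>\<^sub>2\<close> does not prove \<open>\<forall>X \<forall>p \<exists>x \<forall>y \<exists>z. \<delta>\<close>. By completeness and
  compactness there is a countable nonstandard model with a set \<open>X\<close> and a number \<open>p\<close> such that
  \<open>\<forall>x \<exists>y \<forall>z. \<not> \<delta>\<close>. By \<open>B\<Sigma>\<^sub>2\<close>, for all \<open>u\<close> there is \<open>v\<close> such that every \<open>x \<le> u\<close> has a \<open>y \<le> v\<close> with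
  \<open>\<forall>z. \<not> \<delta>\<close>; call a set sparse if its consecutive elements are related in this way, with \<open>z\<close>
  bounded by the elements of the set. There is a notion of largeness of order \<open>n\<close> for coded
  sparse sets, analogous to \<open>\<omega>\<^sup>n\<close>-largeness, which survives the pigeonhole principle and passage
  to a transitive subset for a colouring of pairs, at the cost of decreasing \<open>n\<close>. Sets that
  are large of every standard order exist by overspill. Starting with such a set, a sequence of
  such sets \<open>F\<^sub>0 \<supseteq> F\<^sub>1 \<supseteq> \<dots>\<close> with \<open>a\<^sub>i \<in> F\<^sub>i\<close> decides all coded colourings of pairs and all
  bounded existential questions about coded sets. Let \<open>I\<close> be the cut with cofinal sequence \<open>a\<close>,
  together with the traces of coded sets on \<open>I\<close>. It satisfies \<open>\<Sigma>\<^sub>1\<close> induction and \<open>EM\<close> by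
  construction, it satisfies comprehension and \<open>WKL\<close> since its sets are traces of coded sets, and
  it satisfies \<open>\<forall>x \<exists>y \<forall>z. \<not> \<delta>\<close> by sparseness. So \<open>WKL\<^sub>0 + EM\<close> does not prove the sentence either.
\<close>

section \<open>Semantics and soundness\<close>

text \<open>The ambient model has only Sigma_1 induction and Sigma_2 bounding, so the combinatorics
  is carried out with bounded formulas. Hence the sets in play have codes below one bound
  \<open>B\<close>, quantifiers over sets become bounded quantifiers over codes, having more than
  \<open>a\<close> elements means that no coded injection exists, and \<open>K\<close> stands in for
  exponentiation. Order n+1 means: an element \<open>a\<close> followed by more than
  \<open>a\<close> blocks of order n, each far beyond the previous ones. Every combinatorial step
  consumes a higher order than it returns (2n for n in the pigeonhole principle,
  \<open>em_index n\<close> for n in passing to transitive sets). Infinitely many steps are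
  affordable because the sets have all standard orders at once: whatever can be achieved at each
  standard order can, by overspill, be achieved by one set of all these orders. This is why the
  model has to be nonstandard. The statement \<forall>x \<exists>y \<forall>z survives in the cut
  since sparseness bounds y by the next element, and the greatest element of each stage lies above
  the whole cut, so that a bounded test for z covers every z in the cut.\<close>

locale arith =
  fixes zr on :: 'm and ad ml :: "'m \<Rightarrow> 'm \<Rightarrow> 'm" and ls :: "'m \<Rightarrow> 'm \<Rightarrow> bool"
begin

primrec ev :: "(nat \<Rightarrow> 'm) \<Rightarrow> tm \<Rightarrow> 'm" where
  "ev e (Var n) = e n"
| "ev e Zero = zr"
| "ev e One = on"
| "ev e (s \<^bold>+ t) = ad (ev e s) (ev e t)"
| "ev e (s \<^bold>* t) = ml (ev e s) (ev e t)"

text \<open>The number domain \<open>D\<close> is a separate argument so that a cut can be evaluated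
  with the operations of its model; the model itself is the case \<open>D = UNIV\<close>.\<close>

primrec sat :: "'m set \<Rightarrow> 'm set set \<Rightarrow> (nat \<Rightarrow> 'm) \<Rightarrow> (nat \<Rightarrow> 'm set) \<Rightarrow> fm \<Rightarrow> bool" where
  "sat D S e E \<^bold>\<bottom> = False"
| "sat D S e E (s \<^bold>= t) = (ev e s = ev e t)"
| "sat D S e E (s \<^bold>< t) = ls (ev e s) (ev e t)"
| "sat D S e E (t \<^bold>\<in> X) = (ev e t \<in> E X)"
| "sat D S e E (\<phi> \<^bold>\<longrightarrow> \<psi>) = (sat D S e E \<phi> \<longrightarrow> sat D S e E \<psi>)"
| "sat D S e E (AllN \<phi>) = (\<forall>x\<in>D. sat D S (case_nat x e) E \<phi>)"
| "sat D S e E (AllS \<phi>) = (\<forall>X\<in>S. sat D S e (case_nat X E) \<phi>)"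

lemma ev_substt: "ev e (substt \<sigma> t) = ev (\<lambda>n. ev e (\<sigma> n)) t"
  by (induction t) auto

lemma ev_shift [simp]: "ev e (shift k t) = ev (\<lambda>n. e (n + k)) t"
  by (simp add: shift_def ev_substt)

lemma ev_lift:
  "(\<lambda>n. ev (case_nat x e) (case_nat (Var 0) (\<lambda>n. shift 1 (\<sigma> n)) n)) = case_nat x (\<lambda>n. ev e (\<sigma> n))"
  "(\<lambda>n. ev e (case_nat t Var n)) = case_nat (ev e t) e"
  "(\<lambda>n. case_nat X E (case_nat 0 (\<lambda>n. Suc (\<rho> n)) n)) = case_nat X (\<lambda>n. E (\<rho> n))"
  "(\<lambda>n. E (case_nat k id n)) = case_nat (E k) E"
  by (auto split: nat.split)

lemma sat_subst: "sat D S e E (subst \<sigma> \<rho> \<phi>) = sat D S (\<lambda>n. ev e (\<sigma> n)) (\<lambda>n. E (\<rho> n)) \<phi>"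
  by (induction \<phi> arbitrary: e E \<sigma> \<rho>) (simp_all add: ev_substt ev_lift del: One_nat_def)

lemma sat_liftN [simp]: "sat D S e E (liftN \<phi>) = sat D S (\<lambda>n. e (Suc n)) E \<phi>"
  by (simp add: liftN_def sat_subst)

lemma sat_liftS [simp]: "sat D S e E (liftS \<phi>) = sat D S e (\<lambda>n. E (Suc n)) \<phi>"
  by (simp add: liftS_def sat_subst)

lemma sat_instN [simp]: "sat D S e E (instN t \<phi>) = sat D S (case_nat (ev e t) e) E \<phi>"
  by (simp add: instN_def sat_subst ev_lift)

lemma sat_instS [simp]: "sat D S e E (instS X \<phi>) = sat D S e (case_nat (E X) E) \<phi>"
  by (simp add: instS_def sat_subst ev_lift)

text \<open>Soundness of \<open>AllNE\<close> requires the value of every term to lie in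
  \<open>D\<close>. Sets have no compound terms, so nothing comparable arises for
  \<open>S\<close>.\<close>

definition closed_dom :: "'m set \<Rightarrow> bool" where
  "closed_dom D \<longleftrightarrow> zr \<in> D \<and> on \<in> D \<and> (\<forall>x\<in>D. \<forall>y\<in>D. ad x y \<in> D \<and> ml x y \<in> D)"

lemma ev_in_dom: "closed_dom D \<Longrightarrow> (\<And>n. e n \<in> D) \<Longrightarrow> ev e t \<in> D"
  by (induction t) (auto simp: closed_dom_def)

theorem soundness:
  assumes "\<Gamma> \<turnstile> \<phi>" and D: "closed_dom D"
  shows "(\<And>n. e n \<in> D) \<Longrightarrow> (\<And>n. E n \<in> S) \<Longrightarrow> (\<And>\<gamma>. \<gamma> \<in> \<Gamma> \<Longrightarrow> sat D S e E \<gamma>) \<Longrightarrow> sat D S e E \<phi>"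
  using assms(1)
proof (induction arbitrary: e E rule: provable.induct)
  case (AllNI \<Gamma> \<phi>)
  show ?case
    unfolding sat.simps
  proof
    fix x assume "x \<in> D"
    show "sat D S (case_nat x e) E \<phi>"
      by (rule AllNI.IH) (auto simp: AllNI.prems \<open>x \<in> D\<close> split: nat.split)
  qed
next
  case (AllNE \<Gamma> \<phi> t)
  have "sat D S e E (AllN \<phi>)" by (rule AllNE.IH[OF AllNE.prems])
  then show ?case using ev_in_dom[OF D, of e t] AllNE.prems(1) by simp
next
  case (AllSI \<Gamma> \<phi>)
  show ?case
    unfolding sat.simps
  proof
    fix X assume "X \<in> S"
    show "sat D S e (case_nat X E) \<phi>"
      by (rule AllSI.IH) (auto simp: AllSI.prems \<open>X \<in> S\<close> split: nat.split)
  qed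
next
  case (ImpI \<phi> \<Gamma> \<psi>)
  show ?case
    unfolding sat.simps by (intro impI, rule ImpI.IH) (auto simp: ImpI.prems)
next
  case (Contr \<phi> \<Gamma>)
  show ?case
  proof (rule ccontr)
    assume "\<not> sat D S e E \<phi>"
    then have "sat D S e E \<^bold>\<bottom>" by (intro Contr.IH) (auto simp: Contr.prems)
    then show False by simp
  qed
next
  case (AllSE \<Gamma> \<phi> X)
  have "sat D S e E (AllS \<phi>)" by (rule AllSE.IH[OF AllSE.prems])
  then show ?case using AllSE.prems(2) by simp
next
  case (EqSubst \<Gamma> s t \<phi>)
  have "sat D S e E (s \<^bold>= t)" "sat D S e E (instN s \<phi>)"
    using EqSubst.IH[OF EqSubst.prems] by blast+
  then show ?case by simp
next
  case (ImpE \<Gamma> \<phi> \<psi>)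
  have "sat D S e E (\<phi> \<^bold>\<longrightarrow> \<psi>)" "sat D S e E \<phi>"
    using ImpE.IH[OF ImpE.prems] by blast+
  then show ?case by simp
qed auto

end


section \<open>Substitution in derivations\<close>

lemma substt_substt: "substt \<sigma>' (substt \<sigma> t) = substt (\<lambda>n. substt \<sigma>' (\<sigma> n)) t"
  by (induction t) auto

lemma substt_Var: "substt Var t = t"
  by (induction t) auto

lemma subst_subst:
  "subst \<sigma>' \<rho>' (subst \<sigma> \<rho> \<phi>) = subst (\<lambda>n. substt \<sigma>' (\<sigma> n)) (\<lambda>n. \<rho>' (\<rho> n)) \<phi>"
proof (induction \<phi> arbitrary: \<sigma> \<rho> \<sigma>' \<rho>')
  case (AllN \<phi>)
  have "(\<lambda>n. substt (case_nat (Var 0) (\<lambda>n. shift 1 (\<sigma>' n))) (case_nat (Var 0) (\<lambda>n. shift 1 (\<sigma> n)) n)) =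
        case_nat (Var 0) (\<lambda>n. shift 1 (substt \<sigma>' (\<sigma> n)))"
    by (auto simp: shift_def substt_substt split: nat.split)
  then show ?case by (simp add: AllN del: One_nat_def)
next
  case (AllS \<phi>)
  have "(\<lambda>n. case_nat 0 (\<lambda>n. Suc (\<rho>' n)) (case_nat 0 (\<lambda>n. Suc (\<rho> n)) n)) =
        case_nat 0 (\<lambda>n. Suc (\<rho>' (\<rho> n)))"
    by (auto split: nat.split)
  then show ?case by (simp add: AllS)
qed (auto simp: substt_substt)

lemma substt_cong: "closed_tm m t \<Longrightarrow> \<forall>n<m. \<sigma> n = \<sigma>' n \<Longrightarrow> substt \<sigma> t = substt \<sigma>' t"
  by (induction t) auto

lemma subst_cong:
  "closed_fm m k \<phi> \<Longrightarrow> (\<And>n. n < m \<Longrightarrow> \<sigma> n = \<sigma>' n) \<Longrightarrow> (\<And>n. n < k \<Longrightarrow> \<rho> n = \<rho>' n) \<Longrightarrow>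
    subst \<sigma> \<rho> \<phi> = subst \<sigma>' \<rho>' \<phi>"
proof (induction \<phi> arbitrary: m k \<sigma> \<sigma>' \<rho> \<rho>')
  case (AllN \<phi>)
  show ?case
    unfolding subst.simps
    by (rule arg_cong[where f = AllN], rule AllN.IH[of "Suc m" k])
      (use AllN.prems in \<open>auto split: nat.split\<close>)
next
  case (AllS \<phi>)
  show ?case
    unfolding subst.simps
    by (rule arg_cong[where f = AllS], rule AllS.IH[of m "Suc k"])
      (use AllS.prems in \<open>auto split: nat.split\<close>)
next
  case (Imp \<phi> \<psi>)
  have "subst \<sigma> \<rho> \<phi> = subst \<sigma>' \<rho>' \<phi>"
    by (rule Imp.IH(1)[of m k]) (use Imp.prems in auto)
  moreover have "subst \<sigma> \<rho> \<psi> = subst \<sigma>' \<rho>' \<psi>"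
    by (rule Imp.IH(2)[of m k]) (use Imp.prems in auto)
  ultimately show ?case by simp
next
  case (Eq s t)
  then show ?case using substt_cong[of m _ \<sigma> \<sigma>'] by simp
next
  case (Less s t)
  then show ?case using substt_cong[of m _ \<sigma> \<sigma>'] by simp
next
  case (Mem t X)
  then show ?case using substt_cong[of m t \<sigma> \<sigma>'] by simp
qed simp

lemma subst_id [simp]: "subst Var id \<phi> = \<phi>"
proof -
  have "subst \<sigma> \<rho> \<phi> = \<phi>" if "\<sigma> = Var" "\<rho> = id" for \<sigma> \<rho>
    using that
  proof (induction \<phi> arbitrary: \<sigma> \<rho>)
    case (AllN \<phi>)
    then show ?case by (auto intro!: AllN.IH ext simp: shift_def split: nat.split)
  next
    case (AllS \<phi>)
    then show ?case by (auto intro!: AllS.IH ext split: nat.split)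
  qed (auto simp: substt_Var)
  then show ?thesis by simp
qed

lemma liftN_subst:
  "subst (case_nat (Var 0) (\<lambda>n. shift 1 (\<sigma> n))) \<rho> (liftN \<phi>) = liftN (subst \<sigma> \<rho> \<phi>)"
  by (simp add: liftN_def subst_subst shift_def)

lemma liftS_subst:
  "subst \<sigma> (case_nat 0 (\<lambda>n. Suc (\<rho> n))) (liftS \<phi>) = liftS (subst \<sigma> \<rho> \<phi>)"
  by (simp add: liftS_def subst_subst substt_Var)

lemma subst_instN:
  "subst \<sigma> \<rho> (instN t \<phi>) = instN (substt \<sigma> t) (subst (case_nat (Var 0) (\<lambda>n. shift 1 (\<sigma> n))) \<rho> \<phi>)"
proof -
  have "(\<lambda>n. substt \<sigma> (case_nat t Var n)) =
    (\<lambda>n. substt (case_nat (substt \<sigma> t) Var) (case_nat (Var 0) (\<lambda>n. shift 1 (\<sigma> n)) n))"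
    by (auto simp: shift_def substt_substt substt_Var split: nat.split)
  then show ?thesis by (simp add: instN_def subst_subst del: One_nat_def)
qed

lemma subst_instS:
  "subst \<sigma> \<rho> (instS X \<phi>) = instS (\<rho> X) (subst \<sigma> (case_nat 0 (\<lambda>n. Suc (\<rho> n))) \<phi>)"
proof -
  have "(\<lambda>n. \<rho> (case_nat X id n)) =
    (\<lambda>n. case_nat (\<rho> X) id (case_nat 0 (\<lambda>n. Suc (\<rho> n)) n))"
    by (auto split: nat.split)
  then show ?thesis by (simp add: instS_def subst_subst substt_Var)
qed

lemma weakening: "\<Gamma> \<turnstile> \<phi> \<Longrightarrow> \<Gamma> \<subseteq> \<Delta> \<Longrightarrow> \<Delta> \<turnstile> \<phi>"
proof (induction arbitrary: \<Delta> rule: provable.induct)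
  case (ImpI \<phi> \<Gamma> \<psi>)
  then show ?case by (meson insert_mono provable.ImpI)
next
  case (Contr \<phi> \<Gamma>)
  then show ?case by (meson insert_mono provable.Contr)
next
  case (AllNI \<Gamma> \<phi>)
  then show ?case by (meson image_mono provable.AllNI)
next
  case (AllSI \<Gamma> \<phi>)
  then show ?case by (meson image_mono provable.AllSI)
next
  case (EqSubst \<Gamma> s t \<phi>)
  then show ?case by (meson provable.EqSubst)
qed (auto intro: provable.intros)

lemma provable_subst: "\<Gamma> \<turnstile> \<phi> \<Longrightarrow> subst \<sigma> \<rho> ` \<Gamma> \<turnstile> subst \<sigma> \<rho> \<phi>"
proof (induction arbitrary: \<sigma> \<rho> rule: provable.induct)
  case (AllNI \<Gamma> \<phi>)
  show ?case
    using AllNI.IH[of "case_nat (Var 0) (\<lambda>n. shift 1 (\<sigma> n))" \<rho>]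
    by (auto intro!: provable.AllNI simp: image_image liftN_subst simp del: One_nat_def)
next
  case (AllSI \<Gamma> \<phi>)
  show ?case
    using AllSI.IH[of \<sigma> "case_nat 0 (\<lambda>n. Suc (\<rho> n))"]
    by (auto intro!: provable.AllSI simp: image_image liftS_subst)
next
  case (ImpI \<phi> \<Gamma> \<psi>)
  then show ?case by (simp add: provable.ImpI)
next
  case (ImpE \<Gamma> \<phi> \<psi>)
  then show ?case by (metis provable.ImpE subst.simps(5))
next
  case (Contr \<phi> \<Gamma>)
  then show ?case by (simp add: provable.Contr)
next
  case (AllNE \<Gamma> \<phi> t)
  then show ?case by (auto simp: subst_instN intro: provable.AllNE)
next
  case (AllSE \<Gamma> \<phi> X)
  then show ?case by (auto simp: subst_instS intro: provable.AllSE)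
next
  case (EqSubst \<Gamma> s t \<phi>)
  then show ?case by (metis provable.EqSubst subst.simps(2) subst_instN)
qed (auto intro: provable.intros)

lemma provable_finite: "\<Gamma> \<turnstile> \<phi> \<Longrightarrow> \<exists>\<Delta>. finite \<Delta> \<and> \<Delta> \<subseteq> \<Gamma> \<and> \<Delta> \<turnstile> \<phi>"
proof (induction rule: provable.induct)
  case (Assm \<phi> \<Gamma>)
  then show ?case by (intro exI[of _ "{\<phi>}"]) (simp add: provable.Assm)
next
  case (ImpI \<phi> \<Gamma> \<psi>)
  then obtain \<Delta> where \<Delta>: "finite \<Delta>" "\<Delta> \<subseteq> insert \<phi> \<Gamma>" "\<Delta> \<turnstile> \<psi>" by (elim exE conjE)
  have "insert \<phi> (\<Delta> - {\<phi>}) \<turnstile> \<psi>" by (rule weakening[OF \<Delta>(3)]) blast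
  then have "\<Delta> - {\<phi>} \<turnstile> \<phi> \<^bold>\<longrightarrow> \<psi>" by (rule provable.ImpI)
  then show ?case using \<Delta> by (intro exI[of _ "\<Delta> - {\<phi>}"]) blast
next
  case (ImpE \<Gamma> \<phi> \<psi>)
  then obtain \<Delta> \<Delta>' where \<Delta>: "finite \<Delta>" "\<Delta> \<subseteq> \<Gamma>" "\<Delta> \<turnstile> \<phi> \<^bold>\<longrightarrow> \<psi>"
    and \<Delta>': "finite \<Delta>'" "\<Delta>' \<subseteq> \<Gamma>" "\<Delta>' \<turnstile> \<phi>" by (elim exE conjE)
  have "\<Delta> \<union> \<Delta>' \<turnstile> \<psi>"
    by (rule provable.ImpE[OF weakening[OF \<Delta>(3)] weakening[OF \<Delta>'(3)]]) blast+
  then show ?case using \<Delta> \<Delta>' by (intro exI[of _ "\<Delta> \<union> \<Delta>'"]) simp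
next
  case (Contr \<phi> \<Gamma>)
  then obtain \<Delta> where \<Delta>: "finite \<Delta>" "\<Delta> \<subseteq> insert (\<^bold>\<not> \<phi>) \<Gamma>" "\<Delta> \<turnstile> \<^bold>\<bottom>" by (elim exE conjE)
  have "insert (\<^bold>\<not> \<phi>) (\<Delta> - {\<^bold>\<not> \<phi>}) \<turnstile> \<^bold>\<bottom>" by (rule weakening[OF \<Delta>(3)]) blast
  then have "\<Delta> - {\<^bold>\<not> \<phi>} \<turnstile> \<phi>" by (rule provable.Contr)
  then show ?case using \<Delta> by (intro exI[of _ "\<Delta> - {\<^bold>\<not> \<phi>}"]) blast
next
  case (AllNI \<Gamma> \<phi>)
  then obtain \<Delta> where \<Delta>: "finite \<Delta>" "\<Delta> \<subseteq> liftN ` \<Gamma>" "\<Delta> \<turnstile> \<phi>" by (elim exE conjE)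
  obtain \<Delta>' where \<Delta>': "\<Delta>' \<subseteq> \<Gamma>" "finite \<Delta>'" "\<Delta> = liftN ` \<Delta>'"
    using finite_subset_image[OF \<Delta>(1,2)] by (elim exE conjE)
  have "\<Delta>' \<turnstile> AllN \<phi>" by (rule provable.AllNI) (use \<Delta>(3) \<Delta>'(3) in simp)
  then show ?case using \<Delta>' by (intro exI[of _ \<Delta>']) simp
next
  case (AllSI \<Gamma> \<phi>)
  then obtain \<Delta> where \<Delta>: "finite \<Delta>" "\<Delta> \<subseteq> liftS ` \<Gamma>" "\<Delta> \<turnstile> \<phi>" by (elim exE conjE)
  obtain \<Delta>' where \<Delta>': "\<Delta>' \<subseteq> \<Gamma>" "finite \<Delta>'" "\<Delta> = liftS ` \<Delta>'"
    using finite_subset_image[OF \<Delta>(1,2)] by (elim exE conjE)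
  have "\<Delta>' \<turnstile> AllS \<phi>" by (rule provable.AllSI) (use \<Delta>(3) \<Delta>'(3) in simp)
  then show ?case using \<Delta>' by (intro exI[of _ \<Delta>']) simp
next
  case (AllNE \<Gamma> \<phi> t)
  then show ?case by (elim exE) (rule exI, auto intro: provable.AllNE)
next
  case (AllSE \<Gamma> \<phi> X)
  then show ?case by (elim exE) (rule exI, auto intro: provable.AllSE)
next
  case (EqSubst \<Gamma> s t \<phi>)
  then obtain \<Delta> \<Delta>' where \<Delta>: "finite \<Delta>" "\<Delta> \<subseteq> \<Gamma>" "\<Delta> \<turnstile> s \<^bold>= t"
    and \<Delta>': "finite \<Delta>'" "\<Delta>' \<subseteq> \<Gamma>" "\<Delta>' \<turnstile> instN s \<phi>" by (elim exE conjE)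
  have "\<Delta> \<union> \<Delta>' \<turnstile> instN t \<phi>"
    by (rule provable.EqSubst[OF weakening[OF \<Delta>(3)] weakening[OF \<Delta>'(3)]]) blast+
  then show ?case using \<Delta> \<Delta>' by (intro exI[of _ "\<Delta> \<union> \<Delta>'"]) simp
next
  case (EqRefl \<Gamma> t)
  show ?case by (intro exI[of _ "{}"]) (simp add: provable.EqRefl)
qed


section \<open>Completeness\<close>

lemma closed_tm_mono: "closed_tm m t \<Longrightarrow> m \<le> m' \<Longrightarrow> closed_tm m' t"
  by (induction t) auto

lemma closed_fm_mono: "closed_fm m k \<phi> \<Longrightarrow> m \<le> m' \<Longrightarrow> k \<le> k' \<Longrightarrow> closed_fm m' k' \<phi>"
  by (induction \<phi> arbitrary: m m' k k') (auto intro: closed_tm_mono)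

lemma ex_closed_tm: "\<exists>m. closed_tm m t"
proof (induction t)
  case (Add s t)
  then obtain m m' where "closed_tm m s" "closed_tm m' t" by blast
  then show ?case by (intro exI[of _ "max m m'"]) (auto intro: closed_tm_mono)
next
  case (Mul s t)
  then obtain m m' where "closed_tm m s" "closed_tm m' t" by blast
  then show ?case by (intro exI[of _ "max m m'"]) (auto intro: closed_tm_mono)
qed auto

lemma ex_closed_fm: "\<exists>m. closed_fm m m \<phi>"
proof (induction \<phi>)
  case (Eq s t)
  obtain m m' where "closed_tm m s" "closed_tm m' t" using ex_closed_tm by meson
  then show ?case by (intro exI[of _ "max m m'"]) (auto intro: closed_tm_mono)
next
  case (Less s t)
  obtain m m' where "closed_tm m s" "closed_tm m' t" using ex_closed_tm by meson
  then show ?case by (intro exI[of _ "max m m'"]) (auto intro: closed_tm_mono)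
next
  case (Mem t X)
  obtain m where "closed_tm m t" using ex_closed_tm by blast
  then show ?case by (intro exI[of _ "max m (Suc X)"]) (auto intro: closed_tm_mono)
next
  case (Imp \<phi> \<psi>)
  then obtain m m' where "closed_fm m m \<phi>" "closed_fm m' m' \<psi>" by blast
  then show ?case by (intro exI[of _ "max m m'"]) (auto intro: closed_fm_mono)
next
  case (AllN \<phi>)
  then obtain m where "closed_fm m m \<phi>" by blast
  then show ?case by (intro exI[of _ m]) (auto intro: closed_fm_mono)
next
  case (AllS \<phi>)
  then obtain m where "closed_fm m m \<phi>" by blast
  then show ?case by (intro exI[of _ m]) (auto intro: closed_fm_mono)
qed auto

lemma ex_closed_set: "finite F \<Longrightarrow> \<exists>m\<ge>1. \<forall>\<phi>\<in>F. closed_fm m m \<phi>"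
proof (induction rule: finite_induct)
  case (insert \<phi> F)
  then obtain m where m: "m \<ge> 1" "\<forall>\<phi>\<in>F. closed_fm m m \<phi>" by blast
  obtain m' where "closed_fm m' m' \<phi>" using ex_closed_fm by blast
  then show ?case using m
    by (intro exI[of _ "max m m'"]) (auto intro: closed_fm_mono[of m m] closed_fm_mono[of m' m'])
qed auto

text \<open>The eigenvariable rule with a named variable \<open>v\<close>, as the Henkin
  construction uses it. Sending \<open>v\<close> to index 0 and shifting every other index agrees
  with \<open>liftN\<close> on \<open>\<Gamma>\<close>, where \<open>v\<close> does not occur, and
  undoes the instantiation of \<open>\<chi>\<close>.\<close>

lemma provable_AllN_fresh:
  assumes "\<Gamma> \<turnstile> instN (Var v) \<chi>" and "\<And>\<gamma>. \<gamma> \<in> \<Gamma> \<Longrightarrow> closed_fm v k \<gamma>" and "closed_fm v k (AllN \<chi>)"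
  shows "\<Gamma> \<turnstile> AllN \<chi>"
proof (rule AllNI)
  let ?\<sigma> = "\<lambda>n. if n = v then Var 0 else Var (Suc n)"
  have 1: "subst ?\<sigma> id \<gamma> = liftN \<gamma>" if "\<gamma> \<in> \<Gamma>" for \<gamma>
    unfolding liftN_def by (rule subst_cong[OF assms(2)[OF that]]) auto
  have 2: "subst ?\<sigma> id (instN (Var v) \<chi>) = subst Var id \<chi>"
    unfolding instN_def subst_subst
    by (rule subst_cong[of "Suc v" k]) (use assms(3) in \<open>auto split: nat.split\<close>)
  show "liftN ` \<Gamma> \<turnstile> \<chi>"
    using provable_subst[OF assms(1), of ?\<sigma> id] 1 2 by simp
qed

lemma provable_AllS_fresh:
  assumes "\<Gamma> \<turnstile> instS v \<chi>" and "\<And>\<gamma>. \<gamma> \<in> \<Gamma> \<Longrightarrow> closed_fm m v \<gamma>" and "closed_fm m v (AllS \<chi>)"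
  shows "\<Gamma> \<turnstile> AllS \<chi>"
proof (rule AllSI)
  let ?\<rho> = "\<lambda>n. if n = v then 0 else Suc n"
  have 1: "subst Var ?\<rho> \<gamma> = liftS \<gamma>" if "\<gamma> \<in> \<Gamma>" for \<gamma>
    unfolding liftS_def by (rule subst_cong[OF assms(2)[OF that]]) auto
  have 2: "subst Var ?\<rho> (instS v \<chi>) = subst Var id \<chi>"
    unfolding instS_def subst_subst
    by (rule subst_cong[of m "Suc v"]) (use assms(3) in \<open>auto split: nat.split\<close>)
  show "liftS ` \<Gamma> \<turnstile> \<chi>"
    using provable_subst[OF assms(1), of Var ?\<rho>] 1 2 by simp
qed

abbreviation consistent :: "fm set \<Rightarrow> bool" where "consistent \<Gamma> \<equiv> \<not> \<Gamma> \<turnstile> \<^bold>\<bottom>"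

lemma consistent_cases: "consistent \<Gamma> \<Longrightarrow> consistent (insert \<phi> \<Gamma>) \<or> consistent (insert (\<^bold>\<not> \<phi>) \<Gamma>)"
  by (meson Contr ImpE ImpI)

instance tm :: countable by countable_datatype
instance fm :: countable by countable_datatype

text \<open>Witnesses are variables, not new constants: \<open>\<Gamma>\<close> contains at most
  number variable 0, and only finitely many further formulas have been added, so fresh variables
  always remain.\<close>

lemma henkin_step:
  assumes \<Gamma>: "\<forall>\<gamma>\<in>\<Gamma>. closed_fm 1 0 \<gamma>" and F: "finite F" "consistent (\<Gamma> \<union> F)"
  shows "\<exists>F'. F \<subseteq> F' \<and> finite F' \<and> consistent (\<Gamma> \<union> F') \<and> (\<phi> \<in> F' \<or> \<^bold>\<not> \<phi> \<in> F') \<and>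
    (\<forall>\<chi>. \<phi> = AllN \<chi> \<longrightarrow> \<^bold>\<not> \<phi> \<in> F' \<longrightarrow> (\<exists>t. \<^bold>\<not> instN t \<chi> \<in> F')) \<and>
    (\<forall>\<chi>. \<phi> = AllS \<chi> \<longrightarrow> \<^bold>\<not> \<phi> \<in> F' \<longrightarrow> (\<exists>X. \<^bold>\<not> instS X \<chi> \<in> F'))"
proof (cases "consistent (\<Gamma> \<union> insert \<phi> F)")
  case True
  have "\<^bold>\<not> \<phi> \<notin> insert \<phi> F"
  proof
    assume "\<^bold>\<not> \<phi> \<in> insert \<phi> F"
    then have "\<Gamma> \<union> insert \<phi> F \<turnstile> \<^bold>\<bottom>" by (metis Assm ImpE UnI2 insertI1)
    then show False using True by simp
  qed
  then show ?thesis using True F by (intro exI[of _ "insert \<phi> F"]) auto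
next
  case False
  then have con: "consistent (\<Gamma> \<union> insert (\<^bold>\<not> \<phi>) F)" using consistent_cases[OF F(2), of \<phi>] by simp
  let ?F = "insert (\<^bold>\<not> \<phi>) F"
  \<comment> \<open>\<open>m \<ge> 1\<close> keeps \<open>m\<close> apart from number variable 0,
    which may occur in \<open>\<Gamma>\<close>.\<close>
  obtain m where m: "m \<ge> 1" "\<forall>\<psi>\<in>?F. closed_fm m m \<psi>"
    using ex_closed_set[of ?F] F by blast
  have cl: "closed_fm m m \<gamma>" if "\<gamma> \<in> \<Gamma> \<union> ?F" for \<gamma>
    using that \<Gamma> m closed_fm_mono[of 1 0 \<gamma> m m] by blast
  have "\<^bold>\<not> \<phi> \<in> \<Gamma> \<union> ?F" by simp
  show ?thesis
  proof (cases "(\<exists>\<chi>. \<phi> = AllN \<chi>) \<or> (\<exists>\<chi>. \<phi> = AllS \<chi>)")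
    case False
    then show ?thesis using con F by (intro exI[of _ ?F]) auto
  next
    case True
    then consider \<chi> where "\<phi> = AllN \<chi>" | \<chi> where "\<phi> = AllS \<chi>" by blast
    then show ?thesis
    proof cases
      case 1
      have "consistent (\<Gamma> \<union> insert (\<^bold>\<not> instN (Var m) \<chi>) ?F)"
      proof
        assume "\<Gamma> \<union> insert (\<^bold>\<not> instN (Var m) \<chi>) ?F \<turnstile> \<^bold>\<bottom>"
        then have "\<Gamma> \<union> ?F \<turnstile> instN (Var m) \<chi>" by (auto intro: Contr)
        then have "\<Gamma> \<union> ?F \<turnstile> AllN \<chi>"
          by (rule provable_AllN_fresh[of _ _ _ m]) (use cl m 1 in auto)
        then show False using con 1 by (metis Assm ImpE UnI2 insertI1)
      qed
      then show ?thesis using 1 F by (intro exI[of _ "insert (\<^bold>\<not> instN (Var m) \<chi>) ?F"]) auto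
    next
      case 2
      have "consistent (\<Gamma> \<union> insert (\<^bold>\<not> instS m \<chi>) ?F)"
      proof
        assume "\<Gamma> \<union> insert (\<^bold>\<not> instS m \<chi>) ?F \<turnstile> \<^bold>\<bottom>"
        then have "\<Gamma> \<union> ?F \<turnstile> instS m \<chi>" by (auto intro: Contr)
        then have "\<Gamma> \<union> ?F \<turnstile> AllS \<chi>"
          by (rule provable_AllS_fresh[of _ _ _ m]) (use cl m 2 in auto)
        then show False using con 2 by (metis Assm ImpE UnI2 insertI1)
      qed
      then show ?thesis using 2 F by (intro exI[of _ "insert (\<^bold>\<not> instS m \<chi>) ?F"]) auto
    qed
  qed
qed

lemma henkin_extension:
  assumes \<Gamma>: "\<forall>\<gamma>\<in>\<Gamma>. closed_fm 1 0 \<gamma>" and con: "consistent \<Gamma>"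
  shows "\<exists>T. \<Gamma> \<subseteq> T \<and> consistent T \<and> (\<forall>\<phi>. \<phi> \<in> T \<or> \<^bold>\<not> \<phi> \<in> T) \<and>
    (\<forall>\<chi>. \<^bold>\<not> AllN \<chi> \<in> T \<longrightarrow> (\<exists>t. \<^bold>\<not> instN t \<chi> \<in> T)) \<and>
    (\<forall>\<chi>. \<^bold>\<not> AllS \<chi> \<in> T \<longrightarrow> (\<exists>X. \<^bold>\<not> instS X \<chi> \<in> T))"
proof -
  define Q where "Q = (\<lambda>\<phi> F'. (\<phi> \<in> F' \<or> \<^bold>\<not> \<phi> \<in> F') \<and>
    (\<forall>\<chi>. \<phi> = AllN \<chi> \<longrightarrow> \<^bold>\<not> \<phi> \<in> F' \<longrightarrow> (\<exists>t. \<^bold>\<not> instN t \<chi> \<in> F')) \<and>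
    (\<forall>\<chi>. \<phi> = AllS \<chi> \<longrightarrow> \<^bold>\<not> \<phi> \<in> F' \<longrightarrow> (\<exists>X. \<^bold>\<not> instS X \<chi> \<in> F')))"
  have step: "\<exists>F'. (finite F' \<and> consistent (\<Gamma> \<union> F')) \<and> F \<subseteq> F' \<and> Q (from_nat n) F'"
    if "finite F \<and> consistent (\<Gamma> \<union> F)" for F n
    using henkin_step[OF \<Gamma>, where F = F and \<phi> = "from_nat n"] that unfolding Q_def by blast
  have base: "\<exists>F. finite F \<and> consistent (\<Gamma> \<union> F)"
    by (intro exI[of _ "{}"]) (use con in simp)
  have "\<exists>F. \<forall>n::nat. (finite (F n) \<and> consistent (\<Gamma> \<union> F n)) \<and> F n \<subseteq> F (Suc n) \<and> Q (from_nat n) (F (Suc n))"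
    by (rule dependent_nat_choice[OF base step])
  then obtain F where F: "\<And>n::nat. finite (F n) \<and> consistent (\<Gamma> \<union> F n)"
    "\<And>n. F n \<subseteq> F (Suc n) \<and> Q (from_nat n) (F (Suc n))"
    by blast
  have mono: "F m \<subseteq> F n" if "m \<le> n" for m n
    using that F(2) by (meson lift_Suc_mono_le)
  define T where "T = \<Gamma> \<union> (\<Union>n. F n)"
  have T1: "consistent T"
  proof
    assume "T \<turnstile> \<^bold>\<bottom>"
    then obtain \<Delta> where \<Delta>: "finite \<Delta>" "\<Delta> \<subseteq> T" "\<Delta> \<turnstile> \<^bold>\<bottom>" using provable_finite by blast
    from \<Delta>(1,2) have "\<exists>n. \<Delta> \<subseteq> \<Gamma> \<union> F n"
    proof (induction rule: finite_induct)
      case (insert x \<Delta>)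
      then obtain n where n: "\<Delta> \<subseteq> \<Gamma> \<union> F n" by blast
      obtain n' where "x \<in> \<Gamma> \<union> F n'" using insert unfolding T_def by blast
      then show ?case using n mono[of n "max n n'"] mono[of n' "max n n'"]
        by (intro exI[of _ "max n n'"]) auto
    qed auto
    then show False using F(1) \<Delta>(3) weakening by blast
  qed
  have Q: "\<exists>n. Q \<phi> (F n)" for \<phi> using F(2)[of "to_nat \<phi>"] by (metis from_nat_to_nat)
  have T2: "\<phi> \<in> T \<or> \<^bold>\<not> \<phi> \<in> T" for \<phi>
    using Q[of \<phi>] unfolding Q_def T_def by blast
  have neg: "\<^bold>\<not> \<phi> \<in> F n" if "\<^bold>\<not> \<phi> \<in> T" "Q \<phi> (F n)" for \<phi> n
  proof (rule ccontr)
    assume "\<^bold>\<not> \<phi> \<notin> F n"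
    then have "\<phi> \<in> T" using that(2) unfolding Q_def T_def by blast
    then show False using that(1) T1 by (meson Assm ImpE)
  qed
  have "\<exists>t. \<^bold>\<not> instN t \<chi> \<in> T" if "\<^bold>\<not> AllN \<chi> \<in> T" for \<chi>
  proof -
    obtain n where n: "Q (AllN \<chi>) (F n)" using Q by blast
    then show ?thesis using neg[OF that n] unfolding Q_def T_def by blast
  qed
  moreover have "\<exists>X. \<^bold>\<not> instS X \<chi> \<in> T" if "\<^bold>\<not> AllS \<chi> \<in> T" for \<chi>
  proof -
    obtain n where n: "Q (AllS \<chi>) (F n)" using Q by blast
    then show ?thesis using neg[OF that n] unfolding Q_def T_def by blast
  qed
  moreover have "\<Gamma> \<subseteq> T" unfolding T_def by blast
  ultimately show ?thesis using T1 T2 by (intro exI[of _ T]) simp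
qed

primrec num :: "nat \<Rightarrow> tm" where
  "num 0 = Zero"
| "num (Suc n) = num n \<^bold>+ One"

text \<open>Number variable 0 may occur free in \<open>\<Gamma>\<close> and then acts as a constant. The two axioms make the term
  model infinite, so that its domain can be taken to be \<open>nat\<close>.\<close>

theorem completeness:
  assumes \<Gamma>: "\<forall>\<gamma>\<in>\<Gamma>. closed_fm 1 0 \<gamma>" and con: "consistent \<Gamma>"
    and Suc_neq_0: "AllN (\<^bold>\<not> (Var 0 \<^bold>+ One \<^bold>= Zero)) \<in> \<Gamma>"
    and Suc_inj: "AllN (AllN (Var 0 \<^bold>+ One \<^bold>= Var 1 \<^bold>+ One \<^bold>\<longrightarrow> Var 0 \<^bold>= Var 1)) \<in> \<Gamma>"
  obtains zr on :: nat and ad ml ls S e E where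
    "\<And>n. E n \<in> S" "\<And>\<gamma>. \<gamma> \<in> \<Gamma> \<Longrightarrow> arith.sat zr on ad ml ls UNIV S e E \<gamma>"
proof -
  obtain T where T: "\<Gamma> \<subseteq> T" "consistent T" "\<forall>\<phi>. \<phi> \<in> T \<or> \<^bold>\<not> \<phi> \<in> T"
    "\<forall>\<chi>. \<^bold>\<not> AllN \<chi> \<in> T \<longrightarrow> (\<exists>t. \<^bold>\<not> instN t \<chi> \<in> T)"
    "\<forall>\<chi>. \<^bold>\<not> AllS \<chi> \<in> T \<longrightarrow> (\<exists>X. \<^bold>\<not> instS X \<chi> \<in> T)"
    using henkin_extension[OF \<Gamma> con] by (elim exE conjE)
  have ded: "T \<turnstile> \<phi> \<longleftrightarrow> \<phi> \<in> T" for \<phi>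
    using T(2,3) by (meson Assm ImpE)
  have neg: "\<^bold>\<not> \<phi> \<in> T \<longleftrightarrow> \<phi> \<notin> T" for \<phi>
    using T(2,3) by (meson Assm ImpE)
  have imp: "(\<phi> \<^bold>\<longrightarrow> \<psi>) \<in> T \<longleftrightarrow> (\<phi> \<in> T \<longrightarrow> \<psi> \<in> T)" for \<phi> \<psi>
  proof
    assume "(\<phi> \<^bold>\<longrightarrow> \<psi>) \<in> T" then show "\<phi> \<in> T \<longrightarrow> \<psi> \<in> T" using ded by (meson ImpE)
  next
    assume a: "\<phi> \<in> T \<longrightarrow> \<psi> \<in> T"
    show "(\<phi> \<^bold>\<longrightarrow> \<psi>) \<in> T"
    proof (cases "\<phi> \<in> T")
      case True
      then have "insert \<phi> T \<turnstile> \<psi>" using a by (auto intro: Assm)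
      then show ?thesis using ded ImpI by blast
    next
      case False
      then have "insert (\<^bold>\<not> \<psi>) (insert \<phi> T) \<turnstile> \<^bold>\<bottom>" using neg by (meson Assm ImpE insertCI)
      then show ?thesis using ded ImpI Contr by blast
    qed
  qed
  have allN: "AllN \<phi> \<in> T \<longleftrightarrow> (\<forall>t. instN t \<phi> \<in> T)" for \<phi>
    using T(4) neg ded AllNE by metis
  have allS: "AllS \<phi> \<in> T \<longleftrightarrow> (\<forall>t. instS t \<phi> \<in> T)" for \<phi>
    using T(5) neg ded AllSE by metis
  have es: "instN t \<phi> \<in> T" if "(s \<^bold>= t) \<in> T" "instN s \<phi> \<in> T" for s t \<phi>
    using that ded EqSubst by blast
  \<comment> \<open>\<open>Q s\<close> is the equivalence class of \<open>s\<close> as a predicate,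
    so \<open>range Q\<close> is the term model before its elements are renamed by natural
    numbers.\<close>
  define Q where "Q = (\<lambda>s t. (s \<^bold>= t) \<in> T)"
  have sh: "substt (case_nat u Var) (shift (Suc 0) s) = s" for u s
    by (simp add: shift_def substt_substt substt_Var)
  have Q_refl: "Q s s" for s unfolding Q_def using ded EqRefl by blast
  have Q_sym: "Q t s" if "Q s t" for s t
    using es[of s t "Var 0 \<^bold>= shift 1 s"] that Q_refl[of s] by (simp add: Q_def instN_def sh)
  have Q_trans: "Q s u" if "Q s t" "Q t u" for s t u
    using es[of t u "shift 1 s \<^bold>= Var 0"] that by (simp add: Q_def instN_def sh)
  have Q_eq: "Q s = Q t \<longleftrightarrow> Q s t" for s t
  proof
    assume "Q s t"
    show "Q s = Q t"
    proof
      fix u show "Q s u = Q t u"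
        using \<open>Q s t\<close> Q_sym[of s t] Q_trans[of s t u] Q_trans[of t s u] by argo
    qed
  qed (simp add: Q_refl)
  have Q_add: "Q (s \<^bold>+ u) (s' \<^bold>+ u')" if "Q s s'" "Q u u'" for s u s' u'
  proof -
    have "Q (s \<^bold>+ u) (s' \<^bold>+ u)"
      using es[of s s' "shift 1 (s \<^bold>+ u) \<^bold>= Var 0 \<^bold>+ shift 1 u"] that Q_refl
      by (simp add: Q_def instN_def sh)
    moreover have "Q (s' \<^bold>+ u) (s' \<^bold>+ u')"
      using es[of u u' "shift 1 (s' \<^bold>+ u) \<^bold>= shift 1 s' \<^bold>+ Var 0"] that Q_refl
      by (simp add: Q_def instN_def sh)
    ultimately show ?thesis using Q_trans by blast
  qed
  have Q_mul: "Q (s \<^bold>* u) (s' \<^bold>* u')" if "Q s s'" "Q u u'" for s u s' u'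
  proof -
    have "Q (s \<^bold>* u) (s' \<^bold>* u)"
      using es[of s s' "shift 1 (s \<^bold>* u) \<^bold>= Var 0 \<^bold>* shift 1 u"] that Q_refl
      by (simp add: Q_def instN_def sh)
    moreover have "Q (s' \<^bold>* u) (s' \<^bold>* u')"
      using es[of u u' "shift 1 (s' \<^bold>* u) \<^bold>= shift 1 s' \<^bold>* Var 0"] that Q_refl
      by (simp add: Q_def instN_def sh)
    ultimately show ?thesis using Q_trans by blast
  qed
  have Q_less: "(s \<^bold>< u) \<in> T \<longleftrightarrow> (s' \<^bold>< u') \<in> T" if "Q s s'" "Q u u'" for s u s' u'
  proof -
    have *: "(s' \<^bold>< u') \<in> T" if "Q s s'" "Q u u'" "(s \<^bold>< u) \<in> T" for s u s' u'
    proof -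
      have "(s' \<^bold>< u) \<in> T"
        using es[of s s' "Var 0 \<^bold>< shift 1 u"] that by (simp add: Q_def instN_def sh)
      then show ?thesis
        using es[of u u' "shift 1 s' \<^bold>< Var 0"] that by (simp add: Q_def instN_def sh)
    qed
    show ?thesis using *[of s s' u u'] *[of s' s u' u] that Q_sym by blast
  qed
  have Q_mem: "(s \<^bold>\<in> X) \<in> T \<longleftrightarrow> (s' \<^bold>\<in> X) \<in> T" if "Q s s'" for s s' X
    using es[of s s' "Var 0 \<^bold>\<in> X"] es[of s' s "Var 0 \<^bold>\<in> X"] that Q_sym[OF that]
    by (auto simp: Q_def instN_def)
  have Q_num: "m = n" if "Q (num m) (num n)" for m n
  proof -
    have z: "\<not> Q (t \<^bold>+ One) Zero" for t
    proof -
      have "instN t (\<^bold>\<not> (Var 0 \<^bold>+ One \<^bold>= Zero)) \<in> T" using Suc_neq_0 T(1) allN by blast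
      then show ?thesis by (simp add: Q_def instN_def neg)
    qed
    have i: "Q s t" if "Q (s \<^bold>+ One) (t \<^bold>+ One)" for s t
    proof -
      have "instN t (AllN (Var 0 \<^bold>+ One \<^bold>= Var 1 \<^bold>+ One \<^bold>\<longrightarrow> Var 0 \<^bold>= Var 1)) \<in> T"
        using Suc_inj T(1) allN by blast
      then have "instN s (Var 0 \<^bold>+ One \<^bold>= shift 1 t \<^bold>+ One \<^bold>\<longrightarrow> Var 0 \<^bold>= shift 1 t) \<in> T"
        by (simp add: instN_def allN)
      then show ?thesis using that by (simp add: instN_def sh imp Q_def)
    qed
    show ?thesis using that
    proof (induction m arbitrary: n)
      case 0
      then show ?case using z Q_sym by (cases n) auto
    next
      case (Suc m)
      then show ?case using z i by (cases n) auto
    qed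
  qed
  have "inj (\<lambda>n. Q (num n))" unfolding inj_def Q_eq using Q_num by blast
  then have "infinite (range (\<lambda>n. Q (num n)))" by (rule range_inj_infinite)
  moreover have "range (\<lambda>n. Q (num n)) \<subseteq> range Q" by auto
  ultimately have inf: "infinite (range Q)" using finite_subset by blast
  define q where "q = to_nat_on (range Q)"
  have bij: "bij_betw q (range Q) UNIV" unfolding q_def
    by (rule to_nat_on_infinite) (use inf in auto)
  define r where "r = (\<lambda>t. q (Q t))"
  have r_eq: "r s = r t \<longleftrightarrow> Q s t" for s t
  proof -
    have "q (Q s) = q (Q t) \<longleftrightarrow> Q s = Q t"
      by (rule inj_on_eq_iff[OF bij_betw_imp_inj_on[OF bij]]) (rule rangeI)+
    then show ?thesis by (simp only: r_def Q_eq)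
  qed
  have r_surj: "\<exists>t. r t = x" for x
  proof -
    have "x \<in> q ` range Q" using bij by (simp add: bij_betw_def)
    then show ?thesis unfolding r_def by auto
  qed
  define c where "c = (\<lambda>x. SOME t. r t = x)"
  have rc: "r (c x) = x" for x unfolding c_def using r_surj[of x] by (rule someI_ex)
  have Qcr: "Q (c (r t)) t" for t using rc r_eq by blast
  define ad where "ad = (\<lambda>x y. r (c x \<^bold>+ c y))"
  define ml where "ml = (\<lambda>x y. r (c x \<^bold>* c y))"
  define ls where "ls = (\<lambda>x y. (c x \<^bold>< c y) \<in> T)"
  have r_ad: "ad (r s) (r t) = r (s \<^bold>+ t)" for s t
    unfolding ad_def r_eq by (intro Q_add Qcr)
  have r_ml: "ml (r s) (r t) = r (s \<^bold>* t)" for s t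
    unfolding ml_def r_eq by (intro Q_mul Qcr)
  have r_ls: "ls (r s) (r t) \<longleftrightarrow> (s \<^bold>< t) \<in> T" for s t
    unfolding ls_def by (intro Q_less Qcr)
  interpret arith "r Zero" "r One" ad ml ls .
  have ev: "ev (\<lambda>n. r (\<sigma> n)) t = r (substt \<sigma> t)" for \<sigma> t
    by (induction t) (simp_all add: r_ad r_ml)
  define G where "G = (\<lambda>X. {x. (c x \<^bold>\<in> X) \<in> T})"
  have G: "r t \<in> G X \<longleftrightarrow> (t \<^bold>\<in> X) \<in> T" for t X
    unfolding G_def mem_Collect_eq by (rule Q_mem[OF Qcr])
  \<comment> \<open>Stated for all substitutions, because evaluating a quantifier changes the
    environment: extending the environment by \<open>r t\<close> corresponds to extending
    \<open>\<sigma>\<close> by \<open>t\<close>, and every element of the model is some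
    \<open>r t\<close>.\<close>
  have truth: "sat UNIV (range G) (\<lambda>n. r (\<sigma> n)) (\<lambda>n. G (\<rho> n)) \<phi> \<longleftrightarrow> subst \<sigma> \<rho> \<phi> \<in> T" for \<sigma> \<rho> \<phi>
  proof (induction \<phi> arbitrary: \<sigma> \<rho>)
    case (AllN \<phi>)
    have "case_nat (r t) (\<lambda>n. r (\<sigma> n)) = (\<lambda>n. r (case_nat t \<sigma> n))" for t
      by (auto split: nat.split)
    then have "sat UNIV (range G) (case_nat (r t) (\<lambda>n. r (\<sigma> n))) (\<lambda>n. G (\<rho> n)) \<phi> \<longleftrightarrow>
       subst (case_nat t \<sigma>) \<rho> \<phi> \<in> T" for t
      using AllN.IH by simp
    moreover have "instN t (subst (case_nat (Var 0) (\<lambda>n. shift 1 (\<sigma> n))) \<rho> \<phi>) = subst (case_nat t \<sigma>) \<rho> \<phi>" for t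
    proof -
      have "(\<lambda>n. substt (case_nat t Var) (case_nat (Var 0) (\<lambda>n. shift 1 (\<sigma> n)) n)) = case_nat t \<sigma>"
        by (auto simp: shift_def substt_substt substt_Var split: nat.split)
      then show ?thesis by (simp add: instN_def subst_subst del: One_nat_def)
    qed
    ultimately have "(\<forall>t. sat UNIV (range G) (case_nat (r t) (\<lambda>n. r (\<sigma> n))) (\<lambda>n. G (\<rho> n)) \<phi>) \<longleftrightarrow>
        subst \<sigma> \<rho> (AllN \<phi>) \<in> T" by (simp only: subst.simps allN)
    moreover have "(\<forall>x. P x) \<longleftrightarrow> (\<forall>t. P (r t))" for P
    proof
      assume *: "\<forall>t. P (r t)"
      show "\<forall>x. P x"
      proof
        fix x show "P x" using spec[OF *, of "c x"] by (simp only: rc)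
      qed
    qed simp
    ultimately show ?case by (simp only: sat.simps UNIV_I ball_UNIV)
  next
    case (AllS \<phi>)
    have "case_nat (G t) (\<lambda>n. G (\<rho> n)) = (\<lambda>n. G (case_nat t \<rho> n))" for t
      by (rule ext) (simp split: nat.split)
    then have "sat UNIV (range G) (\<lambda>n. r (\<sigma> n)) (case_nat (G t) (\<lambda>n. G (\<rho> n))) \<phi> \<longleftrightarrow>
       subst \<sigma> (case_nat t \<rho>) \<phi> \<in> T" for t
      using AllS.IH by simp
    moreover have "instS t (subst \<sigma> (case_nat 0 (\<lambda>n. Suc (\<rho> n))) \<phi>) = subst \<sigma> (case_nat t \<rho>) \<phi>" for t
    proof -
      have "(\<lambda>n. case_nat t id (case_nat 0 (\<lambda>n. Suc (\<rho> n)) n)) = case_nat t \<rho>"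
        by (rule ext) (simp split: nat.split)
      then show ?thesis by (simp add: instS_def subst_subst substt_Var)
    qed
    ultimately show ?case by (simp add: allS)
  next
    case Fls
    then show ?case using ded T(2) by auto
  next
    case (Less s t)
    then show ?case by (simp add: ev r_ls)
  qed (simp_all add: ev r_eq imp G Q_def)
  show thesis
  proof (rule that)
    show "G n \<in> range G" for n by simp
    show "sat UNIV (range G) (\<lambda>n. r (Var n)) G \<gamma>" if "\<gamma> \<in> \<Gamma>" for \<gamma>
      using truth[of Var id \<gamma>] that T(1) by auto
  qed
qed

section \<open>Models of \<open>\<Sigma>\<^sub>1\<close> induction\<close>

lemma subst_BAll: "subst \<sigma> \<rho> (BAll t \<phi>) =
    BAll (substt \<sigma> t) (subst (case_nat (Var 0) (\<lambda>n. shift 1 (\<sigma> n))) \<rho> \<phi>)"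
  by (simp add: BAll_def shift_def substt_substt)

lemma subst_BEx: "subst \<sigma> \<rho> (BEx t \<phi>) =
    BEx (substt \<sigma> t) (subst (case_nat (Var 0) (\<lambda>n. shift 1 (\<sigma> n))) \<rho> \<phi>)"
  by (simp add: BEx_def shift_def substt_substt)

lemma delta0_subst: "\<phi> \<in> delta0 \<Longrightarrow> subst \<sigma> \<rho> \<phi> \<in> delta0"
proof (induction arbitrary: \<sigma> rule: delta0.induct)
  case (6 \<phi> t)
  show ?case unfolding subst_BAll by (rule delta0.intros(6)[OF 6(2)])
next
  case (7 \<phi> t)
  show ?case unfolding subst_BEx by (rule delta0.intros(7)[OF 7(2)])
qed (simp_all add: delta0.intros)

definition cenv :: "(nat \<Rightarrow> 'm::countable) \<Rightarrow> nat \<Rightarrow> 'm" where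
  "cenv e n = (if even n then e (n div 2) else from_nat (n div 2))"

lemma cenv_simps: "cenv e (2 * i) = e i" "cenv e (Suc (2 * i)) = from_nat i"
  by (simp_all add: cenv_def)

lemma two_dvd: "Suc (Suc 0) dvd Suc (Suc m) \<longleftrightarrow> Suc (Suc 0) dvd m" "Suc (Suc 0) dvd j + j"
  by presburger+

text \<open>In both schemas every set variable denotes the one set \<open>X\<close>: the
  counterexample involves a single set, and all further sets are coded by numbers.\<close>

locale model = arith zr on ad ml ls
  for zr on :: "'m::countable" and ad ml :: "'m \<Rightarrow> 'm \<Rightarrow> 'm" and ls :: "'m \<Rightarrow> 'm \<Rightarrow> bool" +
  fixes S :: "'m set set" and X :: "'m set"
  assumes ax1: "ad x on \<noteq> zr"
    and ax2: "ad x on = ad y on \<Longrightarrow> x = y"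
    and ax3: "ad x zr = x"
    and ax4: "ad x (ad y on) = ad (ad x y) on"
    and ax5: "ml x zr = zr"
    and ax6: "ml x (ad y on) = ad (ml x y) x"
    and ax7: "\<not> ls x zr"
    and ax8: "ls x (ad y on) \<longleftrightarrow> ls x y \<or> x = y"
    and Sigma1_ind: "\<phi> \<in> sigma0 1 \<Longrightarrow> sat UNIV S e (\<lambda>_. X) (induction_axiom \<phi>)"
    and Sigma2_bnd: "\<phi> \<in> sigma0 2 \<Longrightarrow> sat UNIV S e (\<lambda>_. X) (bounding_axiom \<phi>)"
begin

notation zr ("\<zero>") and on ("\<one>") and ad (infixl "\<oplus>" 65) and ml (infixl "\<otimes>" 70)
  and ls (infix "\<prec>" 50)

definition le (infix "\<preceq>" 50) where "x \<preceq> y \<longleftrightarrow> x \<prec> y \<or> x = y"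

subsection \<open>Definability\<close>

text \<open>\<open>Dz P\<close>: the predicate \<open>P\<close> of environments is defined by a bounded formula, all of whose set
  variables denote \<open>X\<close>. In \<open>cenv e\<close>, the even variables carry \<open>e\<close> and the odd ones name all elements
  of the model, so that parameters are allowed for free.\<close>

definition Tm :: "((nat \<Rightarrow> 'm) \<Rightarrow> 'm) \<Rightarrow> bool" where
  "Tm f \<longleftrightarrow> (\<exists>t. \<forall>e. f e = ev (cenv e) t)"

definition Dz :: "((nat \<Rightarrow> 'm) \<Rightarrow> bool) \<Rightarrow> bool" where
  "Dz P \<longleftrightarrow> (\<exists>\<phi>\<in>delta0. \<forall>e. P e \<longleftrightarrow> sat UNIV S (cenv e) (\<lambda>_. X) \<phi>)"

abbreviation DS :: "'m set \<Rightarrow> bool" where "DS Y \<equiv> Dz (\<lambda>e. e 0 \<in> Y)"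

lemma Tm_const: "Tm (\<lambda>e. c)"
  unfolding Tm_def by (rule exI[of _ "Var (Suc (2 * to_nat c))"]) (simp add: cenv_simps)

lemma Tm_var: "Tm (\<lambda>e. e n)"
  unfolding Tm_def by (rule exI[of _ "Var (2 * n)"]) (simp add: cenv_simps)

lemma Tm_ad: assumes "Tm f" "Tm g" shows "Tm (\<lambda>e. f e \<oplus> g e)"
proof -
  obtain s t where "\<forall>e. f e = ev (cenv e) s" "\<forall>e. g e = ev (cenv e) t"
    using assms unfolding Tm_def by meson
  then show ?thesis unfolding Tm_def by (intro exI[of _ "s \<^bold>+ t"]) simp
qed

lemma Tm_ml: assumes "Tm f" "Tm g" shows "Tm (\<lambda>e. f e \<otimes> g e)"
proof -
  obtain s t where "\<forall>e. f e = ev (cenv e) s" "\<forall>e. g e = ev (cenv e) t"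
    using assms unfolding Tm_def by meson
  then show ?thesis unfolding Tm_def by (intro exI[of _ "s \<^bold>* t"]) simp
qed

lemma Dz_eq: assumes "Tm f" "Tm g" shows "Dz (\<lambda>e. f e = g e)"
proof -
  obtain s t where "\<forall>e. f e = ev (cenv e) s" "\<forall>e. g e = ev (cenv e) t"
    using assms unfolding Tm_def by meson
  then show ?thesis unfolding Dz_def by (intro bexI[of _ "s \<^bold>= t"]) (simp_all add: delta0.intros)
qed

lemma Dz_ls: assumes "Tm f" "Tm g" shows "Dz (\<lambda>e. f e \<prec> g e)"
proof -
  obtain s t where "\<forall>e. f e = ev (cenv e) s" "\<forall>e. g e = ev (cenv e) t"
    using assms unfolding Tm_def by meson
  then show ?thesis unfolding Dz_def by (intro bexI[of _ "s \<^bold>< t"]) (simp_all add: delta0.intros)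
qed

lemma Dz_X: assumes "Tm f" shows "Dz (\<lambda>e. f e \<in> X)"
proof -
  obtain s where "\<forall>e. f e = ev (cenv e) s"
    using assms unfolding Tm_def by meson
  then show ?thesis unfolding Dz_def by (intro bexI[of _ "s \<^bold>\<in> 0"]) (simp_all add: delta0.intros)
qed

lemma Dz_imp: assumes "Dz P" "Dz Q" shows "Dz (\<lambda>e. P e \<longrightarrow> Q e)"
proof -
  obtain \<phi> \<psi> where "\<phi> \<in> delta0" "\<forall>e. P e \<longleftrightarrow> sat UNIV S (cenv e) (\<lambda>_. X) \<phi>"
    "\<psi> \<in> delta0" "\<forall>e. Q e \<longleftrightarrow> sat UNIV S (cenv e) (\<lambda>_. X) \<psi>"
    using assms unfolding Dz_def by meson
  then show ?thesis unfolding Dz_def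
    by (intro bexI[of _ "\<phi> \<^bold>\<longrightarrow> \<psi>"]) (simp_all add: delta0.intros)
qed

lemma Dz_subst:
  assumes P: "Dz P" and F: "\<And>i. Tm (F i)"
  shows "Dz (\<lambda>e. P (\<lambda>i. F i e))"
proof -
  obtain \<phi> where \<phi>: "\<phi> \<in> delta0" "\<And>e. P e \<longleftrightarrow> sat UNIV S (cenv e) (\<lambda>_. X) \<phi>"
    using P unfolding Dz_def by blast
  obtain t where t: "\<And>i e. F i e = ev (cenv e) (t i)"
    using F unfolding Tm_def by metis
  let ?\<sigma> = "\<lambda>n. if even n then t (n div 2) else Var n"
  have "(\<lambda>n. ev (cenv e) (?\<sigma> n)) = cenv (\<lambda>i. F i e)" for e
    by (rule ext) (simp add: t cenv_def)
  then have "P (\<lambda>i. F i e) \<longleftrightarrow> sat UNIV S (cenv e) (\<lambda>_. X) (subst ?\<sigma> id \<phi>)" for e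
    by (simp only: \<phi>(2) sat_subst)
  then show ?thesis unfolding Dz_def using delta0_subst[OF \<phi>(1)] by blast
qed

lemma Dz_app1: "Dz (\<lambda>e. P (e 0)) \<Longrightarrow> Tm f \<Longrightarrow> Dz (\<lambda>e. P (f e))"
  using Dz_subst[of "\<lambda>e. P (e 0)" "\<lambda>i. f"] by simp

lemma Dz_app2:
  assumes "Dz (\<lambda>e. P (e 0) (e (Suc 0)))" "Tm f" "Tm g" shows "Dz (\<lambda>e. P (f e) (g e))"
proof -
  have "Tm (if i = 0 then f else g)" for i :: nat using assms(2,3) by simp
  from Dz_subst[OF assms(1), of "\<lambda>i. if i = 0 then f else g", OF this] show ?thesis by simp
qed

lemma Dz_app3:
  assumes "Dz (\<lambda>e. P (e 0) (e (Suc 0)) (e (Suc (Suc 0))))" "Tm f" "Tm g" "Tm h"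
  shows "Dz (\<lambda>e. P (f e) (g e) (h e))"
proof -
  have "Tm (if i = 0 then f else if i = Suc 0 then g else h)" for i :: nat
    using assms(2,3,4) by simp
  from Dz_subst[OF assms(1), of "\<lambda>i. if i = 0 then f else if i = Suc 0 then g else h", OF this]
  show ?thesis by simp
qed

lemma Dz_all:
  assumes "Dz (\<lambda>e. P (e 0) (\<lambda>n. e (Suc n)))" and "Tm t"
  shows "Dz (\<lambda>e. \<forall>x. x \<prec> t e \<longrightarrow> P x e)"
proof -
  obtain \<phi> where \<phi>: "\<phi> \<in> delta0" "\<And>e. P (e 0) (\<lambda>n. e (Suc n)) \<longleftrightarrow> sat UNIV S (cenv e) (\<lambda>_. X) \<phi>"
    using assms(1) unfolding Dz_def by blast
  obtain u where u: "\<And>e. t e = ev (cenv e) u"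
    using assms(2) unfolding Tm_def by blast
  \<comment> \<open>Prepending \<open>x\<close> to \<open>e\<close> moves the even indices of
    \<open>cenv\<close> by two and fixes the odd ones, whereas the quantifier moves all indices by
    one.\<close>
  let ?\<sigma> = "\<lambda>n. Var (if n = 0 then 0 else if even n then n - 1 else n + 1)"
  have env: "(\<lambda>n. ev (case_nat x (cenv e)) (?\<sigma> n)) = cenv (case_nat x e)" for x e
  proof
    fix n
    show "ev (case_nat x (cenv e)) (?\<sigma> n) = cenv (case_nat x e) n"
    proof (cases "even n")
      case True
      then obtain i where n: "n = 2 * i" by blast
      show ?thesis unfolding n cenv_simps by (cases i) (simp_all, simp add: cenv_def)
    next
      case False
      then obtain i where "n = Suc (2 * i)" by (metis oddE Suc_eq_plus1)
      then show ?thesis by (simp add: cenv_simps)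
    qed
  qed
  have "P x e \<longleftrightarrow> sat UNIV S (case_nat x (cenv e)) (\<lambda>_. X) (subst ?\<sigma> id \<phi>)" for x e
    using \<phi>(2)[of "case_nat x e"] env[of x e] by (simp only: sat_subst id_apply nat.case)
  then have "(\<forall>x. x \<prec> t e \<longrightarrow> P x e) \<longleftrightarrow>
      sat UNIV S (cenv e) (\<lambda>_. X) (BAll u (subst ?\<sigma> id \<phi>))" for e
    by (simp add: BAll_def u)
  then show ?thesis unfolding Dz_def
    by (intro bexI[of _ "BAll u (subst ?\<sigma> id \<phi>)"] delta0.intros(6) delta0_subst \<phi>(1)) blast
qed

lemma Dz_False: "Dz (\<lambda>e. False)"
  unfolding Dz_def by (rule bexI[of _ "\<^bold>\<bottom>"]) (simp_all add: delta0.intros)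

lemma Dz_not: "Dz P \<Longrightarrow> Dz (\<lambda>e. \<not> P e)"
  using Dz_imp[OF _ Dz_False] by simp

lemma Dz_const: "Dz (\<lambda>e. b)"
  using Dz_False Dz_not[OF Dz_False] by (cases b) simp_all

lemma Dz_and: "Dz P \<Longrightarrow> Dz Q \<Longrightarrow> Dz (\<lambda>e. P e \<and> Q e)"
  using Dz_not[OF Dz_imp[of P "\<lambda>e. \<not> Q e"]] Dz_not[of Q] by simp

lemma Dz_or: "Dz P \<Longrightarrow> Dz Q \<Longrightarrow> Dz (\<lambda>e. P e \<or> Q e)"
  using Dz_imp[of "\<lambda>e. \<not> P e" Q] Dz_not[of P] by (simp add: disj_imp)

lemma Dz_iff: "Dz P \<Longrightarrow> Dz Q \<Longrightarrow> Dz (\<lambda>e. P e = Q e)"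
  using Dz_and[OF Dz_imp[of P Q] Dz_imp[of Q P]] by (simp add: iff_conv_conj_imp)

lemma Dz_ex:
  assumes "Dz (\<lambda>e. P (e 0) (\<lambda>n. e (Suc n)))" and "Tm t"
  shows "Dz (\<lambda>e. \<exists>x. x \<prec> t e \<and> P x e)"
  using Dz_not[OF Dz_all[OF Dz_not[OF assms(1)] assms(2)]] by simp

lemma Dz_le: "Tm f \<Longrightarrow> Tm g \<Longrightarrow> Dz (\<lambda>e. f e \<preceq> g e)"
  unfolding le_def by (intro Dz_or Dz_ls Dz_eq)

lemmas Dz_intros = Dz_const Dz_and Dz_or Dz_iff Dz_not Dz_imp Dz_all Dz_ex Dz_le Dz_ls Dz_eq
  Dz_X Tm_const Tm_var Tm_ad Tm_ml

text \<open>Parameters of \<open>Q\<close> are named by the odd variables of \<open>cenv\<close>, so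
  the schema can be used in the fixed environment \<open>?p\<close>.\<close>

lemma Sigma_induct:
  assumes Q: "Dz (\<lambda>e. Q (e (Suc 0)) (e 0))"
    and base: "\<exists>y. Q \<zero> y" and step: "\<And>x. \<exists>y. Q x y \<Longrightarrow> \<exists>y. Q (x \<oplus> \<one>) y"
  shows "\<exists>y. Q x y"
proof -
  obtain \<phi> where \<phi>: "\<phi> \<in> delta0" "\<And>e. Q (e (Suc 0)) (e 0) \<longleftrightarrow> sat UNIV S (cenv e) (\<lambda>_. X) \<phi>"
    using Q unfolding Dz_def by blast
  let ?\<sigma> = "\<lambda>n. Var (if n = 0 then 0 else if n = 2 then 1 else n + 2)"
  let ?p = "cenv (\<lambda>_. \<zero>)"
  have env: "(\<lambda>n. ev (case_nat y (case_nat x ?p)) (?\<sigma> n)) = cenv (case_nat y (case_nat x (\<lambda>_. \<zero>)))" for x y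
  proof
    fix n
    show "ev (case_nat y (case_nat x ?p)) (?\<sigma> n) = cenv (case_nat y (case_nat x (\<lambda>_. \<zero>))) n"
    proof (cases "even n")
      case True
      then obtain i where n: "n = 2 * i" by blast
      consider "i = 0" | "i = 1" | j where "i = Suc (Suc j)" by (metis One_nat_def not0_implies_Suc)
      then show ?thesis unfolding n cenv_simps by cases (simp_all add: cenv_def numeral_2_eq_2 two_dvd)
    next
      case False
      then obtain i where "n = Suc (2 * i)" by (metis oddE Suc_eq_plus1)
      then show ?thesis by (simp add: cenv_simps)
    qed
  qed
  let ?\<psi> = "ExN (subst ?\<sigma> id \<phi>)"
  have q: "sat UNIV S (case_nat x ?p) (\<lambda>_. X) ?\<psi> \<longleftrightarrow> (\<exists>y. Q x y)" for x
  proof -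
    have "Q x y \<longleftrightarrow> sat UNIV S (case_nat y (case_nat x ?p)) (\<lambda>_. X) (subst ?\<sigma> id \<phi>)" for y
      using \<phi>(2)[of "case_nat y (case_nat x (\<lambda>_. \<zero>))"] env[of y x]
      by (simp only: sat_subst id_apply nat.case)
    then show ?thesis by simp
  qed
  have "?\<psi> \<in> sigma0 1"
    using delta0_subst[OF \<phi>(1)] by auto
  from Sigma1_ind[OF this, of ?p]
  have "sat UNIV S ?p (\<lambda>_. X) (induction_axiom ?\<psi>)" .
  moreover have "(\<lambda>n. ev (case_nat x ?p) (case_nat (Var 0 \<^bold>+ One) (\<lambda>n. Var (Suc n)) n)) = case_nat (x \<oplus> \<one>) ?p" for x
    by (rule ext) (simp split: nat.split)
  ultimately have "sat UNIV S (case_nat \<zero> ?p) (\<lambda>_. X) ?\<psi> \<and>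
      (\<forall>x. sat UNIV S (case_nat x ?p) (\<lambda>_. X) ?\<psi> \<longrightarrow> sat UNIV S (case_nat (x \<oplus> \<one>) ?p) (\<lambda>_. X) ?\<psi>) \<longrightarrow>
      (\<forall>x. sat UNIV S (case_nat x ?p) (\<lambda>_. X) ?\<psi>)"
    unfolding induction_axiom_def
    by (simp only: sat.simps sat_instN ev.simps sat_subst[of UNIV S "case_nat x ?p" "\<lambda>_. X" "case_nat (Var 0 \<^bold>+ One) (\<lambda>n. Var (Suc n))" id for x]
        id_apply ball_UNIV) blast
  then show ?thesis unfolding q using base step by blast
qed

lemma Dz_induct:
  assumes "Dz (\<lambda>e. P (e 0))" "P \<zero>" "\<And>x. P x \<Longrightarrow> P (x \<oplus> \<one>)"
  shows "P x"
  using Sigma_induct[of "\<lambda>x y. P x"] Dz_app1[OF assms(1) Tm_var] assms(2,3) by blast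

text \<open>The schema bounds a variable in front of a formula that itself has to begin with an
  existential quantifier. So \<open>y\<close> is taken as that inner quantifier, and the bounded
  variable \<open>w\<close> controls it through \<open>y \<preceq> w\<close>.\<close>

lemma bounding:
  assumes Q: "Dz (\<lambda>e. Q (e (Suc (Suc 0))) (e (Suc 0)) (e 0))"
    and ex: "\<And>x. x \<prec> a \<Longrightarrow> \<exists>y. \<forall>z. Q x y z"
  shows "\<exists>b. \<forall>x. x \<prec> a \<longrightarrow> (\<exists>w y. w \<prec> b \<and> y \<preceq> w \<and> (\<forall>z. Q x y z))"
proof -
  have "Tm (if i = 0 then (\<lambda>e. e 0) else if i = Suc 0 then (\<lambda>e. e (Suc 0)) else (\<lambda>e. e (Suc (Suc (Suc 0)))))" for i :: nat
    by (simp add: Tm_var)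
  from Dz_subst[OF Q, of "\<lambda>i. if i = 0 then (\<lambda>e. e 0) else if i = Suc 0 then (\<lambda>e. e (Suc 0)) else (\<lambda>e. e (Suc (Suc (Suc 0))))", OF this]
  have "Dz (\<lambda>e. Q (e (Suc (Suc (Suc 0)))) (e (Suc 0)) (e 0))" by simp
  then have "Dz (\<lambda>e. e (Suc 0) \<preceq> e (Suc (Suc 0)) \<and> Q (e (Suc (Suc (Suc 0)))) (e (Suc 0)) (e 0))"
    by (intro Dz_and Dz_le Tm_var)
  then obtain \<phi> where \<phi>: "\<phi> \<in> delta0"
    "\<And>e. e (Suc 0) \<preceq> e (Suc (Suc 0)) \<and> Q (e (Suc (Suc (Suc 0)))) (e (Suc 0)) (e 0) \<longleftrightarrow>
      sat UNIV S (cenv e) (\<lambda>_. X) \<phi>"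
    unfolding Dz_def by blast
  let ?\<sigma> = "\<lambda>n. Var (if n = 0 then 0 else if n = 2 then 1 else if n = 4 then 2 else if n = 6 then 3 else n + 4)"
  let ?p = "cenv (\<lambda>_. \<zero>)"
  let ?c = "\<lambda>z y w x p. case_nat z (case_nat y (case_nat w (case_nat x p)))"
  have env: "(\<lambda>n. ev (?c z y w x ?p) (?\<sigma> n)) = cenv (?c z y w x (\<lambda>_. \<zero>))" for x y z w
  proof
    fix n
    show "ev (?c z y w x ?p) (?\<sigma> n) = cenv (?c z y w x (\<lambda>_. \<zero>)) n"
    proof (cases "even n")
      case True
      then obtain i where n: "n = 2 * i" by blast
      consider "i = 0" | "i = 1" | "i = 2" | "i = 3" | j where "i = j + 4"
        by (metis One_nat_def Suc_eq_plus1 add_2_eq_Suc' add_Suc_right not0_implies_Suc numeral_2_eq_2 numeral_3_eq_3 numeral_Bit0)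
      then show ?thesis unfolding n cenv_simps
        by cases (simp_all add: cenv_def eval_nat_numeral two_dvd)
    next
      case False
      then obtain i where "n = Suc (2 * i)" by (metis oddE Suc_eq_plus1)
      then show ?thesis by (simp add: cenv_simps eval_nat_numeral) (simp add: cenv_def)
    qed
  qed
  let ?\<psi> = "ExN (AllN (subst ?\<sigma> id \<phi>))"
  have q: "sat UNIV S (case_nat w (case_nat x ?p)) (\<lambda>_. X) ?\<psi> \<longleftrightarrow> (\<exists>y. y \<preceq> w \<and> (\<forall>z. Q x y z))" for x w
  proof -
    have "y \<preceq> w \<and> Q x y z \<longleftrightarrow> sat UNIV S (?c z y w x ?p) (\<lambda>_. X) (subst ?\<sigma> id \<phi>)" for y z
      using \<phi>(2)[of "?c z y w x (\<lambda>_. \<zero>)"] env[of z y w x]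
      by (simp only: sat_subst id_apply nat.case)
    then have "sat UNIV S (?c z y w x ?p) (\<lambda>_. X) (subst ?\<sigma> id \<phi>) \<longleftrightarrow> y \<preceq> w \<and> Q x y z" for y z
      by simp
    then show ?thesis by simp
  qed
  have "?\<psi> \<in> sigma0 2"
    using delta0_subst[OF \<phi>(1)] by (auto simp: numeral_2_eq_2)
  from Sigma2_bnd[OF this, of ?p]
  have 0: "sat UNIV S ?p (\<lambda>_. X) (bounding_axiom ?\<psi>)" .
  have e1: "(\<lambda>n. ev (case_nat w (case_nat x (case_nat a ?p))) (Var (if n < 2 then n else n + 1))) = case_nat w (case_nat x ?p)" for w x a
    by (rule ext) (auto split: nat.split)
  have e2: "(\<lambda>n. ev (case_nat w (case_nat x (case_nat b (case_nat a ?p)))) (Var (if n < 2 then n else n + 2))) = case_nat w (case_nat x ?p)" for w x b a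
    by (rule ext) (auto split: nat.split)
  have s1: "sat UNIV S (case_nat w (case_nat x (case_nat a ?p))) (\<lambda>_. X) (subst (\<lambda>n. Var (if n < 2 then n else n + 1)) id ?\<psi>)
     \<longleftrightarrow> (\<exists>y. y \<preceq> w \<and> (\<forall>z. Q x y z))" for w x a
    unfolding sat_subst[of UNIV S _ _ _ id ?\<psi>] e1 by (rule q)
  have s2: "sat UNIV S (case_nat w (case_nat x (case_nat b (case_nat a ?p)))) (\<lambda>_. X) (subst (\<lambda>n. Var (if n < 2 then n else n + 2)) id ?\<psi>)
     \<longleftrightarrow> (\<exists>y. y \<preceq> w \<and> (\<forall>z. Q x y z))" for w x a b
    unfolding sat_subst[of UNIV S _ _ _ id ?\<psi>] e2 by (rule q)
  have "(\<forall>x. x \<prec> a \<longrightarrow> (\<exists>w. \<exists>y. y \<preceq> w \<and> (\<forall>z. Q x y z))) \<longrightarrow>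
      (\<exists>b. \<forall>x. x \<prec> a \<longrightarrow> (\<exists>w. w \<prec> b \<and> (\<exists>y. y \<preceq> w \<and> (\<forall>z. Q x y z))))"
    using 0 unfolding bounding_axiom_def BAll_def BEx_def
    by (simp add: s1 s2 del: subst.simps)
  moreover have "\<exists>w. \<exists>y. y \<preceq> w \<and> (\<forall>z. Q x y z)" if "x \<prec> a" for x
    using ex[OF that] unfolding le_def by blast
  ultimately show ?thesis by blast
qed

end

context model
begin

subsection \<open>Arithmetic\<close>

lemma add_zero_left: "\<zero> \<oplus> x = x"
  by (rule Dz_induct[where P = "\<lambda>x. \<zero> \<oplus> x = x"]) (intro Dz_intros, simp_all add: ax3 ax4)

lemma add_Suc_left: "(x \<oplus> \<one>) \<oplus> y = (x \<oplus> y) \<oplus> \<one>"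
  by (rule Dz_induct[where P = "\<lambda>y. (x \<oplus> \<one>) \<oplus> y = (x \<oplus> y) \<oplus> \<one>"]) (intro Dz_intros, simp_all add: ax3 ax4)

lemma add_comm: "x \<oplus> y = y \<oplus> x"
  by (rule Dz_induct[where P = "\<lambda>y. x \<oplus> y = y \<oplus> x"])
    (intro Dz_intros, simp_all add: ax3 ax4 add_zero_left add_Suc_left)

lemma add_assoc: "(x \<oplus> y) \<oplus> z = x \<oplus> (y \<oplus> z)"
  by (rule Dz_induct[where P = "\<lambda>z. (x \<oplus> y) \<oplus> z = x \<oplus> (y \<oplus> z)"])
    (intro Dz_intros, simp_all add: ax3 ax4)

lemma add_left_comm: "x \<oplus> (y \<oplus> z) = y \<oplus> (x \<oplus> z)"
  by (metis add_assoc add_comm)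

lemmas add_ac = add_assoc add_comm add_left_comm

lemma mul_zero_left: "\<zero> \<otimes> x = \<zero>"
  by (rule Dz_induct[where P = "\<lambda>x. \<zero> \<otimes> x = \<zero>"]) (intro Dz_intros, simp_all add: ax3 ax5 ax6)

lemma mul_Suc_left: "(x \<oplus> \<one>) \<otimes> y = x \<otimes> y \<oplus> y"
  by (rule Dz_induct[where P = "\<lambda>y. (x \<oplus> \<one>) \<otimes> y = x \<otimes> y \<oplus> y"])
    (intro Dz_intros, simp_all add: ax3 ax5 ax6 add_ac)

lemma mul_comm: "x \<otimes> y = y \<otimes> x"
  by (rule Dz_induct[where P = "\<lambda>y. x \<otimes> y = y \<otimes> x"])
    (intro Dz_intros, simp_all add: ax5 ax6 mul_zero_left mul_Suc_left)

lemma distrib_left: "x \<otimes> (y \<oplus> z) = x \<otimes> y \<oplus> x \<otimes> z"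
  by (rule Dz_induct[where P = "\<lambda>z. x \<otimes> (y \<oplus> z) = x \<otimes> y \<oplus> x \<otimes> z"])
    (intro Dz_intros, simp_all add: ax3 ax4 ax5 ax6, simp add: add_assoc)

lemma distrib_right: "(y \<oplus> z) \<otimes> x = y \<otimes> x \<oplus> z \<otimes> x"
  by (simp only: mul_comm[of _ x] distrib_left)

lemma mul_one: "x \<otimes> \<one> = x"
  by (metis add_zero_left ax5 ax6)

lemma mul_assoc: "(x \<otimes> y) \<otimes> z = x \<otimes> (y \<otimes> z)"
  by (rule Dz_induct[where P = "\<lambda>z. (x \<otimes> y) \<otimes> z = x \<otimes> (y \<otimes> z)"])
    (intro Dz_intros, simp_all add: ax5 ax6 distrib_left mul_one)

lemma mul_left_comm: "x \<otimes> (y \<otimes> z) = y \<otimes> (x \<otimes> z)"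
  by (metis mul_assoc mul_comm)

lemma mul_one_left: "\<one> \<otimes> x = x"
  by (metis mul_comm mul_one)

lemmas arith_simps [simp] = ax1 ax3 ax5 ax7 add_zero_left mul_zero_left mul_one mul_one_left
lemmas ring = add_ac mul_assoc mul_comm mul_left_comm distrib_left distrib_right

lemma one_neq_zero [simp]: "\<one> \<noteq> \<zero>"
  by (metis add_zero_left ax1)

lemma add_cancel_right: "x \<oplus> z = y \<oplus> z \<longleftrightarrow> x = y"
proof -
  have "x \<oplus> z = y \<oplus> z \<longrightarrow> x = y"
    by (rule Dz_induct[where P = "\<lambda>z. x \<oplus> z = y \<oplus> z \<longrightarrow> x = y"])
      (intro Dz_intros, simp_all add: ax4, metis ax2)
  then show ?thesis by blast
qed

lemma add_cancel_left: "z \<oplus> x = z \<oplus> y \<longleftrightarrow> x = y"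
  using add_cancel_right add_comm by metis

lemma zero_or_Suc: obtains "x = \<zero>" | w where "x = w \<oplus> \<one>"
proof -
  have "\<exists>w. x = \<zero> \<or> x = w \<oplus> \<one>"
    by (rule Sigma_induct[where Q = "\<lambda>x w. x = \<zero> \<or> x = w \<oplus> \<one>"]) (intro Dz_intros, auto)
  then show thesis using that by blast
qed

lemma ls_iff: "x \<prec> y \<longleftrightarrow> (\<exists>z. y = x \<oplus> (z \<oplus> \<one>))"
proof
  have "\<exists>z. x \<prec> y \<longrightarrow> y = x \<oplus> (z \<oplus> \<one>)"
  proof (rule Sigma_induct[where Q = "\<lambda>y z. x \<prec> y \<longrightarrow> y = x \<oplus> (z \<oplus> \<one>)"])
    fix y assume "\<exists>z. x \<prec> y \<longrightarrow> y = x \<oplus> (z \<oplus> \<one>)"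
    then obtain z where z: "x \<prec> y \<longrightarrow> y = x \<oplus> (z \<oplus> \<one>)" by blast
    show "\<exists>z. x \<prec> y \<oplus> \<one> \<longrightarrow> y \<oplus> \<one> = x \<oplus> (z \<oplus> \<one>)"
    proof (cases "x \<prec> y")
      case True
      then show ?thesis using z by (metis add_assoc)
    next
      case False
      then show ?thesis by (metis add_zero_left ax8)
    qed
  qed (intro Dz_intros, simp)
  then show "x \<prec> y \<Longrightarrow> \<exists>z. y = x \<oplus> (z \<oplus> \<one>)" by blast
next
  have "x \<prec> x \<oplus> (z \<oplus> \<one>)" for z
    by (rule Dz_induct[where P = "\<lambda>z. x \<prec> x \<oplus> (z \<oplus> \<one>)"])
      (intro Dz_intros, simp_all add: ax4 ax8)
  then show "\<exists>z. y = x \<oplus> (z \<oplus> \<one>) \<Longrightarrow> x \<prec> y" by blast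
qed

lemma le_iff: "x \<preceq> y \<longleftrightarrow> (\<exists>z. y = x \<oplus> z)"
  unfolding le_def ls_iff by (metis ax3 zero_or_Suc)

lemma ls_add1: "x \<prec> y \<oplus> \<one> \<longleftrightarrow> x \<preceq> y"
  by (simp add: ax8 le_def)

lemma ls_irrefl: "\<not> x \<prec> x"
  unfolding ls_iff by (metis add_cancel_left ax1 ax3)

lemma ls_trans: "x \<prec> y \<Longrightarrow> y \<prec> z \<Longrightarrow> x \<prec> z"
  unfolding ls_iff by (metis add_assoc)

lemma add1_le: "x \<oplus> \<one> \<preceq> y \<longleftrightarrow> x \<prec> y"
  unfolding ls_iff le_iff by (metis add_assoc add_comm)

lemma ls_linear: "x \<prec> y \<or> x = y \<or> y \<prec> x"
  by (rule Dz_induct[where P = "\<lambda>y. x \<prec> y \<or> x = y \<or> y \<prec> x"])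
    (intro Dz_intros, metis ls_iff zero_or_Suc add_zero_left, metis ls_add1 add1_le le_def)

sublocale od: linorder le ls
  by unfold_locales (metis le_def ls_irrefl ls_trans ls_linear)+

lemma zero_le [simp]: "\<zero> \<preceq> x"
  unfolding le_iff by simp

lemma le_add [simp]: "x \<preceq> x \<oplus> y" "x \<preceq> y \<oplus> x"
  unfolding le_iff by (metis add_comm)+

lemma ls_add_one [simp]: "x \<prec> x \<oplus> \<one>"
  by (simp add: ls_add1)

lemma zero_ls: "\<zero> \<prec> x \<longleftrightarrow> x \<noteq> \<zero>"
  using zero_le[of x] unfolding le_def by (metis ls_irrefl)

lemma add_mono_iff: "x \<oplus> z \<preceq> y \<oplus> z \<longleftrightarrow> x \<preceq> y" "x \<oplus> z \<prec> y \<oplus> z \<longleftrightarrow> x \<prec> y"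
  "z \<oplus> x \<preceq> z \<oplus> y \<longleftrightarrow> x \<preceq> y" "z \<oplus> x \<prec> z \<oplus> y \<longleftrightarrow> x \<prec> y"
proof -
  show 1: "z \<oplus> x \<preceq> z \<oplus> y \<longleftrightarrow> x \<preceq> y" for x y
    unfolding le_iff by (simp add: add_assoc add_cancel_left)
  then show 2: "z \<oplus> x \<prec> z \<oplus> y \<longleftrightarrow> x \<prec> y" for x y
    by (meson od.not_le)
  show "x \<oplus> z \<preceq> y \<oplus> z \<longleftrightarrow> x \<preceq> y" "x \<oplus> z \<prec> y \<oplus> z \<longleftrightarrow> x \<prec> y"
    using 1[of x y] 2[of x y] by (simp_all only: add_comm[of _ z])
qed

lemma add_mono: "x \<preceq> x' \<Longrightarrow> y \<preceq> y' \<Longrightarrow> x \<oplus> y \<preceq> x' \<oplus> y'"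
  by (meson add_mono_iff od.order_trans)

lemma mul_mono1: "x \<preceq> y \<Longrightarrow> x \<otimes> z \<preceq> y \<otimes> z"
  unfolding le_iff by (metis distrib_right)

lemma mul_mono: "x \<preceq> x' \<Longrightarrow> y \<preceq> y' \<Longrightarrow> x \<otimes> y \<preceq> x' \<otimes> y'"
  by (metis mul_comm mul_mono1 od.order_trans)

lemma mul_eq_zero: "x \<otimes> y = \<zero> \<longleftrightarrow> x = \<zero> \<or> y = \<zero>"
proof -
  have "x = \<zero> \<or> y = \<zero>" if "x \<otimes> y = \<zero>"
  proof (rule ccontr)
    assume *: "\<not> (x = \<zero> \<or> y = \<zero>)"
    obtain w where "y = w \<oplus> \<one>" using * zero_or_Suc by blast
    then have "x \<preceq> x \<otimes> y" by (simp add: ax6)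
    then have "x \<preceq> \<zero>" using that by simp
    then show False using * unfolding le_def by simp
  qed
  then show ?thesis by auto
qed

lemma mul_strict_mono: "x \<prec> y \<Longrightarrow> z \<noteq> \<zero> \<Longrightarrow> x \<otimes> z \<prec> y \<otimes> z"
proof -
  assume "x \<prec> y" "z \<noteq> \<zero>"
  then obtain w where w: "y = x \<oplus> (w \<oplus> \<one>)" unfolding ls_iff by blast
  have "\<zero> \<prec> (w \<oplus> \<one>) \<otimes> z" using \<open>z \<noteq> \<zero>\<close> by (simp add: zero_ls mul_eq_zero)
  then have "x \<otimes> z \<oplus> \<zero> \<prec> x \<otimes> z \<oplus> (w \<oplus> \<one>) \<otimes> z" by (simp only: add_mono_iff)
  then show ?thesis by (simp add: w distrib_right)
qed

lemma mul_cancel: "z \<noteq> \<zero> \<Longrightarrow> x \<otimes> z = y \<otimes> z \<longleftrightarrow> x = y"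
  using mul_strict_mono[of x y z] mul_strict_mono[of y x z] ls_linear[of x y] ls_irrefl by metis

lemma le_mul: "y \<noteq> \<zero> \<Longrightarrow> x \<preceq> x \<otimes> y"
  using zero_or_Suc[of y] by (metis ax6 le_add(2))

lemma least_number:
  assumes P: "Dz (\<lambda>e. P (e 0))" and x: "P x"
  obtains m where "P m" "\<And>y. y \<prec> m \<Longrightarrow> \<not> P y"
proof -
  have "\<exists>m. P m \<and> (\<forall>y. y \<prec> m \<longrightarrow> \<not> P y)"
  proof (rule ccontr)
    assume *: "\<not> ?thesis"
    have "\<forall>y. y \<prec> z \<longrightarrow> \<not> P y" for z
    proof (rule Dz_induct[where P = "\<lambda>z. \<forall>y. y \<prec> z \<longrightarrow> \<not> P y"])
      show "Dz (\<lambda>e. \<forall>y. y \<prec> e 0 \<longrightarrow> \<not> P y)"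
        by (intro Dz_intros) (rule P)
      show "\<forall>y. y \<prec> x \<oplus> \<one> \<longrightarrow> \<not> P y" if "\<forall>y. y \<prec> x \<longrightarrow> \<not> P y" for x
        using that * by (metis ax8)
    qed simp
    then show False using x ls_add_one by blast
  qed
  then show thesis using that by blast
qed

lemma greatest_number:
  assumes P: "Dz (\<lambda>e. P (e 0))" and x: "P x" and b: "\<And>y. P y \<Longrightarrow> y \<preceq> b"
  obtains m where "P m" "\<And>y. P y \<Longrightarrow> y \<preceq> m"
proof -
  have "Dz (\<lambda>e. \<forall>y. y \<prec> b \<oplus> \<one> \<longrightarrow> P y \<longrightarrow> y \<preceq> e 0)"
    by (intro Dz_intros) (rule P)
  moreover have "\<forall>y. y \<prec> b \<oplus> \<one> \<longrightarrow> P y \<longrightarrow> y \<preceq> b" using b by blast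
  ultimately obtain u where u: "\<forall>y. y \<prec> b \<oplus> \<one> \<longrightarrow> P y \<longrightarrow> y \<preceq> u"
    "\<And>w. w \<prec> u \<Longrightarrow> \<not> (\<forall>y. y \<prec> b \<oplus> \<one> \<longrightarrow> P y \<longrightarrow> y \<preceq> w)"
    by (rule least_number[where P = "\<lambda>u. \<forall>y. y \<prec> b \<oplus> \<one> \<longrightarrow> P y \<longrightarrow> y \<preceq> u"]) blast
  have ub: "y \<preceq> u" if "P y" for y using u(1) b[OF that] that ls_add1 by blast
  have "P u"
  proof (rule ccontr)
    assume "\<not> P u"
    then have lt: "y \<prec> u" if "P y" for y using ub[OF that] that unfolding le_def by blast
    then have "u \<noteq> \<zero>" using x by auto
    then obtain w where w: "u = w \<oplus> \<one>" using zero_or_Suc by blast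
    then have "\<forall>y. y \<prec> b \<oplus> \<one> \<longrightarrow> P y \<longrightarrow> y \<preceq> w" using lt ls_add1 by blast
    then show False using u(2)[of w] w by simp
  qed
  then show thesis using ub that by blast
qed

lemma division:
  assumes "b \<noteq> \<zero>"
  obtains q r where "a = b \<otimes> q \<oplus> r" "r \<prec> b"
proof -
  have "\<exists>q. b \<otimes> q \<preceq> a \<and> a \<prec> b \<otimes> (q \<oplus> \<one>)"
  proof (rule Sigma_induct[where Q = "\<lambda>a q. b \<otimes> q \<preceq> a \<and> a \<prec> b \<otimes> (q \<oplus> \<one>)"])
    show "\<exists>q. b \<otimes> q \<preceq> \<zero> \<and> \<zero> \<prec> b \<otimes> (q \<oplus> \<one>)"
      using assms by (intro exI[of _ "\<zero>"]) (simp add: zero_ls)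
    fix a assume "\<exists>q. b \<otimes> q \<preceq> a \<and> a \<prec> b \<otimes> (q \<oplus> \<one>)"
    then obtain q where q: "b \<otimes> q \<preceq> a" "a \<prec> b \<otimes> (q \<oplus> \<one>)" by blast
    show "\<exists>q. b \<otimes> q \<preceq> a \<oplus> \<one> \<and> a \<oplus> \<one> \<prec> b \<otimes> (q \<oplus> \<one>)"
    proof (cases "a \<oplus> \<one> \<prec> b \<otimes> (q \<oplus> \<one>)")
      case True
      then show ?thesis using q(1) le_add(1)[of a "\<one>"] od.order_trans by blast
    next
      case False
      then have e: "a \<oplus> \<one> = b \<otimes> (q \<oplus> \<one>)" using q(2) add1_le unfolding le_def by blast
      have "b \<otimes> (q \<oplus> \<one>) \<oplus> \<zero> \<prec> b \<otimes> (q \<oplus> \<one>) \<oplus> b"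
        unfolding add_mono_iff zero_ls by (rule assms)
      then show ?thesis unfolding e by (intro exI[of _ "q \<oplus> \<one>"]) (simp add: ax6)
    qed
  qed (intro Dz_intros)
  then obtain q where q: "b \<otimes> q \<preceq> a" "a \<prec> b \<otimes> (q \<oplus> \<one>)" by blast
  then obtain r where r: "a = b \<otimes> q \<oplus> r" unfolding le_iff by blast
  then have "r \<prec> b" using q(2) by (simp add: ax6 add_mono_iff)
  then show thesis using r that by blast
qed

definition dv where "dv a b \<longleftrightarrow> (\<exists>q. b = a \<otimes> q)"

lemma dv_refl [simp]: "dv a a" unfolding dv_def by (metis mul_one)
lemma dv_zero [simp]: "dv a \<zero>" unfolding dv_def by (metis ax5)
lemma dv_trans: "dv a b \<Longrightarrow> dv b c \<Longrightarrow> dv a c" unfolding dv_def by (metis mul_assoc)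
lemma dv_mult: "dv a b \<Longrightarrow> dv a (b \<otimes> c)" unfolding dv_def by (metis mul_assoc)
lemma dv_mult2: "dv a c \<Longrightarrow> dv a (b \<otimes> c)" using dv_mult[of a c b] by (simp add: mul_comm)
lemma dv_triv [simp]: "dv a (a \<otimes> c)" unfolding dv_def by blast

lemma dv_add_iff: assumes "dv a b" shows "dv a (b \<oplus> c) \<longleftrightarrow> dv a c"
proof
  assume "dv a c" then show "dv a (b \<oplus> c)" using assms unfolding dv_def by (metis distrib_left)
next
  assume "dv a (b \<oplus> c)"
  then obtain q q' where q: "b = a \<otimes> q" and q': "b \<oplus> c = a \<otimes> q'" using assms unfolding dv_def by blast
  show "dv a c"
  proof (cases "q \<preceq> q'")
    case True
    then obtain s where "q' = q \<oplus> s" unfolding le_iff by blast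
    then have "c = a \<otimes> s" using q q' by (simp add: distrib_left add_cancel_left)
    then show ?thesis unfolding dv_def by blast
  next
    case False
    then have "a \<otimes> q' \<preceq> a \<otimes> q" using mul_mono[of a a q' q] by simp
    then have "b \<oplus> c \<preceq> b \<oplus> \<zero>" using q q' by simp
    then have "c = \<zero>" unfolding add_mono_iff using zero_le by (meson od.order.antisym)
    then show ?thesis by simp
  qed
qed

lemma dv_le: "dv a b \<Longrightarrow> b \<noteq> \<zero> \<Longrightarrow> a \<preceq> b"
  unfolding dv_def by (metis ax5 le_mul)

lemma dv_nonzero: "dv a b \<Longrightarrow> b \<noteq> \<zero> \<Longrightarrow> a \<noteq> \<zero>"
  unfolding dv_def by auto

lemma dv_one: "dv a \<one> \<Longrightarrow> a = \<one>"
  by (metis dv_le dv_nonzero le_iff od.order.antisym one_neq_zero zero_or_Suc add_comm)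

lemma Dz_dv: assumes "Tm f" "Tm g" shows "Dz (\<lambda>e. dv (f e) (g e))"
proof -
  have "dv a b \<longleftrightarrow> b = \<zero> \<or> (\<exists>q. q \<prec> b \<oplus> \<one> \<and> b = a \<otimes> q)" for a b
  proof -
    have "q \<preceq> b" if "b = a \<otimes> q" "b \<noteq> \<zero>" for q
      using that le_mul[of a q] by (metis mul_comm mul_eq_zero)
    then show ?thesis unfolding dv_def ls_add1 by (metis ax5)
  qed
  then have "Dz (\<lambda>e. dv (e 0) (e (Suc 0)))" by (simp only:) (intro Dz_intros)
  then show ?thesis using assms by (rule Dz_app2)
qed

text \<open>The quantifier is bounded for \<open>cop\<close> to be a \<open>Dz\<close> predicate.\<close>

definition cop where "cop a b \<longleftrightarrow> (\<forall>d. d \<prec> a \<oplus> \<one> \<longrightarrow> dv d a \<longrightarrow> dv d b \<longrightarrow> d = \<one>)"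

lemma Dz_cop: "Tm f \<Longrightarrow> Tm g \<Longrightarrow> Dz (\<lambda>e. cop (f e) (g e))"
  by (rule Dz_app2[of cop]) (unfold cop_def, intro Dz_intros Dz_dv)

lemma copI: "(\<And>d. dv d a \<Longrightarrow> dv d b \<Longrightarrow> d = \<one>) \<Longrightarrow> cop a b"
  unfolding cop_def by blast

lemma copD: "cop a b \<Longrightarrow> a \<noteq> \<zero> \<Longrightarrow> dv d a \<Longrightarrow> dv d b \<Longrightarrow> d = \<one>"
  unfolding cop_def ls_add1 using dv_le by blast

text \<open>In place of Bezout coefficients, which call for subtraction: by division with remainder,
  the least positive \<open>x\<close> with \<open>dv a (b \<otimes> x)\<close> divides every
  \<open>y\<close> with \<open>dv a (b \<otimes> y)\<close>. In particular it divides
  \<open>a\<close>, and the cofactor divides both \<open>a\<close> and \<open>b\<close>, so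
  \<open>x = a\<close>.\<close>

lemma gauss:
  assumes ab: "cop a b" and a: "a \<noteq> \<zero>" and d: "dv a (b \<otimes> c)"
  shows "dv a c"
proof -
  have "Dz (\<lambda>e. e 0 \<noteq> \<zero> \<and> dv a (b \<otimes> e 0))" by (intro Dz_intros Dz_dv)
  moreover have "a \<noteq> \<zero> \<and> dv a (b \<otimes> a)" using a dv_mult2 by simp
  ultimately obtain x where x: "x \<noteq> \<zero>" "dv a (b \<otimes> x)" and
    least: "\<And>y. y \<prec> x \<Longrightarrow> \<not> (y \<noteq> \<zero> \<and> dv a (b \<otimes> y))"
    by (rule least_number[where P = "\<lambda>x. x \<noteq> \<zero> \<and> dv a (b \<otimes> x)"]) blast
  have all: "dv x y" if y: "dv a (b \<otimes> y)" for y
  proof -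
    obtain q r where qr: "y = x \<otimes> q \<oplus> r" "r \<prec> x" using division[OF x(1)] by blast
    have "b \<otimes> y = (b \<otimes> x) \<otimes> q \<oplus> b \<otimes> r" by (simp add: qr distrib_left mul_assoc)
    then have "dv a (b \<otimes> r)" using dv_add_iff[OF dv_mult[OF x(2)]] y by metis
    then have "r = \<zero>" using least[OF qr(2)] by blast
    then show ?thesis using qr by simp
  qed
  obtain y where y: "a = x \<otimes> y" using all[of a] dv_mult2[OF dv_refl] unfolding dv_def by blast
  obtain t where "b \<otimes> x = a \<otimes> t" using x(2) unfolding dv_def by blast
  then have "b \<otimes> x = (y \<otimes> t) \<otimes> x" using y by (simp add: ring)
  then have "b = y \<otimes> t" using x(1) by (simp add: mul_cancel)
  moreover have "dv y a" using y dv_mult2[OF dv_refl] by simp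
  ultimately have "y = \<one>" using copD[OF ab a] by simp
  then show ?thesis using all[OF d] y by simp
qed

lemma cop_mult:
  assumes "cop a b" "cop a c" "a \<noteq> \<zero>"
  shows "cop a (b \<otimes> c)"
proof (rule copI)
  fix d assume d: "dv d a" "dv d (b \<otimes> c)"
  have "cop d b" by (rule copI) (meson assms copD d dv_trans)
  then have "dv d c" using d dv_nonzero assms(3) gauss by blast
  then show "d = \<one>" using assms copD d by blast
qed

lemma cop_commute: "cop a b \<Longrightarrow> a \<noteq> \<zero> \<Longrightarrow> cop b a"
  by (meson copI copD)


subsection \<open>Pairs and codes of finite sets\<close>

definition pc where "pc x y = (x \<oplus> y) \<otimes> (x \<oplus> y) \<oplus> x"

lemma ev_pr [simp]: "ev e (pr s t) = pc (ev e s) (ev e t)"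
  by (simp add: pr_def pc_def)

lemma Tm_pc: "Tm f \<Longrightarrow> Tm g \<Longrightarrow> Tm (\<lambda>e. pc (f e) (g e))"
  unfolding pc_def by (intro Dz_intros)

lemma le_square: "x \<preceq> x \<otimes> x"
  using le_mul[of x x] by (cases "x = \<zero>") auto

lemma sum_le_pc: "x \<oplus> y \<preceq> pc x y"
  unfolding pc_def by (meson le_square le_add od.order_trans)

lemma le_pc: "x \<preceq> pc x y" "y \<preceq> pc x y"
  using sum_le_pc le_add od.order_trans by blast+

lemma pc_mono: "x \<preceq> x' \<Longrightarrow> y \<preceq> y' \<Longrightarrow> pc x y \<preceq> pc x' y'"
  unfolding pc_def by (intro add_mono mul_mono)

lemma pc_strict: "x \<prec> k \<Longrightarrow> y \<preceq> l \<Longrightarrow> pc x y \<prec> pc k l"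
proof -
  assume a: "x \<prec> k" "y \<preceq> l"
  then have "(x \<oplus> y) \<otimes> (x \<oplus> y) \<oplus> x \<preceq> (k \<oplus> l) \<otimes> (k \<oplus> l) \<oplus> x"
    by (intro add_mono mul_mono) auto
  also have "\<dots> \<prec> (k \<oplus> l) \<otimes> (k \<oplus> l) \<oplus> k" using a by (simp add: add_mono_iff)
  finally show ?thesis unfolding pc_def .
qed

text \<open>\<open>pc x y\<close> is at least the square of \<open>x \<oplus> y\<close> and below
  the square of \<open>x \<oplus> y \<oplus> \<one>\<close>, so it determines the sum, and then
  \<open>x\<close>.\<close>

lemma pc_inj: "pc x y = pc x' y' \<longleftrightarrow> x = x' \<and> y = y'"
proof
  assume e: "pc x y = pc x' y'"
  have *: False if "x \<oplus> y \<prec> x' \<oplus> y'" "pc x y = pc x' y'" for x y x' y'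
  proof -
    let ?s = "x \<oplus> y" and ?t = "x' \<oplus> y'"
    have "?s \<oplus> \<one> \<preceq> ?t" using that by (simp add: add1_le)
    then have "(?s \<oplus> \<one>) \<otimes> (?s \<oplus> \<one>) \<preceq> ?t \<otimes> ?t" by (intro mul_mono)
    moreover have "(?s \<oplus> \<one>) \<otimes> (?s \<oplus> \<one>) = ((?s \<otimes> ?s \<oplus> ?s) \<oplus> ?s) \<oplus> \<one>"
      by (simp add: ax6 mul_Suc_left ax4)
    moreover have "pc x y \<preceq> (?s \<otimes> ?s \<oplus> ?s) \<oplus> ?s"
      unfolding pc_def by (meson add_mono le_add od.order_refl od.order_trans)
    ultimately have "pc x y \<prec> ?t \<otimes> ?t" by (metis ls_add1 od.less_le_trans)
    moreover have "?t \<otimes> ?t \<preceq> pc x' y'" unfolding pc_def by simp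
    ultimately show False using that(2) od.not_less by metis
  qed
  have "x \<oplus> y = x' \<oplus> y'" using *[of x y x' y'] *[of x' y' x y] e ls_linear by metis
  then show "x = x' \<and> y = y'" using e unfolding pc_def by (metis add_cancel_left)
qed simp

text \<open>Goedel's moduli: pairwise coprime for indices below \<open>u\<close> when
  \<open>m\<close> is divisible by 1, ..., \<open>u\<close>.\<close>

definition cq where "cq m i = m \<otimes> (i \<oplus> \<one>) \<oplus> \<one>"

definition mem where
  "mem i c \<longleftrightarrow> (\<exists>k m n. c = pc k (pc m n) \<and> i \<prec> k \<and> dv (cq m i) n)"

lemma mem_pc [simp]: "mem i (pc k (pc m n)) \<longleftrightarrow> i \<prec> k \<and> dv (cq m i) n"
  unfolding mem_def by (simp add: pc_inj)

lemma mem_less: "mem i c \<Longrightarrow> i \<prec> c"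
  unfolding mem_def using le_pc od.less_le_trans by blast

lemma Dz_code: assumes "Tm f" "Tm g" shows "Dz (\<lambda>e. mem (f e) (g e))"
proof -
  have "mem i c \<longleftrightarrow> (\<exists>k. k \<prec> c \<oplus> \<one> \<and> (\<exists>m. m \<prec> c \<oplus> \<one> \<and> (\<exists>n. n \<prec> c \<oplus> \<one> \<and>
      (c = pc k (pc m n) \<and> i \<prec> k \<and> dv (cq m i) n))))" for i c
  proof -
    have "k \<preceq> pc k (pc m n)" "m \<preceq> pc k (pc m n)" "n \<preceq> pc k (pc m n)" for k m n
      using le_pc od.order_trans by blast+
    then show ?thesis unfolding mem_def ls_add1 by blast
  qed
  then have "Dz (\<lambda>e. mem (e 0) (e (Suc 0)))" by (simp only: cq_def) (intro Dz_intros Dz_dv Tm_pc)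
  then show ?thesis using assms by (rule Dz_app2)
qed

text \<open>\<open>K u v\<close> ensures that every definable subset of \<open>{i. i \<prec> u}\<close> has a code below \<open>v\<close>; as
  a bounded condition it replaces exponentiation.\<close>

definition K where
  "K u v \<longleftrightarrow> (\<exists>m. m \<prec> v \<and> (\<exists>n. n \<prec> v \<and> (pc u (pc m n) \<prec> v \<and> m \<noteq> \<zero> \<and> n \<noteq> \<zero> \<and>
     (\<forall>j. j \<prec> u \<oplus> \<one> \<longrightarrow> j \<noteq> \<zero> \<longrightarrow> dv j m) \<and> (\<forall>i. i \<prec> u \<longrightarrow> dv (cq m i) n))))"

lemma Dz_K: assumes "Tm f" "Tm g" shows "Dz (\<lambda>e. K (f e) (g e))"
  by (rule Dz_app2[of K, OF _ assms]) (unfold K_def cq_def, intro Dz_intros Dz_dv Tm_pc)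

lemma K_mono: assumes "K u v" "u' \<preceq> u" "v \<preceq> v'" shows "K u' v'"
proof -
  obtain m n where mn: "m \<prec> v" "n \<prec> v" "pc u (pc m n) \<prec> v" "m \<noteq> \<zero>" "n \<noteq> \<zero>"
     "\<And>j. j \<prec> u \<oplus> \<one> \<Longrightarrow> j \<noteq> \<zero> \<Longrightarrow> dv j m" "\<And>i. i \<prec> u \<Longrightarrow> dv (cq m i) n"
    using assms(1) unfolding K_def by blast
  have "pc u' (pc m n) \<preceq> pc u (pc m n)" using assms(2) by (intro pc_mono) auto
  then have "pc u' (pc m n) \<prec> v'" using mn(3) assms(3) by order
  moreover have "m \<prec> v'" "n \<prec> v'" using mn assms by order+
  moreover have "dv j m" if "j \<prec> u' \<oplus> \<one>" "j \<noteq> \<zero>" for j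
    using mn(6) that assms(2) unfolding ls_add1 by (meson od.order_trans)
  moreover have "dv (cq m i) n" if "i \<prec> u'" for i
    using mn(7) that assms(2) by (meson od.less_le_trans)
  ultimately show ?thesis unfolding K_def using mn(4,5) by blast
qed

lemma K_less: "K u v \<Longrightarrow> u \<prec> v"
  unfolding K_def using le_pc(1) od.le_less_trans by blast

text \<open>The common multiples of 1, ..., \<open>u\<close> and of the moduli are built by Sigma_1
  induction, one factor at a time.\<close>

lemma ex_K: "\<exists>v. K u v"
proof -
  have "\<exists>m. m \<noteq> \<zero> \<and> (\<forall>j. j \<prec> u \<oplus> \<one> \<longrightarrow> j \<noteq> \<zero> \<longrightarrow> dv j m)"
  proof (rule Sigma_induct[where Q = "\<lambda>u m. m \<noteq> \<zero> \<and> (\<forall>j. j \<prec> u \<oplus> \<one> \<longrightarrow> j \<noteq> \<zero> \<longrightarrow> dv j m)"])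
    show "\<exists>m. m \<noteq> \<zero> \<and> (\<forall>j. j \<prec> \<zero> \<oplus> \<one> \<longrightarrow> j \<noteq> \<zero> \<longrightarrow> dv j m)"
      by (intro exI[of _ "\<one>"]) (auto simp: ax8[of _ "\<zero>"] simp del: add_zero_left)
    fix u assume "\<exists>m. m \<noteq> \<zero> \<and> (\<forall>j. j \<prec> u \<oplus> \<one> \<longrightarrow> j \<noteq> \<zero> \<longrightarrow> dv j m)"
    then obtain m where "m \<noteq> \<zero>" "\<And>j. j \<prec> u \<oplus> \<one> \<Longrightarrow> j \<noteq> \<zero> \<Longrightarrow> dv j m" by blast
    then show "\<exists>m. m \<noteq> \<zero> \<and> (\<forall>j. j \<prec> u \<oplus> \<one> \<oplus> \<one> \<longrightarrow> j \<noteq> \<zero> \<longrightarrow> dv j m)"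
      by (intro exI[of _ "m \<otimes> (u \<oplus> \<one>)"])
        (auto simp: mul_eq_zero ax8[of _ "u \<oplus> \<one>"] intro: dv_mult dv_mult2)
  qed (intro Dz_intros Dz_dv)
  then obtain m where m: "m \<noteq> \<zero>" "\<forall>j. j \<prec> u \<oplus> \<one> \<longrightarrow> j \<noteq> \<zero> \<longrightarrow> dv j m" by blast
  have "\<exists>n. n \<noteq> \<zero> \<and> (\<forall>i. i \<prec> u \<longrightarrow> dv (cq m i) n)"
  proof (rule Sigma_induct[where Q = "\<lambda>u n. n \<noteq> \<zero> \<and> (\<forall>i. i \<prec> u \<longrightarrow> dv (cq m i) n)"])
    show "\<exists>n. n \<noteq> \<zero> \<and> (\<forall>i. i \<prec> \<zero> \<longrightarrow> dv (cq m i) n)"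
      by (intro exI[of _ "\<one>"]) simp
    fix u assume "\<exists>n. n \<noteq> \<zero> \<and> (\<forall>i. i \<prec> u \<longrightarrow> dv (cq m i) n)"
    then obtain n where "n \<noteq> \<zero>" "\<And>i. i \<prec> u \<Longrightarrow> dv (cq m i) n" by blast
    then show "\<exists>n. n \<noteq> \<zero> \<and> (\<forall>i. i \<prec> u \<oplus> \<one> \<longrightarrow> dv (cq m i) n)"
      by (intro exI[of _ "n \<otimes> cq m u"])
        (auto simp: mul_eq_zero ax8[of _ u] cq_def intro: dv_mult dv_mult2)
  qed (unfold cq_def, intro Dz_intros Dz_dv)
  then obtain n where n: "n \<noteq> \<zero>" "\<forall>i. i \<prec> u \<longrightarrow> dv (cq m i) n" by blast
  let ?v = "pc u (pc m n) \<oplus> \<one>"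
  have "m \<preceq> pc u (pc m n)" "n \<preceq> pc u (pc m n)" using le_pc od.order_trans by blast+
  then have "m \<prec> ?v" "n \<prec> ?v" "pc u (pc m n) \<prec> ?v" by (simp_all add: ls_add1)
  then have "K u ?v" unfolding K_def using m n by blast
  then show ?thesis by blast
qed

text \<open>A common divisor is coprime to \<open>m\<close> and divides
  \<open>m \<otimes> s\<close>, the difference of the moduli, where \<open>s\<close> is the
  difference of the indices. So it divides \<open>s\<close>, which is at most \<open>u\<close> and
  therefore divides \<open>m\<close>.\<close>

lemma cop_cq:
  assumes m: "\<And>j. j \<preceq> u \<Longrightarrow> j \<noteq> \<zero> \<Longrightarrow> dv j m" and "i \<prec> i'" "i' \<prec> u"
  shows "cop (cq m i) (cq m i')"
proof (rule copI)
  fix d assume d: "dv d (cq m i)" "dv d (cq m i')"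
  obtain s where s: "i' = i \<oplus> s" "s \<noteq> \<zero>" using \<open>i \<prec> i'\<close> unfolding ls_iff by (metis ax1)
  have d0: "d \<noteq> \<zero>" using dv_nonzero[OF d(1)] by (simp add: cq_def)
  have *: "d' = \<one>" if "dv d' d" "dv d' m" for d'
  proof -
    have "dv d' (m \<otimes> (i \<oplus> \<one>) \<oplus> \<one>)" using dv_trans[OF that(1) d(1)] by (simp add: cq_def)
    then show ?thesis using dv_add_iff[OF dv_mult[OF that(2)]] dv_one by blast
  qed
  have "cq m i' = cq m i \<oplus> m \<otimes> s" by (simp add: cq_def s ring)
  then have "dv d (m \<otimes> s)" using d dv_add_iff by metis
  moreover have "cop d m" using * by (rule copI)
  ultimately have "dv d s" using gauss d0 by blast
  moreover have "s \<preceq> u" using s \<open>i' \<prec> u\<close> le_add(2)[of s i] by (metis od.less_imp_le od.order_trans)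
  ultimately have "dv d m" using m[OF _ s(2)] dv_trans by blast
  then show "d = \<one>" using * by simp
qed

text \<open>By induction on \<open>j\<close>, a divisor of \<open>n\<close> is found that contains
  exactly the moduli of those \<open>i \<prec> j\<close> with \<open>P i\<close>. Remaining a
  divisor of \<open>n\<close> is what keeps the code below \<open>v\<close>. The code is given as an
  explicit triple because codes of finite sequences have to be triples.\<close>

lemma code_exists_triple:
  assumes K: "K u v" and P: "Dz (\<lambda>e. P (e 0))"
  shows "\<exists>x y z. pc x (pc y z) \<prec> v \<and> (\<forall>i. mem i (pc x (pc y z)) \<longleftrightarrow> i \<prec> u \<and> P i)"
proof -
  obtain m n where mn: "pc u (pc m n) \<prec> v" "m \<noteq> \<zero>" "n \<noteq> \<zero>"
     "\<And>j. j \<preceq> u \<Longrightarrow> j \<noteq> \<zero> \<Longrightarrow> dv j m" "\<And>i. i \<prec> u \<Longrightarrow> dv (cq m i) n"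
    using K unfolding K_def ls_add1 by blast
  have cq0: "cq m i \<noteq> \<zero>" for i by (simp add: cq_def)
  have cq1: "cq m i \<noteq> \<one>" for i
  proof
    assume "cq m i = \<one>"
    then have "m \<otimes> (i \<oplus> \<one>) = \<zero>" unfolding cq_def by (metis add_cancel_right add_zero_left)
    then show False using mn(2) by (simp add: mul_eq_zero)
  qed
  have cop: "cop (cq m i) (cq m i')" if "i \<noteq> i'" "i \<prec> u" "i' \<prec> u" for i i'
    using that cop_cq[OF mn(4)] cop_commute cq0 ls_linear by metis
  let ?R = "\<lambda>j n'. n' \<noteq> \<zero> \<and> dv n' n \<and> (\<forall>i. i \<prec> u \<longrightarrow>
     (i \<prec> j \<and> P i \<longrightarrow> dv (cq m i) n') \<and> (\<not> (i \<prec> j \<and> P i) \<longrightarrow> cop (cq m i) n'))"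
  have "\<exists>n'. j \<preceq> u \<longrightarrow> ?R j n'" for j
  proof (rule Sigma_induct[where Q = "\<lambda>j n'. j \<preceq> u \<longrightarrow> ?R j n'"])
    show "Dz (\<lambda>e. e (Suc 0) \<preceq> u \<longrightarrow> ?R (e (Suc 0)) (e 0))"
      unfolding cq_def by (intro Dz_intros Dz_dv Dz_cop P Dz_app1[OF P])
    show "\<exists>n'. \<zero> \<preceq> u \<longrightarrow> ?R \<zero> n'"
      by (intro exI[of _ "\<one>"]) (auto intro: copI dv_one simp: dv_def)
    fix j assume "\<exists>n'. j \<preceq> u \<longrightarrow> ?R j n'"
    then obtain n' where R: "j \<preceq> u \<longrightarrow> ?R j n'" by blast
    show "\<exists>n'. j \<oplus> \<one> \<preceq> u \<longrightarrow> ?R (j \<oplus> \<one>) n'"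
    proof (cases "j \<prec> u")
      case False
      then show ?thesis by (simp add: add1_le)
    next
      case True
      then have n': "n' \<noteq> \<zero>" "dv n' n" and div: "\<And>i. i \<prec> u \<Longrightarrow> i \<prec> j \<Longrightarrow> P i \<Longrightarrow> dv (cq m i) n'"
        and cp: "\<And>i. i \<prec> u \<Longrightarrow> \<not> (i \<prec> j \<and> P i) \<Longrightarrow> cop (cq m i) n'"
        using R by auto
      show ?thesis
      proof (cases "P j")
        case False
        then have "i \<prec> j \<oplus> \<one> \<and> P i \<longleftrightarrow> i \<prec> j \<and> P i" for i by (auto simp: ax8)
        then show ?thesis using R True by (intro exI[of _ n']) (auto simp: le_def)
      next
        case PT: True
        obtain t where t: "n = n' \<otimes> t" using n'(2) unfolding dv_def by blast
        have cj: "cop (cq m j) n'" using cp[OF True] by (simp add: ls_irrefl)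
        \<comment> \<open>The new modulus is coprime to \<open>n'\<close> and divides
          \<open>n\<close>, so it divides the cofactor \<open>t\<close>, and its product with
          \<open>n'\<close> is still a divisor of \<open>n\<close>.\<close>
        have "dv (cq m j) t" using gauss[OF cj cq0] mn(5)[OF True] t by simp
        then have "dv (n' \<otimes> cq m j) n" using t unfolding dv_def by (metis mul_assoc)
        moreover have "cop (cq m i) (n' \<otimes> cq m j)" if "i \<prec> u" "\<not> (i \<prec> j \<oplus> \<one> \<and> P i)" for i
        proof (rule cop_mult[OF _ _ cq0])
          show "cop (cq m i) n'" using that by (intro cp) (auto simp: ax8)
          show "cop (cq m i) (cq m j)" using that True PT by (intro cop) auto
        qed
        moreover have "dv (cq m i) (n' \<otimes> cq m j)" if "i \<prec> u" "i \<prec> j \<oplus> \<one>" "P i" for i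
          using that div[of i] by (cases "i = j") (auto simp: ax8 intro: dv_mult dv_mult2)
        ultimately show ?thesis using n'(1) cq0
          by (intro exI[of _ "n' \<otimes> cq m j"]) (simp add: mul_eq_zero)
      qed
    qed
  qed
  then obtain n' where n': "?R u n'" using od.order_refl by blast
  have "dv (cq m i) n' \<longleftrightarrow> P i" if "i \<prec> u" for i
    using n' that copD[OF _ cq0 dv_refl, of i n'] cq1 by blast
  then have "mem i (pc u (pc m n')) \<longleftrightarrow> i \<prec> u \<and> P i" for i by auto
  moreover have "pc u (pc m n') \<preceq> pc u (pc m n)"
    using dv_le n' mn(3) by (intro pc_mono) auto
  then have "pc u (pc m n') \<prec> v" using mn(1) by order
  ultimately show ?thesis by blast
qed

lemma code_exists:
  assumes "K u v" "Dz (\<lambda>e. P (e 0))"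
  obtains c where "c \<prec> v" "\<And>i. mem i c \<longleftrightarrow> i \<prec> u \<and> P i"
  using code_exists_triple[OF assms] by blast

end

context model
begin

subsection \<open>Coded sets and definability\<close>

definition Cd where "Cd c = {i. mem i c}"
text \<open>Quantifying over \<open>FS B\<close> is bounded quantification over codes, so statements
  about such sets remain \<open>Dz\<close> predicates and are open to induction.\<close>

definition FS where "FS B = {Cd c |c. c \<prec> B}"
text \<open>One coded set of pairs stands for a whole family of sets.\<close>

definition sec where "sec R j = {x. pc j x \<in> R}"

text \<open>The bound by a term turns quantification over the members into a bounded
  quantifier.\<close>

definition DzB :: "((nat \<Rightarrow> 'm) \<Rightarrow> 'm set) \<Rightarrow> bool" where
  "DzB Y \<longleftrightarrow> Dz (\<lambda>e. e 0 \<in> Y (\<lambda>n. e (Suc n))) \<and> (\<exists>t. Tm t \<and> (\<forall>e. \<forall>x\<in>Y e. x \<prec> t e))"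

lemma Tm_subst: assumes f: "Tm f" and F: "\<And>i. Tm (F i)" shows "Tm (\<lambda>e. f (\<lambda>i. F i e))"
proof -
  obtain t where t: "\<And>i e. F i e = ev (cenv e) (t i)" using F unfolding Tm_def by metis
  obtain u where u: "\<And>e. f e = ev (cenv e) u" using f unfolding Tm_def by blast
  let ?\<sigma> = "\<lambda>n. if even n then t (n div 2) else Var n"
  have "(\<lambda>n. ev (cenv e) (?\<sigma> n)) = cenv (\<lambda>i. F i e)" for e
    by (rule ext) (simp add: t cenv_def)
  then have "f (\<lambda>i. F i e) = ev (cenv e) (substt ?\<sigma> u)" for e
    by (simp only: u ev_substt)
  then show ?thesis unfolding Tm_def by blast
qed

lemma Dz_Cons:
  assumes P: "Dz (\<lambda>e. P (e 0) (\<lambda>n. e (Suc n)))" and f: "Tm f" and g: "\<And>i. Tm (g i)"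
  shows "Dz (\<lambda>e. P (f e) (\<lambda>i. g i e))"
proof -
  have "Tm (case_nat f g i)" for i using f g by (cases i) simp_all
  from Dz_subst[OF P, of "case_nat f g", OF this] show ?thesis by simp
qed

lemma DzB_mem: "DzB Y \<Longrightarrow> Tm f \<Longrightarrow> Dz (\<lambda>e. f e \<in> Y e)"
  unfolding DzB_def using Dz_Cons[of "\<lambda>x e. x \<in> Y e" f "\<lambda>i e. e i"] Tm_var by blast

lemma DzB_env:
  assumes Y: "DzB Y" and g: "\<And>i. Tm (g i)"
  shows "DzB (\<lambda>e. Y (\<lambda>i. g i e))"
proof -
  obtain t where t: "Tm t" "\<forall>e. \<forall>x\<in>Y e. x \<prec> t e" using Y unfolding DzB_def by blast
  have "Dz (\<lambda>e. e 0 \<in> Y (\<lambda>n. e (Suc n)))" using Y unfolding DzB_def by blast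
  then have "Dz (\<lambda>e. e 0 \<in> Y (\<lambda>i. g i (\<lambda>n. e (Suc n))))"
    by (rule Dz_Cons[where P = "\<lambda>x e. x \<in> Y e" and g = "\<lambda>i e. g i (\<lambda>n. e (Suc n))"])
      (intro Tm_var, rule Tm_subst[OF g Tm_var])
  moreover have "Tm (\<lambda>e. t (\<lambda>i. g i e))" using Tm_subst[OF t(1) g] .
  ultimately show ?thesis using t(2) unfolding DzB_def by blast
qed

lemma Dz_ball:
  assumes Y: "DzB Y" and P: "Dz (\<lambda>e. P (e 0) (\<lambda>n. e (Suc n)))"
  shows "Dz (\<lambda>e. \<forall>x\<in>Y e. P x e)"
proof -
  obtain t where t: "Tm t" "\<forall>e. \<forall>x\<in>Y e. x \<prec> t e" using Y unfolding DzB_def by blast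
  have "(\<forall>x\<in>Y e. P x e) \<longleftrightarrow> (\<forall>x. x \<prec> t e \<longrightarrow> x \<in> Y e \<longrightarrow> P x e)" for e using t(2) by blast
  moreover have "Dz (\<lambda>e. \<forall>x. x \<prec> t e \<longrightarrow> x \<in> Y e \<longrightarrow> P x e)"
    using Y unfolding DzB_def by (intro Dz_all Dz_imp P t(1)) blast
  ultimately show ?thesis by simp
qed

lemma Dz_bex:
  assumes Y: "DzB Y" and P: "Dz (\<lambda>e. P (e 0) (\<lambda>n. e (Suc n)))"
  shows "Dz (\<lambda>e. \<exists>x\<in>Y e. P x e)"
  using Dz_not[OF Dz_ball[OF Y Dz_not[OF P]]] by simp

lemma Dz_subset:
  assumes "DzB Y" "DzB Z"
  shows "Dz (\<lambda>e. Y e \<subseteq> Z e)"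
  unfolding subset_eq by (rule Dz_ball[OF assms(1)]) (use assms(2) in \<open>simp add: DzB_def\<close>)

lemma DzB_Cd: "Tm f \<Longrightarrow> DzB (\<lambda>e. Cd (f e))"
  unfolding DzB_def Cd_def using mem_less
  by (auto intro!: Dz_code Tm_var Tm_subst[of f "\<lambda>i e. e (Suc i)"])

lemma DzB_FS: assumes "Y \<in> FS B" shows "DzB (\<lambda>e. Y)"
proof -
  obtain c where "Y = Cd c" using assms unfolding FS_def by blast
  then show ?thesis using DzB_Cd[OF Tm_const[of c]] by simp
qed

lemma DzB_sec: assumes "DzB R" "Tm f" shows "DzB (\<lambda>e. sec (R e) (f e))"
proof -
  obtain t where t: "Tm t" "\<forall>e. \<forall>x\<in>R e. x \<prec> t e" using assms(1) unfolding DzB_def by blast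
  have "Dz (\<lambda>e. pc (f (\<lambda>n. e (Suc n))) (e 0) \<in> R (\<lambda>n. e (Suc n)))"
    by (intro DzB_mem DzB_env[OF assms(1)] Tm_var Tm_pc Tm_subst[OF assms(2)])
  moreover have "\<forall>x\<in>sec (R e) (f e). x \<prec> t e" for e
    using t(2) le_pc(2) od.le_less_trans unfolding sec_def by blast
  ultimately show ?thesis using t(1) unfolding DzB_def sec_def mem_Collect_eq by blast
qed

lemma DzB_insert: assumes "DzB Y" "Tm f" shows "DzB (\<lambda>e. insert (f e) (Y e))"
proof -
  obtain t where t: "Tm t" "\<forall>e. \<forall>x\<in>Y e. x \<prec> t e" using assms(1) unfolding DzB_def by blast
  have "Dz (\<lambda>e. e 0 = f (\<lambda>n. e (Suc n)) \<or> e 0 \<in> Y (\<lambda>n. e (Suc n)))"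
    by (intro Dz_or Dz_eq DzB_mem DzB_env[OF assms(1)] Tm_var Tm_subst[OF assms(2)])
  moreover have "f e \<prec> f e \<oplus> \<one> \<oplus> t e" "\<forall>x\<in>Y e. x \<prec> f e \<oplus> \<one> \<oplus> t e" for e
    using t(2) le_add ls_add_one od.less_le_trans by blast+
  moreover have "Tm (\<lambda>e. f e \<oplus> \<one> \<oplus> t e)" by (intro Tm_ad Tm_const assms(2) t(1))
  ultimately show ?thesis unfolding DzB_def insert_iff by blast
qed

lemma DzB_Collect: assumes "Tm t" "Dz (\<lambda>e. P (e 0) (\<lambda>n. e (Suc n)))" shows "DzB (\<lambda>e. {x. x \<prec> t e \<and> P x e})"
proof -
  have "Dz (\<lambda>e. e 0 \<prec> t (\<lambda>n. e (Suc n)) \<and> P (e 0) (\<lambda>n. e (Suc n)))"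
    by (intro Dz_and Dz_ls assms(2) Tm_var Tm_subst[OF assms(1)])
  then show ?thesis unfolding DzB_def mem_Collect_eq using assms(1) by blast
qed

lemma DzB_filter: assumes "DzB Y" "Dz (\<lambda>e. P (e 0) (\<lambda>n. e (Suc n)))" shows "DzB (\<lambda>e. {x \<in> Y e. P x e})"
proof -
  obtain t where t: "Tm t" "\<forall>e. \<forall>x\<in>Y e. x \<prec> t e" using assms(1) unfolding DzB_def by blast
  have "Dz (\<lambda>e. e 0 \<in> Y (\<lambda>n. e (Suc n)) \<and> P (e 0) (\<lambda>n. e (Suc n)))"
    by (intro Dz_and assms(2)) (use assms(1) in \<open>simp add: DzB_def\<close>)
  then show ?thesis unfolding DzB_def mem_Collect_eq using t by blast
qed

lemma Dz_exFS:
  assumes "Tm t" "Dz (\<lambda>e. P (Cd (e 0)) (\<lambda>n. e (Suc n)))"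
  shows "Dz (\<lambda>e. \<exists>Y\<in>FS (t e). P Y e)"
proof -
  have "(\<exists>Y\<in>FS (t e). P Y e) \<longleftrightarrow> (\<exists>c. c \<prec> t e \<and> P (Cd c) e)" for e
    unfolding FS_def by blast
  then show ?thesis using Dz_ex[where P = "\<lambda>c. P (Cd c)", OF assms(2,1)] by simp
qed

lemma Dz_allFS:
  assumes "Tm t" "Dz (\<lambda>e. P (Cd (e 0)) (\<lambda>n. e (Suc n)))"
  shows "Dz (\<lambda>e. \<forall>Y\<in>FS (t e). P Y e)"
  using Dz_not[OF Dz_exFS[OF assms(1), OF Dz_not[OF assms(2)]]] by simp

lemmas DzB_intros = Dz_exFS Dz_allFS Dz_ball Dz_bex Dz_subset DzB_mem Dz_intros Tm_pc
  DzB_Cd DzB_sec DzB_insert DzB_Collect DzB_filter Dz_K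

lemma FS_mono: "B \<preceq> B' \<Longrightarrow> FS B \<subseteq> FS B'"
  unfolding FS_def using od.less_le_trans by blast

lemma FS_comprehension:
  assumes "K u B" "Dz (\<lambda>e. P (e 0))" "\<And>x. P x \<Longrightarrow> x \<prec> u"
  shows "{x. P x} \<in> FS B"
proof -
  obtain c where "c \<prec> B" "\<And>i. mem i c \<longleftrightarrow> i \<prec> u \<and> P i" using code_exists[OF assms(1,2)] by blast
  then have "{x. P x} = Cd c" using assms(3) unfolding Cd_def by blast
  then show ?thesis using \<open>c \<prec> B\<close> unfolding FS_def by blast
qed


subsection \<open>Largeness\<close>

text \<open>A multi-valued injection of \<open>J\<close> into the numbers below \<open>a\<close>.
  Values may be multiple, so that such relations can be defined without selecting one.\<close>

definition injrel where
  "injrel a J s \<longleftrightarrow> (\<forall>j\<in>J. \<exists>i. i \<prec> a \<and> pc j i \<in> s) \<and>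
     (\<forall>j\<in>J. \<forall>j'\<in>J. \<forall>i. i \<prec> a \<longrightarrow> pc j i \<in> s \<longrightarrow> pc j' i \<in> s \<longrightarrow> j = j')"

text \<open>Internally, \<open>J\<close> has more than \<open>a\<close> elements. Defining this by the absence of an injection makes
  the pigeonhole principle immediate.\<close>

definition big where "big B a J \<longleftrightarrow> \<not> (\<exists>s\<in>FS B. injrel a J s)"

lemma Dz_injrel:
  assumes [intro]: "Tm a" and J: "DzB J" and s: "DzB s"
  shows "Dz (\<lambda>e. injrel (a e) (J e) (s e))"
  unfolding injrel_def
  by (intro DzB_intros DzB_env[OF J] DzB_env[OF s] Tm_subst[OF assms(1)] J s)

lemma Dz_big:
  assumes "Tm B" "Tm a" "DzB J"
  shows "Dz (\<lambda>e. big (B e) (a e) (J e))"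
  unfolding big_def
  by (intro DzB_intros Dz_injrel DzB_env[OF assms(3)] Tm_subst[OF assms(2)] Tm_subst[OF assms(1)] assms)

end

text \<open>\<open>A u v w\<close> is the sparseness relation, kept abstract: \<open>v\<close> is
  far beyond \<open>u\<close>, as tested by numbers up to \<open>w\<close>. The single condition
  \<open>A_K\<close> yields all the room used later: \<open>pc u u \<prec> v\<close>,
  \<open>K (u \<oplus> \<one>) v\<close> and
  \<open>K (u \<oplus> u \<oplus> \<one>) v\<close>.\<close>

locale largeness = model zr on ad ml ls S X
  for zr on :: "'m::countable" and ad ml :: "'m \<Rightarrow> 'm \<Rightarrow> 'm" and ls :: "'m \<Rightarrow> 'm \<Rightarrow> bool"
    and S :: "'m set set" and X :: "'m set" +
  fixes A :: "'m \<Rightarrow> 'm \<Rightarrow> 'm \<Rightarrow> bool"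
  assumes Dz_A0: "Dz (\<lambda>e. A (e 0) (e (Suc 0)) (e (Suc (Suc 0))))"
    and A_K: "A u v w \<Longrightarrow> K (pc (u \<oplus> (\<one> \<oplus> \<one>)) (u \<oplus> (\<one> \<oplus> \<one>))) v"
begin

lemma Dz_A: "Tm f \<Longrightarrow> Tm g \<Longrightarrow> Tm h \<Longrightarrow> Dz (\<lambda>e. A (f e) (g e) (h e))"
  by (rule Dz_app3[OF Dz_A0])

lemma A_pc: "A u v w \<Longrightarrow> pc u u \<prec> v"
  by (meson A_K K_less K_mono le_add(1) od.order_refl pc_mono)

lemma A_less: "A u v w \<Longrightarrow> u \<prec> v"
  using A_pc le_pc(1) od.le_less_trans by blast

lemma A_K_Suc: "A u v w \<Longrightarrow> K (u \<oplus> \<one>) v"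
proof (rule K_mono[OF A_K])
  have "u \<oplus> \<one> \<preceq> u \<oplus> (\<one> \<oplus> \<one>)" by (simp add: add_mono_iff)
  then show "u \<oplus> \<one> \<preceq> pc (u \<oplus> (\<one> \<oplus> \<one>)) (u \<oplus> (\<one> \<oplus> \<one>))" using le_pc(1) od.order_trans by blast
qed (assumption, rule od.order_refl)

lemma A_K_double: "A u v w \<Longrightarrow> K (u \<oplus> u \<oplus> \<one>) v"
proof (rule K_mono[OF A_K])
  have "u \<oplus> u \<oplus> \<one> \<preceq> (u \<oplus> u \<oplus> \<one>) \<oplus> (\<one> \<oplus> \<one> \<oplus> \<one>)" by simp
  also have "\<dots> = (u \<oplus> (\<one> \<oplus> \<one>)) \<oplus> (u \<oplus> (\<one> \<oplus> \<one>))" by (simp add: add_ac)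
  also have "\<dots> \<preceq> pc (u \<oplus> (\<one> \<oplus> \<one>)) (u \<oplus> (\<one> \<oplus> \<one>))" by (rule sum_le_pc)
  finally show "u \<oplus> u \<oplus> \<one> \<preceq> pc (u \<oplus> (\<one> \<oplus> \<one>)) (u \<oplus> (\<one> \<oplus> \<one>))" .
qed (assumption, rule od.order_refl)

text \<open>The third argument ranges over \<open>V\<close> as well: the elements of a set are
  themselves the bounds for the innermost quantifier of the counterexample.\<close>

definition apart where "apart U V \<longleftrightarrow> (\<forall>u\<in>U. \<forall>v\<in>V. \<forall>w\<in>V. A u v w)"

lemma apart_mono: "apart U V \<Longrightarrow> U' \<subseteq> U \<Longrightarrow> V' \<subseteq> V \<Longrightarrow> apart U' V'"
  unfolding apart_def by blast

lemma Dz_apart: assumes "DzB U" "DzB V" shows "Dz (\<lambda>e. apart (U e) (V e))"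
  unfolding apart_def
  by (intro DzB_intros Dz_A DzB_env[OF assms(1)] DzB_env[OF assms(2)] assms)

text \<open>The analogue of \<open>\<omega>\<^sup>n\<close>-largeness, for standard \<open>n\<close>. All witnesses have codes below \<open>B\<close>.\<close>

primrec L :: "'m \<Rightarrow> nat \<Rightarrow> 'm set \<Rightarrow> bool" where
  "L B 0 Y = (\<exists>x\<in>Y. True)"
| "L B (Suc n) Y = (\<exists>a\<in>Y. \<exists>J\<in>FS B. \<exists>R\<in>FS B. big B a J \<and>
     (\<forall>j\<in>J. sec R j \<subseteq> Y \<and> L B n (sec R j) \<and> apart (insert a J) (sec R j) \<and>
       (\<forall>i\<in>J. i \<prec> j \<longrightarrow> apart (sec R i) (sec R j))))"

text \<open>The induction is external: each standard \<open>n\<close> has a bounded formula of its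
  own.\<close>

lemma Dz_L: "Tm B \<Longrightarrow> DzB Y \<Longrightarrow> Dz (\<lambda>e. L (B e) n (Y e))"
proof (induction n arbitrary: B Y)
  case 0
  then show ?case unfolding L.simps by (intro DzB_intros)
next
  case (Suc n)
  show ?case unfolding L.simps
    by (intro DzB_intros Suc.IH Dz_big Dz_apart Tm_subst[OF Suc.prems(1)] DzB_env[OF Suc.prems(2)])
qed

lemma L_nonempty: "L B n Y \<Longrightarrow> \<exists>x. x \<in> Y"
  by (cases n) auto

end

text \<open>Elements of the sets lie below \<open>k\<close>, pairs of such elements below
  \<open>pc k k\<close>, and families of sets of pairs, indexed by elements, below
  \<open>pc (pc k k) (pc k k)\<close>. \<open>KB\<close> gives all definable sets of these kinds a
  code below \<open>B\<close>, so one bound serves throughout.\<close>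

locale world = largeness zr on ad ml ls S X A
  for zr on :: "'m::countable" and ad ml :: "'m \<Rightarrow> 'm \<Rightarrow> 'm" and ls :: "'m \<Rightarrow> 'm \<Rightarrow> bool"
    and S :: "'m set set" and X :: "'m set" and A :: "'m \<Rightarrow> 'm \<Rightarrow> 'm \<Rightarrow> bool" +
  fixes k B :: 'm
  assumes KB: "K (pc (pc k k) (pc k k)) B"
begin

definition FK where "FK = {Y \<in> FS B. \<forall>x\<in>Y. x \<prec> k}"

lemma pc_less1: "x \<prec> k \<Longrightarrow> y \<prec> k \<Longrightarrow> pc x y \<prec> pc k k"
  by (rule pc_strict) simp_all

lemma pc_less2: "x \<prec> k \<Longrightarrow> y \<prec> pc k k \<Longrightarrow> pc x y \<prec> pc (pc k k) (pc k k)"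
  using le_pc(1)[of k k] by (intro pc_strict) order+

lemma less1: "x \<prec> k \<Longrightarrow> x \<prec> pc k k" "x \<prec> pc k k \<Longrightarrow> x \<prec> pc (pc k k) (pc k k)"
  using le_pc(1) od.less_le_trans by blast+

lemma FKI:
  assumes "Dz (\<lambda>e. P (e 0))" "\<And>x. P x \<Longrightarrow> x \<prec> k" shows "{x. P x} \<in> FK"
  using FS_comprehension[OF KB assms(1)] less1 assms(2) unfolding FK_def by blast

lemma FSI1:
  assumes "Dz (\<lambda>e. P (e 0))" "\<And>x. P x \<Longrightarrow> x \<prec> pc k k" shows "{x. P x} \<in> FS B"
  using FS_comprehension[OF KB assms(1)] less1 assms(2) by blast

lemma FSI2:
  assumes "Dz (\<lambda>e. P (e 0))" "\<And>x. P x \<Longrightarrow> x \<prec> pc (pc k k) (pc k k)" shows "{x. P x} \<in> FS B"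
  using FS_comprehension[OF KB assms(1)] assms(2) by blast

lemma DzB_FK: "Y \<in> FK \<Longrightarrow> DzB (\<lambda>e. Y)"
  unfolding FK_def using DzB_FS by blast

lemma FK_less: "Y \<in> FK \<Longrightarrow> x \<in> Y \<Longrightarrow> x \<prec> k"
  unfolding FK_def by blast

lemma FK_FS: "Y \<in> FK \<Longrightarrow> Y \<in> FS B"
  unfolding FK_def by blast

lemma FK_subset: assumes "Y \<in> FK" "Dz (\<lambda>e. e 0 \<in> Z)" "Z \<subseteq> Y" shows "Z \<in> FK"
  using FKI[of "\<lambda>x. x \<in> Z"] assms FK_less by auto

lemma DS_sec: "R \<in> FS B \<Longrightarrow> Dz (\<lambda>e. e 0 \<in> sec R j)"
  unfolding sec_def mem_Collect_eq by (intro DzB_intros DzB_FS)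

lemma FK_sec: "Y \<in> FK \<Longrightarrow> R \<in> FS B \<Longrightarrow> sec R j \<subseteq> Y \<Longrightarrow> sec R j \<in> FK"
  using FK_subset DS_sec by blast

lemma FK_singleton: "x \<prec> k \<Longrightarrow> {x} \<in> FK"
  using FKI[of "\<lambda>y. y = x", OF Dz_eq[OF Tm_var Tm_const]] by auto

text \<open>Definable choice: take the least code. The bound \<open>pc k k\<close> on the sections
  ensures that the collected family still has a code below \<open>B\<close>. A choice is made at
  every index that has one, so \<open>D\<close> does not enter the definition of
  \<open>T\<close>.\<close>

lemma choice:
  assumes P: "Dz (\<lambda>e. P (e 0) (Cd (e (Suc 0))))"
    and D: "\<And>i. i \<in> D \<Longrightarrow> i \<prec> k \<and> (\<exists>s\<in>FS B. (\<forall>x\<in>s. x \<prec> pc k k) \<and> P i s)"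
  shows "\<exists>T\<in>FS B. \<forall>i\<in>D. P i (sec T i)"
proof -
  define Q where "Q = (\<lambda>i c. (\<forall>x\<in>Cd c. x \<prec> pc k k) \<and> P i (Cd c))"
  define G where "G = (\<lambda>i c. Q i c \<and> (\<forall>c'. c' \<prec> c \<longrightarrow> \<not> Q i c'))"
  have Q: "Dz (\<lambda>e. Q (f e) (g e))" if "Tm f" "Tm g" for f g
    unfolding Q_def
    by (intro DzB_intros that Tm_subst[OF that(1)] Tm_subst[OF that(2)] Dz_app2[where P = "\<lambda>i c. P i (Cd c)", OF P])
  have G: "Dz (\<lambda>e. G (f e) (g e))" if "Tm f" "Tm g" for f g
    unfolding G_def
    by (intro DzB_intros Q that Tm_subst[OF that(1)] Tm_subst[OF that(2)])
  have ex: "\<exists>c. c \<prec> B \<and> G i c" if i: "i \<in> D" for i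
  proof -
    obtain c where c: "c \<prec> B" "Q i c" using D[OF i] unfolding FS_def Q_def by blast
    have "Dz (\<lambda>e. Q i (e 0))" by (intro Q DzB_intros)
    then obtain m where m: "Q i m" "\<And>y. y \<prec> m \<Longrightarrow> \<not> Q i y" using least_number[of "Q i" c] c(2) by blast
    then have "m \<preceq> c" using c(2) od.not_less by blast
    then have "m \<prec> B" using c(1) by order
    then show ?thesis using m unfolding G_def by blast
  qed
  have uniq: "c = c'" if "G i c" "G i c'" for i c c'
    using that ls_linear[of c c'] unfolding G_def by blast
  define T where "T = {z. \<exists>i. i \<prec> k \<and> (\<exists>x. x \<prec> pc k k \<and> (z = pc i x \<and> (\<exists>c. c \<prec> B \<and> G i c \<and> x \<in> Cd c)))}"
  have "T \<in> FS B"
    unfolding T_def by (rule FSI2) (intro DzB_intros G, use pc_less2 in blast)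
  moreover have "P i (sec T i)" if "i \<in> D" for i
  proof -
    obtain c where c: "c \<prec> B" "G i c" using ex[OF \<open>i \<in> D\<close>] by blast
    have "sec T i = Cd c"
      using c uniq D[OF \<open>i \<in> D\<close>] unfolding T_def sec_def by (auto simp: pc_inj G_def Q_def)
    then show ?thesis using c(2) unfolding G_def Q_def by simp
  qed
  ultimately show ?thesis by blast
qed

text \<open>Pigeonhole principle, with fewer colours than \<open>Min Y\<close>. If there is no monochromatic set,
  then every block of \<open>Y\<close> contains a colour that does not occur in earlier blocks.\<close>

lemma pigeonhole:
  assumes "Y \<in> FK" and G: "G \<in> FS B" and "L B (2 * n) Y"
    and "\<And>y. y \<in> Y \<Longrightarrow> \<exists>i. pc y i \<in> G" and "\<And>y i z. y \<in> Y \<Longrightarrow> pc y i \<in> G \<Longrightarrow> z \<in> Y \<Longrightarrow> i \<prec> z"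
  shows "\<exists>H\<in>FK. H \<subseteq> Y \<and> L B n H \<and> (\<exists>i. \<forall>y\<in>H. pc y i \<in> G)"
  using assms(1,3-)
proof (induction n arbitrary: Y)
  case 0
  then obtain x where x: "x \<in> Y" by auto
  obtain i where "pc x i \<in> G" using 0 x by blast
  then show ?case using x 0 FK_singleton FK_less by (intro bexI[of _ "{x}"]) auto
next
  case (Suc n)
  note Y = \<open>Y \<in> FK\<close> and col = Suc.prems(3) and colb = Suc.prems(4)
  note GB [intro] = DzB_FS[OF G]
  have "L B (Suc (Suc (2 * n))) Y" using Suc.prems(2) by simp
  then obtain a J R where a: "a \<in> Y" and J: "J \<in> FS B" and R: "R \<in> FS B" and bigJ: "big B a J"
    and blk: "\<And>j. j \<in> J \<Longrightarrow> sec R j \<subseteq> Y" "\<And>j. j \<in> J \<Longrightarrow> L B (Suc (2 * n)) (sec R j)"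
      "\<And>j. j \<in> J \<Longrightarrow> apart (insert a J) (sec R j)"
      "\<And>i j. i \<in> J \<Longrightarrow> j \<in> J \<Longrightarrow> i \<prec> j \<Longrightarrow> apart (sec R i) (sec R j)"
    unfolding L.simps(2)[of B "Suc (2 * n)"] by blast
  have Jk: "j \<prec> k" if j: "j \<in> J" for j
  proof -
    obtain x where x: "x \<in> sec R j" using L_nonempty blk(2)[OF j] by blast
    have "A j x x" using blk(3)[OF j] j x unfolding apart_def by blast
    moreover have "x \<prec> k" using blk(1)[OF j] x FK_less[OF Y] by blast
    ultimately show ?thesis using A_less od.less_trans by blast
  qed
  show ?case
  proof (rule ccontr)
    assume no: "\<not> ?case"
    \<comment> \<open>\<open>t\<close> relates a block to the colours below \<open>a\<close> that
      occur in it for the first time. Different blocks have different new colours, so if every block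
      had one, \<open>J\<close> would inject into \<open>a\<close>.\<close>
    define t where "t = {z. \<exists>j\<in>J. \<exists>i. i \<prec> a \<and> (z = pc j i \<and> (\<exists>y\<in>sec R j. pc y i \<in> G) \<and>
      (\<forall>j'\<in>J. j' \<prec> j \<longrightarrow> (\<forall>y\<in>sec R j'. pc y i \<notin> G)))}"
    have "t \<in> FS B"
      unfolding t_def
    proof (rule FSI1)
      show "x \<prec> pc k k" if "\<exists>j\<in>J. \<exists>i. i \<prec> a \<and> (x = pc j i \<and> (\<exists>y\<in>sec R j. pc y i \<in> G) \<and>
        (\<forall>j'\<in>J. j' \<prec> j \<longrightarrow> (\<forall>y\<in>sec R j'. pc y i \<notin> G)))" for x
        using that Jk FK_less[OF Y a] pc_less1 od.less_trans by blast
    qed (intro DzB_intros DzB_FS[OF J] DzB_FS[OF R] GB)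
    moreover have "injrel a J t"
      unfolding injrel_def
    proof (intro conjI ballI allI impI)
      fix j j' i assume "j \<in> J" "j' \<in> J" "pc j i \<in> t" "pc j' i \<in> t"
      then show "j = j'" unfolding t_def using ls_linear[of j j'] by (auto simp: pc_inj)
    next
      fix j assume j: "j \<in> J"
      show "\<exists>i. i \<prec> a \<and> pc j i \<in> t"
      proof (rule ccontr)
        assume nt: "\<not> ?thesis"
        \<comment> \<open>Block \<open>j\<close> has no new colour. So for each of its colours there
          is an earlier element of that colour, far below the block, which can be put in front of
          sub-blocks of that colour.\<close>
        have old: "\<exists>j'\<in>J. j' \<prec> j \<and> (\<exists>y\<in>sec R j'. pc y i \<in> G)" if "y \<in> sec R j" "pc y i \<in> G" for y i
        proof -
          have "i \<prec> a" using colb that blk(1)[OF j] a by blast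
          then show ?thesis using nt j that unfolding t_def by blast
        qed
        obtain b J' R' where b: "b \<in> sec R j" and J': "J' \<in> FS B" and R': "R' \<in> FS B" and bigJ': "big B b J'"
          and blk': "\<And>l. l \<in> J' \<Longrightarrow> sec R' l \<subseteq> sec R j" "\<And>l. l \<in> J' \<Longrightarrow> L B (2 * n) (sec R' l)"
            "\<And>l. l \<in> J' \<Longrightarrow> apart (insert b J') (sec R' l)"
            "\<And>i l. i \<in> J' \<Longrightarrow> l \<in> J' \<Longrightarrow> i \<prec> l \<Longrightarrow> apart (sec R' i) (sec R' l)"
          using blk(2)[OF j] unfolding L.simps by blast
        have bk: "b \<prec> k" using b blk(1)[OF j] FK_less[OF Y] by blast
        have subY: "sec R' l \<subseteq> Y" if "l \<in> J'" for l using blk'(1)[OF that] blk(1)[OF j] by blast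
        have J'k: "l \<prec> k" if l: "l \<in> J'" for l
        proof -
          obtain x where x: "x \<in> sec R' l" using L_nonempty blk'(2)[OF l] by blast
          have "A l x x" using blk'(3)[OF l] l x unfolding apart_def by blast
          moreover have "x \<prec> k" using subY[OF l] x FK_less[OF Y] by blast
          ultimately show ?thesis using A_less od.less_trans by blast
        qed
        \<comment> \<open>The induction hypothesis is going to be applied to each sub-block
          \<open>l\<close> of block \<open>j\<close>; \<open>s\<close> is a monochromatic part of
          order \<open>n\<close>.\<close>
        define P where "P = (\<lambda>l s. s \<subseteq> sec R' l \<and> L B n s \<and> (\<exists>i. i \<prec> a \<and> (\<forall>y\<in>s. pc y i \<in> G)))"
        have "Dz (\<lambda>e. P (e 0) (Cd (e (Suc 0))))"
          unfolding P_def by (intro DzB_intros DzB_FS[OF R'] GB Dz_L)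
        moreover have "l \<prec> k \<and> (\<exists>s\<in>FS B. (\<forall>x\<in>s. x \<prec> pc k k) \<and> P l s)" if l: "l \<in> J'" for l
        proof -
          have "\<exists>H\<in>FK. H \<subseteq> sec R' l \<and> L B n H \<and> (\<exists>i. \<forall>y\<in>H. pc y i \<in> G)"
            by (rule Suc.IH[OF FK_sec[OF Y R' subY[OF l]] blk'(2)[OF l]])
              (use col colb subY[OF l] in blast)+
          then obtain H i where H: "H \<in> FK" "H \<subseteq> sec R' l" "L B n H" "\<forall>y\<in>H. pc y i \<in> G" by blast
          obtain y where y: "y \<in> H" using L_nonempty[OF H(3)] by blast
          then have "y \<in> Y" "pc y i \<in> G" using H(2,4) subY[OF l] by auto
          then have "i \<prec> a" by (rule colb[OF _ _ a])
          then have "P l H" using H unfolding P_def by auto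
          then show ?thesis using J'k[OF l] less1(1)[OF FK_less[OF H(1)]] FK_FS[OF H(1)] by auto
        qed
        ultimately have "\<exists>T\<in>FS B. \<forall>l\<in>J'. P l (sec T l)" by (rule choice)
        then obtain T where T: "T \<in> FS B" and PT: "\<And>l. l \<in> J' \<Longrightarrow> P l (sec T l)"
          by blast
        define C where "C = (\<lambda>i. {l \<in> J'. \<forall>y\<in>sec T l. pc y i \<in> G})"
        have DzC: "DzB (\<lambda>e. C (f e))" if "Tm f" for f
          unfolding C_def by (intro DzB_intros DzB_FS[OF J'] DzB_FS[OF T] GB Tm_subst[OF that])
        have inj: "\<exists>s\<in>FS B. (\<forall>x\<in>s. x \<prec> pc k k) \<and> (\<exists>h. h \<prec> b \<and> (pc h h \<prec> b \<and> i \<prec> h \<and> injrel h (C i) s))"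
          if i: "i \<prec> a" "l \<in> C i" for i l
        proof -
          have l: "l \<in> J'" "\<forall>y\<in>sec T l. pc y i \<in> G" using i unfolding C_def by auto
          obtain y where "y \<in> sec T l" using PT[OF l(1)] L_nonempty unfolding P_def by blast
          then have "y \<in> sec R j" "pc y i \<in> G" using PT[OF l(1)] blk'(1)[OF l(1)] l(2) unfolding P_def by blast+
          then obtain j' h where h: "j' \<in> J" "j' \<prec> j" "h \<in> sec R j'" "pc h i \<in> G" using old by blast
          have hY: "h \<in> Y" using h blk(1) by blast
          have ap: "apart (sec R j') (sec R j)" using blk(4) h j by blast
          \<comment> \<open>The earlier element \<open>h\<close> followed by the monochromatic parts
            of colour \<open>i\<close>. By \<open>no\<close> this set is not of order
            \<open>Suc n\<close>, and the only clause that can fail is that there are more than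
            \<open>h\<close> such parts.\<close>
          define H where "H = {y. y = h \<or> (\<exists>l\<in>C i. y \<in> sec T l)}"
          have TC: "sec T l \<subseteq> sec R' l" "L B n (sec T l)" "l \<in> J'" if "l \<in> C i" for l
            using that PT unfolding C_def P_def by auto
          have HY: "H \<subseteq> Y" using hY TC subY unfolding H_def by blast
          have "H \<in> FK" unfolding H_def
            by (rule FKI) (intro DzB_intros DzC DzB_FS[OF T], use HY FK_less[OF Y] in \<open>auto simp: H_def\<close>)
          have mono: "\<forall>y\<in>H. pc y i \<in> G" using h unfolding H_def C_def by auto
          have "\<not> L B (Suc n) H"
          proof
            assume "L B (Suc n) H"
            then have ?case using \<open>H \<in> FK\<close> HY mono by (intro bexI[of _ H] conjI exI[of _ i])
            then show False using no by contradiction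
          qed
          moreover have "C i \<in> FS B"
            using FKI[of "\<lambda>l. l \<in> C i"] DzB_mem[OF DzC[OF Tm_const] Tm_var] J'k FK_FS TC(3) by auto
          moreover have "sec T l \<subseteq> H \<and> L B n (sec T l) \<and> apart (insert h (C i)) (sec T l) \<and>
            (\<forall>i'\<in>C i. i' \<prec> l \<longrightarrow> apart (sec T i') (sec T l))" if l: "l \<in> C i" for l
          proof (intro conjI ballI impI)
            show "sec T l \<subseteq> H" using l unfolding H_def by blast
            show "L B n (sec T l)" using TC l by blast
            show "apart (insert h (C i)) (sec T l)"
              using ap blk'(1,3)[OF TC(3)[OF l]] TC(1)[OF l] TC(3) h(3) unfolding apart_def by blast
            show "apart (sec T i') (sec T l)" if "i' \<in> C i" "i' \<prec> l" for i'
              using blk'(4)[OF TC(3)[OF that(1)] TC(3)[OF l] that(2)] TC(1)[OF l] TC(1)[OF that(1)] apart_mono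
              by blast
          qed
          moreover have "h \<in> H" unfolding H_def by blast
          ultimately have "\<not> big B h (C i)" using T unfolding L.simps by blast
          then obtain s where s: "s \<in> FS B" "injrel h (C i) s" unfolding big_def by blast
          have Ah: "A h b b" using ap h(3) b unfolding apart_def by blast
          have hk: "h \<prec> k" using hY FK_less[OF Y] by blast
          define s' where "s' = {z. z \<in> s \<and> z \<prec> pc k k}"
          have "s' \<in> FS B" unfolding s'_def by (rule FSI1) (intro DzB_intros DzB_FS[OF s(1)], blast)
          moreover have "injrel h (C i) s'"
            using s(2) pc_less1[OF J'k od.less_trans[OF _ hk]] TC(3) unfolding injrel_def s'_def by blast
          moreover have "A a h h" using blk(3)[OF h(1)] h(3) unfolding apart_def by blast
          then have "i \<prec> h" using A_less od.less_trans[OF i(1)] by blast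
          moreover have "\<forall>x\<in>s'. x \<prec> pc k k" unfolding s'_def by blast
          ultimately show ?thesis using A_less[OF Ah] A_pc[OF Ah]
            by (intro bexI[of _ s'] conjI exI[of _ h])
        qed
        define D where "D = {i. i \<prec> a \<and> (\<exists>l. l \<in> C i)}"
        define P' where "P' = (\<lambda>i s. \<exists>h. h \<prec> b \<and> (pc h h \<prec> b \<and> i \<prec> h \<and> injrel h (C i) s))"
        have "Dz (\<lambda>e. P' (e 0) (Cd (e (Suc 0))))"
          unfolding P'_def by (intro DzB_intros Dz_injrel DzC)
        moreover have "i \<prec> k \<and> (\<exists>s\<in>FS B. (\<forall>x\<in>s. x \<prec> pc k k) \<and> P' i s)" if "i \<in> D" for i
          using that inj FK_less[OF Y a] od.less_trans unfolding D_def P'_def by blast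
        ultimately have "\<exists>E\<in>FS B. \<forall>i\<in>D. P' i (sec E i)" by (rule choice)
        then obtain E where E: "E \<in> FS B" and PE: "\<And>i. i \<in> D \<Longrightarrow> P' i (sec E i)"
          by blast
        \<comment> \<open>For each colour \<open>i\<close>, the sub-blocks of that colour inject
          into some \<open>h\<close>. The pair of \<open>i\<close> and the value is at most
          \<open>pc h h\<close>, hence below \<open>b\<close>. Altogether \<open>J'\<close> would
          inject into \<open>b\<close>.\<close>
        define t' where "t' = {z. \<exists>l\<in>J'. \<exists>i. i \<prec> a \<and> (\<exists>v. v \<prec> b \<and> (\<exists>h. h \<prec> b \<and>
          (z = pc l (pc i v) \<and> pc i v \<prec> b \<and> v \<prec> h \<and> l \<in> C i \<and> injrel h (C i) (sec E i) \<and> pc l v \<in> sec E i)))}"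
        have "t' \<in> FS B"
          unfolding t'_def
        proof (rule FSI1)
          show "x \<prec> pc k k" if "\<exists>l\<in>J'. \<exists>i. i \<prec> a \<and> (\<exists>v. v \<prec> b \<and> (\<exists>h. h \<prec> b \<and>
          (x = pc l (pc i v) \<and> pc i v \<prec> b \<and> v \<prec> h \<and> l \<in> C i \<and> injrel h (C i) (sec E i) \<and> pc l v \<in> sec E i)))" for x
            using that J'k bk pc_less1 od.less_trans by blast
        qed (intro DzB_intros DzC Dz_injrel DzB_FS[OF J'] DzB_FS[OF E])
        moreover have "injrel b J' t'"
          unfolding injrel_def
        proof (intro conjI ballI allI impI)
          fix l assume l: "l \<in> J'"
          obtain i where i: "i \<prec> a" "\<forall>y\<in>sec T l. pc y i \<in> G" using PT[OF l] unfolding P_def by blast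
          then have "l \<in> C i" "i \<in> D" using l unfolding C_def D_def by auto
          then obtain h where h: "h \<prec> b" "pc h h \<prec> b" "i \<prec> h" "injrel h (C i) (sec E i)"
            using PE unfolding P'_def by blast
          then obtain v where v: "v \<prec> h" "pc l v \<in> sec E i" using \<open>l \<in> C i\<close> unfolding injrel_def by blast
          have "pc i v \<preceq> pc h h" using v(1) h(3) by (intro pc_mono) auto
          then have "pc i v \<prec> b" "v \<prec> b" using h(1,2) v(1) by order+
          then show "\<exists>w. w \<prec> b \<and> pc l w \<in> t'"
            unfolding t'_def mem_Collect_eq using l i(1) h v \<open>l \<in> C i\<close> by blast
        next
          fix l l' w assume "l \<in> J'" "l' \<in> J'" "pc l w \<in> t'" "pc l' w \<in> t'"
          then obtain i v h h' where "w = pc i v" "v \<prec> h" "l \<in> C i" "l' \<in> C i" "injrel h (C i) (sec E i)"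
            "pc l v \<in> sec E i" "pc l' v \<in> sec E i"
            unfolding t'_def by (auto simp: pc_inj)
          then show "l = l'" unfolding injrel_def by blast
        qed
        ultimately show False using bigJ' unfolding big_def by blast
      qed
    qed
    ultimately show False using bigJ unfolding big_def by blast
  qed
qed

text \<open>Pigeonhole principle with the code of the set of \<open>x \<prec> u\<close> satisfying
  \<open>P y x\<close> as the colour of \<open>y\<close>. By the hypothesis on \<open>K\<close> such
  codes exist below the least element of \<open>Y\<close>, as is required of colours.\<close>

lemma pattern:
  assumes Y: "Y \<in> FK" and "L B (2 * n) Y" and P: "Dz (\<lambda>e. P (e 0) (e (Suc 0)))"
    and K: "\<And>y. y \<in> Y \<Longrightarrow> K u y"
  shows "\<exists>H\<in>FK. H \<subseteq> Y \<and> L B n H \<and> (\<forall>y\<in>H. \<forall>z\<in>H. \<forall>x. x \<prec> u \<longrightarrow> P y x = P z x)"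
proof -
  have DY: "Dz (\<lambda>e. e 0 \<in> Y)" using DzB_mem[OF DzB_FK[OF Y] Tm_var] .
  obtain y0 where "y0 \<in> Y" using L_nonempty assms(2) by blast
  then obtain z0 where z0: "z0 \<in> Y" "\<And>z. z \<in> Y \<Longrightarrow> z0 \<preceq> z"
    using least_number[of "\<lambda>y. y \<in> Y", OF DY] od.not_less by metis
  have P': "Dz (\<lambda>e. P (f e) (g e))" if "Tm f" "Tm g" for f g using Dz_app2[OF P that] .
  define G where "G = {w. \<exists>y\<in>Y. \<exists>c. c \<prec> z0 \<and> (w = pc y c \<and> (\<forall>x. x \<prec> u \<longrightarrow> mem x c = P y x))}"
  have G: "G \<in> FS B"
    unfolding G_def
    by (rule FSI1) (intro DzB_intros P' Dz_code DzB_FK[OF Y],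
        use pc_less1[OF FK_less[OF Y] od.less_trans[OF _ FK_less[OF Y z0(1)]]] in blast)
  have "\<exists>H\<in>FK. H \<subseteq> Y \<and> L B n H \<and> (\<exists>i. \<forall>y\<in>H. pc y i \<in> G)"
  proof (rule pigeonhole[OF Y G assms(2)])
    fix y assume y: "y \<in> Y"
    have "Dz (\<lambda>e. P y (e 0))" by (intro P' Tm_const Tm_var)
    from code_exists[OF K[OF z0(1)] this]
    obtain c where "c \<prec> z0" "\<And>i. mem i c \<longleftrightarrow> i \<prec> u \<and> P y i" by blast
    then show "\<exists>i. pc y i \<in> G" using y unfolding G_def by blast
  next
    fix y i z assume "pc y i \<in> G" "z \<in> Y"
    then have "i \<prec> z0" unfolding G_def by (auto simp: pc_inj)
    then show "i \<prec> z" using z0(2)[OF \<open>z \<in> Y\<close>] by order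
  qed
  then obtain H i where H: "H \<in> FK" "H \<subseteq> Y" "L B n H" and i: "\<forall>y\<in>H. pc y i \<in> G" by blast
  have eq: "mem x i = P y x" if "y \<in> H" "x \<prec> u" for x y
    using i that unfolding G_def by (auto simp: pc_inj)
  have "\<forall>y\<in>H. \<forall>z\<in>H. \<forall>x. x \<prec> u \<longrightarrow> P y x = P z x"
  proof (intro ballI allI impI)
    fix y z x assume "y \<in> H" "z \<in> H" "x \<prec> u"
    then show "P y x = P z x" by (simp flip: eq)
  qed
  then show ?thesis using H by (intro bexI[of _ H] conjI)
qed

end

section \<open>Halving arguments and transitive subsets\<close>

context world
begin

text \<open>\<open>sepr i J\<close>: internally, \<open>J\<close> injects into the power set of \<open>{x. x \<prec> i}\<close>.\<close>

definition sepr where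
  "sepr i J \<longleftrightarrow> (\<exists>s\<in>FS B. \<forall>j\<in>J. \<forall>j'\<in>J. j \<noteq> j' \<longrightarrow> (\<exists>x. x \<prec> i \<and> (pc j x \<in> s) \<noteq> (pc j' x \<in> s)))"

lemma Dz_sepr: assumes "Tm i" "DzB J" shows "Dz (\<lambda>e. sepr (i e) (J e))"
  unfolding sepr_def
  by (intro DzB_intros DzB_env[OF assms(2)] Tm_subst[OF assms(1)])

text \<open>The internal form of halving a cardinality: position \<open>i\<close> stores the truth
  value of \<open>c\<close>, and the earlier positions separate the elements within each
  half.\<close>

lemma sepr_split:
  assumes J: "J \<in> FK" and c: "Dz (\<lambda>e. c (e 0))" and i: "i \<prec> k"
    and s0: "sepr i {j \<in> J. c j}" and s1: "sepr i {j \<in> J. \<not> c j}"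
  shows "sepr (i \<oplus> \<one>) J"
proof -
  obtain s0 where s0: "s0 \<in> FS B"
    "\<And>j j'. j \<in> J \<Longrightarrow> c j \<Longrightarrow> j' \<in> J \<Longrightarrow> c j' \<Longrightarrow> j \<noteq> j' \<Longrightarrow> \<exists>x. x \<prec> i \<and> (pc j x \<in> s0) \<noteq> (pc j' x \<in> s0)"
    using s0 unfolding sepr_def by blast
  obtain s1 where s1: "s1 \<in> FS B"
    "\<And>j j'. j \<in> J \<Longrightarrow> \<not> c j \<Longrightarrow> j' \<in> J \<Longrightarrow> \<not> c j' \<Longrightarrow> j \<noteq> j' \<Longrightarrow> \<exists>x. x \<prec> i \<and> (pc j x \<in> s1) \<noteq> (pc j' x \<in> s1)"
    using s1 unfolding sepr_def by blast
  define s where "s = {w. \<exists>j\<in>J. \<exists>x. x \<prec> i \<oplus> \<one> \<and> (w = pc j x \<and>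
    (c j \<and> (x = i \<or> w \<in> s0) \<or> \<not> c j \<and> x \<noteq> i \<and> w \<in> s1))}"
  have "s \<in> FS B"
    unfolding s_def
  proof (rule FSI1)
    show "w \<prec> pc k k" if "\<exists>j\<in>J. \<exists>x. x \<prec> i \<oplus> \<one> \<and> (w = pc j x \<and>
      (c j \<and> (x = i \<or> w \<in> s0) \<or> \<not> c j \<and> x \<noteq> i \<and> w \<in> s1))" for w
    proof -
      from that obtain j x where "j \<in> J" "x \<prec> i \<oplus> \<one>" "w = pc j x" by blast
      moreover have "x \<prec> k" using \<open>x \<prec> i \<oplus> \<one>\<close> i unfolding ls_add1 by order
      ultimately show ?thesis using pc_less1[OF FK_less[OF J]] by blast
    qed
  qed (intro DzB_intros DzB_FK[OF J] DzB_FS[OF s0(1)] DzB_FS[OF s1(1)] Dz_app1[OF c])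
  moreover have mem_i: "pc j i \<in> s \<longleftrightarrow> c j" if "j \<in> J" for j
    using that unfolding s_def by (auto simp: pc_inj)
  have mem_x: "pc j x \<in> s \<longleftrightarrow> (if c j then pc j x \<in> s0 else pc j x \<in> s1)" if "j \<in> J" "x \<prec> i" for j x
    using that ls_irrefl[of i] unfolding s_def by (auto simp: pc_inj ax8)
  have "\<exists>x. x \<prec> i \<oplus> \<one> \<and> (pc j x \<in> s) \<noteq> (pc j' x \<in> s)" if j: "j \<in> J" "j' \<in> J" "j \<noteq> j'" for j j'
  proof (cases "c j = c j'")
    case False
    then have "(pc j i \<in> s) \<noteq> (pc j' i \<in> s)" using mem_i j by simp
    then show ?thesis using ls_add_one by blast
  next
    case True
    then have "\<exists>x. x \<prec> i \<and> (pc j x \<in> s) \<noteq> (pc j' x \<in> s)"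
      using s0(2)[OF j(1) _ j(2) _ j(3)] s1(2)[OF j(1) _ j(2) _ j(3)] mem_x[OF j(1)] mem_x[OF j(2)]
      by (cases "c j") auto
    then show ?thesis using ax8 by blast
  qed
  then have "\<forall>j\<in>J. \<forall>j'\<in>J. j \<noteq> j' \<longrightarrow> (\<exists>x. x \<prec> i \<oplus> \<one> \<and> (pc j x \<in> s) \<noteq> (pc j' x \<in> s))"
    by (intro ballI impI)
  ultimately show ?thesis unfolding sepr_def by (intro bexI[of _ s])
qed

lemma empty_FS: "{} \<in> FS B"
  using FSI1[of "\<lambda>_. False", OF Dz_False] by simp

lemma sepr_trivial: "J \<subseteq> {x} \<Longrightarrow> sepr i J"
  unfolding sepr_def by (rule bexI[OF _ empty_FS]) blast

text \<open>An injection into the power set of the numbers below \<open>i\<close> becomes one into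
  \<open>b\<close> by taking codes below \<open>b\<close>. So \<open>J\<close> internally has more
  than 2^i elements.\<close>

lemma big_not_sepr:
  assumes big: "big B b J" and J: "J \<in> FK" and b: "b \<prec> k" and K: "K i b"
  shows "\<not> sepr i J"
proof
  assume "sepr i J"
  then obtain s where s: "s \<in> FS B"
    "\<And>j j'. j \<in> J \<Longrightarrow> j' \<in> J \<Longrightarrow> j \<noteq> j' \<Longrightarrow> \<exists>x. x \<prec> i \<and> (pc j x \<in> s) \<noteq> (pc j' x \<in> s)"
    unfolding sepr_def by blast
  define t where "t = {w. \<exists>j\<in>J. \<exists>c. c \<prec> b \<and> (w = pc j c \<and> (\<forall>x. x \<prec> i \<longrightarrow> mem x c = (pc j x \<in> s)))}"
  have "t \<in> FS B"
    unfolding t_def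
    by (rule FSI1) (intro DzB_intros Dz_code DzB_FK[OF J] DzB_FS[OF s(1)],
        use pc_less1[OF FK_less[OF J] od.less_trans[OF _ b]] in blast)
  moreover have "injrel b J t"
    unfolding injrel_def
  proof (intro conjI ballI allI impI)
    fix j assume j: "j \<in> J"
    have "Dz (\<lambda>e. pc j (e 0) \<in> s)" by (intro DzB_intros DzB_FS[OF s(1)])
    from code_exists[OF K this] obtain c where "c \<prec> b" "\<And>x. mem x c \<longleftrightarrow> x \<prec> i \<and> pc j x \<in> s" by blast
    then show "\<exists>c. c \<prec> b \<and> pc j c \<in> t" using j unfolding t_def by blast
  next
    fix j j' c assume j: "j \<in> J" "j' \<in> J" and "pc j c \<in> t" "pc j' c \<in> t"
    then have "\<forall>x. x \<prec> i \<longrightarrow> mem x c = (pc j x \<in> s)" "\<forall>x. x \<prec> i \<longrightarrow> mem x c = (pc j' x \<in> s)"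
      unfolding t_def by (auto simp: pc_inj)
    then show "j = j'" using s(2)[OF j] by blast
  qed
  ultimately show False using big unfolding big_def by blast
qed

text \<open>The value \<open>i0\<close> of \<open>x\<close> is not taken on \<open>H\<close>.
  Sending the elements of \<open>H\<close> with value \<open>a\<close> to \<open>i0\<close> instead
  gives an injection of \<open>H\<close> into \<open>a\<close>.\<close>

lemma big_insert:
  assumes big: "big B a H" and H: "H \<in> FK" and x: "x \<notin> H" "x \<prec> k" and a: "a \<prec> k"
  shows "big B (a \<oplus> \<one>) (insert x H)"
  unfolding big_def
proof
  assume "\<exists>s\<in>FS B. injrel (a \<oplus> \<one>) (insert x H) s"
  then obtain s where s: "s \<in> FS B" and
    tot: "\<And>j. j = x \<or> j \<in> H \<Longrightarrow> \<exists>i. (i \<prec> a \<or> i = a) \<and> pc j i \<in> s" and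
    inj: "\<And>j j' i. j = x \<or> j \<in> H \<Longrightarrow> j' = x \<or> j' \<in> H \<Longrightarrow> i \<prec> a \<or> i = a \<Longrightarrow> pc j i \<in> s \<Longrightarrow> pc j' i \<in> s \<Longrightarrow> j = j'"
    unfolding injrel_def ax8 insert_iff by blast
  obtain i0 where i0: "i0 \<prec> a \<or> i0 = a" "pc x i0 \<in> s" using tot[of x] by blast
  define t where "t = {w. \<exists>j\<in>H. \<exists>i. i \<prec> a \<and> (w = pc j i \<and> (w \<in> s \<or> i = i0 \<and> pc j a \<in> s))}"
  have "t \<in> FS B"
    unfolding t_def
    by (rule FSI1) (intro DzB_intros DzB_FK[OF H] DzB_FS[OF s],
        use pc_less1[OF FK_less[OF H] od.less_trans[OF _ a]] in blast)
  moreover have t: "pc j i \<in> t \<longleftrightarrow> pc j i \<in> s \<or> i = i0 \<and> pc j a \<in> s" if "j \<in> H" "i \<prec> a" for j i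
    using that unfolding t_def by (auto simp: pc_inj)
  have no: "pc j i0 \<notin> s" if "j \<in> H" for j
    using inj[of x j i0] that x(1) i0 by blast
  have "injrel a H t"
    unfolding injrel_def
  proof (intro conjI ballI allI impI)
    fix j assume j: "j \<in> H"
    obtain i where i: "i \<prec> a \<or> i = a" "pc j i \<in> s" using tot j by blast
    show "\<exists>i. i \<prec> a \<and> pc j i \<in> t"
    proof (cases "i \<prec> a")
      case True
      then show ?thesis using t[OF j] i(2) by blast
    next
      case False
      then have "pc j a \<in> s" using i by simp
      moreover from this have "i0 \<prec> a" using i0(1) no[OF j] by blast
      ultimately show ?thesis using t[OF j] by blast
    qed
  next
    fix j j' i assume j: "j \<in> H" "j' \<in> H" and i: "i \<prec> a" and "pc j i \<in> t" "pc j' i \<in> t"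
    then have *: "pc j i \<in> s \<or> i = i0 \<and> pc j a \<in> s" "pc j' i \<in> s \<or> i = i0 \<and> pc j' a \<in> s"
      using t by simp_all
    show "j = j'"
    proof (cases "i = i0")
      case True
      then show ?thesis using * no[OF j(1)] no[OF j(2)] inj[of j j' a] j by blast
    next
      case False
      then show ?thesis using * inj[of j j' i] j i by blast
    qed
  qed
  ultimately show False using big unfolding big_def by blast
qed

lemma big_singleton: "big B \<zero> {x}"
  unfolding big_def injrel_def by simp

text \<open>End-homogeneity. For transitivity this is enough, since only the colours of two pairs
  with the same smaller element have to be compared.\<close>

definition prehom where
  "prehom d J \<longleftrightarrow> (\<forall>i\<in>J. \<forall>j\<in>J. \<forall>l\<in>J. i \<prec> j \<longrightarrow> i \<prec> l \<longrightarrow> d i j = d i l)"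

lemma Dz_prehom:
  assumes d: "Dz (\<lambda>e. d (e 0) (e (Suc 0)))" and J: "DzB J" shows "Dz (\<lambda>e. prehom d (J e))"
  unfolding prehom_def
  by (intro DzB_intros DzB_env[OF J] J Dz_app2[where P = d, OF d])

text \<open>Each element of the result costs two bits: one for splitting off the least element
  \<open>x0\<close>, one for keeping a sufficiently large colour class over \<open>x0\<close>. The
  statement is a bounded property of \<open>i\<close>, so the induction is internal and reaches
  nonstandard \<open>i\<close>.\<close>

lemma tournament:
  assumes d: "Dz (\<lambda>e. d (e 0) (e (Suc 0)))"
  shows "i \<oplus> i \<prec> k \<longrightarrow> (\<forall>J\<in>FS B. (\<forall>x\<in>J. x \<prec> k) \<longrightarrow> \<not> sepr (i \<oplus> i) J \<longrightarrow>
     (\<exists>J'\<in>FS B. J' \<subseteq> J \<and> big B i J' \<and> prehom d J'))"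
proof (rule Dz_induct[where P = "\<lambda>i. i \<oplus> i \<prec> k \<longrightarrow> (\<forall>J\<in>FS B. (\<forall>x\<in>J. x \<prec> k) \<longrightarrow> \<not> sepr (i \<oplus> i) J \<longrightarrow>
     (\<exists>J'\<in>FS B. J' \<subseteq> J \<and> big B i J' \<and> prehom d J'))"])
  show "Dz (\<lambda>e. e 0 \<oplus> e 0 \<prec> k \<longrightarrow> (\<forall>J\<in>FS B. (\<forall>x\<in>J. x \<prec> k) \<longrightarrow> \<not> sepr (e 0 \<oplus> e 0) J \<longrightarrow>
     (\<exists>J'\<in>FS B. J' \<subseteq> J \<and> big B (e 0) J' \<and> prehom d J')))"
    by (intro DzB_intros Dz_sepr Dz_big Dz_prehom d)
next
  show "\<zero> \<oplus> \<zero> \<prec> k \<longrightarrow> (\<forall>J\<in>FS B. (\<forall>x\<in>J. x \<prec> k) \<longrightarrow> \<not> sepr (\<zero> \<oplus> \<zero>) J \<longrightarrow>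
     (\<exists>J'\<in>FS B. J' \<subseteq> J \<and> big B \<zero> J' \<and> prehom d J'))"
  proof (intro impI ballI)
    fix J assume J: "J \<in> FS B" "\<forall>x\<in>J. x \<prec> k" "\<not> sepr (\<zero> \<oplus> \<zero>) J"
    then obtain x where x: "x \<in> J" using sepr_trivial by blast
    have "{x} \<in> FS B" using FK_FS FK_singleton J(2) x by blast
    moreover have "prehom d {x}" unfolding prehom_def by simp
    ultimately show "\<exists>J'\<in>FS B. J' \<subseteq> J \<and> big B \<zero> J' \<and> prehom d J'"
      using x big_singleton by (intro bexI[of _ "{x}"]) auto
  qed
next
  fix i
  assume IH: "i \<oplus> i \<prec> k \<longrightarrow> (\<forall>J\<in>FS B. (\<forall>x\<in>J. x \<prec> k) \<longrightarrow> \<not> sepr (i \<oplus> i) J \<longrightarrow>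
     (\<exists>J'\<in>FS B. J' \<subseteq> J \<and> big B i J' \<and> prehom d J'))"
  show "i \<oplus> \<one> \<oplus> (i \<oplus> \<one>) \<prec> k \<longrightarrow> (\<forall>J\<in>FS B. (\<forall>x\<in>J. x \<prec> k) \<longrightarrow> \<not> sepr (i \<oplus> \<one> \<oplus> (i \<oplus> \<one>)) J \<longrightarrow>
     (\<exists>J'\<in>FS B. J' \<subseteq> J \<and> big B (i \<oplus> \<one>) J' \<and> prehom d J'))"
  proof (intro impI ballI)
    fix J assume ik: "i \<oplus> \<one> \<oplus> (i \<oplus> \<one>) \<prec> k" and J: "J \<in> FS B" "\<forall>x\<in>J. x \<prec> k" "\<not> sepr (i \<oplus> \<one> \<oplus> (i \<oplus> \<one>)) J"
    have i2: "i \<oplus> \<one> \<oplus> (i \<oplus> \<one>) = i \<oplus> i \<oplus> \<one> \<oplus> \<one>" by (simp add: add_ac)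
    have lt1: "i \<oplus> i \<oplus> \<one> \<prec> k" using ik ls_add_one[of "i \<oplus> i \<oplus> \<one>"] unfolding i2 by order
    then have lt0: "i \<oplus> i \<prec> k" using ls_add_one[of "i \<oplus> i"] by order
    then have lti: "i \<prec> k" using le_add(1)[of i i] by order
    have JFK: "J \<in> FK" using J unfolding FK_def by blast
    have DJ: "Dz (\<lambda>e. e 0 \<in> J)" by (intro DzB_intros DzB_FS[OF J(1)])
    obtain x where "x \<in> J" using J(3) sepr_trivial by blast
    then obtain x0 where x0: "x0 \<in> J" "\<And>y. y \<in> J \<Longrightarrow> x0 \<preceq> y"
      using least_number[of "\<lambda>y. y \<in> J", OF DJ] od.not_less by metis
    define J1 where "J1 = {j \<in> J. j \<noteq> x0}"
    have J1: "J1 \<in> FK" unfolding J1_def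
      by (rule FK_subset[OF JFK]) (unfold mem_Collect_eq, intro DzB_intros DzB_FK[OF JFK], blast)
    have ns1: "\<not> sepr (i \<oplus> i \<oplus> \<one>) J1"
    proof
      assume "sepr (i \<oplus> i \<oplus> \<one>) J1"
      moreover have "sepr (i \<oplus> i \<oplus> \<one>) {j \<in> J. \<not> j \<noteq> x0}" by (rule sepr_trivial[of _ x0]) blast
      moreover have "Dz (\<lambda>e. e 0 \<noteq> x0)" by (intro DzB_intros)
      ultimately show False using sepr_split[of J "\<lambda>j. j \<noteq> x0", OF JFK _ lt1] J(3) unfolding J1_def i2 by blast
    qed
    have Dd: "Dz (\<lambda>e. d x0 (e 0))" by (rule Dz_app2[OF d]) (intro DzB_intros)+
    have "\<exists>b. \<not> sepr (i \<oplus> i) {j \<in> J1. d x0 j = b}"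
    proof (rule ccontr)
      assume "\<not> ?thesis"
      then have "sepr (i \<oplus> i) {j \<in> J1. d x0 j = True}" "sepr (i \<oplus> i) {j \<in> J1. d x0 j = False}" by blast+
      then show False using sepr_split[of J1 "d x0", OF J1 Dd lt0] ns1 by simp
    qed
    then obtain b where b: "\<not> sepr (i \<oplus> i) {j \<in> J1. d x0 j = b}" by blast
    let ?Jb = "{j \<in> J1. d x0 j = b}"
    have Jb: "?Jb \<in> FK"
      by (rule FK_subset[OF J1]) (unfold mem_Collect_eq, intro DzB_intros DzB_FK[OF J1] Dd, blast)
    have "\<exists>J'\<in>FS B. J' \<subseteq> ?Jb \<and> big B i J' \<and> prehom d J'"
      using IH lt0 FK_FS[OF Jb] FK_less[OF Jb] b by blast
    then obtain J' where J': "J' \<in> FS B" "J' \<subseteq> ?Jb" "big B i J'" "prehom d J'" by blast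
    have J'FK: "J' \<in> FK" using J'(1,2) FK_less[OF Jb] unfolding FK_def by blast
    have "x0 \<notin> J'" using J'(2) unfolding J1_def by blast
    then have 1: "big B (i \<oplus> \<one>) (insert x0 J')"
      using big_insert[OF J'(3) J'FK _ _ lti] J(2) x0(1) by blast
    have 2: "insert x0 J' \<subseteq> J" using J'(2) x0(1) unfolding J1_def by blast
    have 3: "insert x0 J' \<in> FS B"
      by (rule FK_FS, rule FK_subset[OF JFK]) (intro DzB_intros DzB_FS[OF J'(1)], rule 2)
    have least: "\<not> y \<prec> x0" if "y \<in> insert x0 J'" for y using x0(2) 2 that od.not_less by blast
    have dx0: "d x0 y = b" if "y \<in> J'" for y using J'(2) that by blast
    have "prehom d (insert x0 J')"
      unfolding prehom_def
    proof (intro ballI impI)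
      fix u v w assume uvw: "u \<in> insert x0 J'" "v \<in> insert x0 J'" "w \<in> insert x0 J'" "u \<prec> v" "u \<prec> w"
      then have vw: "v \<in> J'" "w \<in> J'" using least[of u] by auto
      show "d u v = d u w"
      proof (cases "u = x0")
        case True
        then show ?thesis using dx0 vw by simp
      next
        case False
        then show ?thesis using J'(4) uvw vw unfolding prehom_def by blast
      qed
    qed
    then show "\<exists>J'\<in>FS B. J' \<subseteq> J \<and> big B (i \<oplus> \<one>) J' \<and> prehom d J'" using 1 2 3 by blast
  qed
qed

definition tr where
  "tr f H \<longleftrightarrow> (\<forall>x\<in>H. \<forall>y\<in>H. \<forall>z\<in>H. x \<prec> y \<longrightarrow> y \<prec> z \<longrightarrow> f x y = f y z \<longrightarrow> f x z = f x y)"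

lemma Dz_tr:
  assumes f: "Dz (\<lambda>e. f (e 0) (e (Suc 0)))" and H: "DzB H" shows "Dz (\<lambda>e. tr f (H e))"
  unfolding tr_def
  by (intro DzB_intros DzB_env[OF H] H Dz_app2[where P = f, OF f])

text \<open>Two levels are spent on choosing \<open>a\<close> and then \<open>b\<close> inside a
  block, the two doublings on two thinnings of the blocks by \<open>pattern\<close>, and the rest on
  the induction hypothesis inside each block.\<close>

primrec em_index :: "nat \<Rightarrow> nat" where
  "em_index 0 = 0"
| "em_index (Suc n) = Suc (Suc (2 * (2 * em_index n)))"

lemma big_nonempty: "big B a J \<Longrightarrow> \<exists>j. j \<in> J"
  unfolding big_def injrel_def using empty_FS by blast

text \<open>The blocks \<open>sec R j\<close> of \<open>Y\<close> are thinned out so that \<open>f x y\<close> depends only on \<open>x\<close> and the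
  block of \<open>y\<close>, and then so that it depends only on the blocks of \<open>x\<close> and \<open>y\<close>. A union of
  transitive blocks is then transitive if the induced colouring of the blocks is, and
  \<open>tournament\<close> provides sufficiently many such blocks.\<close>

lemma transitive_subset:
  assumes f: "Dz (\<lambda>e. f (e 0) (e (Suc 0)))"
  shows "Y \<in> FK \<Longrightarrow> L B (em_index n) Y \<Longrightarrow> \<exists>H\<in>FK. H \<subseteq> Y \<and> L B n H \<and> tr f H"
proof (induction n arbitrary: Y)
  case 0
  then obtain x where x: "x \<in> Y" by auto
  have "{x} \<in> FK" using x 0 FK_singleton FK_less by blast
  moreover have "tr f {x}" unfolding tr_def by (simp add: ls_irrefl)
  ultimately show ?case using x by (intro bexI[of _ "{x}"]) auto
next
  case (Suc n)
  note Y = \<open>Y \<in> FK\<close>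
  define m where "m = em_index n"
  have f': "Dz (\<lambda>e. f (g e) (h e))" if "Tm g" "Tm h" for g h using Dz_app2[OF f that] .
  have "L B (Suc (Suc (2 * (2 * m)))) Y" using Suc.prems(2) unfolding m_def by simp
  then obtain a J0 R0 where a: "a \<in> Y" and J0: "J0 \<in> FS B" and R0: "R0 \<in> FS B" and bigJ0: "big B a J0"
    and blk0: "\<And>j. j \<in> J0 \<Longrightarrow> sec R0 j \<subseteq> Y" "\<And>j. j \<in> J0 \<Longrightarrow> L B (Suc (2 * (2 * m))) (sec R0 j)"
      "\<And>j. j \<in> J0 \<Longrightarrow> apart (insert a J0) (sec R0 j)"
    unfolding L.simps(2)[of B "Suc (2 * (2 * m))"] by blast
  obtain j0 where j0: "j0 \<in> J0" using big_nonempty[OF bigJ0] by blast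
  define Y1 where "Y1 = sec R0 j0"
  have Y1Y: "Y1 \<subseteq> Y" and LY1: "L B (Suc (2 * (2 * m))) Y1" and aY1: "\<And>v w. v \<in> Y1 \<Longrightarrow> w \<in> Y1 \<Longrightarrow> A a v w"
    unfolding Y1_def using blk0[OF j0] by (auto simp: apart_def)
  have Y1: "Y1 \<in> FK" unfolding Y1_def by (rule FK_sec[OF Y R0 blk0(1)[OF j0]])
  obtain b J R where b: "b \<in> Y1" and J: "J \<in> FS B" and R: "R \<in> FS B" and bigJ: "big B b J"
    and RY: "\<And>j. j \<in> J \<Longrightarrow> sec R j \<subseteq> Y1" and RL: "\<And>j. j \<in> J \<Longrightarrow> L B (2 * (2 * m)) (sec R j)"
    and bR: "\<And>j. j \<in> J \<Longrightarrow> apart (insert b J) (sec R j)"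
    and RR: "\<And>i j. i \<in> J \<Longrightarrow> j \<in> J \<Longrightarrow> i \<prec> j \<Longrightarrow> apart (sec R i) (sec R j)"
    using LY1 unfolding L.simps by blast
  have RFK: "sec R j \<in> FK" if "j \<in> J" for j by (rule FK_sec[OF Y1 R RY[OF that]])
  have Jk: "j \<prec> k" if j: "j \<in> J" for j
  proof -
    obtain x where x: "x \<in> sec R j" using L_nonempty RL[OF j] by blast
    have "A j x x" using bR[OF j] j x unfolding apart_def by blast
    moreover have "x \<prec> k" using RFK[OF j] x FK_less by blast
    ultimately show ?thesis using A_less od.less_trans by blast
  qed
  have JFK: "J \<in> FK" using J Jk unfolding FK_def by blast
  have step: "\<exists>T\<in>FS B. \<forall>j\<in>J. sec T j \<subseteq> sec U j \<and> P j (sec T j)"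
    if U: "U \<in> FS B" "\<And>j. j \<in> J \<Longrightarrow> sec U j \<in> FK"
      and P: "Dz (\<lambda>e. P (e 0) (Cd (e (Suc 0))))"
      and ex: "\<And>j. j \<in> J \<Longrightarrow> \<exists>H\<in>FK. H \<subseteq> sec U j \<and> P j H" for U P
  proof (rule choice)
    show "Dz (\<lambda>e. Cd (e (Suc 0)) \<subseteq> sec U (e 0) \<and> P (e 0) (Cd (e (Suc 0))))"
      by (intro DzB_intros DzB_FS[OF U(1)] P)
    show "j \<prec> k \<and> (\<exists>s\<in>FS B. (\<forall>x\<in>s. x \<prec> pc k k) \<and> s \<subseteq> sec U j \<and> P j s)" if j: "j \<in> J" for j
    proof -
      obtain H where H: "H \<in> FK" "H \<subseteq> sec U j" "P j H" using ex[OF j] by blast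
      then show ?thesis using Jk[OF j] FK_FS[OF H(1)] less1(1)[OF FK_less[OF H(1)]] by blast
    qed
  qed
  \<comment> \<open>What lies to the left of block \<open>j\<close>. The predicate \<open>P1\<close>
    below makes the colour of each such \<open>x\<close> with the elements of the thinned block
    constant.\<close>
  define V where "V = (\<lambda>j. {x. x = a \<or> (\<exists>i\<in>J. i \<prec> j \<and> x \<in> sec R i)})"
  have VA: "A x y y" if j: "j \<in> J" and x: "x \<in> V j" and y: "y \<in> sec R j" for x y j
  proof (cases "x = a")
    case True
    then show ?thesis using aY1 RY[OF j] y by blast
  next
    case False
    then obtain i where i: "i \<in> J" "i \<prec> j" "x \<in> sec R i" using x unfolding V_def by blast
    then show ?thesis using RR[OF i(1) j i(2)] y unfolding apart_def by blast
  qed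
  define P1 where "P1 = (\<lambda>j s. L B (2 * m) s \<and> (\<forall>x. x \<prec> k \<longrightarrow> x \<in> V j \<longrightarrow> (\<forall>y\<in>s. \<forall>z\<in>s. f x y = f x z)))"
  have "\<exists>T\<in>FS B. \<forall>j\<in>J. sec T j \<subseteq> sec R j \<and> P1 j (sec T j)"
  proof (rule step[OF R RFK])
    show "Dz (\<lambda>e. P1 (e 0) (Cd (e (Suc 0))))"
      unfolding P1_def V_def mem_Collect_eq by (intro DzB_intros Dz_L DzB_FS[OF J] DzB_FS[OF R] f')
    show "\<exists>H\<in>FK. H \<subseteq> sec R j \<and> P1 j H" if j: "j \<in> J" for j
    proof -
      obtain x0 where x0: "x0 \<in> sec R j" using L_nonempty[OF RL[OF j]] by blast
      have "Dz (\<lambda>e. e 0 \<in> V j)" unfolding V_def mem_Collect_eq by (intro DzB_intros DzB_FS[OF J] DzB_FS[OF R])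
      moreover have "a \<in> V j" unfolding V_def by blast
      moreover have "x \<preceq> x0" if "x \<in> V j" for x using A_less[OF VA[OF j that x0]] by simp
      \<comment> \<open>Block \<open>j\<close> is far beyond the greatest element \<open>u\<close>
        of \<open>V j\<close>, which leaves room for patterns on all numbers up to
        \<open>u\<close>.\<close>
      ultimately obtain u where u: "u \<in> V j" "\<And>x. x \<in> V j \<Longrightarrow> x \<preceq> u"
        using greatest_number[of "\<lambda>x. x \<in> V j"] by metis
      have "\<exists>H\<in>FK. H \<subseteq> sec R j \<and> L B (2 * m) H \<and> (\<forall>y\<in>H. \<forall>z\<in>H. \<forall>x. x \<prec> u \<oplus> \<one> \<longrightarrow> f x y = f x z)"
        by (rule pattern[OF RFK[OF j] RL[OF j], where P = "\<lambda>y x. f x y"])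
          (intro f' Tm_var, rule A_K_Suc[OF VA[OF j u(1)]])
      then show ?thesis unfolding P1_def using u(2) ls_add1 by meson
    qed
  qed
  then obtain S1 where S1: "S1 \<in> FS B" "\<And>j. j \<in> J \<Longrightarrow> sec S1 j \<subseteq> sec R j" "\<And>j. j \<in> J \<Longrightarrow> P1 j (sec S1 j)" by blast
  have S1FK: "sec S1 j \<in> FK" if "j \<in> J" for j by (rule FK_sec[OF RFK[OF that] S1(1) S1(2)[OF that]])
  have c1: "f x y = f x z" if "j \<in> J" "x \<in> V j" "y \<in> sec S1 j" "z \<in> sec S1 j" for j x y z
  proof -
    have "x \<prec> y" using A_less[OF VA[OF that(1,2)]] S1(2)[OF that(1)] that(3) by blast
    then have "x \<prec> k" using FK_less[OF S1FK[OF that(1)] that(3)] by order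
    then show ?thesis using S1(3)[OF that(1)] that unfolding P1_def by blast
  qed
  have Vsec: "x \<in> V j" if "i \<in> J" "i \<prec> j" "x \<in> sec R i" for i j x using that unfolding V_def by blast
  have aV: "a \<in> V j" for j unfolding V_def by blast
  \<comment> \<open>\<open>P2\<close> makes the colours towards later blocks independent of the
    element of block \<open>i\<close>. One bit per later block is enough for \<open>pattern\<close>,
    because by \<open>c1\<close> the colour is already constant on the later block.\<close>
  define P2 where "P2 = (\<lambda>i s. L B m s \<and> (\<forall>j\<in>J. i \<prec> j \<longrightarrow> (\<forall>w\<in>sec S1 j. \<forall>y\<in>s. \<forall>z\<in>s. f y w = f z w)))"
  have "\<exists>T\<in>FS B. \<forall>j\<in>J. sec T j \<subseteq> sec S1 j \<and> P2 j (sec T j)"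
  proof (rule step[OF S1(1) S1FK])
    show "Dz (\<lambda>e. P2 (e 0) (Cd (e (Suc 0))))"
      unfolding P2_def by (intro DzB_intros Dz_L DzB_FS[OF J] DzB_FS[OF S1(1)] f')
    show "\<exists>H\<in>FK. H \<subseteq> sec S1 i \<and> P2 i H" if i: "i \<in> J" for i
    proof -
      have DJ: "Dz (\<lambda>e. e 0 \<in> J)" by (intro DzB_intros DzB_FS[OF J])
      obtain u where u: "u \<in> J" "\<And>x. x \<in> J \<Longrightarrow> x \<preceq> u"
        using greatest_number[of "\<lambda>x. x \<in> J" i k, OF DJ i] Jk by (metis od.less_imp_le)
      have "\<exists>H\<in>FK. H \<subseteq> sec S1 i \<and> L B m H \<and> (\<forall>y\<in>H. \<forall>z\<in>H. \<forall>x. x \<prec> u \<oplus> \<one> \<longrightarrow>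
         (\<exists>w\<in>sec S1 x. f y w) = (\<exists>w\<in>sec S1 x. f z w))"
      proof (rule pattern[OF S1FK[OF i], where P = "\<lambda>y x. \<exists>w\<in>sec S1 x. f y w"])
        show "L B (2 * m) (sec S1 i)" using S1(3)[OF i] unfolding P1_def by blast
        show "Dz (\<lambda>e. \<exists>w\<in>sec S1 (e (Suc 0)). f (e 0) w)" by (intro DzB_intros DzB_FS[OF S1(1)] f')
        fix y assume "y \<in> sec S1 i"
        then have "A u y y" using S1(2)[OF i] bR[OF i] u(1) unfolding apart_def by blast
        then show "K (u \<oplus> \<one>) y" by (rule A_K_Suc)
      qed
      then obtain H where H: "H \<in> FK" "H \<subseteq> sec S1 i" "L B m H"
        "\<And>y z x. y \<in> H \<Longrightarrow> z \<in> H \<Longrightarrow> x \<prec> u \<oplus> \<one> \<Longrightarrow> (\<exists>w\<in>sec S1 x. f y w) = (\<exists>w\<in>sec S1 x. f z w)" by blast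
      have "f y w = f z w" if jw: "j \<in> J" "i \<prec> j" "w \<in> sec S1 j" and yz: "y \<in> H" "z \<in> H" for j w y z
      proof -
        have V: "x \<in> V j" if "x \<in> H" for x using Vsec[OF i jw(2)] S1(2)[OF i] H(2) that by blast
        have "(\<exists>w\<in>sec S1 j. f x w) \<longleftrightarrow> f x w" if "x \<in> H" for x
          using c1[OF jw(1) V[OF that] _ jw(3)] jw(3) by blast
        then show ?thesis using H(4)[OF yz] u(2)[OF jw(1)] yz unfolding ls_add1 by blast
      qed
      then have "P2 i H" unfolding P2_def using H(3) by blast
      then show ?thesis using H(1,2) by blast
    qed
  qed
  then obtain S2 where S2: "S2 \<in> FS B" "\<And>j. j \<in> J \<Longrightarrow> sec S2 j \<subseteq> sec S1 j" "\<And>j. j \<in> J \<Longrightarrow> P2 j (sec S2 j)" by blast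
  have S2FK: "sec S2 j \<in> FK" if "j \<in> J" for j by (rule FK_sec[OF S1FK[OF that] S2(1) S2(2)[OF that]])
  have "\<exists>T\<in>FS B. \<forall>j\<in>J. sec T j \<subseteq> sec S2 j \<and> (L B n (sec T j) \<and> tr f (sec T j))"
  proof (rule step[OF S2(1) S2FK])
    show "Dz (\<lambda>e. L B n (Cd (e (Suc 0))) \<and> tr f (Cd (e (Suc 0))))"
      by (intro DzB_intros Dz_L Dz_tr f)
    show "\<exists>H\<in>FK. H \<subseteq> sec S2 i \<and> L B n H \<and> tr f H" if i: "i \<in> J" for i
      by (rule Suc.IH[OF S2FK[OF i]]) (use S2(3)[OF i] in \<open>simp add: P2_def m_def\<close>)
  qed
  then obtain Z where Z: "Z \<in> FS B" "\<And>j. j \<in> J \<Longrightarrow> sec Z j \<subseteq> sec S2 j" "\<And>j. j \<in> J \<Longrightarrow> L B n (sec Z j)"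
    "\<And>j. j \<in> J \<Longrightarrow> tr f (sec Z j)" by blast
  have ZS1: "sec Z j \<subseteq> sec S1 j" if "j \<in> J" for j using Z(2) S2(2) that by blast
  have ZR: "sec Z j \<subseteq> sec R j" if "j \<in> J" for j using ZS1 S1(2) that by blast
  have ZY1: "sec Z j \<subseteq> Y1" if "j \<in> J" for j using ZR RY that by blast
  \<comment> \<open>The colouring of indices induced by \<open>f\<close>; for
    \<open>i \<prec> j\<close> any elements of the two blocks give the same value.\<close>
  define d where "d = (\<lambda>i j. \<exists>y\<in>sec Z i. \<exists>w\<in>sec Z j. f y w)"
  have const: "f y w = f y' w'" if ij: "i \<in> J" "j \<in> J" "i \<prec> j" and "y \<in> sec Z i" "w \<in> sec Z j" "y' \<in> sec Z i" "w' \<in> sec Z j"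
    for i j y w y' w'
  proof -
    have "f y w = f y' w" using S2(3)[OF ij(1)] ij(2,3) that Z(2) ZS1 unfolding P2_def by blast
    moreover have "y' \<in> V j" using Vsec[OF ij(1,3)] ZR[OF ij(1)] that by blast
    then have "f y' w = f y' w'" using c1[OF ij(2)] ZS1[OF ij(2)] that by blast
    ultimately show ?thesis by simp
  qed
  have fd: "f y w = d i j" if ij: "i \<in> J" "j \<in> J" "i \<prec> j" and yw: "y \<in> sec Z i" "w \<in> sec Z j" for i j y w
    using const[OF ij yw] yw unfolding d_def by blast
  have Dd: "Dz (\<lambda>e. d (e 0) (e (Suc 0)))" unfolding d_def by (intro DzB_intros DzB_FS[OF Z(1)] f')
  define c where "c = (\<lambda>j. \<exists>w\<in>sec Z j. f a w)"
  have fc: "f a w = c j" if "j \<in> J" "w \<in> sec Z j" for j w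
    using c1[OF that(1) aV] ZS1[OF that(1)] that(2) unfolding c_def by blast
  have Dc: "Dz (\<lambda>e. c (e 0))" unfolding c_def by (intro DzB_intros DzB_FS[OF Z(1)] f')
  have Aab: "A a b b" using aY1 b by blast
  have bk: "b \<prec> k" using FK_less[OF Y1 b] .
  \<comment> \<open>\<open>J\<close> internally has more than 2^(2a+1) elements. One bit pays for
    making the colour of \<open>a\<close> with the blocks constant, the other 2a bits for
    \<open>tournament\<close>, which returns more than \<open>a\<close> blocks.\<close>
  have nsJ: "\<not> sepr (a \<oplus> a \<oplus> \<one>) J" by (rule big_not_sepr[OF bigJ JFK bk A_K_double[OF Aab]])
  have "a \<oplus> a \<oplus> \<one> \<prec> k" using K_less[OF A_K_double[OF Aab]] bk by order
  then have aak: "a \<oplus> a \<prec> k" using ls_add_one[of "a \<oplus> a"] by order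
  have "\<exists>v. \<not> sepr (a \<oplus> a) {j \<in> J. c j = v}"
  proof (rule ccontr)
    assume "\<not> ?thesis"
    then have "sepr (a \<oplus> a) {j \<in> J. c j = True}" "sepr (a \<oplus> a) {j \<in> J. c j = False}" by blast+
    then show False using sepr_split[OF JFK Dc aak] nsJ by simp
  qed
  then obtain v where v: "\<not> sepr (a \<oplus> a) {j \<in> J. c j = v}" by blast
  have Jv: "{j \<in> J. c j = v} \<in> FK"
    by (rule FK_subset[OF JFK]) (unfold mem_Collect_eq, intro DzB_intros DzB_FS[OF J] Dc, blast)
  then have "\<exists>J'\<in>FS B. J' \<subseteq> {j \<in> J. c j = v} \<and> big B a J' \<and> prehom d J'"
    using tournament[OF Dd, of a] aak v FK_FS[OF Jv] FK_less[OF Jv] by blast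
  then obtain J' where J': "J' \<in> FS B" "J' \<subseteq> {j \<in> J. c j = v}" "big B a J'" "prehom d J'" by blast
  have J'J: "j \<in> J" "c j = v" if "j \<in> J'" for j using J'(2) that by auto
  define H where "H = {x. x = a \<or> (\<exists>j\<in>J'. x \<in> sec Z j)}"
  have HY: "H \<subseteq> Y" unfolding H_def using a ZY1 J'J(1) Y1Y by blast
  have HFK: "H \<in> FK"
    by (rule FK_subset[OF Y _ HY]) (unfold H_def mem_Collect_eq, intro DzB_intros DzB_FS[OF J'(1)] DzB_FS[OF Z(1)])
  have "sec Z j \<subseteq> H \<and> L B n (sec Z j) \<and> apart (insert a J') (sec Z j) \<and>
      (\<forall>i\<in>J'. i \<prec> j \<longrightarrow> apart (sec Z i) (sec Z j))" if j: "j \<in> J'" for j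
  proof (intro conjI ballI impI)
    show "sec Z j \<subseteq> H" unfolding H_def using j by blast
    show "L B n (sec Z j)" using Z(3) J'J(1) j by blast
    show "apart (insert a J') (sec Z j)"
      unfolding apart_def
    proof (intro ballI)
      fix u v w assume u: "u \<in> insert a J'" and vw: "v \<in> sec Z j" "w \<in> sec Z j"
      show "A u v w"
      proof (cases "u = a")
        case True
        then show ?thesis using aY1 ZY1[OF J'J(1)[OF j]] vw by blast
      next
        case False
        then show ?thesis using u bR[OF J'J(1)[OF j]] J'J(1) ZR[OF J'J(1)[OF j]] vw unfolding apart_def by blast
      qed
    qed
    fix i assume i: "i \<in> J'" "i \<prec> j"
    show "apart (sec Z i) (sec Z j)"
      by (rule apart_mono[OF RR[OF J'J(1)[OF i(1)] J'J(1)[OF j] i(2)]]) (rule ZR[OF J'J(1)], fact)+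
  qed
  moreover have "a \<in> H" unfolding H_def by blast
  ultimately have "L B (Suc n) H" using J'(1,3) Z(1) unfolding L.simps by blast
  moreover have "tr f H"
    unfolding tr_def
  proof (intro ballI impI)
    fix x y z assume xyz: "x \<in> H" "y \<in> H" "z \<in> H" "x \<prec> y" "y \<prec> z" and eq: "f x y = f y z"
    have a_least: "\<not> w \<prec> a" if w: "w \<in> H" for w
    proof (cases "w = a")
      case False
      then obtain j where "j \<in> J'" "w \<in> sec Z j" using w unfolding H_def by blast
      then have "A a w w" using aY1 ZY1[OF J'J(1)] by blast
      then show ?thesis using A_less by (meson od.not_less_iff_gr_or_eq)
    qed (simp add: ls_irrefl)
    have blkH: "\<exists>j\<in>J'. w \<in> sec Z j" if "w \<in> H" "w \<noteq> a" for w using that unfolding H_def by blast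
    have "y \<noteq> a" "z \<noteq> a" using a_least[OF xyz(1)] a_least[OF xyz(2)] xyz(4,5) by auto
    then obtain j l where j: "j \<in> J'" "y \<in> sec Z j" and l: "l \<in> J'" "z \<in> sec Z l" using blkH xyz by meson
    note jJ = J'J(1)[OF j(1)] and lJ = J'J(1)[OF l(1)]
    have ord: "i \<preceq> j" if ij: "i \<in> J" "j \<in> J" "u \<in> sec Z i" "w \<in> sec Z j" "u \<prec> w" for i j u w
    proof (rule ccontr)
      assume "\<not> i \<preceq> j"
      then have "j \<prec> i" by (meson od.not_le)
      then have "A w u u" using RR[OF ij(2,1)] ZR ij unfolding apart_def by blast
      then show False using A_less ij(5) od.less_asym by blast
    qed
    \<comment> \<open>For \<open>x = a\<close> the colour is always \<open>v\<close>. If all three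
      elements share a block, that block is transitive. If only \<open>x\<close> and
      \<open>y\<close> do, then \<open>f x z = f y z\<close> and \<open>eq\<close> applies. If
      \<open>x\<close> is in an earlier block than \<open>y\<close>, end-homogeneity
      applies.\<close>
    show "f x z = f x y"
    proof (cases "x = a")
      case True
      then show ?thesis using fc[OF jJ j(2)] fc[OF lJ l(2)] J'J(2)[OF j(1)] J'J(2)[OF l(1)] by simp
    next
      case False
      then obtain i where i: "i \<in> J'" "x \<in> sec Z i" using blkH[OF xyz(1)] by blast
      note iJ = J'J(1)[OF i(1)]
      have ij: "i \<preceq> j" by (rule ord[OF iJ jJ i(2) j(2) xyz(4)])
      have jl: "j \<preceq> l" by (rule ord[OF jJ lJ j(2) l(2) xyz(5)])
      show ?thesis
      proof (cases "i = j")
        case ijeq: True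
        show ?thesis
        proof (cases "j = l")
          case True
          then show ?thesis using Z(4)[OF iJ] ijeq i j l xyz(4,5) eq unfolding tr_def by blast
        next
          case False
          then have "i \<prec> l" using ij jl ijeq unfolding le_def by blast
          then have "f x z = f y z" using fd[OF iJ lJ] i(2) l(2) j(2) ijeq by simp
          then show ?thesis using eq by simp
        qed
      next
        case False
        then have "i \<prec> j" using ij unfolding le_def by blast
        moreover from this have "i \<prec> l" using jl by order
        ultimately have "d i j = d i l" using J'(4) i(1) j(1) l(1) unfolding prehom_def by blast
        then show ?thesis
          using fd[OF iJ jJ \<open>i \<prec> j\<close> i(2) j(2)] fd[OF iJ lJ \<open>i \<prec> l\<close> i(2) l(2)] by simp
      qed
    qed
  qed
  ultimately show ?case using HFK HY by blast
qed

end

section \<open>Standard numbers and overspill\<close>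

context model
begin

text \<open>The four witnesses are put below one common number \<open>y\<close>, which leaves a
  single unbounded existential quantifier.\<close>

lemma Sigma_induct4:
  assumes Q: "Dz (\<lambda>e. Q (e (Suc (Suc (Suc (Suc 0))))) (e (Suc (Suc (Suc 0)))) (e (Suc (Suc 0))) (e (Suc 0)) (e 0))"
    and base: "\<exists>a b c d. Q \<zero> a b c d"
    and step: "\<And>x a b c d. Q x a b c d \<Longrightarrow> \<exists>a b c d. Q (x \<oplus> \<one>) a b c d"
  shows "\<exists>a b c d. Q x a b c d"
proof -
  define P where "P = (\<lambda>x y. \<exists>a. a \<prec> y \<and> (\<exists>b. b \<prec> y \<and> (\<exists>c. c \<prec> y \<and> (\<exists>d. d \<prec> y \<and> Q x a b c d))))"
  have P: "(\<exists>y. P x y) \<longleftrightarrow> (\<exists>a b c d. Q x a b c d)" for x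
  proof
    assume "\<exists>a b c d. Q x a b c d"
    then obtain a b c d where q: "Q x a b c d" by blast
    have "a \<preceq> a \<oplus> b \<oplus> (c \<oplus> d)" "b \<preceq> a \<oplus> b \<oplus> (c \<oplus> d)" "c \<preceq> a \<oplus> b \<oplus> (c \<oplus> d)" "d \<preceq> a \<oplus> b \<oplus> (c \<oplus> d)"
      using le_add od.order_trans by blast+
    then have "P x (a \<oplus> b \<oplus> (c \<oplus> d) \<oplus> \<one>)" unfolding P_def ls_add1 using q by blast
    then show "\<exists>y. P x y" by blast
  qed (auto simp: P_def)
  have "Tm (if i = 0 then (\<lambda>e. e 0) else if i = Suc 0 then (\<lambda>e. e (Suc 0)) else if i = Suc (Suc 0) then (\<lambda>e. e (Suc (Suc 0)))
     else if i = Suc (Suc (Suc 0)) then (\<lambda>e. e (Suc (Suc (Suc 0)))) else (\<lambda>e. e (Suc (Suc (Suc (Suc (Suc 0)))))))" for i :: nat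
    by (simp add: Tm_var)
  from Dz_subst[OF Q, of "\<lambda>i. if i = 0 then (\<lambda>e. e 0) else if i = Suc 0 then (\<lambda>e. e (Suc 0)) else if i = Suc (Suc 0) then (\<lambda>e. e (Suc (Suc 0)))
     else if i = Suc (Suc (Suc 0)) then (\<lambda>e. e (Suc (Suc (Suc 0)))) else (\<lambda>e. e (Suc (Suc (Suc (Suc (Suc 0))))))", OF this]
  have "Dz (\<lambda>e. Q (e (Suc (Suc (Suc (Suc (Suc 0)))))) (e (Suc (Suc (Suc 0)))) (e (Suc (Suc 0))) (e (Suc 0)) (e 0))" by simp
  then have "Dz (\<lambda>e. P (e (Suc 0)) (e 0))" unfolding P_def by (intro Dz_intros)
  moreover have "\<exists>y. P \<zero> y" using base P by blast
  moreover have "\<exists>y. P (x \<oplus> \<one>) y" if "\<exists>y. P x y" for x using that step unfolding P by blast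
  ultimately show ?thesis using Sigma_induct[of P x] P by blast
qed

primrec nm :: "nat \<Rightarrow> 'm" where
  "nm 0 = \<zero>"
| "nm (Suc n) = nm n \<oplus> \<one>"

lemma standard_downward: "i \<preceq> nm n \<Longrightarrow> \<exists>m\<le>n. i = nm m"
proof (induction n)
  case 0
  then have "i = \<zero>" using zero_le[of i] od.order.antisym by simp
  then show ?case by (metis nm.simps(1) order_refl)
next
  case (Suc n)
  then consider "i \<preceq> nm n" | "i = nm (Suc n)" by (auto simp: le_def ax8)
  then show ?case using Suc.IH by cases (auto intro: le_SucI)
qed

text \<open>If no nonstandard number had witnesses, the numbers with witnesses would be exactly the
  standard ones, and Sigma_1 induction would make \<open>N\<close> one of them.\<close>

lemma overspill4:
  assumes Q: "Dz (\<lambda>e. Q (e (Suc (Suc (Suc (Suc 0))))) (e (Suc (Suc (Suc 0)))) (e (Suc (Suc 0))) (e (Suc 0)) (e 0))"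
    and N: "\<And>n. nm n \<prec> N" and std: "\<And>n. \<exists>a b c d. Q (nm n) a b c d"
  shows "\<exists>i a b c d. (\<forall>n. nm n \<prec> i) \<and> Q i a b c d"
proof (rule ccontr)
  assume no: "\<not> ?thesis"
  have *: "\<exists>m. x = nm m" if "Q x a b c d" for x a b c d
  proof -
    obtain n where "\<not> nm n \<prec> x" using no \<open>Q x a b c d\<close> by blast
    then have "x \<preceq> nm n" by (meson od.not_less)
    then show ?thesis using standard_downward by blast
  qed
  have "\<exists>a b c d. Q N a b c d"
  proof (rule Sigma_induct4[OF Q])
    show "\<exists>a b c d. Q \<zero> a b c d" using std[of 0] by simp
    fix x a b c d assume "Q x a b c d"
    then obtain m where "x = nm m" using * by blast
    then show "\<exists>a b c d. Q (x \<oplus> \<one>) a b c d" using std[of "Suc m"] by simp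
  qed
  then obtain m where "N = nm m" using * by blast
  then show False using N[of m] ls_irrefl by simp
qed

end

section \<open>Dependence of largeness on the bounds and on the order\<close>

context world
begin

text \<open>Changing the code bound admits no new injections: only pairs below \<open>pc k k\<close>
  matter, and every coded set of these has a code below \<open>B\<close> already.\<close>

lemma big_upward:
  assumes "big B a J" "\<And>j. j \<in> J \<Longrightarrow> j \<prec> k" "a \<preceq> k"
  shows "big B' a J"
  unfolding big_def
proof
  assume "\<exists>s\<in>FS B'. injrel a J s"
  then obtain s where s: "s \<in> FS B'" "injrel a J s" by blast
  define t where "t = {w. w \<in> s \<and> w \<prec> pc k k}"
  have "t \<in> FS B" unfolding t_def by (rule FSI1) (intro DzB_intros DzB_FS[OF s(1)], blast)
  moreover have "injrel a J t"
    unfolding injrel_def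
  proof (intro conjI ballI allI impI)
    fix j assume j: "j \<in> J"
    obtain i where i: "i \<prec> a" "pc j i \<in> s" using s(2) j unfolding injrel_def by blast
    have "i \<prec> k" using i(1) assms(3) by order
    then show "\<exists>i. i \<prec> a \<and> pc j i \<in> t" using i pc_less1 assms(2)[OF j] unfolding t_def by blast
  next
    fix j j' i assume "j \<in> J" "j' \<in> J" "i \<prec> a" "pc j i \<in> t" "pc j' i \<in> t"
    then show "j = j'" using s(2) unfolding t_def injrel_def by blast
  qed
  ultimately show False using assms(1) unfolding big_def by blast
qed

lemma L_upward:
  assumes B': "B \<preceq> B'"
  shows "L B n Y \<Longrightarrow> (\<And>y. y \<in> Y \<Longrightarrow> y \<prec> k) \<Longrightarrow> L B' n Y"
proof (induction n arbitrary: Y)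
  case (Suc n)
  then obtain a J R where a: "a \<in> Y" and J: "J \<in> FS B" "R \<in> FS B" "big B a J"
    and blk: "\<And>j. j \<in> J \<Longrightarrow> sec R j \<subseteq> Y" "\<And>j. j \<in> J \<Longrightarrow> L B n (sec R j)"
      "\<And>j. j \<in> J \<Longrightarrow> apart (insert a J) (sec R j)"
      "\<And>i j. i \<in> J \<Longrightarrow> j \<in> J \<Longrightarrow> i \<prec> j \<Longrightarrow> apart (sec R i) (sec R j)"
    unfolding L.simps by blast
  have Jk: "j \<prec> k" if j: "j \<in> J" for j
  proof -
    obtain x where x: "x \<in> sec R j" using L_nonempty blk(2)[OF j] by blast
    have "A j x x" using blk(3)[OF j] j x unfolding apart_def by blast
    moreover have "x \<prec> k" using blk(1)[OF j] x Suc.prems(2) by blast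
    ultimately show ?thesis using A_less od.less_trans by blast
  qed
  have ak: "a \<preceq> k" using Suc.prems(2)[OF a] by simp
  have "big B' a J" by (rule big_upward[OF J(3) Jk ak])
  moreover have "J \<in> FS B'" "R \<in> FS B'" using FS_mono[OF B'] J by blast+
  moreover have "L B' n (sec R j)" if j: "j \<in> J" for j
    by (rule Suc.IH[OF blk(2)[OF j]]) (use blk(1)[OF j] Suc.prems(2) in blast)
  ultimately show ?case unfolding L.simps using a blk by blast
qed simp

lemma L_Suc_imp: "L B (Suc n) Y \<Longrightarrow> L B n Y"
proof (induction n arbitrary: Y)
  case 0
  then show ?case by auto
next
  case (Suc n)
  then show ?case unfolding L.simps(2)[of B "Suc n"] L.simps(2)[of B n Y] by blast
qed

lemma L_le: "L B n Y \<Longrightarrow> m \<le> n \<Longrightarrow> L B m Y"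
  by (induction n) (auto dest: L_Suc_imp simp: le_Suc_eq simp del: L.simps)

lemma big_initial_segment:
  assumes "a \<prec> k"
  shows "i \<preceq> a \<longrightarrow> big B i {j. j \<prec> i \<oplus> \<one>}"
proof (rule Dz_induct[where P = "\<lambda>i. i \<preceq> a \<longrightarrow> big B i {j. j \<prec> i \<oplus> \<one>}"])
  have "DzB (\<lambda>e. {j. j \<prec> e 0 \<oplus> \<one>})"
    using DzB_Collect[of "\<lambda>e. e 0 \<oplus> \<one>" "\<lambda>_ _. True"] by (simp add: Dz_const Tm_ad Tm_var Tm_const)
  then show "Dz (\<lambda>e. e 0 \<preceq> a \<longrightarrow> big B (e 0) {j. j \<prec> e 0 \<oplus> \<one>})"
    by (intro Dz_intros Dz_big)
  have "{j. j \<prec> \<zero> \<oplus> \<one>} = {\<zero>}" by (auto simp only: ax8 ax7)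
  then show "\<zero> \<preceq> a \<longrightarrow> big B \<zero> {j. j \<prec> \<zero> \<oplus> \<one>}" using big_singleton by simp
  fix i assume IH: "i \<preceq> a \<longrightarrow> big B i {j. j \<prec> i \<oplus> \<one>}"
  show "i \<oplus> \<one> \<preceq> a \<longrightarrow> big B (i \<oplus> \<one>) {j. j \<prec> i \<oplus> \<one> \<oplus> \<one>}"
  proof
    assume i: "i \<oplus> \<one> \<preceq> a"
    then have ik: "i \<oplus> \<one> \<prec> k" "i \<prec> k" "i \<preceq> a" using assms ls_add_one[of i] by order+
    have "{j. j \<prec> i \<oplus> \<one>} \<in> FK"
      by (rule FKI) (intro DzB_intros, use ik in order)
    moreover have "i \<oplus> \<one> \<notin> {j. j \<prec> i \<oplus> \<one>}" using ls_irrefl by simp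
    ultimately have "big B (i \<oplus> \<one>) (insert (i \<oplus> \<one>) {j. j \<prec> i \<oplus> \<one>})"
      using big_insert IH ik by blast
    moreover have "insert (i \<oplus> \<one>) {j. j \<prec> i \<oplus> \<one>} = {j. j \<prec> i \<oplus> \<one> \<oplus> \<one>}"
      using ax8[of _ "i \<oplus> \<one>"] by blast
    ultimately show "big B (i \<oplus> \<one>) {j. j \<prec> i \<oplus> \<one> \<oplus> \<one>}" by simp
  qed
qed

end


subsection \<open>Existence of large sets\<close>

context largeness
begin

abbreviation KK where "KK k B \<equiv> K (pc (pc k k) (pc k k)) B"

lemma worldI: "KK k B \<Longrightarrow> world zr on ad ml ls S X A k B"
  by unfold_locales

lemma ex_world: "\<exists>B'. KK k B' \<and> b \<preceq> B' \<and> c \<preceq> B'"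
proof -
  obtain B0 where "KK k B0" using ex_K by blast
  moreover have "B0 \<preceq> B0 \<oplus> (b \<oplus> c)" "b \<preceq> B0 \<oplus> (b \<oplus> c)" "c \<preceq> B0 \<oplus> (b \<oplus> c)"
    using le_add od.order_trans by blast+
  ultimately show ?thesis using K_mono od.order_refl by blast
qed

text \<open>The induction on \<open>n\<close> is external. Within it,
  \<open>b \<oplus> \<one>\<close> blocks are strung together by internal Sigma_1 induction on their
  number, which may be nonstandard. \<open>A_ex\<close> gives one \<open>v\<close> for all
  \<open>w\<close>, so the next block can be placed beyond \<open>v\<close> before its size is
  known.\<close>

lemma existence:
  assumes A_ex: "\<And>u. \<exists>v. \<forall>u' v' w. u' \<preceq> u \<longrightarrow> v \<preceq> v' \<longrightarrow> A u' v' w"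
  shows "\<exists>k B Y. KK k B \<and> Y \<in> FS B \<and> (\<forall>y\<in>Y. b \<preceq> y \<and> y \<prec> k) \<and> L B n Y"
proof (induction n arbitrary: b)
  case 0
  obtain B where B: "KK (b \<oplus> \<one>) B" using ex_K by blast
  interpret w: world zr on ad ml ls S X A "b \<oplus> \<one>" B by (rule worldI[OF B])
  have "{b} \<in> FS B" using w.FK_singleton[OF ls_add_one] w.FK_FS by blast
  then show ?case using B by (intro exI[of _ "b \<oplus> \<one>"] exI[of _ B] exI[of _ "{b}"]) simp
next
  case (Suc n)
  let ?a = b
  \<comment> \<open>\<open>r\<close> codes the first \<open>i\<close> blocks. The clause on
    \<open>u \<prec> ?a \<oplus> \<one>\<close> prepares apartness from both \<open>?a\<close> and
    the index set, which will consist of the numbers up to \<open>?a\<close>.\<close>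
  define \<Psi> where "\<Psi> = (\<lambda>i k B r. KK k B \<and> r \<prec> B \<and> (\<forall>j. j \<prec> i \<longrightarrow>
    (\<forall>x\<in>sec (Cd r) j. x \<prec> k) \<and> L B n (sec (Cd r) j) \<and>
    (\<forall>u. u \<prec> ?a \<oplus> \<one> \<longrightarrow> (\<forall>v\<in>sec (Cd r) j. \<forall>w\<in>sec (Cd r) j. A u v w)) \<and>
    (\<forall>i'. i' \<prec> j \<longrightarrow> apart (sec (Cd r) i') (sec (Cd r) j))))"
  \<comment> \<open>\<open>d\<close> fills the fourth slot of \<open>Sigma_induct4\<close>.\<close>
  have "\<exists>k B r (d::'m). \<Psi> i k B r" for i
  proof (rule Sigma_induct4[where Q = "\<lambda>i k B r d. \<Psi> i k B r"])
    show "Dz (\<lambda>e. \<Psi> (e (Suc (Suc (Suc (Suc 0))))) (e (Suc (Suc (Suc 0)))) (e (Suc (Suc 0))) (e (Suc 0)))"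
      unfolding \<Psi>_def by (intro DzB_intros Dz_L Dz_A Dz_apart)
  next
    obtain B where B: "KK \<zero> B" using ex_K by blast
    then have "\<zero> \<prec> B" using K_less zero_le od.le_less_trans by blast
    then have "\<Psi> \<zero> \<zero> B \<zero>" unfolding \<Psi>_def using B by simp
    then show "\<exists>k B r (d::'m). \<Psi> \<zero> k B r" by blast
  next
    fix i k B r d assume \<Psi>: "\<Psi> i k B r"
    obtain v where v: "\<And>u' v' w. u' \<preceq> k \<oplus> ?a \<Longrightarrow> v \<preceq> v' \<Longrightarrow> A u' v' w" using A_ex[of "k \<oplus> ?a"] by blast
    obtain k1 B1 Y where Y: "KK k1 B1" "Y \<in> FS B1" "\<And>y. y \<in> Y \<Longrightarrow> v \<preceq> y \<and> y \<prec> k1" "L B1 n Y"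
      using Suc.IH[of v] by blast
    have Yk1: "y \<prec> k1" if "y \<in> Y" for y using Y(3)[OF that] by blast
    \<comment> \<open>Above the elements of the old blocks and of the new one, and above the new
      index \<open>i\<close>, so that the extended family has a code.\<close>
    define k' where "k' = k \<oplus> (k1 \<oplus> (i \<oplus> \<one>))"
    have k': "k \<preceq> k'" "k1 \<preceq> k'" "i \<prec> k'"
      unfolding k'_def ls_iff[of i] using le_add od.order_trans by (blast, blast, metis add_ac)
    obtain B' where B': "KK k' B'" "B \<preceq> B'" "B1 \<preceq> B'" using ex_world by blast
    interpret w': world zr on ad ml ls S X A k' B' by (rule worldI[OF B'(1)])
    have KB: "KK k B" and rB: "r \<prec> B" using \<Psi> unfolding \<Psi>_def by blast+
    interpret w: world zr on ad ml ls S X A k B by (rule worldI[OF KB])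
    interpret w1: world zr on ad ml ls S X A k1 B1 by (rule worldI[OF Y(1)])
    have blk: "\<And>x. x \<in> sec (Cd r) j \<Longrightarrow> x \<prec> k" "L B n (sec (Cd r) j)"
      "\<And>u v w. u \<prec> ?a \<oplus> \<one> \<Longrightarrow> v \<in> sec (Cd r) j \<Longrightarrow> w \<in> sec (Cd r) j \<Longrightarrow> A u v w"
      "\<And>i'. i' \<prec> j \<Longrightarrow> apart (sec (Cd r) i') (sec (Cd r) j)" if j: "j \<prec> i" for j
      using \<Psi> j unfolding \<Psi>_def by blast+
    define R' where "R' = {w. \<exists>j. j \<prec> i \<oplus> \<one> \<and> (\<exists>x. x \<prec> k' \<and> (w = pc j x \<and> (j \<prec> i \<and> w \<in> Cd r \<or> j = i \<and> x \<in> Y)))}"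
    have "R' \<in> FS B'"
      unfolding R'_def
    proof (rule w'.FSI1)
      show "w \<prec> pc k' k'" if "\<exists>j. j \<prec> i \<oplus> \<one> \<and> (\<exists>x. x \<prec> k' \<and> (w = pc j x \<and> (j \<prec> i \<and> w \<in> Cd r \<or> j = i \<and> x \<in> Y)))" for w
        using that w'.pc_less1 k'(3) unfolding ls_add1 by (meson od.le_less_trans)
    qed (intro DzB_intros DzB_FS[OF Y(2)])
    then obtain r' where r': "r' \<prec> B'" "R' = Cd r'" unfolding FS_def by blast
    have old: "sec R' j = sec (Cd r) j" if "j \<prec> i" for j
    proof -
      have "x \<prec> k'" if "pc j x \<in> Cd r" for x
      proof -
        have "x \<prec> k" using blk(1)[OF \<open>j \<prec> i\<close>, of x] that unfolding sec_def by blast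
        then show ?thesis using k'(1) by order
      qed
      then show ?thesis using that ls_irrefl ax8 unfolding R'_def sec_def by (auto simp: pc_inj)
    qed
    have new: "sec R' i = Y"
    proof -
      have "x \<prec> k'" if "x \<in> Y" for x using Yk1[OF that] k'(2) by order
      then show ?thesis using ls_irrefl unfolding R'_def sec_def by (auto simp: pc_inj)
    qed
    have "\<Psi> (i \<oplus> \<one>) k' B' r'"
      unfolding \<Psi>_def r'(2)[symmetric]
    proof (intro conjI allI impI)
      show "KK k' B'" by (rule B'(1))
      show "r' \<prec> B'" by (rule r'(1))
      fix j assume "j \<prec> i \<oplus> \<one>"
      then consider "j \<prec> i" | "j = i" unfolding ax8 by blast
      then have "(\<forall>x\<in>sec R' j. x \<prec> k') \<and> L B' n (sec R' j) \<and>
        (\<forall>u. u \<prec> ?a \<oplus> \<one> \<longrightarrow> (\<forall>v\<in>sec R' j. \<forall>w\<in>sec R' j. A u v w)) \<and> (\<forall>i'. i' \<prec> j \<longrightarrow> apart (sec R' i') (sec R' j))"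
      proof cases
        case 1
        have "L B' n (sec (Cd r) j)" by (rule w.L_upward[OF B'(2) blk(2)[OF 1] blk(1)[OF 1]])
        moreover have "x \<prec> k'" if "x \<in> sec (Cd r) j" for x using blk(1)[OF 1 that] k'(1) by order
        moreover have "sec R' i' = sec (Cd r) i'" if "i' \<prec> j" for i' using old od.less_trans[OF that 1] by blast
        ultimately show ?thesis unfolding old[OF 1] using blk(3,4)[OF 1] by simp
      next
        case 2
        have "L B' n Y" by (rule w1.L_upward[OF B'(3) Y(4)]) (use Y(3) in blast)
        moreover have "x \<prec> k'" if "x \<in> Y" for x using Yk1[OF that] k'(2) by order
        moreover have "A u v' w" if u: "u \<prec> ?a \<oplus> \<one>" and v': "v' \<in> Y" for u v' w
        proof (rule v)
          show "u \<preceq> k \<oplus> ?a" using u le_add(2)[of ?a k] unfolding ls_add1 by order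
          show "v \<preceq> v'" using Y(3)[OF v'] by blast
        qed
        moreover have "apart (sec R' i') Y" if i': "i' \<prec> i" for i'
          unfolding apart_def old[OF i']
        proof (intro ballI v)
          fix u v' assume u: "u \<in> sec (Cd r) i'" and v': "v' \<in> Y"
          show "u \<preceq> k \<oplus> ?a" using blk(1)[OF i' u] le_add(1)[of k ?a] by order
          show "v \<preceq> v'" using Y(3)[OF v'] by blast
        qed
        ultimately show ?thesis unfolding 2 new by blast
      qed
      then show "\<forall>x\<in>sec R' j. x \<prec> k'" "L B' n (sec R' j)"
        "\<And>u. u \<prec> ?a \<oplus> \<one> \<Longrightarrow> (\<forall>v\<in>sec R' j. \<forall>w\<in>sec R' j. A u v w)"
        "\<And>i'. i' \<prec> j \<Longrightarrow> apart (sec R' i') (sec R' j)" by blast+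
    qed
    then show "\<exists>k B r (d::'m). \<Psi> (i \<oplus> \<one>) k B r" by blast
  qed
  then obtain k B r where \<Psi>: "\<Psi> (?a \<oplus> \<one>) k B r" by blast
  have KB: "KK k B" and rB: "r \<prec> B" using \<Psi> unfolding \<Psi>_def by blast+
  define R where "R = Cd r"
  have blk: "\<And>x. x \<in> sec R j \<Longrightarrow> x \<prec> k" "L B n (sec R j)"
      "\<And>u v w. u \<prec> ?a \<oplus> \<one> \<Longrightarrow> v \<in> sec R j \<Longrightarrow> w \<in> sec R j \<Longrightarrow> A u v w"
      "\<And>i'. i' \<prec> j \<Longrightarrow> apart (sec R i') (sec R j)" if j: "j \<prec> ?a \<oplus> \<one>" for j
    using \<Psi> j unfolding \<Psi>_def R_def by blast+
  interpret w: world zr on ad ml ls S X A k B by (rule worldI[OF KB])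
  define k' where "k' = k \<oplus> (?a \<oplus> \<one>)"
  have k': "k \<preceq> k'" "?a \<prec> k'"
    unfolding k'_def ls_iff[of ?a] using le_add by (blast, metis add_ac)
  obtain B' where B': "KK k' B'" "B \<preceq> B'" using ex_world by blast
  interpret w': world zr on ad ml ls S X A k' B' by (rule worldI[OF B'(1)])
  have R: "R \<in> FS B'" using rB FS_mono[OF B'(2)] unfolding FS_def R_def by blast
  define J where "J = {j. j \<prec> ?a \<oplus> \<one>}"
  have bigJ: "big B' ?a J" unfolding J_def using w'.big_initial_segment[OF k'(2)] od.order_refl by blast
  have J: "J \<in> FS B'" unfolding J_def
    by (rule w'.FK_FS[OF w'.FKI]) (intro DzB_intros, use k'(2) ls_add1 od.le_less_trans in blast)
  define Y where "Y = {x. x = ?a \<or> (\<exists>j\<in>J. x \<in> sec R j)}"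
  have Yk: "b \<preceq> y \<and> y \<prec> k'" if y: "y \<in> Y" for y
  proof (cases "y = ?a")
    case True
    then show ?thesis using k'(2) by simp
  next
    case False
    then obtain j where j: "j \<prec> ?a \<oplus> \<one>" "y \<in> sec R j" using y unfolding Y_def J_def by blast
    have "y \<prec> k'" using blk(1)[OF j] k'(1) by order
    moreover have "A ?a y y" using blk(3)[OF j(1) ls_add_one] j(2) by blast
    ultimately show ?thesis using A_less od.less_imp_le by blast
  qed
  have "Y \<in> FS B'"
  proof -
    have "Dz (\<lambda>e. e 0 = ?a \<or> (\<exists>j\<in>J. e 0 \<in> sec R j))" by (intro DzB_intros DzB_FS[OF J] DzB_FS[OF R])
    then have "Y \<in> w'.FK" unfolding Y_def
      by (rule w'.FKI) (use Yk in \<open>simp add: Y_def\<close>)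
    then show ?thesis by (rule w'.FK_FS)
  qed
  moreover have "L B' (Suc n) Y"
  proof -
    have "sec R j \<subseteq> Y \<and> L B' n (sec R j) \<and> apart (insert ?a J) (sec R j) \<and>
       (\<forall>i\<in>J. i \<prec> j \<longrightarrow> apart (sec R i) (sec R j))" if "j \<in> J" for j
    proof -
      have j: "j \<prec> ?a \<oplus> \<one>" using that unfolding J_def by blast
      have "L B' n (sec R j)" by (rule w.L_upward[OF B'(2) blk(2)[OF j] blk(1)[OF j]])
      moreover have "sec R j \<subseteq> Y" using that unfolding Y_def by blast
      moreover have "apart (insert ?a J) (sec R j)"
        unfolding apart_def J_def using blk(3)[OF j] ls_add_one by blast
      ultimately show ?thesis using blk(4)[OF j] by blast
    qed
    moreover have "?a \<in> Y" unfolding Y_def by blast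
    ultimately show ?thesis unfolding L.simps using J R bigJ by blast
  qed
  ultimately show ?case using B'(1) Yk by blast
qed

end

subsection \<open>Saturation\<close>

context largeness
begin

text \<open>\<open>L B i\<close> is only defined for standard \<open>i\<close>; a matrix represents it uniformly in \<open>i\<close> as a subset
  of the model, which allows for overspill.\<close>

definition Phi where
  "Phi B W Y \<longleftrightarrow> (\<exists>a\<in>Y. \<exists>J\<in>FS B. \<exists>R\<in>FS B. big B a J \<and>
     (\<forall>j\<in>J. sec R j \<subseteq> Y \<and> (\<exists>c. c \<prec> B \<and> (c \<in> W \<and> Cd c \<subseteq> sec R j \<and> sec R j \<subseteq> Cd c)) \<and>
       apart (insert a J) (sec R j) \<and> (\<forall>i\<in>J. i \<prec> j \<longrightarrow> apart (sec R i) (sec R j))))"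

lemma Phi_cong: "(\<And>c. c \<prec> B \<Longrightarrow> c \<in> W \<longleftrightarrow> c \<in> W') \<Longrightarrow> Phi B W Y = Phi B W' Y"
proof -
  assume "\<And>c. c \<prec> B \<Longrightarrow> c \<in> W \<longleftrightarrow> c \<in> W'"
  then have "(\<exists>c. c \<prec> B \<and> (c \<in> W \<and> Cd c \<subseteq> Z \<and> Z \<subseteq> Cd c)) \<longleftrightarrow> (\<exists>c. c \<prec> B \<and> (c \<in> W' \<and> Cd c \<subseteq> Z \<and> Z \<subseteq> Cd c))" for Z
    by blast
  then show ?thesis unfolding Phi_def by simp
qed

lemma Dz_Phi:
  assumes B: "Tm B" and W: "DzB W" and Y: "DzB Y"
  shows "Dz (\<lambda>e. Phi (B e) (W e) (Y e))"
  unfolding Phi_def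
  by (intro DzB_intros Dz_big Dz_apart Tm_subst[OF B] DzB_env[OF W] DzB_env[OF Y] B Y)

text \<open>One step of the recursion for \<open>L\<close>, with the previous row of the matrix
  \<open>w\<close> in place of the predicate \<open>L B i'\<close>.\<close>

definition level where
  "level B w i c \<longleftrightarrow> i = \<zero> \<and> (\<exists>x\<in>Cd c. True) \<or> (\<exists>i'. i' \<prec> i \<and> (i = i' \<oplus> \<one> \<and> Phi B (sec (Cd w) i') (Cd c)))"

lemma Dz_level:
  assumes "Tm B" "Tm w" "Tm i" "Tm c" shows "Dz (\<lambda>e. level (B e) (w e) (i e) (c e))"
  unfolding level_def
  by (intro DzB_intros Dz_Phi assms Tm_subst[OF assms(1)] Tm_subst[OF assms(2)] Tm_subst[OF assms(3)] Tm_subst[OF assms(4)])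

definition matrix where
  "matrix B i w \<longleftrightarrow> (\<forall>i'. i' \<prec> i \<longrightarrow> (\<forall>c. c \<prec> B \<longrightarrow> (pc i' c \<in> Cd w) = level B w i' c))"

lemma Dz_matrix:
  assumes "Tm B" "Tm i" "Tm w" shows "Dz (\<lambda>e. matrix (B e) (i e) (w e))"
  unfolding matrix_def
  by (intro DzB_intros Dz_level assms Tm_subst[OF assms(1)] Tm_subst[OF assms(2)] Tm_subst[OF assms(3)])

text \<open>A row depends only on the row before it, so rows can be appended one at a time without
  disturbing the earlier ones. The induction is internal, so the number of rows may be
  nonstandard.\<close>

lemma ex_matrix: "\<exists>w. matrix B i w"
proof (rule Sigma_induct[where Q = "\<lambda>i w. matrix B i w"])
  show "Dz (\<lambda>e. matrix B (e (Suc 0)) (e 0))" by (intro Dz_matrix DzB_intros)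
  show "\<exists>w. matrix B \<zero> w" unfolding matrix_def by simp
  fix i assume "\<exists>w. matrix B i w"
  then obtain w where w: "matrix B i w" by blast
  obtain v where v: "K (pc (i \<oplus> \<one>) B) v" using ex_K by blast
  define P where "P = (\<lambda>z. \<exists>i'. i' \<prec> i \<oplus> \<one> \<and> (\<exists>c. c \<prec> B \<and> (z = pc i' c \<and> (i' \<prec> i \<and> z \<in> Cd w \<or> i' = i \<and> level B w i c))))"
  have "Dz (\<lambda>e. P (e 0))" unfolding P_def by (intro DzB_intros Dz_level)
  then obtain w' where w': "\<And>z. mem z w' \<longleftrightarrow> z \<prec> pc (i \<oplus> \<one>) B \<and> P z"
    using code_exists[OF v, of P] by metis
  have lt: "pc i' c \<prec> pc (i \<oplus> \<one>) B" if "i' \<prec> i \<oplus> \<one>" "c \<prec> B" for i' c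
    by (rule pc_strict) (use that in simp_all)
  have old: "pc i' c \<in> Cd w' \<longleftrightarrow> pc i' c \<in> Cd w" if "i' \<prec> i" "c \<prec> B" for i' c
  proof -
    have "i' \<prec> i \<oplus> \<one>" "i' \<noteq> i" using that ls_irrefl ax8 by blast+
    moreover have "P (pc i' c) \<longleftrightarrow> pc i' c \<in> Cd w"
      using that calculation unfolding P_def by (auto simp: pc_inj)
    ultimately show ?thesis using lt[of i' c] that w'[of "pc i' c"] unfolding Cd_def by blast
  qed
  have new: "pc i c \<in> Cd w' \<longleftrightarrow> level B w i c" if "c \<prec> B" for c
  proof -
    have "P (pc i c) \<longleftrightarrow> level B w i c" using that ls_irrefl[of i] unfolding P_def by (auto simp: pc_inj)
    then show ?thesis using lt[of i c] that w'[of "pc i c"] ls_add_one unfolding Cd_def by blast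
  qed
  have lev: "level B w' i' c = level B w i' c" if "i' \<prec> i \<oplus> \<one>" for i' c
  proof -
    have "Phi B (sec (Cd w') i'') (Cd c) = Phi B (sec (Cd w) i'') (Cd c)" if "i'' \<prec> i'" for i''
    proof (rule Phi_cong)
      fix c assume "c \<prec> B"
      moreover have "i'' \<prec> i" using \<open>i' \<prec> i \<oplus> \<one>\<close> that unfolding ls_add1 by order
      ultimately show "c \<in> sec (Cd w') i'' \<longleftrightarrow> c \<in> sec (Cd w) i''" using old unfolding sec_def by simp
    qed
    then show ?thesis unfolding level_def by blast
  qed
  have "matrix B (i \<oplus> \<one>) w'"
    unfolding matrix_def
  proof (intro allI impI)
    fix i' c assume i': "i' \<prec> i \<oplus> \<one>" and c: "c \<prec> B"
    show "(pc i' c \<in> Cd w') = level B w' i' c"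
    proof (cases "i' = i")
      case True
      then show ?thesis using new[OF c] lev[OF i'] by simp
    next
      case False
      then have "i' \<prec> i" using i' ax8 by blast
      then show ?thesis using old[OF _ c] lev[OF i'] w c unfolding matrix_def by simp
    qed
  qed
  then show "\<exists>w. matrix B (i \<oplus> \<one>) w" by blast
qed

end

context world
begin

lemma matrix_correct:
  assumes w: "matrix B i w"
  shows "nm n \<prec> i \<Longrightarrow> c \<prec> B \<Longrightarrow> (\<And>x. x \<in> Cd c \<Longrightarrow> x \<prec> k) \<Longrightarrow> pc (nm n) c \<in> Cd w \<longleftrightarrow> L B n (Cd c)"
proof (induction n arbitrary: c)
  case 0
  have "pc \<zero> c \<in> Cd w \<longleftrightarrow> level B w \<zero> c" using w 0 unfolding matrix_def by simp
  then show ?case unfolding level_def by simp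
next
  case (Suc n)
  have ni: "nm n \<prec> i" using Suc.prems(1) ls_add_one[of "nm n"] unfolding nm.simps by order
  have "pc (nm (Suc n)) c \<in> Cd w \<longleftrightarrow> level B w (nm (Suc n)) c"
    using w Suc.prems(1,2) unfolding matrix_def by blast
  also have "\<dots> \<longleftrightarrow> Phi B (sec (Cd w) (nm n)) (Cd c)"
  proof
    assume "Phi B (sec (Cd w) (nm n)) (Cd c)"
    then show "level B w (nm (Suc n)) c"
      unfolding level_def nm.simps by (intro disjI2 exI[of _ "nm n"] conjI ls_add_one refl)
  qed (auto simp: level_def dest!: ax2)
  also have "\<dots> \<longleftrightarrow> L B (Suc n) (Cd c)"
  proof -
    \<comment> \<open>A matrix speaks about codes, \<open>L\<close> about sets. The section has some
      code below \<open>B\<close>, and the induction hypothesis holds for each of its codes, so it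
      does not matter which one is taken.\<close>
    have "(\<exists>c'. c' \<prec> B \<and> (c' \<in> sec (Cd w) (nm n) \<and> Cd c' \<subseteq> sec R j \<and> sec R j \<subseteq> Cd c')) \<longleftrightarrow> L B n (sec R j)"
      if R: "R \<in> FS B" and sub: "sec R j \<subseteq> Cd c" for R j
    proof -
      have "Cd c \<in> FK" using Suc.prems(2,3) unfolding FK_def FS_def by blast
      then have "sec R j \<in> FS B" using FK_FS FK_sec[OF _ R sub] by blast
      then obtain c0 where c0: "c0 \<prec> B" "sec R j = Cd c0" unfolding FS_def by blast
      have k: "x \<prec> k" if "x \<in> Cd c0" for x using Suc.prems(3) sub c0(2) that by blast
      show ?thesis
      proof
        assume "\<exists>c'. c' \<prec> B \<and> (c' \<in> sec (Cd w) (nm n) \<and> Cd c' \<subseteq> sec R j \<and> sec R j \<subseteq> Cd c')"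
        then obtain c' where c': "c' \<prec> B" "pc (nm n) c' \<in> Cd w" "Cd c' = sec R j" unfolding sec_def by blast
        have "\<And>x. x \<in> Cd c' \<Longrightarrow> x \<prec> k" using k c' c0 by simp
        then have "L B n (Cd c')" using Suc.IH[OF ni c'(1)] c'(2) by blast
        then show "L B n (sec R j)" using c'(3) by simp
      next
        assume "L B n (sec R j)"
        then have "pc (nm n) c0 \<in> Cd w" using Suc.IH[OF ni c0(1) k] c0(2) by simp
        then show "\<exists>c'. c' \<prec> B \<and> (c' \<in> sec (Cd w) (nm n) \<and> Cd c' \<subseteq> sec R j \<and> sec R j \<subseteq> Cd c')"
          using c0 unfolding sec_def by (intro exI[of _ c0]) auto
      qed
    qed
    then show ?thesis unfolding Phi_def L.simps by (simp cong: conj_cong bex_cong)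
  qed
  finally show ?case .
qed

end

context largeness
begin

text \<open>Overspill for: some coded set belongs to all rows up to \<open>i\<close> of a correct
  matrix. For a nonstandard \<open>i\<close> these rows include all standard orders. The matrix is
  returned too, since \<open>saturation\<close> is based on it.\<close>

lemma uniformly_large:
  assumes A_ex: "\<And>u. \<exists>v. \<forall>u' v' w. u' \<preceq> u \<longrightarrow> v \<preceq> v' \<longrightarrow> A u' v' w"
    and N: "\<And>n. nm n \<prec> N"
  shows "\<exists>k B i w Y. KK k B \<and> (\<forall>n. nm n \<prec> i) \<and> matrix B i w \<and> Y \<in> FS B \<and> (\<forall>x\<in>Y. x \<prec> k) \<and> (\<forall>n. L B n Y)"
proof -
  define Q where "Q = (\<lambda>i k B w y. KK k B \<and> matrix B (i \<oplus> \<one>) w \<and> y \<prec> B \<and> (\<forall>x\<in>Cd y. x \<prec> k) \<and>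
    (\<forall>i'. i' \<prec> i \<oplus> \<one> \<longrightarrow> pc i' y \<in> Cd w))"
  have "\<exists>i k B w y. (\<forall>n. nm n \<prec> i) \<and> Q i k B w y"
  proof (rule overspill4[OF _ N])
    show "Dz (\<lambda>e. Q (e (Suc (Suc (Suc (Suc 0))))) (e (Suc (Suc (Suc 0)))) (e (Suc (Suc 0))) (e (Suc 0)) (e 0))"
      unfolding Q_def by (intro DzB_intros Dz_matrix)
    fix n
    obtain k B Y where Y: "KK k B" "Y \<in> FS B" "\<forall>y\<in>Y. y \<prec> k" "L B n Y"
      using existence[OF A_ex, of "\<zero>" n] by blast
    interpret world zr on ad ml ls S X A k B by (rule worldI[OF Y(1)])
    obtain y where y: "y \<prec> B" "Y = Cd y" using Y(2) unfolding FS_def by blast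
    obtain w where w: "matrix B (nm n \<oplus> \<one>) w" using ex_matrix by blast
    have "pc i' y \<in> Cd w" if i': "i' \<prec> nm n \<oplus> \<one>" for i'
    proof -
      obtain m where m: "m \<le> n" "i' = nm m" using standard_downward i' unfolding ls_add1 by blast
      have "L B m (Cd y)" using L_le[OF Y(4) m(1)] y(2) by simp
      then show ?thesis using matrix_correct[OF w, of m y] i' y Y(3) m(2) by simp
    qed
    then have "Q (nm n) k B w y" unfolding Q_def using Y(1,3) w y by blast
    then show "\<exists>k B w y. Q (nm n) k B w y" by blast
  qed
  then obtain i k B w y where i: "\<And>n. nm n \<prec> i" and Q: "Q i k B w y" by blast
  have KB: "KK k B" using Q unfolding Q_def by blast
  interpret world zr on ad ml ls S X A k B by (rule worldI[OF KB])
  have i1: "nm n \<prec> i \<oplus> \<one>" for n using i ax8 by blast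
  have m: "matrix B (i \<oplus> \<one>) w" using Q unfolding Q_def by blast
  have "L B n (Cd y)" for n
    using matrix_correct[OF m i1[of n], of y] Q i1[of n] unfolding Q_def by blast
  then show ?thesis
    using Q i1 unfolding Q_def FS_def by blast
qed

end

locale saturated_world = world zr on ad ml ls S X A k B
  for zr on :: "'m::countable" and ad ml :: "'m \<Rightarrow> 'm \<Rightarrow> 'm" and ls :: "'m \<Rightarrow> 'm \<Rightarrow> bool"
    and S :: "'m set set" and X :: "'m set" and A :: "'m \<Rightarrow> 'm \<Rightarrow> 'm \<Rightarrow> bool" and k B :: 'm +
  fixes N w :: 'm
  assumes nonstandard: "nm n \<prec> N" and matrix: "matrix B N w"
begin

text \<open>This is how steps that lower the order can be repeated without loss: the input has every
  standard order, the step gives a result at every standard order, and overspill gives one result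
  for all of them.\<close>

lemma saturation:
  assumes D: "Dz (\<lambda>e. D (Cd (e 0)))" and std: "\<And>n. \<exists>Y\<in>FK. D Y \<and> L B n Y"
  shows "\<exists>Y\<in>FK. D Y \<and> (\<forall>n. L B n Y)"
proof -
  \<comment> \<open>Rows are consulted only below \<open>N\<close>, where the matrix is known to be
    correct. \<open>a\<close>, \<open>b\<close> and \<open>c\<close> are fillers for
    \<open>overspill4\<close>.\<close>
  define Q where "Q = (\<lambda>i (a::'m) (b::'m) (c::'m) y. y \<prec> B \<and> (\<forall>x\<in>Cd y. x \<prec> k) \<and> D (Cd y) \<and>
    (\<forall>i'. i' \<prec> i \<oplus> \<one> \<longrightarrow> i' \<prec> N \<longrightarrow> pc i' y \<in> Cd w))"
  have "\<exists>i a b c y. (\<forall>n. nm n \<prec> i) \<and> Q i a b c y"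
  proof (rule overspill4[OF _ nonstandard])
    show "Dz (\<lambda>e. Q (e (Suc (Suc (Suc (Suc 0))))) (e (Suc (Suc (Suc 0)))) (e (Suc (Suc 0))) (e (Suc 0)) (e 0))"
      unfolding Q_def by (intro DzB_intros D)
    fix n
    obtain Y where Y: "Y \<in> FK" "D Y" "L B n Y" using std by blast
    obtain y where y: "y \<prec> B" "Y = Cd y" using FK_FS[OF Y(1)] unfolding FS_def by blast
    have "pc i' y \<in> Cd w" if i': "i' \<prec> nm n \<oplus> \<one>" "i' \<prec> N" for i'
    proof -
      obtain m where m: "m \<le> n" "i' = nm m" using standard_downward i' unfolding ls_add1 by blast
      have "L B m (Cd y)" using L_le[OF Y(3) m(1)] y(2) by simp
      then show ?thesis using matrix_correct[OF matrix, of m y] i' y FK_less[OF Y(1)] m(2) by simp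
    qed
    then have "Q (nm n) \<zero> \<zero> \<zero> y" unfolding Q_def using Y(2) FK_less[OF Y(1)] y by blast
    then show "\<exists>a b c y. Q (nm n) a b c y" by blast
  qed
  then obtain i a b c y where i: "\<And>n. nm n \<prec> i" and Q: "Q i a b c y" by blast
  have "pc (nm n) y \<in> Cd w" for n
    using Q i[of n] nonstandard[of n] ax8 unfolding Q_def by blast
  then have "L B n (Cd y)" for n
    using matrix_correct[OF matrix nonstandard, of y n] Q unfolding Q_def by blast
  moreover have "Cd y \<in> FK" using Q unfolding Q_def FK_def FS_def by blast
  ultimately show ?thesis using Q unfolding Q_def by blast
qed

text \<open>Three uses of \<open>saturation\<close>: pass to a block, leaving \<open>a\<close>
  behind; pass to a transitive subset; fix the answers to bounded existential questions about
  \<open>s\<close>. The last is conditional because \<open>pattern\<close> needs room for a pattern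
  of length \<open>c \<oplus> \<one>\<close>; for \<open>c\<close> in the cut there is room at all
  late stages.\<close>

lemma extension_step:
  assumes F: "F \<in> FK" "\<And>n. L B n F" and s: "s \<in> FS B"
  shows "\<exists>F'\<in>FK. F' \<subseteq> F \<and> (\<forall>n. L B n F') \<and> (\<exists>a\<in>F. apart {a} F') \<and>
    tr (\<lambda>x y. pc (pc x y) \<one> \<in> s) F' \<and>
    ((\<forall>y\<in>F. K (c \<oplus> \<one>) y) \<longrightarrow> (\<forall>y\<in>F'. \<forall>z\<in>F'. \<forall>x. x \<prec> c \<oplus> \<one> \<longrightarrow>
      (\<exists>v. v \<prec> y \<and> pc x v \<in> s) = (\<exists>v. v \<prec> z \<and> pc x v \<in> s)))"
proof -
  let ?f = "\<lambda>x y. pc (pc x y) \<one> \<in> s"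
  have "\<exists>Y\<in>FK. (Y \<subseteq> F \<and> (\<exists>a\<in>F. apart {a} Y)) \<and> (\<forall>n. L B n Y)"
  proof (rule saturation)
    show "Dz (\<lambda>e. Cd (e 0) \<subseteq> F \<and> (\<exists>a\<in>F. apart {a} (Cd (e 0))))"
      by (intro DzB_intros DzB_FK[OF F(1)] Dz_apart DzB_FS[OF empty_FS])
    fix n
    obtain a J R where a: "a \<in> F" "R \<in> FS B" "big B a J" and
      blk: "\<And>j. j \<in> J \<Longrightarrow> sec R j \<subseteq> F \<and> L B n (sec R j) \<and> apart (insert a J) (sec R j)"
      using F(2)[of "Suc n"] unfolding L.simps by blast
    obtain j where j: "j \<in> J" using big_nonempty[OF a(3)] by blast
    have "sec R j \<in> FK" using FK_sec[OF F(1) a(2)] blk[OF j] by blast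
    moreover have "apart {a} (sec R j)" by (rule apart_mono[of "insert a J" "sec R j"]) (use blk[OF j] in auto)
    ultimately show "\<exists>Y\<in>FK. (Y \<subseteq> F \<and> (\<exists>a\<in>F. apart {a} Y)) \<and> L B n Y" using blk[OF j] a(1) by blast
  qed
  then obtain F1 a where F1: "F1 \<in> FK" "F1 \<subseteq> F" "\<And>n. L B n F1" and a: "a \<in> F" "apart {a} F1" by blast
  have f: "Dz (\<lambda>e. ?f (e 0) (e (Suc 0)))" by (intro DzB_intros DzB_FS[OF s])
  have "\<exists>Y\<in>FK. (Y \<subseteq> F1 \<and> tr ?f Y) \<and> (\<forall>n. L B n Y)"
  proof (rule saturation)
    show "Dz (\<lambda>e. Cd (e 0) \<subseteq> F1 \<and> tr ?f (Cd (e 0)))"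
      by (intro DzB_intros DzB_FK[OF F1(1)] Dz_tr f)
    show "\<exists>Y\<in>FK. (Y \<subseteq> F1 \<and> tr ?f Y) \<and> L B n Y" for n
      using transitive_subset[where f = ?f, OF f F1(1) F1(3)] by blast
  qed
  then obtain F2 where F2: "F2 \<in> FK" "F2 \<subseteq> F1" "\<And>n. L B n F2" "tr ?f F2" by blast
  show ?thesis
  proof (cases "\<forall>y\<in>F. K (c \<oplus> \<one>) y")
    case False
    then show ?thesis using F1(2) F2 a apart_mono[OF a(2) subset_refl F2(2)] by blast
  next
    case True
    define P where "P = (\<lambda>y x. \<exists>v. v \<prec> y \<and> pc x v \<in> s)"
    have "\<exists>Y\<in>FK. (Y \<subseteq> F2 \<and> (\<forall>y\<in>Y. \<forall>z\<in>Y. \<forall>x. x \<prec> c \<oplus> \<one> \<longrightarrow> P y x = P z x)) \<and> (\<forall>n. L B n Y)"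
    proof (rule saturation)
      show "Dz (\<lambda>e. Cd (e 0) \<subseteq> F2 \<and> (\<forall>y\<in>Cd (e 0). \<forall>z\<in>Cd (e 0). \<forall>x. x \<prec> c \<oplus> \<one> \<longrightarrow> P y x = P z x))"
        unfolding P_def by (intro DzB_intros DzB_FK[OF F2(1)] DzB_FS[OF s])
      fix n
      have "\<exists>H\<in>FK. H \<subseteq> F2 \<and> L B n H \<and> (\<forall>y\<in>H. \<forall>z\<in>H. \<forall>x. x \<prec> c \<oplus> \<one> \<longrightarrow> P y x = P z x)"
      proof (rule pattern[OF F2(1) F2(3)])
        show "Dz (\<lambda>e. P (e 0) (e (Suc 0)))" unfolding P_def by (intro DzB_intros DzB_FS[OF s])
        show "K (c \<oplus> \<one>) y" if "y \<in> F2" for y using True that F1(2) F2(2) by blast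
      qed
      then show "\<exists>Y\<in>FK. (Y \<subseteq> F2 \<and> (\<forall>y\<in>Y. \<forall>z\<in>Y. \<forall>x. x \<prec> c \<oplus> \<one> \<longrightarrow> P y x = P z x)) \<and> L B n Y" by blast
    qed
    then obtain F3 where F3: "F3 \<in> FK" "F3 \<subseteq> F2" "\<And>n. L B n F3"
      "\<forall>y\<in>F3. \<forall>z\<in>F3. \<forall>x. x \<prec> c \<oplus> \<one> \<longrightarrow> P y x = P z x" by blast
    have "apart {a} F3" by (rule apart_mono[OF a(2)]) (use F2(2) F3(2) in auto)
    moreover have "tr ?f F3" using F2(4) F3(2) unfolding tr_def by blast
    moreover have "F3 \<subseteq> F" using F1(2) F2(2) F3(2) by blast
    ultimately show ?thesis using F3(1,3,4) a(1) unfolding P_def by blast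
  qed
qed

end

section \<open>The cut\<close>

lemma (in arith) sat_AllN_pow:
  assumes "\<And>e. (\<And>n. e n \<in> D) \<Longrightarrow> sat D S e E \<phi>" "\<And>n. e n \<in> D"
  shows "sat D S e E ((AllN ^^ m) \<phi>)"
  using assms(2)
proof (induction m arbitrary: e)
  case 0
  then show ?case using assms(1) by simp
next
  case (Suc m)
  have "sat D S (case_nat x e) E ((AllN ^^ m) \<phi>)" if "x \<in> D" for x
    by (rule Suc.IH) (simp add: that Suc.prems split: nat.split)
  then show ?case by simp
qed

lemma (in arith) sat_AllS_pow:
  assumes "\<And>E. (\<And>n. E n \<in> S) \<Longrightarrow> sat D S e E \<phi>" "\<And>n. E n \<in> S"
  shows "sat D S e E ((AllS ^^ m) \<phi>)"
  using assms(2)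
proof (induction m arbitrary: E)
  case 0
  then show ?case using assms(1) by simp
next
  case (Suc m)
  have "sat D S e (case_nat Y E) ((AllS ^^ m) \<phi>)" if "Y \<in> S" for Y
    by (rule Suc.IH) (simp add: that Suc.prems split: nat.split)
  then show ?case by simp
qed

lemma (in arith) sat_BAll [simp]:
  "sat D S e E (BAll t \<phi>) \<longleftrightarrow> (\<forall>x\<in>D. ls x (ev e t) \<longrightarrow> sat D S (case_nat x e) E \<phi>)"
  by (simp add: BAll_def)

lemma (in arith) sat_BEx [simp]:
  "sat D S e E (BEx t \<phi>) \<longleftrightarrow> (\<exists>x\<in>D. ls x (ev e t) \<and> sat D S (case_nat x e) E \<phi>)"
  by (simp add: BEx_def)

context model
begin

lemma Tm_ev: "(\<And>n. Tm (h n)) \<Longrightarrow> Tm (\<lambda>e. ev (\<lambda>n. h n e) t)"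
  by (induction t) (simp_all add: Dz_intros)

lemma Dz_sat:
  assumes G: "\<And>n f. Tm f \<Longrightarrow> Dz (\<lambda>e. f e \<in> G n)"
  shows "\<phi> \<in> delta0 \<Longrightarrow> (\<And>n. Tm (h n)) \<Longrightarrow> Dz (\<lambda>e. sat UNIV S (\<lambda>n. h n e) G \<phi>)"
proof (induction arbitrary: h rule: delta0.induct)
  case (6 \<phi> t)
  have "Dz (\<lambda>e. sat UNIV S (\<lambda>n. case_nat (\<lambda>e. e 0) (\<lambda>m e. h m (\<lambda>i. e (Suc i))) n e) G \<phi>)"
    by (rule 6) (auto intro!: Tm_var Tm_subst[OF 6(3)] split: nat.split)
  moreover have "(\<lambda>n. case_nat (\<lambda>e. e 0) (\<lambda>m e. h m (\<lambda>i. e (Suc i))) n e) = case_nat (e 0) (\<lambda>n. h n (\<lambda>i. e (Suc i)))" for e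
    by (rule ext) (simp split: nat.split)
  ultimately have "Dz (\<lambda>e. sat UNIV S (case_nat (e 0) (\<lambda>n. h n (\<lambda>i. e (Suc i)))) G \<phi>)" by simp
  from Dz_all[where P = "\<lambda>x e. sat UNIV S (case_nat x (\<lambda>n. h n e)) G \<phi>", OF this Tm_ev[of h t, OF 6(3)]]
  show ?case by simp
next
  case (7 \<phi> t)
  have "Dz (\<lambda>e. sat UNIV S (\<lambda>n. case_nat (\<lambda>e. e 0) (\<lambda>m e. h m (\<lambda>i. e (Suc i))) n e) G \<phi>)"
    by (rule 7) (auto intro!: Tm_var Tm_subst[OF 7(3)] split: nat.split)
  moreover have "(\<lambda>n. case_nat (\<lambda>e. e 0) (\<lambda>m e. h m (\<lambda>i. e (Suc i))) n e) = case_nat (e 0) (\<lambda>n. h n (\<lambda>i. e (Suc i)))" for e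
    by (rule ext) (simp split: nat.split)
  ultimately have "Dz (\<lambda>e. sat UNIV S (case_nat (e 0) (\<lambda>n. h n (\<lambda>i. e (Suc i)))) G \<phi>)" by simp
  from Dz_ex[where P = "\<lambda>x e. sat UNIV S (case_nat x (\<lambda>n. h n e)) G \<phi>", OF this Tm_ev[of h t, OF 7(3)]]
  show ?case by simp
qed (simp_all add: Dz_False Dz_eq Dz_ls Dz_imp G Tm_ev)

end

text \<open>\<open>F_stable\<close> offers stages beyond any given \<open>j\<close> because its
  premise, for \<open>c\<close> in the cut, is only known from some stage on. In
  \<open>F_tr\<close>, a two-valued colouring is represented by the pairs of colour 1.\<close>

locale cut = world zr on ad ml ls S X A k B
  for zr on :: "'m::countable" and ad ml :: "'m \<Rightarrow> 'm \<Rightarrow> 'm" and ls :: "'m \<Rightarrow> 'm \<Rightarrow> bool"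
    and S :: "'m set set" and X :: "'m set" and A :: "'m \<Rightarrow> 'm \<Rightarrow> 'm \<Rightarrow> bool" and k B :: 'm +
  fixes F :: "nat \<Rightarrow> 'm set" and a :: "nat \<Rightarrow> 'm"
  assumes F_FK: "F i \<in> FK" and F_step: "F (Suc i) \<subseteq> F i"
    and a_in: "a i \<in> F i" and a_apart: "apart {a i} (F (Suc i))"
    and F_tr: "s \<in> FS B \<Longrightarrow> \<exists>i. tr (\<lambda>x y. pc (pc x y) \<one> \<in> s) (F i)"
    and F_stable: "s \<in> FS B \<Longrightarrow> \<exists>i\<ge>j. (\<forall>y\<in>F i. K (c \<oplus> \<one>) y) \<longrightarrow>
      (\<forall>y\<in>F (Suc i). \<forall>z\<in>F (Suc i). \<forall>x. x \<prec> c \<oplus> \<one> \<longrightarrow>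
        (\<exists>v. v \<prec> y \<and> pc x v \<in> s) = (\<exists>v. v \<prec> z \<and> pc x v \<in> s))"
begin

definition I where "I = {x. \<exists>i. x \<preceq> a i}"
definition SI where "SI = {s \<inter> I |s. s \<in> FS B}"

lemma F_mono: "i \<le> j \<Longrightarrow> F j \<subseteq> F i"
  by (rule lift_Suc_antimono_le[of F]) (rule F_step)

lemma a_F: "i \<le> j \<Longrightarrow> a j \<in> F i"
  using F_mono a_in by blast

lemma A_a: "i < j \<Longrightarrow> v \<in> F j \<Longrightarrow> w \<in> F j \<Longrightarrow> A (a i) v w"
  using a_apart[of i] F_mono[of "Suc i" j] unfolding apart_def by (meson Suc_leI singletonI subsetD)

lemma a_less: "i < j \<Longrightarrow> a i \<prec> a j"
  using A_a[OF _ a_in a_in] A_less by blast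

lemma I_down: "x \<in> I \<Longrightarrow> y \<preceq> x \<Longrightarrow> y \<in> I"
  unfolding I_def using od.order_trans by blast

lemma a_I: "a i \<in> I"
  unfolding I_def using od.order_refl by blast


lemma I_less: assumes "x \<in> I" shows "\<exists>i. \<forall>j\<ge>i. x \<prec> a j"
proof -
  obtain i where i: "x \<preceq> a i" using assms unfolding I_def by blast
  have "x \<prec> a j" if "Suc i \<le> j" for j using a_less[of i j] i that by (meson Suc_le_eq od.le_less_trans)
  then show ?thesis by blast
qed

lemma I_k: "x \<in> I \<Longrightarrow> x \<prec> k"
  using I_less FK_less[OF F_FK a_in] od.less_trans by blast

lemma I_pc: assumes "x \<in> I" "y \<in> I" shows "pc x y \<in> I"
proof -
  obtain i j where i: "\<And>l. i \<le> l \<Longrightarrow> x \<prec> a l" and j: "\<And>l. j \<le> l \<Longrightarrow> y \<prec> a l" using I_less assms by meson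
  let ?l = "max i j"
  have "pc x y \<preceq> pc (a ?l) (a ?l)" using i[of ?l] j[of ?l] by (intro pc_mono) auto
  moreover have "pc (a ?l) (a ?l) \<prec> a (Suc ?l)" using A_pc[OF A_a[OF lessI a_in a_in]] .
  ultimately have "pc x y \<preceq> a (Suc ?l)" by order
  then show ?thesis unfolding I_def by blast
qed

lemma I_closed: "closed_dom I"
proof -
  have z: "\<zero> \<in> I" using I_down[OF a_I zero_le] .
  have "\<zero> \<prec> a (Suc 0)" using a_less[of 0 "Suc 0"] zero_le od.le_less_trans by blast
  then have "\<one> \<preceq> a (Suc 0)" using add1_le[of "\<zero>"] by simp
  then have o: "\<one> \<in> I" using I_down a_I by blast
  have "x \<oplus> y \<in> I \<and> x \<otimes> y \<in> I" if "x \<in> I" "y \<in> I" for x y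
  proof
    show "x \<oplus> y \<in> I" by (rule I_down[OF I_pc[OF that] sum_le_pc])
    have "x \<otimes> y \<preceq> (x \<oplus> y) \<otimes> (x \<oplus> y)" by (rule mul_mono) simp_all
    also have "\<dots> \<preceq> pc x y" unfolding pc_def by simp
    finally show "x \<otimes> y \<in> I" by (rule I_down[OF I_pc[OF that]])
  qed
  then show ?thesis unfolding closed_dom_def using z o by blast
qed

lemma I_zero [simp]: "\<zero> \<in> I" and I_one [simp]: "\<one> \<in> I"
  and I_ad: "x \<in> I \<Longrightarrow> y \<in> I \<Longrightarrow> x \<oplus> y \<in> I" and I_ml: "x \<in> I \<Longrightarrow> y \<in> I \<Longrightarrow> x \<otimes> y \<in> I"
  using I_closed unfolding closed_dom_def by blast+

lemma I_Suc: "x \<in> I \<Longrightarrow> x \<oplus> \<one> \<in> I"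
  by (rule I_ad) simp_all

lemma I_K_F: assumes "c \<in> I" shows "\<exists>i. \<forall>j\<ge>i. \<forall>y\<in>F j. K (c \<oplus> \<one>) y"
proof -
  obtain i where i: "c \<preceq> a i" using assms unfolding I_def by blast
  have "K (c \<oplus> \<one>) y" if "Suc i \<le> j" "y \<in> F j" for j y
  proof (rule K_mono[OF A_K_Suc[OF A_a[of i j]]])
    show "c \<oplus> \<one> \<preceq> a i \<oplus> \<one>" using i by (simp add: add_mono_iff)
  qed (use that in auto)
  then show ?thesis by blast
qed

lemma I_K: assumes "c \<in> I" shows "\<exists>v\<in>I. K c v"
proof -
  obtain i where "K (c \<oplus> \<one>) (a i)" using I_K_F[OF assms] a_in by blast
  then have "K c (a i)" by (rule K_mono) simp_all
  then show ?thesis using a_I by blast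
qed

lemma SI_comprehension:
  assumes "Dz (\<lambda>e. P (e 0))" shows "\<exists>Z\<in>SI. \<forall>x\<in>I. x \<in> Z \<longleftrightarrow> P x"
proof -
  have "{x. x \<prec> k \<and> P x} \<in> FS B" by (rule FK_FS[OF FKI]) (intro Dz_intros assms, blast)
  then have "{x. x \<prec> k \<and> P x} \<inter> I \<in> SI" unfolding SI_def by blast
  then show ?thesis using I_k by (intro bexI[of _ "{x. x \<prec> k \<and> P x} \<inter> I"]) auto
qed

lemma env_SI:
  assumes "\<And>n. E n \<in> SI" shows "\<exists>G. (\<forall>n. G n \<in> FS B) \<and> (\<forall>n. E n = G n \<inter> I)"
proof -
  have "\<forall>n. \<exists>s. s \<in> FS B \<and> E n = s \<inter> I" using assms unfolding SI_def by blast
  then have "\<exists>G. \<forall>n. G n \<in> FS B \<and> E n = G n \<inter> I" by (rule Hilbert_Choice.choice)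
  then show ?thesis by blast
qed

text \<open>\<open>I\<close> is an initial segment that contains the values of terms, so bounded
  quantifiers range over the same elements on both sides.\<close>

lemma absolute:
  assumes "\<phi> \<in> delta0" and "\<And>n. E n = G n \<inter> I"
  shows "(\<And>n. e n \<in> I) \<Longrightarrow> sat I SI e E \<phi> \<longleftrightarrow> sat UNIV S e G \<phi>"
  using assms(1)
proof (induction arbitrary: e rule: delta0.induct)
  case (4 t Y)
  show ?case using ev_in_dom[where e = e, OF I_closed 4, of t] assms(2) by simp
next
  case (6 \<phi> t)
  have eq: "sat I SI (case_nat x e) E \<phi> = sat UNIV S (case_nat x e) G \<phi>" if "x \<in> I" for x
    using that 6(3) by (intro 6(2)) (auto split: nat.split)
  have lt: "x \<in> I" if "x \<prec> ev e t" for x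
    using I_down[OF ev_in_dom[where e = e, OF I_closed 6(3)], of x t] that od.less_imp_le by blast
  have "(\<forall>x\<in>I. x \<prec> ev e t \<longrightarrow> sat I SI (case_nat x e) E \<phi>) \<longleftrightarrow> (\<forall>x. x \<prec> ev e t \<longrightarrow> sat UNIV S (case_nat x e) G \<phi>)"
    using eq lt by meson
  then show ?case by simp
next
  case (7 \<phi> t)
  have eq: "sat I SI (case_nat x e) E \<phi> = sat UNIV S (case_nat x e) G \<phi>" if "x \<in> I" for x
    using that 7(3) by (intro 7(2)) (auto split: nat.split)
  have lt: "x \<in> I" if "x \<prec> ev e t" for x
    using I_down[OF ev_in_dom[where e = e, OF I_closed 7(3)], of x t] that od.less_imp_le by blast
  have "(\<exists>x\<in>I. x \<prec> ev e t \<and> sat I SI (case_nat x e) E \<phi>) \<longleftrightarrow> (\<exists>x. x \<prec> ev e t \<and> sat UNIV S (case_nat x e) G \<phi>)"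
    using eq lt by meson
  then show ?case by simp
next
  case (5 \<phi> \<psi>)
  have "sat I SI e E \<phi> = sat UNIV S e G \<phi>" "sat I SI e E \<psi> = sat UNIV S e G \<psi>"
    using 5 by blast+
  then show ?case by simp
next
  case 1
  show ?case by simp
next
  case (2 s t)
  show ?case by simp
next
  case (3 s t)
  show ?case by simp
qed

lemma delta0_relation:
  assumes "\<phi> \<in> delta0" "\<And>n. e n \<in> I" "\<And>n. E n \<in> SI"
  shows "\<exists>Q. Dz (\<lambda>e. Q (e (Suc 0)) (e 0)) \<and>
    (\<forall>x\<in>I. \<forall>y\<in>I. sat I SI (case_nat y (case_nat x e)) E \<phi> = Q x y)"
proof -
  obtain G where G: "\<forall>n. G n \<in> FS B" "\<forall>n. E n = G n \<inter> I" using env_SI[of E, OF assms(3)] by (elim exE conjE)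
  define Q where "Q = (\<lambda>x y. sat UNIV S (case_nat y (case_nat x e)) G \<phi>)"
  show ?thesis
  proof (intro exI[of _ Q] conjI ballI)
    have "Dz (\<lambda>e'. sat UNIV S (\<lambda>n. case_nat (\<lambda>e'. e' 0) (case_nat (\<lambda>e'. e' (Suc 0)) (\<lambda>n e'. e n)) n e') G \<phi>)"
      by (rule Dz_sat[OF DzB_mem[OF DzB_FS] assms(1)], rule spec[OF G(1)]) (auto intro: Tm_var Tm_const split: nat.split)
    moreover have "(\<lambda>n. case_nat (\<lambda>e'. e' 0) (case_nat (\<lambda>e'. e' (Suc 0)) (\<lambda>n e'. e n)) n e') =
       case_nat (e' 0) (case_nat (e' (Suc 0)) e)" for e' :: "nat \<Rightarrow> 'm"
      by (rule ext) (simp split: nat.split)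
    ultimately show "Dz (\<lambda>e. Q (e (Suc 0)) (e 0))" unfolding Q_def by simp
    show "sat I SI (case_nat y (case_nat x e)) E \<phi> = Q x y" if "x \<in> I" "y \<in> I" for x y
      unfolding Q_def by (rule absolute[OF assms(1) spec[OF G(2)]]) (simp add: that assms(2) split: nat.split)
  qed
qed

lemma Dz_rel: "Dz (\<lambda>e. Q (e (Suc 0)) (e 0)) \<Longrightarrow> Tm f \<Longrightarrow> Tm g \<Longrightarrow> Dz (\<lambda>e. Q (f e) (g e))"
  using Dz_app2[of "\<lambda>y x. Q x y" g f] by simp

text \<open>Strong Sigma_1 bounding in the cut. By \<open>F_stable\<close> the elements of some
  \<open>F (Suc i)\<close> all give the same answers for \<open>x \<preceq> c\<close>. Since
  \<open>a l\<close> belongs to it for all large \<open>l\<close>, a witness anywhere in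
  \<open>I\<close> yields one below \<open>a (Suc i)\<close>.\<close>

lemma Sigma1_bounded:
  assumes Q: "Dz (\<lambda>e. Q (e (Suc 0)) (e 0))" and c: "c \<in> I"
  shows "\<exists>d\<in>I. \<forall>x. x \<preceq> c \<longrightarrow> (\<exists>y\<in>I. Q x y) = (\<exists>y. y \<prec> d \<and> Q x y)"
proof -
  define s where "s = {z. \<exists>x. x \<prec> k \<and> (\<exists>y. y \<prec> k \<and> (z = pc x y \<and> Q x y))}"
  have "s \<in> FS B" unfolding s_def
    by (rule FSI1) (intro DzB_intros Dz_rel[OF Q], use pc_less1 in blast)
  have s: "pc x y \<in> s \<longleftrightarrow> Q x y" if "x \<prec> k" "y \<prec> k" for x y
    using that unfolding s_def by (auto simp: pc_inj)
  obtain j where j: "\<forall>i\<ge>j. \<forall>y\<in>F i. K (c \<oplus> \<one>) y" using I_K_F[OF c] by blast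
  obtain i where i: "j \<le> i" "(\<forall>y\<in>F i. K (c \<oplus> \<one>) y) \<longrightarrow>
      (\<forall>y\<in>F (Suc i). \<forall>z\<in>F (Suc i). \<forall>x. x \<prec> c \<oplus> \<one> \<longrightarrow>
        (\<exists>v. v \<prec> y \<and> pc x v \<in> s) = (\<exists>v. v \<prec> z \<and> pc x v \<in> s))" using F_stable[OF \<open>s \<in> FS B\<close>, of j c] by blast
  have st: "(\<exists>v. v \<prec> y \<and> pc x v \<in> s) = (\<exists>v. v \<prec> z \<and> pc x v \<in> s)"
    if "y \<in> F (Suc i)" "z \<in> F (Suc i)" "x \<preceq> c" for x y z
    using i(2) j i(1) that unfolding ls_add1 by blast
  show ?thesis
  proof (intro bexI[of _ "a (Suc i)"] allI impI)
    show "a (Suc i) \<in> I" by (rule a_I)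
    fix x assume x: "x \<preceq> c"
    then have xk: "x \<prec> k" using I_k[OF I_down[OF c]] by blast
    show "(\<exists>y\<in>I. Q x y) \<longleftrightarrow> (\<exists>y. y \<prec> a (Suc i) \<and> Q x y)"
    proof
      assume "\<exists>y. y \<prec> a (Suc i) \<and> Q x y"
      then show "\<exists>y\<in>I. Q x y" using I_down[OF a_I] od.less_imp_le by blast
    next
      assume "\<exists>y\<in>I. Q x y"
      then obtain y where y: "y \<in> I" "Q x y" by blast
      obtain l where l: "\<forall>j\<ge>l. y \<prec> a j" using I_less[OF y(1)] by blast
      have "pc x y \<in> s" using s[OF xk I_k[OF y(1)]] y(2) by blast
      then have "\<exists>v. v \<prec> a (max l (Suc i)) \<and> pc x v \<in> s" using l by (intro exI[of _ y]) simp
      then have "\<exists>v. v \<prec> a (Suc i) \<and> pc x v \<in> s" using st[OF a_F a_F x, of "Suc i" "max l (Suc i)"] by simp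
      then obtain v where v: "v \<prec> a (Suc i)" "pc x v \<in> s" by blast
      have "v \<prec> k" using v(1) I_k[OF a_I[of "Suc i"]] by order
      then show "\<exists>y. y \<prec> a (Suc i) \<and> Q x y" using v s[OF xk] by blast
    qed
  qed
qed

text \<open>Up to a given \<open>c\<close>, \<open>Sigma1_bounded\<close> replaces the existential
  quantifier over \<open>I\<close> by a bounded one, and induction in the ambient model
  applies.\<close>

lemma sat_induction:
  assumes "\<phi> \<in> sigma0 1" and e: "\<And>n. e n \<in> I" and E: "\<And>n. E n \<in> SI"
  shows "sat I SI e E (induction_axiom \<phi>)"
proof -
  obtain \<psi> where \<psi>: "\<phi> = ExN \<psi>" "\<psi> \<in> delta0" using assms(1) by auto
  obtain Q where Q: "Dz (\<lambda>e. Q (e (Suc 0)) (e 0))"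
    "\<forall>x\<in>I. \<forall>y\<in>I. sat I SI (case_nat y (case_nat x e)) E \<psi> = Q x y"
    using delta0_relation[where e = e and E = E, OF \<psi>(2) e E] by (elim exE conjE)
  have sat: "sat I SI (case_nat x e) E \<phi> \<longleftrightarrow> (\<exists>y\<in>I. Q x y)" if "x \<in> I" for x
    using bspec[OF Q(2) that] \<psi>(1) by simp
  have env: "(\<lambda>n. ev (case_nat x e) (case_nat (Var 0 \<^bold>+ One) (\<lambda>n. Var (Suc n)) n)) = case_nat (x \<oplus> \<one>) e" for x
    by (rule ext) (simp split: nat.split)
  have ind: "\<exists>y\<in>I. Q c y" if base: "\<exists>y\<in>I. Q \<zero> y"
    and step: "\<And>x. x \<in> I \<Longrightarrow> \<exists>y\<in>I. Q x y \<Longrightarrow> \<exists>y\<in>I. Q (x \<oplus> \<one>) y" and c: "c \<in> I" for c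
  proof -
    obtain d where d: "\<And>x. x \<preceq> c \<Longrightarrow> (\<exists>y\<in>I. Q x y) = (\<exists>y. y \<prec> d \<and> Q x y)"
      using Sigma1_bounded[of Q c, OF Q(1) c] by blast
    have "x \<preceq> c \<longrightarrow> (\<exists>y. y \<prec> d \<and> Q x y)" for x
    proof (rule Dz_induct[where P = "\<lambda>x. x \<preceq> c \<longrightarrow> (\<exists>y. y \<prec> d \<and> Q x y)"])
      show "Dz (\<lambda>e. e 0 \<preceq> c \<longrightarrow> (\<exists>y. y \<prec> d \<and> Q (e 0) y))"
        by (intro Dz_intros Dz_rel[OF Q(1)])
      show "\<zero> \<preceq> c \<longrightarrow> (\<exists>y. y \<prec> d \<and> Q \<zero> y)" using d base by blast
      fix x assume IH: "x \<preceq> c \<longrightarrow> (\<exists>y. y \<prec> d \<and> Q x y)"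
      show "x \<oplus> \<one> \<preceq> c \<longrightarrow> (\<exists>y. y \<prec> d \<and> Q (x \<oplus> \<one>) y)"
      proof
        assume xc: "x \<oplus> \<one> \<preceq> c"
        then have x: "x \<preceq> c" using ls_add_one[of x] by order
        then have "\<exists>y\<in>I. Q x y" using IH d by blast
        then have "\<exists>y\<in>I. Q (x \<oplus> \<one>) y" using step I_down[OF c x] by blast
        then show "\<exists>y. y \<prec> d \<and> Q (x \<oplus> \<one>) y" using d[OF xc] by blast
      qed
    qed
    then show ?thesis using d by blast
  qed
  have sat1: "sat I SI (case_nat x e) E (subst (case_nat (Var 0 \<^bold>+ One) (\<lambda>n. Var (Suc n))) id \<phi>) \<longleftrightarrow>
     (\<exists>y\<in>I. Q (x \<oplus> \<one>) y)" if "x \<in> I" for x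
    unfolding sat_subst env using sat[OF I_Suc[OF that]] by simp
  have "(\<exists>y\<in>I. Q \<zero> y) \<and> (\<forall>x\<in>I. (\<exists>y\<in>I. Q x y) \<longrightarrow> (\<exists>y\<in>I. Q (x \<oplus> \<one>) y)) \<longrightarrow> (\<forall>x\<in>I. \<exists>y\<in>I. Q x y)"
  proof (intro impI ballI)
    fix c assume h: "(\<exists>y\<in>I. Q \<zero> y) \<and> (\<forall>x\<in>I. (\<exists>y\<in>I. Q x y) \<longrightarrow> (\<exists>y\<in>I. Q (x \<oplus> \<one>) y))" and c: "c \<in> I"
    show "\<exists>y\<in>I. Q c y"
      by (rule ind[OF conjunct1[OF h] mp[OF bspec[OF conjunct2[OF h]]] c])
  qed
  moreover have "sat I SI e E (induction_axiom \<phi>) \<longleftrightarrow>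
     ((\<exists>y\<in>I. Q \<zero> y) \<and> (\<forall>x\<in>I. (\<exists>y\<in>I. Q x y) \<longrightarrow> (\<exists>y\<in>I. Q (x \<oplus> \<one>) y)) \<longrightarrow> (\<forall>x\<in>I. \<exists>y\<in>I. Q x y))"
    unfolding induction_axiom_def by (simp only: sat.simps sat_instN ev.simps sat[OF I_zero] sat sat1 cong: ball_cong) blast
  ultimately show ?thesis by blast
qed

lemma sat_comprehension:
  assumes "\<phi> \<in> sigma0 1" "\<psi> \<in> pi0 1" and e: "\<And>n. e n \<in> I" and E: "\<And>n. E n \<in> SI"
  shows "sat I SI e E (comprehension_axiom \<phi> \<psi>)"
proof -
  obtain \<alpha> where \<alpha>: "\<phi> = ExN \<alpha>" "\<alpha> \<in> delta0" using assms(1) by auto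
  obtain \<beta> where \<beta>: "\<psi> = AllN \<beta>" "\<beta> \<in> delta0" using assms(2) by auto
  obtain P where P: "Dz (\<lambda>e. P (e (Suc 0)) (e 0))"
    "\<forall>x\<in>I. \<forall>y\<in>I. sat I SI (case_nat y (case_nat x e)) E \<alpha> = P x y"
    using delta0_relation[where e = e and E = E, OF \<alpha>(2) e E] by (elim exE conjE)
  obtain Q where Q: "Dz (\<lambda>e. Q (e (Suc 0)) (e 0))"
    "\<forall>x\<in>I. \<forall>y\<in>I. sat I SI (case_nat y (case_nat x e)) E \<beta> = Q x y"
    using delta0_relation[where e = e and E = E, OF \<beta>(2) e E] by (elim exE conjE)
  have \<phi>: "sat I SI (case_nat x e) E \<phi> \<longleftrightarrow> (\<exists>y\<in>I. P x y)" if "x \<in> I" for x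
    using bspec[OF P(2) that] \<alpha>(1) by simp
  have lift: "sat I SI (case_nat x e) (case_nat Z E) (liftS \<phi>) \<longleftrightarrow> (\<exists>y\<in>I. P x y)" if "x \<in> I" for x Z
    using \<phi>[OF that] by simp
  have \<psi>: "sat I SI (case_nat x e) E \<psi> \<longleftrightarrow> (\<forall>y\<in>I. Q x y)" if "x \<in> I" for x
    using bspec[OF Q(2) that] \<beta>(1) by simp
  have main: "\<exists>Z\<in>SI. \<forall>x\<in>I. x \<in> Z \<longleftrightarrow> (\<exists>y\<in>I. P x y)" if eq: "\<And>x. x \<in> I \<Longrightarrow> (\<exists>y\<in>I. P x y) \<longleftrightarrow> (\<forall>y\<in>I. Q x y)"
  proof -
    \<comment> \<open>Witness comparison: a witness for \<open>P\<close> that comes before every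
      failure of \<open>Q\<close>. A witness outside \<open>I\<close> does no harm: if there were
      none in \<open>I\<close>, then \<open>Q\<close> would fail at some element of
      \<open>I\<close>, which comes earlier.\<close>
    have "Dz (\<lambda>e. \<exists>y. y \<prec> k \<and> (P (e 0) y \<and> (\<forall>y'. y' \<prec> y \<longrightarrow> Q (e 0) y')))"
      by (intro Dz_intros Dz_rel[OF P(1)] Dz_rel[OF Q(1)])
    then obtain Z where Z: "Z \<in> SI" "\<And>x. x \<in> I \<Longrightarrow> x \<in> Z \<longleftrightarrow> (\<exists>y. y \<prec> k \<and> (P x y \<and> (\<forall>y'. y' \<prec> y \<longrightarrow> Q x y')))"
      using SI_comprehension[where P = "\<lambda>x. \<exists>y. y \<prec> k \<and> (P x y \<and> (\<forall>y'. y' \<prec> y \<longrightarrow> Q x y'))"] by blast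
    have eq2: "(\<exists>y. y \<prec> k \<and> (P x y \<and> (\<forall>y'. y' \<prec> y \<longrightarrow> Q x y'))) \<longleftrightarrow> (\<exists>y\<in>I. P x y)" if x: "x \<in> I" for x
    proof
      assume "\<exists>y\<in>I. P x y"
      then obtain y where y: "y \<in> I" "P x y" by blast
      then have "\<forall>y\<in>I. Q x y" using eq[OF x] by blast
      then have "\<forall>y'. y' \<prec> y \<longrightarrow> Q x y'" using I_down[OF y(1)] od.less_imp_le by blast
      then show "\<exists>y. y \<prec> k \<and> (P x y \<and> (\<forall>y'. y' \<prec> y \<longrightarrow> Q x y'))" using y I_k by blast
    next
      assume "\<exists>y. y \<prec> k \<and> (P x y \<and> (\<forall>y'. y' \<prec> y \<longrightarrow> Q x y'))"
      then obtain y where y: "P x y" "\<forall>y'. y' \<prec> y \<longrightarrow> Q x y'" by blast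
      show "\<exists>y\<in>I. P x y"
      proof (rule ccontr)
        assume no: "\<not> ?thesis"
        then obtain y0 where y0: "y0 \<in> I" "\<not> Q x y0" using eq[OF x] by blast
        have "y \<notin> I" using no y(1) by blast
        then have "y0 \<prec> y" using I_down[OF y0(1)] od.not_less by blast
        then show False using y(2) y0(2) by blast
      qed
    qed
    show ?thesis
    proof (intro bexI[of _ Z] ballI)
      show "(x \<in> Z) = (\<exists>y\<in>I. P x y)" if "x \<in> I" for x
        by (rule trans[OF Z(2)[OF that] eq2[OF that]])
    qed (rule Z(1))
  qed
  have "(\<forall>x\<in>I. (\<exists>y\<in>I. P x y) = (\<forall>y\<in>I. Q x y)) \<longrightarrow> (\<exists>Z\<in>SI. \<forall>x\<in>I. x \<in> Z \<longleftrightarrow> (\<exists>y\<in>I. P x y))"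
    by (intro impI main) (erule bspec)
  moreover have "sat I SI e E (comprehension_axiom \<phi> \<psi>) \<longleftrightarrow>
     ((\<forall>x\<in>I. sat I SI (case_nat x e) E \<phi> = sat I SI (case_nat x e) E \<psi>) \<longrightarrow>
       (\<exists>Z\<in>SI. \<forall>x\<in>I. (x \<in> Z) = sat I SI (case_nat x e) (case_nat Z E) (liftS \<phi>)))"
  proof -
    have logic: "(((a \<longrightarrow> b) \<longrightarrow> (b \<longrightarrow> a) \<longrightarrow> False) \<longrightarrow> False) \<longleftrightarrow> a = b"
      "((\<forall>Z\<in>SI. P Z \<longrightarrow> False) \<longrightarrow> False) \<longleftrightarrow> (\<exists>Z\<in>SI. P Z)" for a b P by auto
    show ?thesis
      unfolding comprehension_axiom_def by (simp only: sat.simps ev.simps nat.case) (simp only: logic)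
  qed
  ultimately show ?thesis using \<phi> \<psi> lift by (simp cong: ball_cong)
qed

lemma sat_basic:
  assumes "\<phi> \<in> basic_axioms" and e: "\<And>n. e n \<in> I"
  shows "sat I SI e E \<phi>"
  using assms(1) unfolding basic_axioms_def
  by (auto simp: ax4 ax6 ax8 dest: ax2)

theorem sat_RCA0: "\<phi> \<in> RCA0 \<Longrightarrow> (\<And>n. e n \<in> I) \<Longrightarrow> (\<And>n. E n \<in> SI) \<Longrightarrow> sat I SI e E \<phi>"
proof -
  assume "\<phi> \<in> RCA0" and e: "\<And>n. e n \<in> I" and E: "\<And>n. E n \<in> SI"
  then obtain \<psi> m l where \<phi>: "\<phi> = (AllS ^^ l) ((AllN ^^ m) \<psi>)" and
    \<psi>: "\<psi> \<in> basic_axioms \<union> {induction_axiom \<phi> |\<phi>. \<phi> \<in> sigma0 1}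
     \<union> {comprehension_axiom \<phi> \<psi> |\<phi> \<psi>. \<phi> \<in> sigma0 1 \<and> \<psi> \<in> pi0 1}"
    unfolding RCA0_def closures_def by blast
  have st: "sat I SI e E \<psi>" if "\<And>n. e n \<in> I" "\<And>n. E n \<in> SI" for e E
    using \<psi> sat_basic[where e = e and E = E] sat_induction[where e = e and E = E]
      sat_comprehension[where e = e and E = E] that by blast
  show ?thesis
    unfolding \<phi>
  proof (rule sat_AllS_pow[OF sat_AllN_pow])
    show "sat I SI e E \<psi>" if "\<And>n. E n \<in> SI" "\<And>n. e n \<in> I" for E e
      by (rule st[OF that(2,1)])
  qed (rule e, rule E)
qed

end

subsection \<open>Codes of finite sequences\<close>

context model
begin

definition tri where
  "tri c \<longleftrightarrow> (\<exists>x. x \<prec> c \<oplus> \<one> \<and> (\<exists>y. y \<prec> c \<oplus> \<one> \<and> (\<exists>z. z \<prec> c \<oplus> \<one> \<and> c = pc x (pc y z))))"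

definition scode where
  "scode c \<longleftrightarrow> tri c \<and> (\<forall>c'. c' \<prec> c \<longrightarrow> tri c' \<longrightarrow> \<not> (Cd c' \<subseteq> Cd c \<and> Cd c \<subseteq> Cd c'))"

definition hlen where "hlen s l \<longleftrightarrow> (\<forall>i. i \<prec> l \<longleftrightarrow> (\<exists>j. mem (pc i j) s))"

definition fseq where
  "fseq s \<longleftrightarrow> scode s \<and> (\<forall>z. mem z s \<longrightarrow> (\<exists>x y. z = pc x y)) \<and>
     (\<forall>i j j'. mem (pc i j) s \<longrightarrow> mem (pc i j') s \<longrightarrow> j = j') \<and> (\<exists>l. hlen s l)"

lemma triple_le: "x \<preceq> pc x (pc y z)" "y \<preceq> pc x (pc y z)" "z \<preceq> pc x (pc y z)"
  using le_pc od.order_trans by blast+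

lemma tri_iff: "tri c \<longleftrightarrow> (\<exists>x y z. c = pc x (pc y z))"
  unfolding tri_def ls_add1 using triple_le by blast

lemma Dz_tri: "Tm f \<Longrightarrow> Dz (\<lambda>e. tri (f e))"
  by (rule Dz_app1[of tri]) (unfold tri_def, intro DzB_intros)

lemma Dz_scode: "Tm f \<Longrightarrow> Dz (\<lambda>e. scode (f e))"
  by (rule Dz_app1[of scode]) (unfold scode_def, intro DzB_intros Dz_tri)

lemma scode_exists:
  assumes K: "K u v" and P: "Dz (\<lambda>e. P (e 0))" "\<And>z. P z \<Longrightarrow> z \<prec> u"
  shows "\<exists>c. c \<prec> v \<and> scode c \<and> Cd c = {z. P z}"
proof -
  obtain x y z where xyz: "pc x (pc y z) \<prec> v" "\<forall>i. mem i (pc x (pc y z)) \<longleftrightarrow> i \<prec> u \<and> P i"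
    using code_exists_triple[OF K P(1)] by blast
  define c0 where "c0 = pc x (pc y z)"
  have c0: "tri c0" "Cd c0 = {z. P z}" using xyz(2) P(2) unfolding c0_def tri_iff Cd_def by blast+
  define Q where "Q = (\<lambda>c. tri c \<and> Cd c \<subseteq> Cd c0 \<and> Cd c0 \<subseteq> Cd c)"
  have "Dz (\<lambda>e. Q (e 0))" unfolding Q_def by (intro DzB_intros Dz_tri)
  moreover have "Q c0" unfolding Q_def using c0(1) by blast
  ultimately obtain c where c: "Q c" "\<And>c'. c' \<prec> c \<Longrightarrow> \<not> Q c'" using least_number[of Q] by blast
  have "c \<preceq> c0" using c(2) \<open>Q c0\<close> od.not_less by blast
  then have "c \<prec> v" using xyz(1) unfolding c0_def by order
  moreover have "Cd c = {z. P z}" using c(1) c0(2) unfolding Q_def by blast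
  moreover have "scode c" using c unfolding scode_def Q_def by blast
  ultimately show ?thesis by blast
qed

text \<open>An \<open>scode\<close> is the least code of its set, so it lies below any
  \<open>v\<close> that provides some code.\<close>

lemma scode_bound:
  assumes K: "K u v" and c: "scode c" "\<And>z. mem z c \<Longrightarrow> z \<prec> u"
  shows "c \<prec> v"
proof (rule ccontr)
  assume nl: "\<not> c \<prec> v"
  have "Dz (\<lambda>e. mem (e 0) c)" by (intro Dz_code Dz_intros)
  then obtain c' where c': "c' \<prec> v" "scode c'" "Cd c' = Cd c"
    using scode_exists[OF K, of "\<lambda>z. mem z c"] c(2) unfolding Cd_def by blast
  have "c' \<prec> c" using c'(1) nl by order
  then show False using c(1) c'(2,3) unfolding scode_def by blast
qed

definition bfun where
  "bfun Y n \<longleftrightarrow> (\<forall>i. i \<prec> n \<longrightarrow> (\<exists>j. j \<prec> \<one> \<oplus> \<one> \<and> pc i j \<in> Y)) \<and>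
    (\<forall>i. i \<prec> n \<longrightarrow> (\<forall>j. j \<prec> \<one> \<oplus> \<one> \<longrightarrow> (\<forall>j'. j' \<prec> \<one> \<oplus> \<one> \<longrightarrow> pc i j \<in> Y \<longrightarrow> pc i j' \<in> Y \<longrightarrow> j = j')))"

text \<open>The graph of the function cut off at length \<open>n\<close>; the explicit bound gives
  it the form required by \<open>DzB_Collect\<close>.\<close>

definition rest where
  "rest Y n = {z. z \<prec> pc n (\<one> \<oplus> \<one>) \<and> (\<exists>i. i \<prec> n \<and> (\<exists>j. j \<prec> \<one> \<oplus> \<one> \<and> (z = pc i j \<and> z \<in> Y)))}"

lemma rest_pc: "pc i j \<in> rest Y n \<longleftrightarrow> i \<prec> n \<and> j \<prec> \<one> \<oplus> \<one> \<and> pc i j \<in> Y"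
proof -
  have "pc i j \<prec> pc n (\<one> \<oplus> \<one>)" if "i \<prec> n" "j \<prec> \<one> \<oplus> \<one>" using that by (intro pc_strict) auto
  then show ?thesis unfolding rest_def by (auto simp: pc_inj)
qed

lemma restE: "z \<in> rest Y n \<Longrightarrow> \<exists>i j. z = pc i j \<and> i \<prec> n \<and> j \<prec> \<one> \<oplus> \<one> \<and> z \<in> Y"
  unfolding rest_def by blast

lemma fseq_rest:
  assumes Y: "bfun Y n" and c: "scode c" "Cd c = rest Y n"
  shows "fseq c" "hlen c n"
proof -
  have m: "mem z c \<longleftrightarrow> z \<in> rest Y n" for z using c(2) unfolding Cd_def by blast
  show h: "hlen c n" unfolding hlen_def m rest_pc using Y unfolding bfun_def by blast
  have "j = j'" if "mem (pc i j) c" "mem (pc i j') c" for i j j'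
    using that Y unfolding m rest_pc bfun_def by blast
  moreover have "\<exists>x y. z = pc x y" if "mem z c" for z using restE that unfolding m by blast
  ultimately show "fseq c" unfolding fseq_def using c(1) h by blast
qed

end

subsection \<open>The cut satisfies \<open>EM\<close> and \<open>WKL\<close>\<close>

context cut
begin

lemma SI_sub: "Z \<in> SI \<Longrightarrow> Z \<subseteq> I"
  unfolding SI_def by blast

lemma sat_infinite_set: "sat I SI e E (infinite_set n) \<longleftrightarrow> (\<forall>x\<in>I. \<exists>y\<in>I. x \<prec> y \<and> y \<in> E n)"
  by (simp add: infinite_set_def)

lemma sat_color: "sat I SI e E (color n x y i) \<longleftrightarrow> pc (pc (ev e x) (ev e y)) (ev e i) \<in> E n"
  by (simp add: color_def)

lemma sat_transitive_set: "sat I SI e E (transitive_set n m) \<longleftrightarrow> (\<forall>x\<in>I. \<forall>y\<in>I. \<forall>z\<in>I.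
   x \<prec> y \<and> y \<prec> z \<and> x \<in> E m \<and> y \<in> E m \<and> z \<in> E m \<longrightarrow> (\<forall>i\<in>I. i \<prec> \<one> \<oplus> \<one> \<longrightarrow>
    pc (pc x y) i \<in> E n \<and> pc (pc y z) i \<in> E n \<longrightarrow> pc (pc x z) i \<in> E n))"
  by (simp add: transitive_set_def sat_color two_def eval_nat_numeral conj_ac)

lemma sat_coloringD:
  assumes "sat I SI e E (coloring n)"
  shows "\<And>x y. x \<in> I \<Longrightarrow> y \<in> I \<Longrightarrow> x \<prec> y \<Longrightarrow> \<exists>i\<in>I. pc (pc x y) i \<in> E n"
    and "\<And>x y i j. x \<in> I \<Longrightarrow> y \<in> I \<Longrightarrow> i \<in> I \<Longrightarrow> j \<in> I \<Longrightarrow> pc (pc x y) i \<in> E n \<Longrightarrow> pc (pc x y) j \<in> E n \<Longrightarrow> i = j"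
    and "\<And>z. z \<in> I \<Longrightarrow> z \<in> E n \<Longrightarrow> \<exists>x y i. z = pc (pc x y) i \<and> x \<prec> y \<and> i \<prec> \<one> \<oplus> \<one>"
proof -
  have *: "(\<forall>z\<in>I. z \<in> E n \<longrightarrow> (\<exists>x\<in>I. \<exists>y\<in>I. \<exists>i\<in>I. z = pc (pc x y) i \<and> x \<prec> y \<and> i \<prec> \<one> \<oplus> \<one>)) \<and>
    (\<forall>x\<in>I. \<forall>y\<in>I. x \<prec> y \<longrightarrow> (\<exists>i\<in>I. pc (pc x y) i \<in> E n)) \<and>
    (\<forall>x\<in>I. \<forall>y\<in>I. \<forall>i\<in>I. \<forall>j\<in>I. pc (pc x y) i \<in> E n \<and> pc (pc x y) j \<in> E n \<longrightarrow> i = j)"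
    using assms by (simp add: coloring_def sat_color two_def eval_nat_numeral) blast
  show "\<And>x y. x \<in> I \<Longrightarrow> y \<in> I \<Longrightarrow> x \<prec> y \<Longrightarrow> \<exists>i\<in>I. pc (pc x y) i \<in> E n"
    using * by blast
  show "\<And>x y i j. x \<in> I \<Longrightarrow> y \<in> I \<Longrightarrow> i \<in> I \<Longrightarrow> j \<in> I \<Longrightarrow> pc (pc x y) i \<in> E n \<Longrightarrow> pc (pc x y) j \<in> E n \<Longrightarrow> i = j"
    using * by blast
  show "\<And>z. z \<in> I \<Longrightarrow> z \<in> E n \<Longrightarrow> \<exists>x y i. z = pc (pc x y) i \<and> x \<prec> y \<and> i \<prec> \<one> \<oplus> \<one>"
    using * by blast
qed

text \<open>The witness is the trace of a transitive \<open>F i\<close>, unbounded in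
  \<open>I\<close> since \<open>a j \<in> F i\<close> for all \<open>j \<ge> i\<close>.
  \<open>tr\<close> only compares whether colours are 1; as colours are unique and either 0 or 1,
  this settles both.\<close>

theorem sat_EM: "sat I SI e E EM"
proof -
  have "\<exists>H\<in>SI. sat I SI e (case_nat H (case_nat C E)) (infinite_set 0) \<and>
      sat I SI e (case_nat H (case_nat C E)) (transitive_set 1 0)"
    if C: "C \<in> SI" and col: "sat I SI e (case_nat C E) (coloring 0)" for C
  proof -
    obtain s where s: "s \<in> FS B" "C = s \<inter> I" using C unfolding SI_def by blast
    note c = sat_coloringD[OF col, unfolded nat.case]
    obtain i where i: "tr (\<lambda>x y. pc (pc x y) \<one> \<in> s) (F i)" using F_tr[OF s(1)] by blast
    define H where "H = F i \<inter> I"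
    have H: "H \<in> SI" unfolding H_def SI_def using FK_FS[OF F_FK] by blast
    have "\<forall>x\<in>I. \<exists>y\<in>I. x \<prec> y \<and> y \<in> H"
    proof
      fix x assume "x \<in> I"
      then obtain l where "\<forall>j\<ge>l. x \<prec> a j" using I_less by blast
      then show "\<exists>y\<in>I. x \<prec> y \<and> y \<in> H"
        unfolding H_def using a_I a_F by (intro bexI[of _ "a (max l i)"]) auto
    qed
    moreover have "pc (pc x z) u \<in> C"
      if xyz: "x \<in> H" "y \<in> H" "z \<in> H" "x \<prec> y" "y \<prec> z" and u: "u \<in> I" "pc (pc x y) u \<in> C" "pc (pc y z) u \<in> C" for x y z u
    proof -
      have I: "x \<in> I" "y \<in> I" "z \<in> I" and Fi: "x \<in> F i" "y \<in> F i" "z \<in> F i" using xyz unfolding H_def by auto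
      have f: "pc (pc p q) \<one> \<in> s \<longleftrightarrow> pc (pc p q) \<one> \<in> C" if "p \<in> I" "q \<in> I" for p q
        using s(2) I_pc[OF I_pc[OF that] I_one] by blast
      have T: "(pc (pc x y) \<one> \<in> C) = (pc (pc y z) \<one> \<in> C) \<Longrightarrow> (pc (pc x z) \<one> \<in> C) = (pc (pc x y) \<one> \<in> C)"
        using i Fi xyz(4,5) f I unfolding tr_def by metis
      have xz: "x \<prec> z" using xyz(4,5) by order
      obtain w where w: "w \<in> I" "pc (pc x z) w \<in> C" using c(1)[OF I(1,3) xz] by blast
      have two: "v = \<zero> \<or> v = \<one>" if v: "pc (pc p q) v \<in> C" for p q v
      proof -
        obtain x' y' v' where "pc (pc p q) v = pc (pc x' y') v'" "v' \<prec> \<one> \<oplus> \<one>"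
          using c(3)[of "pc (pc p q) v"] v SI_sub[OF C] by blast
        then have "v \<prec> \<one> \<oplus> \<one>" by (simp add: pc_inj)
        then have "v \<prec> \<zero> \<oplus> \<one> \<or> v = \<one>" using ax8[of v "\<one>"] by simp
        then show ?thesis using ax8[of v "\<zero>"] ax7 by blast
      qed
      have one: "pc (pc p q) \<one> \<in> C \<longleftrightarrow> v = \<one>" if "p \<in> I" "q \<in> I" "v \<in> I" "pc (pc p q) v \<in> C" for p q v
        using c(2)[OF that(1,2,3) I_one that(4)] that(4) by blast
      have "(w = \<one>) = (u = \<one>)"
        using T one[OF I(1,2) u(1,2)] one[OF I(2,3) u(1,3)] one[OF I(1,3) w] by blast
      then have "w = u" using two[OF w(2)] two[OF u(2)] by auto
      then show ?thesis using w(2) by simp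
    qed
    ultimately show ?thesis
      unfolding sat_infinite_set sat_transitive_set
      by (intro bexI[OF _ H] conjI ballI impI) (simp_all, blast)
  qed
  then show ?thesis unfolding EM_def by simp
qed

text \<open>Compactness by overspill: finite paths of every length in \<open>I\<close> exist, hence
  also a coded one whose length is outside \<open>I\<close>, and its trace is total on
  \<open>I\<close>.\<close>

lemma wkl_core:
  assumes T: "T \<in> SI"
    and seq: "\<And>\<sigma>. \<sigma> \<in> T \<Longrightarrow> fseq \<sigma>" "\<And>\<sigma> i j. \<sigma> \<in> T \<Longrightarrow> mem (pc i j) \<sigma> \<Longrightarrow> j \<prec> \<one> \<oplus> \<one>"
    and tree: "\<And>\<sigma> \<tau>. \<sigma> \<in> T \<Longrightarrow> \<tau> \<in> I \<Longrightarrow> fseq \<tau> \<Longrightarrow> Cd \<tau> \<subseteq> Cd \<sigma> \<Longrightarrow> \<tau> \<in> T"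
    and inf: "\<And>x. x \<in> I \<Longrightarrow> \<exists>\<sigma>\<in>T. x \<prec> \<sigma>"
  shows "\<exists>G\<in>SI. (\<forall>z\<in>G. \<exists>x\<in>I. \<exists>y\<in>I. z = pc x y) \<and> (\<forall>x\<in>I. \<exists>y\<in>I. pc x y \<in> G) \<and>
    (\<forall>x y y'. pc x y \<in> G \<longrightarrow> pc x y' \<in> G \<longrightarrow> y = y') \<and>
    (\<forall>m\<in>I. \<exists>c\<in>T. fseq c \<and> hlen c m \<and> (\<forall>z. mem z c \<longrightarrow> z \<in> G))"
proof -
  obtain t where t: "t \<in> FS B" "T = t \<inter> I" using T unfolding SI_def by blast
  have two_I: "\<one> \<oplus> \<one> \<in> I" by (simp add: I_ad)
  have kB: "k \<prec> B" using K_less[OF KB] le_pc(1)[of k k] le_pc(1)[of "pc k k" "pc k k"] by order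
  \<comment> \<open>The coded set \<open>t\<close> is used instead of its trace \<open>T\<close>, so
    that \<open>\<Theta>\<close> is definable in the ambient model and can hold outside
    \<open>I\<close>.\<close>
  define \<Theta> where "\<Theta> = (\<lambda>n. \<exists>y. y \<prec> B \<and> (bfun (Cd y) n \<and> (\<forall>m. m \<prec> n \<oplus> \<one> \<longrightarrow>
     (\<exists>c\<in>t. scode c \<and> Cd c \<subseteq> rest (Cd y) m \<and> rest (Cd y) m \<subseteq> Cd c))))"
  have "Dz (\<lambda>e. \<Theta> (e 0))"
    unfolding \<Theta>_def bfun_def rest_def by (intro DzB_intros DzB_FS[OF t(1)] Dz_scode)
  have code_I: "\<exists>v\<in>I. K (pc m (\<one> \<oplus> \<one>)) v" if "m \<in> I" for m by (rule I_K[OF I_pc[OF that two_I]])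
  have std: "\<Theta> n" if n: "n \<in> I" for n
  proof -
    \<comment> \<open>Codes of binary sequences of length less than \<open>n\<close> lie below
      \<open>v\<close>. As \<open>T\<close> is unbounded in \<open>I\<close>, it has an element
      above \<open>v\<close>, whose length is therefore at least \<open>n\<close>.\<close>
    obtain v where v: "v \<in> I" "K (pc n (\<one> \<oplus> \<one>)) v" using code_I[OF n] by blast
    obtain \<sigma> where \<sigma>: "\<sigma> \<in> T" "v \<prec> \<sigma>" using inf[OF v(1)] by blast
    obtain l where l: "hlen \<sigma> l" using seq(1)[OF \<sigma>(1)] unfolding fseq_def by blast
    have nl: "n \<preceq> l"
    proof (rule ccontr)
      assume "\<not> n \<preceq> l"
      then have ln: "l \<prec> n" by order
      have "z \<prec> pc n (\<one> \<oplus> \<one>)" if z: "mem z \<sigma>" for z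
      proof -
        obtain i j where ij: "z = pc i j" using seq(1)[OF \<sigma>(1)] z unfolding fseq_def by blast
        have "i \<prec> l" using l z unfolding hlen_def ij by blast
        then have "i \<prec> n" using ln by order
        moreover have "j \<prec> \<one> \<oplus> \<one>" using seq(2)[OF \<sigma>(1)] z unfolding ij by blast
        ultimately show ?thesis unfolding ij by (intro pc_strict) auto
      qed
      then have "\<sigma> \<prec> v" using scode_bound[OF v(2)] seq(1)[OF \<sigma>(1)] unfolding fseq_def by blast
      then show False using \<sigma>(2) by order
    qed
    have bf: "bfun (Cd \<sigma>) m" if "m \<preceq> n" for m
      unfolding bfun_def Cd_def mem_Collect_eq
    proof (intro conjI allI impI)
      fix i assume "i \<prec> m"
      then have "i \<prec> l" using that nl by order
      then show "\<exists>j. j \<prec> \<one> \<oplus> \<one> \<and> mem (pc i j) \<sigma>" using l seq(2)[OF \<sigma>(1)] unfolding hlen_def by blast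
    next
      fix i j j' assume "mem (pc i j) \<sigma>" "mem (pc i j') \<sigma>"
      then show "j = j'" using seq(1)[OF \<sigma>(1)] unfolding fseq_def by blast
    qed
    have "\<exists>c\<in>t. scode c \<and> Cd c \<subseteq> rest (Cd \<sigma>) m \<and> rest (Cd \<sigma>) m \<subseteq> Cd c" if m: "m \<prec> n \<oplus> \<one>" for m
    proof -
      have mn: "m \<preceq> n" using m ls_add1 by blast
      obtain v where v: "v \<in> I" "K (pc m (\<one> \<oplus> \<one>)) v" using code_I[OF I_down[OF n mn]] by blast
      have D: "Dz (\<lambda>e. e 0 \<in> rest (Cd \<sigma>) m)" unfolding rest_def mem_Collect_eq by (intro DzB_intros)
      have "\<exists>c. c \<prec> v \<and> scode c \<and> Cd c = {z. z \<in> rest (Cd \<sigma>) m}"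
        by (rule scode_exists[OF v(2) D]) (simp add: rest_def)
      then obtain c where c: "c \<prec> v" "scode c" "Cd c = rest (Cd \<sigma>) m" by auto
      have "c \<in> I" using I_down[OF v(1)] c(1) od.less_imp_le by blast
      moreover have "Cd c \<subseteq> Cd \<sigma>" unfolding c(3) rest_def by blast
      ultimately have "c \<in> T" using tree[OF \<sigma>(1)] fseq_rest(1)[OF bf[OF mn] c(2,3)] by blast
      then show ?thesis using t(2) c(2,3) by blast
    qed
    moreover have "\<sigma> \<prec> k" using I_k SI_sub[OF T] \<sigma>(1) by blast
    then have "\<sigma> \<prec> B" using kB by order
    ultimately show ?thesis unfolding \<Theta>_def using bf[OF od.order_refl]
      by (intro exI[of _ \<sigma>] conjI allI impI)
  qed
  \<comment> \<open>Otherwise \<open>\<Theta>\<close> would define \<open>I\<close>, and the least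
    number outside \<open>I\<close> would be the successor of an element of
    \<open>I\<close>.\<close>
  have "\<exists>n. n \<notin> I \<and> \<Theta> n"
  proof (rule ccontr)
    assume no: "\<not> ?thesis"
    have nk: "\<not> \<Theta> k" using no I_k[of k] ls_irrefl by blast
    have D: "Dz (\<lambda>e. \<not> \<Theta> (e 0))" by (rule Dz_not) fact
    obtain n where n: "\<not> \<Theta> n" "\<And>m. m \<prec> n \<Longrightarrow> \<not> \<not> \<Theta> m"
      by (rule least_number[where P = "\<lambda>n. \<not> \<Theta> n", OF D nk], rule that)
    have nI: "n \<notin> I" using n(1) std by blast
    then obtain n' where n': "n = n' \<oplus> \<one>" using zero_or_Suc[of n] I_zero by metis
    then have "n' \<in> I" using n(2)[of n'] no by auto
    then show False using nI I_Suc n' by blast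
  qed
  then obtain n y where n: "n \<notin> I" and y: "bfun (Cd y) n"
    "\<And>m. m \<prec> n \<oplus> \<one> \<Longrightarrow> \<exists>c\<in>t. scode c \<and> Cd c \<subseteq> rest (Cd y) m \<and> rest (Cd y) m \<subseteq> Cd c"
    unfolding \<Theta>_def by blast
  have In: "x \<prec> n" if "x \<in> I" for x using I_down[OF that] n od.not_less by blast
  have "Dz (\<lambda>e. \<exists>i. i \<prec> k \<and> (\<exists>j. j \<prec> \<one> \<oplus> \<one> \<and> (e 0 = pc i j \<and> e 0 \<in> Cd y)))" by (intro DzB_intros)
  then obtain G where G: "G \<in> SI"
    "\<forall>z\<in>I. (z \<in> G) = (\<exists>i. i \<prec> k \<and> (\<exists>j. j \<prec> \<one> \<oplus> \<one> \<and> (z = pc i j \<and> z \<in> Cd y)))"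
    using SI_comprehension[where P = "\<lambda>z. \<exists>i. i \<prec> k \<and> (\<exists>j. j \<prec> \<one> \<oplus> \<one> \<and> (z = pc i j \<and> z \<in> Cd y))"] by blast
  have GE: "\<exists>i j. z = pc i j \<and> j \<prec> \<one> \<oplus> \<one> \<and> z \<in> Cd y \<and> i \<in> I \<and> j \<in> I" if z: "z \<in> G" for z
  proof -
    have zI: "z \<in> I" using SI_sub[OF G(1)] z by blast
    then obtain i j where ij: "z = pc i j" "j \<prec> \<one> \<oplus> \<one>" "z \<in> Cd y" using G(2) z by blast
    have "i \<in> I" "j \<in> I" using I_down[OF zI] le_pc unfolding ij(1) by blast+
    then show ?thesis using ij by blast
  qed
  show ?thesis
  proof (intro bexI[OF _ G(1)] conjI)
    show "\<forall>z\<in>G. \<exists>x\<in>I. \<exists>y\<in>I. z = pc x y" using GE by blast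
    show "\<forall>x\<in>I. \<exists>y\<in>I. pc x y \<in> G"
    proof
      fix x assume x: "x \<in> I"
      obtain j where j: "j \<prec> \<one> \<oplus> \<one>" "pc x j \<in> Cd y" using y(1) In[OF x] unfolding bfun_def by blast
      have jI: "j \<in> I" using I_down[OF two_I] j(1) od.less_imp_le by blast
      have "pc x j \<in> G" using bspec[OF G(2) I_pc[OF x jI]] I_k[OF x] j by blast
      then show "\<exists>y\<in>I. pc x y \<in> G" using jI by blast
    qed
    show "\<forall>x z z'. pc x z \<in> G \<longrightarrow> pc x z' \<in> G \<longrightarrow> z = z'"
    proof (intro allI impI)
      fix x z z' assume "pc x z \<in> G" "pc x z' \<in> G"
      then have "z \<prec> \<one> \<oplus> \<one>" "pc x z \<in> Cd y" "x \<in> I" "z' \<prec> \<one> \<oplus> \<one>" "pc x z' \<in> Cd y"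
        using GE by (metis pc_inj)+
      then show "z = z'" using y(1) In unfolding bfun_def by blast
    qed
    show "\<forall>m\<in>I. \<exists>c\<in>T. fseq c \<and> hlen c m \<and> (\<forall>z. mem z c \<longrightarrow> z \<in> G)"
    proof
      fix m assume m: "m \<in> I"
      have mn: "m \<prec> n" by (rule In[OF m])
      then have "m \<prec> n \<oplus> \<one>" using ax8 by blast
      then obtain c where c: "c \<in> t" "scode c" "Cd c = rest (Cd y) m" using y(2) by blast
      obtain v where v: "v \<in> I" "K (pc m (\<one> \<oplus> \<one>)) v" using code_I[OF m] by blast
      have "z \<prec> pc m (\<one> \<oplus> \<one>)" if "mem z c" for z using that c(3) unfolding Cd_def rest_def by blast
      \<comment> \<open>So far \<open>c\<close> is only known to be in \<open>t\<close>. The bound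
        on sequence codes puts it in \<open>I\<close>, hence in \<open>T\<close>.\<close>
      then have "c \<prec> v" by (rule scode_bound[OF v(2) c(2)])
      then have cI: "c \<in> I" using I_down[OF v(1)] od.less_imp_le by blast
      have bm: "bfun (Cd y) m" using y(1) mn od.less_trans unfolding bfun_def by blast
      have "z \<in> G" if z: "mem z c" for z
      proof -
        have zI: "z \<in> I" using I_down[OF cI] mem_less[OF z] od.less_imp_le by blast
        have "z \<in> rest (Cd y) m" using z c(3) unfolding Cd_def by blast
        then obtain i j where "z = pc i j" "i \<prec> m" "j \<prec> \<one> \<oplus> \<one>" "z \<in> Cd y" using restE by blast
        moreover from this have "i \<prec> k" using I_k[OF m] by order
        ultimately show ?thesis using bspec[OF G(2) zI] by blast
      qed
      then show "\<exists>c\<in>T. fseq c \<and> hlen c m \<and> (\<forall>z. mem z c \<longrightarrow> z \<in> G)"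
        using c(1) cI t(2) fseq_rest[OF bm c(2,3)] by blast
    qed
  qed
qed

end

section \<open>Meaning of the coding formulas in the cut\<close>

context cut
begin

text \<open>Witnesses that occur in decoding are bounded by the code, so they lie in
  \<open>I\<close>, and the formula has the same meaning there as the predicate in the ambient
  model. The formulas up to \<open>fin_seq\<close> are treated in the same way.\<close>

lemma sat_triple: "ev e c \<in> I \<Longrightarrow> sat I SI e E (triple c) \<longleftrightarrow> tri (ev e c)"
proof -
  assume c: "ev e c \<in> I"
  have "sat I SI e E (triple c) \<longleftrightarrow> (\<exists>x\<in>I. \<exists>y\<in>I. \<exists>z\<in>I. ev e c = pc x (pc y z))"
    by (simp add: triple_def eval_nat_numeral)
  also have "\<dots> \<longleftrightarrow> tri (ev e c)"
  proof
    assume "tri (ev e c)"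
    then obtain x y z where "ev e c = pc x (pc y z)" unfolding tri_iff by blast
    moreover from this have "x \<in> I" "y \<in> I" "z \<in> I" using I_down[OF c] triple_le by metis+
    ultimately show "\<exists>x\<in>I. \<exists>y\<in>I. \<exists>z\<in>I. ev e c = pc x (pc y z)" by blast
  qed (auto simp: tri_iff)
  finally show ?thesis .
qed

lemma sat_in_code: "ev e c \<in> I \<Longrightarrow> sat I SI e E (in_code i c) \<longleftrightarrow> mem (ev e i) (ev e c)"
proof -
  assume c: "ev e c \<in> I"
  have "sat I SI e E (in_code i c) \<longleftrightarrow> (\<exists>x\<in>I. \<exists>y\<in>I. \<exists>z\<in>I. ev e c = pc x (pc y z) \<and> ev e i \<prec> x \<and>
      (\<exists>q\<in>I. z = q \<otimes> cq y (ev e i)))"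
    by (simp add: in_code_def eval_nat_numeral cq_def) blast
  also have "\<dots> \<longleftrightarrow> mem (ev e i) (ev e c)"
  proof
    assume "mem (ev e i) (ev e c)"
    then obtain x y z q where *: "ev e c = pc x (pc y z)" "ev e i \<prec> x" "z = cq y (ev e i) \<otimes> q"
      unfolding mem_def dv_def by blast
    have I: "x \<in> I" "y \<in> I" "z \<in> I" using I_down[OF c] triple_le *(1) by metis+
    have "z = q \<otimes> cq y (ev e i)" using *(3) by (simp add: mul_comm)
    moreover have "q \<preceq> q \<otimes> cq y (ev e i)" by (rule le_mul) (simp add: cq_def)
    ultimately have "q \<in> I" "z = q \<otimes> cq y (ev e i)" using I_down[OF I(3)] by auto
    then show "\<exists>x\<in>I. \<exists>y\<in>I. \<exists>z\<in>I. ev e c = pc x (pc y z) \<and> ev e i \<prec> x \<and> (\<exists>q\<in>I. z = q \<otimes> cq y (ev e i))"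
      using * I by blast
  next
    assume "\<exists>x\<in>I. \<exists>y\<in>I. \<exists>z\<in>I. ev e c = pc x (pc y z) \<and> ev e i \<prec> x \<and> (\<exists>q\<in>I. z = q \<otimes> cq y (ev e i))"
    then obtain x y z q where *: "ev e c = pc x (pc y z)" "ev e i \<prec> x" "z = q \<otimes> cq y (ev e i)" by blast
    have "z = cq y (ev e i) \<otimes> q" using *(3) by (simp add: mul_comm)
    then show "mem (ev e i) (ev e c)" unfolding mem_def dv_def using *(1,2) by blast
  qed
  finally show ?thesis .
qed

lemma mem_I: "mem i c \<Longrightarrow> c \<in> I \<Longrightarrow> i \<in> I"
  using I_down mem_less od.less_imp_le by blast

lemma mem_pc_I: "mem (pc i j) c \<Longrightarrow> c \<in> I \<Longrightarrow> i \<in> I \<and> j \<in> I"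
  using mem_I I_down le_pc by blast

lemma sat_set_code: "ev e c \<in> I \<Longrightarrow> sat I SI e E (set_code c) \<longleftrightarrow> scode (ev e c)"
proof -
  assume c: "ev e c \<in> I"
  have "sat I SI e E (set_code c) \<longleftrightarrow> tri (ev e c) \<and> (\<forall>c'\<in>I. c' \<prec> ev e c \<longrightarrow> tri c' \<longrightarrow>
      \<not> (\<forall>z\<in>I. mem z c' = mem z (ev e c)))"
    by (simp add: set_code_def sat_triple sat_in_code c eval_nat_numeral iff_conv_conj_imp[symmetric]
        cong: ball_cong) blast
  also have "\<dots> \<longleftrightarrow> scode (ev e c)"
  proof -
    have "(\<forall>z\<in>I. mem z c' = mem z (ev e c)) \<longleftrightarrow> Cd c' \<subseteq> Cd (ev e c) \<and> Cd (ev e c) \<subseteq> Cd c'" if "c' \<in> I" for c'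
      using mem_I[OF _ that] mem_I[OF _ c] unfolding Cd_def by blast
    moreover have "c' \<in> I" if "c' \<prec> ev e c" for c' using I_down[OF c] that od.less_imp_le by blast
    ultimately show ?thesis unfolding scode_def by blast
  qed
  finally show ?thesis .
qed

lemma sat_has_length:
  assumes s: "ev e s \<in> I" and l: "ev e l \<in> I"
  shows "sat I SI e E (has_length s l) \<longleftrightarrow> hlen (ev e s) (ev e l)"
proof -
  have "sat I SI e E (has_length s l) \<longleftrightarrow> (\<forall>i\<in>I. (i \<prec> ev e l) = (\<exists>j\<in>I. mem (pc i j) (ev e s)))"
    by (simp add: has_length_def sat_in_code s l eval_nat_numeral cong: ball_cong) blast
  also have "\<dots> \<longleftrightarrow> hlen (ev e s) (ev e l)"
    unfolding hlen_def using mem_pc_I[OF _ s] I_down[OF l] od.less_imp_le by meson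
  finally show ?thesis .
qed

lemma sat_fin_seq:
  assumes s: "ev e s \<in> I"
  shows "sat I SI e E (fin_seq s) \<longleftrightarrow> fseq (ev e s)"
proof -
  let ?s = "ev e s"
  have "sat I SI e E (fin_seq s) \<longleftrightarrow> scode ?s \<and>
     (\<forall>z\<in>I. mem z ?s \<longrightarrow> (\<exists>x\<in>I. \<exists>y\<in>I. z = pc x y)) \<and>
     (\<forall>i\<in>I. \<forall>j\<in>I. \<forall>j'\<in>I. mem (pc i j) ?s \<longrightarrow> mem (pc i j') ?s \<longrightarrow> j = j') \<and> (\<exists>l\<in>I. hlen ?s l)"
    by (simp add: fin_seq_def sat_set_code sat_in_code sat_has_length s eval_nat_numeral cong: ball_cong bex_cong)
  also have "\<dots> \<longleftrightarrow> fseq ?s"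
  proof -
    \<comment> \<open>A length cannot exceed the code \<open>?s\<close>: otherwise \<open>?s\<close>
      itself would be in the domain, and a pair with first component \<open>?s\<close> would be
      smaller than \<open>?s\<close>.\<close>
    have "l \<in> I" if l: "hlen ?s l" for l
    proof (rule I_down[OF s])
      show "l \<preceq> ?s"
      proof (rule ccontr)
        assume "\<not> l \<preceq> ?s"
        then have "?s \<prec> l" by order
        then obtain j where "mem (pc ?s j) ?s" using l unfolding hlen_def by blast
        then have "pc ?s j \<prec> ?s" by (rule mem_less)
        then show False using le_pc(1)[of ?s j] by order
      qed
    qed
    then have l: "(\<exists>l\<in>I. hlen ?s l) \<longleftrightarrow> (\<exists>l. hlen ?s l)" by blast
    have pairs: "(\<forall>z\<in>I. mem z ?s \<longrightarrow> (\<exists>x\<in>I. \<exists>y\<in>I. z = pc x y)) \<longleftrightarrow> (\<forall>z. mem z ?s \<longrightarrow> (\<exists>x y. z = pc x y))"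
    proof (intro iffI allI ballI impI)
      fix z assume "\<forall>z\<in>I. mem z ?s \<longrightarrow> (\<exists>x\<in>I. \<exists>y\<in>I. z = pc x y)" "mem z ?s"
      then show "\<exists>x y. z = pc x y" using mem_I[OF _ s] by blast
    next
      fix z assume "\<forall>z. mem z ?s \<longrightarrow> (\<exists>x y. z = pc x y)" and m: "mem z ?s"
      then obtain x y where z: "z = pc x y" by blast
      have "x \<in> I \<and> y \<in> I" using mem_pc_I[OF m[unfolded z] s] .
      then show "\<exists>x\<in>I. \<exists>y\<in>I. z = pc x y" using z by blast
    qed
    have uniq: "(\<forall>i\<in>I. \<forall>j\<in>I. \<forall>j'\<in>I. mem (pc i j) ?s \<longrightarrow> mem (pc i j') ?s \<longrightarrow> j = j') \<longleftrightarrow>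
       (\<forall>i j j'. mem (pc i j) ?s \<longrightarrow> mem (pc i j') ?s \<longrightarrow> j = j')"
    proof (intro iffI allI ballI impI)
      fix i j j' assume h: "\<forall>i\<in>I. \<forall>j\<in>I. \<forall>j'\<in>I. mem (pc i j) ?s \<longrightarrow> mem (pc i j') ?s \<longrightarrow> j = j'"
        and m: "mem (pc i j) ?s" "mem (pc i j') ?s"
      show "j = j'" using h m mem_pc_I[OF m(1) s] mem_pc_I[OF m(2) s] by blast
    qed blast
    show ?thesis unfolding fseq_def l pairs uniq by (rule refl)
  qed
  finally show ?thesis .
qed

lemma sat_binary_treeD:
  assumes "sat I SI e E (binary_tree n)" and T: "E n \<in> SI"
  shows "\<And>\<sigma>. \<sigma> \<in> E n \<Longrightarrow> fseq \<sigma>"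
    and "\<And>\<sigma> i j. \<sigma> \<in> E n \<Longrightarrow> mem (pc i j) \<sigma> \<Longrightarrow> j \<prec> \<one> \<oplus> \<one>"
    and "\<And>\<sigma> \<tau>. \<sigma> \<in> E n \<Longrightarrow> \<tau> \<in> I \<Longrightarrow> fseq \<tau> \<Longrightarrow> Cd \<tau> \<subseteq> Cd \<sigma> \<Longrightarrow> \<tau> \<in> E n"
proof -
  have *: "(\<forall>\<sigma>\<in>I. \<sigma> \<in> E n \<longrightarrow> fseq \<sigma> \<and> (\<forall>i\<in>I. \<forall>j\<in>I. mem (pc i j) \<sigma> \<longrightarrow> j \<prec> \<one> \<oplus> \<one>)) \<and>
    (\<forall>\<sigma>\<in>I. \<forall>\<tau>\<in>I. \<sigma> \<in> E n \<and> fseq \<tau> \<and> (\<forall>z\<in>I. mem z \<tau> \<longrightarrow> mem z \<sigma>) \<longrightarrow> \<tau> \<in> E n)"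
    using assms(1)
    by (simp add: binary_tree_def binary_seq_def initial_segment_def sat_fin_seq sat_in_code two_def
        eval_nat_numeral cong: ball_cong) blast
  have sub: "\<sigma> \<in> I" if "\<sigma> \<in> E n" for \<sigma> using SI_sub[OF T] that by blast
  show "\<And>\<sigma>. \<sigma> \<in> E n \<Longrightarrow> fseq \<sigma>" using * sub by blast
  show "\<And>\<sigma> i j. \<sigma> \<in> E n \<Longrightarrow> mem (pc i j) \<sigma> \<Longrightarrow> j \<prec> \<one> \<oplus> \<one>" using * sub mem_pc_I by meson
  show "\<And>\<sigma> \<tau>. \<sigma> \<in> E n \<Longrightarrow> \<tau> \<in> I \<Longrightarrow> fseq \<tau> \<Longrightarrow> Cd \<tau> \<subseteq> Cd \<sigma> \<Longrightarrow> \<tau> \<in> E n"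
    using * sub unfolding Cd_def by blast
qed

lemma sat_path_through:
  assumes T: "T \<in> SI"
    and G: "\<forall>z\<in>G. \<exists>x\<in>I. \<exists>y\<in>I. z = pc x y" "\<forall>x\<in>I. \<exists>y\<in>I. pc x y \<in> G"
      "\<forall>x y y'. pc x y \<in> G \<longrightarrow> pc x y' \<in> G \<longrightarrow> y = y'"
    and c: "\<forall>m\<in>I. \<exists>c\<in>T. fseq c \<and> hlen c m \<and> (\<forall>z. mem z c \<longrightarrow> z \<in> G)"
  shows "sat I SI e (case_nat G (case_nat T E)) (path_through 0 1)"
proof -
  let ?E = "case_nat G (case_nat T E)"
  have "sat I SI e ?E (total_function 0)"
    using G by (simp add: total_function_def eval_nat_numeral)
  moreover have "\<forall>m\<in>I. \<exists>c\<in>I. c \<in> T \<and> fseq c \<and> hlen c m \<and> (\<forall>z\<in>I. mem z c \<longrightarrow> z \<in> G)"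
    using c SI_sub[OF T] by blast
  then have "sat I SI e ?E (AllN (ExN (Var 0 \<^bold>\<in> 1 \<^bold>\<and> fin_seq (Var 0) \<^bold>\<and> has_length (Var 0) (Var 1)
         \<^bold>\<and> AllN (in_code (Var 0) (Var 1) \<^bold>\<longrightarrow> Var 0 \<^bold>\<in> 0))))"
    by (simp add: sat_fin_seq sat_has_length sat_in_code cong: ball_cong bex_cong) blast
  ultimately show ?thesis unfolding path_through_def by (simp only: sat.simps) blast
qed

theorem sat_WKL: "sat I SI e E WKL"
proof -
  have "\<exists>G\<in>SI. sat I SI e (case_nat G (case_nat T E)) (path_through 0 1)"
    if T: "T \<in> SI" and tree: "sat I SI e (case_nat T E) (binary_tree 0)"
      and inf: "sat I SI e (case_nat T E) (infinite_set 0)" for T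
  proof -
    note t = sat_binary_treeD[OF tree, unfolded nat.case, OF T]
    have inf': "\<exists>\<sigma>\<in>T. x \<prec> \<sigma>" if "x \<in> I" for x using inf that unfolding sat_infinite_set nat.case by blast
    have "\<exists>G\<in>SI. (\<forall>z\<in>G. \<exists>x\<in>I. \<exists>y\<in>I. z = pc x y) \<and> (\<forall>x\<in>I. \<exists>y\<in>I. pc x y \<in> G) \<and>
      (\<forall>x y y'. pc x y \<in> G \<longrightarrow> pc x y' \<in> G \<longrightarrow> y = y') \<and>
      (\<forall>m\<in>I. \<exists>c\<in>T. fseq c \<and> hlen c m \<and> (\<forall>z. mem z c \<longrightarrow> z \<in> G))"
    proof (rule wkl_core[OF T])
      show "fseq \<sigma>" if "\<sigma> \<in> T" for \<sigma> by (rule t(1)[OF that])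
      show "j \<prec> \<one> \<oplus> \<one>" if "\<sigma> \<in> T" "mem (pc i j) \<sigma>" for \<sigma> i j by (rule t(2)[OF that])
      show "\<tau> \<in> T" if "\<sigma> \<in> T" "\<tau> \<in> I" "fseq \<tau>" "Cd \<tau> \<subseteq> Cd \<sigma>" for \<sigma> \<tau> by (rule t(3)[OF that])
      show "\<exists>\<sigma>\<in>T. x \<prec> \<sigma>" if "x \<in> I" for x by (rule inf'[OF that])
    qed
    then obtain G where "G \<in> SI" "\<forall>z\<in>G. \<exists>x\<in>I. \<exists>y\<in>I. z = pc x y" "\<forall>x\<in>I. \<exists>y\<in>I. pc x y \<in> G"
      "\<forall>x y y'. pc x y \<in> G \<longrightarrow> pc x y' \<in> G \<longrightarrow> y = y'"
      "\<forall>m\<in>I. \<exists>c\<in>T. fseq c \<and> hlen c m \<and> (\<forall>z. mem z c \<longrightarrow> z \<in> G)"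
      by (elim bexE conjE)
    then show ?thesis using sat_path_through[OF T] by blast
  qed
  then show ?thesis unfolding WKL_def by simp
qed

text \<open>\<open>w\<close> is the greatest element of \<open>F (Suc i)\<close>. It lies above the
  cut because \<open>F (Suc i)\<close> contains \<open>a j\<close> for all large \<open>j\<close>,
  so a quantifier bounded by \<open>w\<close> covers all of \<open>I\<close>.\<close>

lemma A_cut: "\<exists>w. (\<forall>z\<in>I. z \<preceq> w) \<and> A (a i) (a (Suc i)) w"
proof -
  have "Dz (\<lambda>e. e 0 \<in> F (Suc i))" by (rule DzB_mem[OF DzB_FK[OF F_FK] Tm_var])
  moreover have "y \<preceq> k" if "y \<in> F (Suc i)" for y using FK_less[OF F_FK that] by simp
  ultimately obtain w where w: "w \<in> F (Suc i)" "\<And>y. y \<in> F (Suc i) \<Longrightarrow> y \<preceq> w"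
    using greatest_number[of "\<lambda>y. y \<in> F (Suc i)" "a (Suc i)" k, OF _ a_in] by metis
  have "z \<preceq> w" if z: "z \<in> I" for z
  proof -
    obtain l where "\<forall>j\<ge>l. z \<prec> a j" using I_less[OF z] by blast
    then have "z \<prec> a (max l (Suc i))" by simp
    moreover have "a (max l (Suc i)) \<preceq> w" by (rule w(2)[OF a_F]) simp
    ultimately show ?thesis by order
  qed
  then show ?thesis using A_a[OF lessI a_in w(1)] by blast
qed

end

section \<open>Construction of the sequence that defines the cut\<close>

context saturated_world
begin

lemma ex_cut:
  assumes F0: "F0 \<in> FK" "\<And>n. L B n F0"
  shows "\<exists>F a. cut zr on ad ml ls S X A k B F a"
proof -
  \<comment> \<open>Every pair of a code and a number occurs as \<open>dec i\<close> for arbitrarily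
    large \<open>i\<close>, as \<open>F_stable\<close> demands.\<close>
  define dec :: "nat \<Rightarrow> 'm \<times> 'm" where "dec = (\<lambda>i. from_nat (fst (prod_decode i)))"
  have dec: "dec (prod_encode (to_nat p, j)) = p" for p j unfolding dec_def by simp
  define stable where "stable = (\<lambda>s c F F'. (\<forall>y\<in>F. K (c \<oplus> \<one>) y) \<longrightarrow> (\<forall>y\<in>F'. \<forall>z\<in>F'. \<forall>x. x \<prec> c \<oplus> \<one> \<longrightarrow>
      (\<exists>v. v \<prec> y \<and> pc x v \<in> s) = (\<exists>v. v \<prec> z \<and> pc x v \<in> s)))"
  define Q where "Q = (\<lambda>i F F'. F' \<subseteq> F \<and> (\<exists>a\<in>F. apart {a} F') \<and> (fst (dec i) \<prec> B \<longrightarrow>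
    tr (\<lambda>x y. pc (pc x y) \<one> \<in> Cd (fst (dec i))) F' \<and> stable (Cd (fst (dec i))) (snd (dec i)) F F'))"
  have "\<exists>F. \<forall>i. (F i \<in> FK \<and> (\<forall>n. L B n (F i))) \<and> Q i (F i) (F (Suc i))"
  proof (rule dependent_nat_choice)
    show "\<exists>F. F \<in> FK \<and> (\<forall>n. L B n F)" using F0 by blast
    fix F i assume F: "F \<in> FK \<and> (\<forall>n. L B n F)"
    \<comment> \<open>The empty set is the default at stages that do not name a code below
      \<open>B\<close>.\<close>
    define s where "s = (if fst (dec i) \<prec> B then Cd (fst (dec i)) else {})"
    have s: "s \<in> FS B" unfolding s_def using empty_FS by (simp add: FS_def) blast
    obtain F' where F': "F' \<in> FK" "F' \<subseteq> F" "\<forall>n. L B n F'" "\<exists>a\<in>F. apart {a} F'"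
      "tr (\<lambda>x y. pc (pc x y) \<one> \<in> s) F'" "stable s (snd (dec i)) F F'"
      using extension_step[of F s "snd (dec i)"] F s unfolding stable_def by blast
    have "s = Cd (fst (dec i))" if "fst (dec i) \<prec> B" using that unfolding s_def by simp
    then have "Q i F F'" unfolding Q_def using F'(2,4-6) by blast
    then show "\<exists>F'. (F' \<in> FK \<and> (\<forall>n. L B n F')) \<and> Q i F F'" using F'(1,3) by blast
  qed
  then obtain F where F: "\<And>i. F i \<in> FK" "\<And>i. Q i (F i) (F (Suc i))" by blast
  have "\<forall>i. \<exists>a. a \<in> F i \<and> apart {a} (F (Suc i))" using F(2) unfolding Q_def by blast
  then obtain a where a: "\<And>i. a i \<in> F i" "\<And>i. apart {a i} (F (Suc i))" by metis
  have FQ: "tr (\<lambda>x y. pc (pc x y) \<one> \<in> Cd c) (F (Suc i)) \<and> stable (Cd c) d (F i) (F (Suc i))"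
    if "dec i = (c, d)" "c \<prec> B" for i c d
    using F(2)[of i] that unfolding Q_def by simp
  have "cut zr on ad ml ls S X A k B F a"
  proof
    show "F i \<in> FK" "a i \<in> F i" "apart {a i} (F (Suc i))" for i using F(1) a by blast+
    show "F (Suc i) \<subseteq> F i" for i using F(2)[of i] unfolding Q_def by blast
    fix s assume "s \<in> FS B"
    then obtain c where c: "c \<prec> B" "s = Cd c" unfolding FS_def by blast
    show "\<exists>i. tr (\<lambda>x y. pc (pc x y) \<one> \<in> s) (F i)"
      using FQ[OF dec[of "(c, \<zero>)" 0] c(1)] c(2) by blast
    show "\<exists>i\<ge>j. (\<forall>y\<in>F i. K (d \<oplus> \<one>) y) \<longrightarrow> (\<forall>y\<in>F (Suc i). \<forall>z\<in>F (Suc i). \<forall>x. x \<prec> d \<oplus> \<one> \<longrightarrow>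
        (\<exists>v. v \<prec> y \<and> pc x v \<in> s) = (\<exists>v. v \<prec> z \<and> pc x v \<in> s))" for j d
    proof (intro exI conjI)
      show "j \<le> prod_encode (to_nat (c, d), j)" by (rule le_prod_encode_2)
      show "(\<forall>y\<in>F (prod_encode (to_nat (c, d), j)). K (d \<oplus> \<one>) y) \<longrightarrow>
        (\<forall>y\<in>F (Suc (prod_encode (to_nat (c, d), j))). \<forall>z\<in>F (Suc (prod_encode (to_nat (c, d), j))). \<forall>x. x \<prec> d \<oplus> \<one> \<longrightarrow>
        (\<exists>v. v \<prec> y \<and> pc x v \<in> s) = (\<exists>v. v \<prec> z \<and> pc x v \<in> s))"
        using FQ[OF dec[of "(c, d)" j] c(1)] unfolding stable_def c(2) by blast
    qed
  qed
  then show ?thesis by blast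
qed

end

section \<open>Nonstandard models of the base theory\<close>

lemma (in arith) ev_cong: "closed_tm m t \<Longrightarrow> (\<And>n. n < m \<Longrightarrow> e n = e' n) \<Longrightarrow> ev e t = ev e' t"
  by (induction t) auto

lemma (in arith) sat_cong:
  "closed_fm m k \<phi> \<Longrightarrow> (\<And>n. n < m \<Longrightarrow> e n = e' n) \<Longrightarrow> (\<And>n. n < k \<Longrightarrow> E n = E' n) \<Longrightarrow>
    sat D S e E \<phi> = sat D S e' E' \<phi>"
proof (induction \<phi> arbitrary: m k e e' E E')
  case (Eq s t)
  then show ?case using ev_cong[of m s e e'] ev_cong[of m t e e'] by simp
next
  case (Less s t)
  then show ?case using ev_cong[of m s e e'] ev_cong[of m t e e'] by simp
next
  case (Mem t Y)
  then show ?case using ev_cong[of m t e e'] by simp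
next
  case (Imp \<phi> \<psi>)
  have c: "closed_fm m k \<phi>" "closed_fm m k \<psi>" using Imp.prems(1) by simp_all
  have "sat D S e E \<phi> = sat D S e' E' \<phi>" "sat D S e E \<psi> = sat D S e' E' \<psi>"
    by (rule Imp.IH(1)[OF c(1)] Imp.IH(2)[OF c(2)]; (rule Imp.prems; assumption))+
  then show ?case by simp
next
  case (AllN \<phi>)
  have "sat D S (case_nat x e) E \<phi> = sat D S (case_nat x e') E' \<phi>" for x
    by (rule AllN.IH[of "Suc m" k]) (use AllN.prems in \<open>auto split: nat.split\<close>)
  then show ?case by simp
next
  case (AllS \<phi>)
  have "sat D S e (case_nat Y E) \<phi> = sat D S e' (case_nat Y E') \<phi>" for Y
    by (rule AllS.IH[of m "Suc k"]) (use AllS.prems in \<open>auto split: nat.split\<close>)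
  then show ?case by simp
qed simp

lemma (in arith) sat_AllN_powD:
  "sat D S e E ((AllN ^^ m) \<phi>) \<Longrightarrow> (\<And>n. e' n \<in> D) \<Longrightarrow>
    sat D S (\<lambda>n. if n < m then e' n else e (n - m)) E \<phi>"
proof (induction m arbitrary: e)
  case (Suc m)
  have "sat D S (case_nat (e' m) e) E ((AllN ^^ m) \<phi>)" using Suc.prems by simp
  from Suc.IH[OF this Suc.prems(2)]
  have "sat D S (\<lambda>n. if n < m then e' n else case_nat (e' m) e (n - m)) E \<phi>" .
  moreover have "(\<lambda>n. if n < m then e' n else case_nat (e' m) e (n - m)) = (\<lambda>n. if n < Suc m then e' n else e (n - Suc m))"
    by (rule ext) (auto split: nat.split dest: less_antisym simp: less_Suc_eq diff_Suc)
  ultimately show ?case by simp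
qed simp

lemma (in arith) sat_AllS_powD:
  "sat D S e E ((AllS ^^ m) \<phi>) \<Longrightarrow> (\<And>n. E' n \<in> S) \<Longrightarrow>
    sat D S e (\<lambda>n. if n < m then E' n else E (n - m)) \<phi>"
proof (induction m arbitrary: E)
  case (Suc m)
  have "sat D S e (case_nat (E' m) E) ((AllS ^^ m) \<phi>)" using Suc.prems by simp
  from Suc.IH[OF this Suc.prems(2)]
  have "sat D S e (\<lambda>n. if n < m then E' n else case_nat (E' m) E (n - m)) \<phi>" .
  moreover have "(\<lambda>n. if n < m then E' n else case_nat (E' m) E (n - m)) = (\<lambda>n. if n < Suc m then E' n else E (n - Suc m))"
    by (rule ext) (auto split: nat.split dest: less_antisym simp: less_Suc_eq diff_Suc)
  ultimately show ?case by simp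
qed simp

lemma closed_AllN_pow: "closed_fm j k ((AllN ^^ m) \<phi>) = closed_fm (m + j) k \<phi>"
  by (induction m arbitrary: j) simp_all

lemma closed_AllS_pow: "closed_fm j k ((AllS ^^ m) \<phi>) = closed_fm j (m + k) \<phi>"
  by (induction m arbitrary: k) simp_all

lemma closuresI: "\<phi> \<in> A \<Longrightarrow> closed_fm m k \<phi> \<Longrightarrow> (AllS ^^ k) ((AllN ^^ m) \<phi>) \<in> closures A"
  unfolding closures_def by (auto simp: closed_AllN_pow closed_AllS_pow)

text \<open>A schema is given by universal closures of its instances; since each instance has
  finitely many parameters, this gives it for arbitrary environments.\<close>

lemma (in arith) sat_closures:
  assumes "\<And>\<psi>. \<psi> \<in> closures A \<Longrightarrow> sat UNIV S e E \<psi>" and \<phi>: "\<phi> \<in> A" and E': "\<And>n. E' n \<in> S"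
  shows "sat UNIV S e' E' \<phi>"
proof -
  obtain m where m: "closed_fm m m \<phi>" using ex_closed_fm by blast
  then have "(AllS ^^ m) ((AllN ^^ m) \<phi>) \<in> closures A" by (rule closuresI[OF \<phi>])
  then have "sat UNIV S e E ((AllS ^^ m) ((AllN ^^ m) \<phi>))" using assms(1) by blast
  from sat_AllN_powD[OF sat_AllS_powD[OF this, of E'], OF E', of e']
  have "sat UNIV S (\<lambda>n. if n < m then e' n else e (n - m)) (\<lambda>n. if n < m then E' n else E (n - m)) \<phi>" by simp
  moreover have "sat UNIV S (\<lambda>n. if n < m then e' n else e (n - m)) (\<lambda>n. if n < m then E' n else E (n - m)) \<phi> = sat UNIV S e' E' \<phi>"
    by (rule sat_cong[OF m]) simp_all
  ultimately show ?thesis by simp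
qed

lemma modelI:
  fixes zr on :: "'m::countable"
  assumes sat: "\<And>\<psi>. \<psi> \<in> RCA0 \<union> BSigma 2 \<Longrightarrow> arith.sat zr on ad ml ls UNIV S e E \<psi>" and X: "X \<in> S"
  shows "model zr on ad ml ls S X"
proof -
  interpret arith zr on ad ml ls .
  have R: "sat UNIV S e' (\<lambda>_. X) \<phi>" if "\<phi> \<in> basic_axioms \<union> {induction_axiom \<phi> |\<phi>. \<phi> \<in> sigma0 1}
     \<union> {comprehension_axiom \<phi> \<psi> |\<phi> \<psi>. \<phi> \<in> sigma0 1 \<and> \<psi> \<in> pi0 1}" for \<phi> e'
    by (rule sat_closures[OF _ that, where e = e and E = E]) (use sat X in \<open>auto simp: RCA0_def\<close>)
  have B: "sat UNIV S e' (\<lambda>_. X) \<phi>" if "\<phi> \<in> {bounding_axiom \<phi> |\<phi>. \<phi> \<in> sigma0 2}" for \<phi> e'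
    by (rule sat_closures[OF _ that, where e = e and E = E]) (use sat X in \<open>auto simp: BSigma_def\<close>)
  have basic: "\<forall>\<phi>\<in>basic_axioms. sat UNIV S (case_nat x (\<lambda>_. y)) (\<lambda>_. X) \<phi>" for x y
    using R by blast
  note ax = basic[unfolded basic_axioms_def]
  show ?thesis
  proof
    fix x y
    show "ad x on \<noteq> zr" using ax[of x y] by simp
    show "x = y" if "ad x on = ad y on" using ax[of x y] that by simp
    show "ad x zr = x" using ax[of x y] by simp
    show "ad x (ad y on) = ad (ad x y) on" using ax[of x y] by simp
    show "ml x zr = zr" using ax[of x y] by simp
    show "ml x (ad y on) = ad (ml x y) x" using ax[of x y] by simp
    show "\<not> ls x zr" using ax[of x y] by simp
    show "ls x (ad y on) \<longleftrightarrow> ls x y \<or> x = y" using ax[of x y] by auto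
  next
    fix \<phi> e' assume "\<phi> \<in> sigma0 1"
    then show "sat UNIV S e' (\<lambda>_. X) (induction_axiom \<phi>)" by (intro R) blast
  next
    fix \<phi> e' assume "\<phi> \<in> sigma0 2"
    then show "sat UNIV S e' (\<lambda>_. X) (bounding_axiom \<phi>)" by (intro B) blast
  qed
qed

lemma (in model) ev_num: "ev e (num n) = nm n"
  by (induction n) simp_all

lemma (in model) nm_less: "m < n \<Longrightarrow> nm m \<prec> nm n"
proof (induction n)
  case (Suc n)
  then show ?case by (auto simp: ax8 less_Suc_eq)
qed simp

lemma closed_num: "closed_tm m (num n)"
  by (induction n) simp_all

lemma closed_closures: "\<psi> \<in> closures A \<Longrightarrow> closed_fm 0 0 \<psi>"
  unfolding closures_def by blast

text \<open>Number variable 0, free in the formulas added to \<open>\<Gamma>\<close>, acts as the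
  nonstandard element. Completeness is used twice: a model of \<open>\<Gamma>\<close> in which the
  variable denotes a large numeral shows that every finite part of \<open>\<Delta>\<close> is
  consistent, and then \<open>\<Delta>\<close> itself has a model.\<close>

lemma nonstandard_model:
  assumes \<phi>: "closed_fm 0 0 \<phi>" and not: "\<not> RCA0 \<union> BSigma 2 \<turnstile> \<phi>"
  obtains zr on :: nat and ad ml ls S N where
    "S \<noteq> {}" "\<And>e E. \<not> arith.sat zr on ad ml ls UNIV S e E \<phi>"
    "\<And>X. X \<in> S \<Longrightarrow> model zr on ad ml ls S X"
    "\<And>X n. X \<in> S \<Longrightarrow> ls (model.nm zr on ad n) N"
proof -
  define \<Gamma> where "\<Gamma> = insert (\<^bold>\<not> \<phi>) (RCA0 \<union> BSigma 2)"
  have con: "consistent \<Gamma>" unfolding \<Gamma>_def using not provable.Contr by blast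
  have cl0: "closed_fm 0 0 \<gamma>" if "\<gamma> \<in> \<Gamma>" for \<gamma>
    using that \<phi> closed_closures unfolding \<Gamma>_def RCA0_def BSigma_def by auto
  then have cl: "\<forall>\<gamma>\<in>\<Gamma>. closed_fm 1 0 \<gamma>" using closed_fm_mono[of 0 0] by blast
  have "(AllS ^^ 0) ((AllN ^^ 1) (\<^bold>\<not> (Var 0 \<^bold>+ One \<^bold>= Zero))) \<in> RCA0"
    unfolding RCA0_def by (rule closuresI) (simp_all add: basic_axioms_def)
  then have s1: "AllN (\<^bold>\<not> (Var 0 \<^bold>+ One \<^bold>= Zero)) \<in> \<Gamma>" unfolding \<Gamma>_def by simp
  have "(AllS ^^ 0) ((AllN ^^ 2) (Var 0 \<^bold>+ One \<^bold>= Var 1 \<^bold>+ One \<^bold>\<longrightarrow> Var 0 \<^bold>= Var 1)) \<in> RCA0"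
    unfolding RCA0_def by (rule closuresI) (simp_all add: basic_axioms_def)
  then have s2: "AllN (AllN (Var 0 \<^bold>+ One \<^bold>= Var 1 \<^bold>+ One \<^bold>\<longrightarrow> Var 0 \<^bold>= Var 1)) \<in> \<Gamma>"
    unfolding \<Gamma>_def by (simp add: numeral_2_eq_2)
  have mod: "model zr on ad ml ls S X" if "\<And>\<gamma>. \<gamma> \<in> \<Gamma> \<Longrightarrow> arith.sat zr on ad ml ls UNIV S e E \<gamma>" "X \<in> S"
    for zr on :: nat and ad ml ls S e E X
    by (rule modelI[where e = e and E = E]) (use that in \<open>auto simp: \<Gamma>_def\<close>)
  define \<Delta> where "\<Delta> = \<Gamma> \<union> range (\<lambda>n. num n \<^bold>< Var 0)"
  have con\<Delta>: "consistent \<Delta>"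
  proof
    assume "\<Delta> \<turnstile> \<^bold>\<bottom>"
    then obtain \<Delta>0 where \<Delta>0: "finite \<Delta>0" "\<Delta>0 \<subseteq> \<Delta>" "\<Delta>0 \<turnstile> \<^bold>\<bottom>" using provable_finite by blast
    have "finite (\<Delta>0 \<inter> range (\<lambda>n. num n \<^bold>< Var 0))" using \<Delta>0(1) by blast
    then obtain M where M: "finite M" "\<Delta>0 \<inter> range (\<lambda>n. num n \<^bold>< Var 0) = (\<lambda>n. num n \<^bold>< Var 0) ` M"
      using finite_subset_image[of "\<Delta>0 \<inter> range (\<lambda>n. num n \<^bold>< Var 0)" "\<lambda>n. num n \<^bold>< Var 0" UNIV] by blast
    obtain b where b: "\<And>n. n \<in> M \<Longrightarrow> n < b" using M(1) by (meson finite_nat_set_iff_bounded)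
    obtain zr on :: nat and ad ml ls S e E where
      E: "\<And>n. E n \<in> S" and sat: "\<And>\<gamma>. \<gamma> \<in> \<Gamma> \<Longrightarrow> arith.sat zr on ad ml ls UNIV S e E \<gamma>"
    proof (rule completeness[OF cl con s1 s2])
      fix zr on :: nat and ad ml ls S e E
      assume "\<And>n. E n \<in> S" "\<And>\<gamma>. \<gamma> \<in> \<Gamma> \<Longrightarrow> arith.sat zr on ad ml ls UNIV S e E \<gamma>"
      then show ?thesis by (rule that)
    qed
    interpret model zr on ad ml ls S "E 0" by (rule mod[OF sat E])
    have "sat UNIV S (\<lambda>_. nm b) E \<^bold>\<bottom>"
    proof (rule soundness[OF \<Delta>0(3)])
      show "closed_dom UNIV" unfolding closed_dom_def by simp
      fix \<gamma> assume \<gamma>: "\<gamma> \<in> \<Delta>0"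
      show "sat UNIV S (\<lambda>_. nm b) E \<gamma>"
      proof (cases "\<gamma> \<in> \<Gamma>")
        case True
        then show ?thesis using sat[OF True] sat_cong[OF cl0[OF True], of "\<lambda>_. nm b" e E E] by simp
      next
        case False
        then obtain n where "n \<in> M" "\<gamma> = (num n \<^bold>< Var 0)" using \<gamma> \<Delta>0(2) M(2) unfolding \<Delta>_def by blast
        then show ?thesis using nm_less[OF b] by (simp add: ev_num)
      qed
    qed (simp_all add: E)
    then show False by simp
  qed
  have cl\<Delta>: "\<forall>\<gamma>\<in>\<Delta>. closed_fm 1 0 \<gamma>" using cl unfolding \<Delta>_def by (auto simp: closed_num)
  have sub: "\<Gamma> \<subseteq> \<Delta>" unfolding \<Delta>_def by blast
  obtain zr on :: nat and ad ml ls S e E where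
    E: "\<And>n. E n \<in> S" and sat: "\<And>\<gamma>. \<gamma> \<in> \<Delta> \<Longrightarrow> arith.sat zr on ad ml ls UNIV S e E \<gamma>"
  proof (rule completeness[OF cl\<Delta> con\<Delta> subsetD[OF sub s1] subsetD[OF sub s2]])
      fix zr on :: nat and ad ml ls S e E
      assume "\<And>n. E n \<in> S" "\<And>\<gamma>. \<gamma> \<in> \<Delta> \<Longrightarrow> arith.sat zr on ad ml ls UNIV S e E \<gamma>"
      then show ?thesis by (rule that)
    qed
  have sat\<Gamma>: "arith.sat zr on ad ml ls UNIV S e E \<gamma>" if "\<gamma> \<in> \<Gamma>" for \<gamma>
    using sat that unfolding \<Delta>_def by blast
  show ?thesis
  proof (rule that[of S zr on ad ml ls "e 0"])
    show "S \<noteq> {}" using E by blast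
    fix X assume X: "X \<in> S"
    interpret model zr on ad ml ls S X by (rule mod[OF sat\<Gamma> X])
    show "model zr on ad ml ls S X" by unfold_locales
    have "sat UNIV S e E (num n \<^bold>< Var 0)" for n by (rule sat) (simp add: \<Delta>_def)
    then show "ls (nm n) (e 0)" for n by (simp add: ev_num)
  next
    interpret arith zr on ad ml ls .
    fix e' E'
    have "sat UNIV S e E (\<^bold>\<not> \<phi>)" by (rule sat\<Gamma>) (simp add: \<Gamma>_def)
    then show "\<not> sat UNIV S e' E' \<phi>" using sat_cong[OF \<phi>, of e e' E E'] by simp
  qed
qed

section \<open>Conservativity\<close>

text \<open>Index 0 is the innermost variable \<open>z\<close>, index 3 the outermost variable
  \<open>p\<close>, which also serves as padding.\<close>

abbreviation env4 :: "'m \<Rightarrow> 'm \<Rightarrow> 'm \<Rightarrow> 'm \<Rightarrow> nat \<Rightarrow> 'm" where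
  "env4 p x y z \<equiv> case_nat z (case_nat y (case_nat x (\<lambda>_. p)))"

lemma (in model) ex_submodel:
  assumes N: "\<And>n. nm n \<prec> N" and \<delta>: "\<delta> \<in> delta0"
    and ce: "\<And>x. \<exists>y. \<forall>z. \<not> sat UNIV S (env4 p x y z) (\<lambda>_. X) \<delta>"
  shows "\<exists>I SI. closed_dom I \<and> (\<forall>\<gamma>\<in>WKL0 \<union> {EM}. \<forall>e E. (\<forall>n. e n \<in> I) \<longrightarrow> (\<forall>n. E n \<in> SI) \<longrightarrow> sat I SI e E \<gamma>)
    \<and> p \<in> I \<and> (\<exists>Z\<in>SI. \<forall>x\<in>I. \<exists>y\<in>I. \<forall>z\<in>I. \<not> sat I SI (env4 p x y z) (\<lambda>_. Z) \<delta>)"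
proof -
  define \<theta> where "\<theta> = (\<lambda>x y z. \<not> sat UNIV S (env4 p x y z) (\<lambda>_. X) \<delta>)"
  have D\<theta>: "Dz (\<lambda>e. \<theta> (f e) (g e) (h e))" if t: "Tm f" "Tm g" "Tm h" for f g h
  proof -
    have "Dz (\<lambda>e. sat UNIV S (\<lambda>n. case_nat h (case_nat g (case_nat f (\<lambda>_ _. p))) n e) (\<lambda>_. X) \<delta>)"
      by (rule Dz_sat[OF Dz_X \<delta>]) (use t Tm_const in \<open>auto split: nat.split\<close>)
    moreover have "(\<lambda>n. case_nat h (case_nat g (case_nat f (\<lambda>_ _. p))) n e) = env4 p (f e) (g e) (h e)" for e
      by (rule ext) (simp split: nat.split)
    ultimately show ?thesis unfolding \<theta>_def by (simp add: Dz_not)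
  qed
  text \<open>If \<open>A (a i) (a (Suc i)) w\<close> for a sequence \<open>a\<close> cofinal in a cut \<open>I\<close> and some \<open>w\<close> above \<open>I\<close>, then
    \<open>\<forall>x. \<exists>y. \<forall>z. \<theta> x y z\<close> holds in \<open>I\<close>; the conjunct \<open>K\<close> closes \<open>I\<close> under coding.\<close>
  define A where "A = (\<lambda>u v w. K (pc (u \<oplus> (\<one> \<oplus> \<one>)) (u \<oplus> (\<one> \<oplus> \<one>))) v \<and> p \<prec> v \<and>
    (\<forall>x. x \<prec> u \<oplus> \<one> \<longrightarrow> (\<exists>y. y \<prec> v \<oplus> \<one> \<and> (\<forall>z. z \<prec> w \<oplus> \<one> \<longrightarrow> \<theta> x y z))))"
  interpret largeness zr on ad ml ls S X A
  proof
    show "Dz (\<lambda>e. A (e 0) (e (Suc 0)) (e (Suc (Suc 0))))"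
      unfolding A_def by (intro Dz_intros Dz_K Tm_pc D\<theta>)
  qed (simp add: A_def)
  have A_ex: "\<exists>v. \<forall>u' v' w. u' \<preceq> u \<longrightarrow> v \<preceq> v' \<longrightarrow> A u' v' w" for u
  proof -
    have "Dz (\<lambda>e. \<theta> (e (Suc (Suc 0))) (e (Suc 0)) (e 0))" by (rule D\<theta>) (rule Tm_var)+
    moreover have "\<exists>y. \<forall>z. \<theta> x y z" for x using ce unfolding \<theta>_def .
    \<comment> \<open>The one use of Sigma_2 bounding: it bounds the \<open>y\<close> for all
      \<open>x \<preceq> u\<close> at once, independently of any bound on \<open>z\<close>.\<close>
    ultimately obtain b where b: "\<And>x. x \<prec> u \<oplus> \<one> \<Longrightarrow> \<exists>w y. w \<prec> b \<and> y \<preceq> w \<and> (\<forall>z. \<theta> x y z)"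
      using bounding[of \<theta> "u \<oplus> \<one>"] by blast
    obtain v0 where v0: "K (pc (u \<oplus> (\<one> \<oplus> \<one>)) (u \<oplus> (\<one> \<oplus> \<one>))) v0" using ex_K by blast
    define v where "v = b \<oplus> v0 \<oplus> (p \<oplus> \<one>)"
    have "b \<preceq> b \<oplus> v0" "v0 \<preceq> b \<oplus> v0" "b \<oplus> v0 \<preceq> v" "p \<oplus> \<one> \<preceq> v"
      unfolding v_def by (rule le_add)+
    then have v: "b \<preceq> v" "v0 \<preceq> v" "p \<prec> v" using ls_add_one[of p] by order+
    have "A u' v' w" if u': "u' \<preceq> u" and v': "v \<preceq> v'" for u' v' w
    proof -
      have "u' \<oplus> (\<one> \<oplus> \<one>) \<preceq> u \<oplus> (\<one> \<oplus> \<one>)" using u' by (simp only: add_mono_iff)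
      then have "K (pc (u' \<oplus> (\<one> \<oplus> \<one>)) (u' \<oplus> (\<one> \<oplus> \<one>))) v'"
        using v(2) v' by (intro K_mono[OF v0] pc_mono) order+
      moreover have "p \<prec> v'" using v(3) v' by order
      moreover have "\<exists>y. y \<prec> v' \<oplus> \<one> \<and> (\<forall>z. z \<prec> w \<oplus> \<one> \<longrightarrow> \<theta> x y z)" if "x \<prec> u' \<oplus> \<one>" for x
      proof -
        have "x \<preceq> u" using that u' unfolding ls_add1 by order
        then obtain w0 y where y: "w0 \<prec> b" "y \<preceq> w0" "\<forall>z. \<theta> x y z" using b unfolding ls_add1 by blast
        have "y \<preceq> v'" using y(1,2) v(1) v' by order
        then show ?thesis unfolding ls_add1 using y(3) by blast
      qed
      ultimately show ?thesis unfolding A_def by blast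
    qed
    then show ?thesis by blast
  qed
  obtain k B i w Y where B: "KK k B" and i: "\<forall>n. nm n \<prec> i" "matrix B i w"
    and Y: "Y \<in> FS B" "\<forall>x\<in>Y. x \<prec> k" "\<forall>n. L B n Y"
    using uniformly_large[OF A_ex N] by (elim exE conjE)
  interpret saturated_world zr on ad ml ls S X A k B i w
    by (intro saturated_world.intro saturated_world_axioms.intro worldI[OF B]) (use i in blast)+
  have "Y \<in> FK" unfolding FK_def using Y(1,2) by blast
  then obtain F a where cut: "cut zr on ad ml ls S X A k B F a" using ex_cut[of Y] Y(3) by blast
  interpret cut zr on ad ml ls S X A k B F a by (rule cut)
  have A_I: "\<exists>w. (\<forall>z\<in>I. z \<preceq> w) \<and> p \<prec> a (Suc i) \<and>
     (\<forall>x. x \<preceq> a i \<longrightarrow> (\<exists>y. y \<preceq> a (Suc i) \<and> (\<forall>z. z \<preceq> w \<longrightarrow> \<theta> x y z)))" for i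
    using A_cut[of i] unfolding A_def ls_add1 by (elim exE conjE) (intro exI conjI, assumption+)
  \<comment> \<open>The conjunct \<open>p \<prec> v\<close> of \<open>A\<close> puts
    \<open>p\<close> below \<open>a (Suc 0)\<close>.\<close>
  have p: "p \<in> I" using A_I[of 0] I_down[OF a_I[of "Suc 0"]] od.less_imp_le by blast
  obtain Z where Z: "Z \<in> SI" "\<And>x. x \<in> I \<Longrightarrow> x \<in> Z \<longleftrightarrow> x \<in> X"
    using SI_comprehension[OF Dz_X[OF Tm_var]] by blast
  have ZX: "Z = X \<inter> I" using Z SI_sub[OF Z(1)] by blast
  have abs: "sat I SI (env4 p x y z) (\<lambda>_. Z) \<delta> \<longleftrightarrow> \<not> \<theta> x y z" if "x \<in> I" "y \<in> I" "z \<in> I" for x y z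
  proof -
    have "env4 p x y z n \<in> I" for n using that p by (simp split: nat.split)
    then show ?thesis
      using absolute[OF \<delta>, of "\<lambda>_. Z" "\<lambda>_. X" "env4 p x y z"] ZX unfolding \<theta>_def by simp
  qed
  have "\<exists>y\<in>I. \<forall>z\<in>I. \<not> sat I SI (env4 p x y z) (\<lambda>_. Z) \<delta>" if x: "x \<in> I" for x
  proof -
    obtain i where "x \<preceq> a i" using x unfolding I_def by blast
    then obtain w y where w: "\<forall>z\<in>I. z \<preceq> w" and y: "y \<preceq> a (Suc i)" "\<forall>z. z \<preceq> w \<longrightarrow> \<theta> x y z"
      using A_I[of i] by blast
    have "y \<in> I" using I_down[OF a_I y(1)] .
    then show ?thesis using abs[OF x] w y(2) by blast
  qed
  then have no: "\<exists>Z\<in>SI. \<forall>x\<in>I. \<exists>y\<in>I. \<forall>z\<in>I. \<not> sat I SI (env4 p x y z) (\<lambda>_. Z) \<delta>"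
    by (intro bexI[OF _ Z(1)] ballI)
  have "sat I SI e E \<gamma>" if \<gamma>: "\<gamma> \<in> WKL0 \<union> {EM}" and e: "\<forall>n. e n \<in> I" and E: "\<forall>n. E n \<in> SI" for \<gamma> e E
  proof -
    consider "\<gamma> = WKL" | "\<gamma> = EM" | "\<gamma> \<in> RCA0" using \<gamma> unfolding WKL0_def by blast
    then show ?thesis
      by cases (simp_all add: sat_WKL sat_EM sat_RCA0 e E)
  qed
  then show ?thesis by (intro exI[of _ I] exI[of _ SI] conjI ballI allI impI I_closed p no)
qed

theorem theorem5p3:
  shows "conservative_over (WKL0 \<union> {EM}) (RCA0 \<union> BSigma 2) (forall_pi0 4)"
  unfolding conservative_over_def
proof (intro ballI impI)
  fix \<phi> assume "\<phi> \<in> forall_pi0 4" and \<phi>: "sentence \<phi>" and pr: "WKL0 \<union> {EM} \<turnstile> \<phi>"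
  then obtain \<delta> where \<phi>_eq: "\<phi> = AllS (AllN (ExN (AllN (ExN \<delta>))))" and \<delta>: "\<delta> \<in> delta0"
    unfolding forall_pi0_def by (auto simp: eval_nat_numeral)
  have cl: "closed_fm 4 1 \<delta>" using \<phi> unfolding \<phi>_eq by (simp add: eval_nat_numeral)
  show "RCA0 \<union> BSigma 2 \<turnstile> \<phi>"
  proof (rule ccontr)
    assume "\<not> RCA0 \<union> BSigma 2 \<turnstile> \<phi>"
    then obtain zr on :: nat and ad ml ls S N where S: "S \<noteq> {}"
      and neg: "\<And>e E. \<not> arith.sat zr on ad ml ls UNIV S e E \<phi>"
      and mod: "\<And>X. X \<in> S \<Longrightarrow> model zr on ad ml ls S X"
      and N: "\<And>X n. X \<in> S \<Longrightarrow> ls (model.nm zr on ad n) N"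
      by (rule nonstandard_model[OF \<phi>]) (rule that)
    interpret arith zr on ad ml ls .
    \<comment> \<open>By \<open>cl\<close>, \<open>\<delta>\<close> has free number indices below 4
      and set index 0 only, so the remaining entries of an environment may be replaced by
      padding.\<close>
    have env: "sat D T (case_nat z (case_nat y (case_nat x (case_nat p e)))) (case_nat Y E) \<delta> =
      sat D T (env4 p x y z) (\<lambda>_. Y) \<delta>" for D T x y z p e Y E
      by (rule sat_cong[OF cl]) (auto split: nat.split)
    have sat_\<phi>: "sat D T e E \<phi> \<longleftrightarrow>
      (\<forall>Y\<in>T. \<forall>p\<in>D. \<exists>x\<in>D. \<forall>y\<in>D. \<exists>z\<in>D. sat D T (env4 p x y z) (\<lambda>_. Y) \<delta>)" for D T e E
      unfolding \<phi>_eq by (simp add: env)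
    obtain X p where X: "X \<in> S" and ce: "\<And>x. \<exists>y. \<forall>z. \<not> sat UNIV S (env4 p x y z) (\<lambda>_. X) \<delta>"
      using neg unfolding sat_\<phi> by auto
    interpret model zr on ad ml ls S X by (rule mod[OF X])
    obtain I SI Z where D: "closed_dom I" "p \<in> I" "Z \<in> SI"
      and sat: "\<forall>\<gamma>\<in>WKL0 \<union> {EM}. \<forall>e E. (\<forall>n. e n \<in> I) \<longrightarrow> (\<forall>n. E n \<in> SI) \<longrightarrow> sat I SI e E \<gamma>"
      and no: "\<forall>x\<in>I. \<exists>y\<in>I. \<forall>z\<in>I. \<not> sat I SI (env4 p x y z) (\<lambda>_. Z) \<delta>"
      using ex_submodel[OF N[OF X] \<delta> ce] by (elim exE conjE bexE)
    have "sat I SI (\<lambda>_. p) (\<lambda>_. Z) \<phi>"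
    proof (rule soundness[OF pr D(1)])
      fix \<gamma> assume "\<gamma> \<in> WKL0 \<union> {EM}"
      then show "sat I SI (\<lambda>_. p) (\<lambda>_. Z) \<gamma>" by (rule sat[rule_format]) (rule D)+
    qed (rule D)+
    then show False using no D unfolding sat_\<phi> by blast
  qed
qed

end
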